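(* Let $C$ be a smooth projective curve of genus $g$ over an algebraically closed field $k$, $P$ a point of $C$, and $d\geq1$ an integer. Let $A_d=R_d/(x,z)$, $\mathfrak a=(A_d)_+$, and let $v_1\le\cdots\le v_s$ be the weights of the variables $y_1,\dots,y_s$ in the minimal weighted presentation $S_d=k[\tilde x,\tilde z,y_1,\dots,y_s]\twoheadrightarrow R_d$ (notation in the context). Suppose that $\mathfrak a^2=0$ and, moreover, that $v_1=\cdots=v_s=v$. Then the minimal free resolution of $R_d$ over $S_d$ is pure with Betti numbers \[ \beta_{i,(i+1)v}^{S_d}(R_d)=i\binom{s+1}{i+1},\qquad 1\leq i\leq s. \] For $P$ an ordinary point, the minimal free resolution of $R_{g+1}$ (over $S_{g+1}$) is always pure.
   Context: The section ring is $R_d=\bigoplus_{m\geq 0}H^0(C,\mathcal{O}_C(mdP))$, graded by $m$. The Weierstrass semigroup of $P$ is $H(P)=\{-\operatorname{ord}_P(f)\mid f\in k(C)^\times\text{ regular away from }P\}\subseteq\mathbb{Z}_{\ge0}$; $P$ is ordinary if $\mathbb{Z}_{\ge0}\setminus H(P)=\{1,\dots,g\}$. Set $q_d=\min\{q\geq1\mid qd\in H(P)\}$ and $e_d=q_dd$. Let $x\in(R_d)_1$ be the image of $1$ under the natural inclusion $k=H^0(C,\mathcal{O}_C)\subset H^0(C,\mathcal{O}_C(dP))$, and let $z\in(R_d)_{q_d}=H^0(C,\mathcal{O}_C(e_dP))$ be an element corresponding to a rational function with pole order exactly $e_d$ at $P$. The elements $x,z$ can be completed to a minimal homogeneous $k$-algebra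 generating set of $R_d$, giving a minimal weighted presentation $S_d=k[\tilde x,\tilde z,y_1,\dots,y_s]\twoheadrightarrow R_d$ with $\tilde x\mapsto x$, $\tilde z\mapsto z$, $\deg\tilde x=1$, $\deg\tilde z=q_d$, $\deg y_a=v_a$, $v_1\leq\cdots\leq v_s$. Put $A_d=R_d/(x,z)$ and let $\mathfrak a=(A_d)_+$ be its ideal of positive-degree elements. Betti numbers are $\beta^{S_d}_{i,j}(R_d)=\dim_k\operatorname{Tor}_i^{S_d}(R_d,k)_j$. A minimal graded free resolution $F_\bullet$ is pure if each $F_i$ is generated in a single degree (for each $i$ there is at most one $j$ with $\beta_{i,j}\ne0$). *)

theory Defs
  imports
    "HOL-Computational_Algebra.Polynomial"
    "HOL-Library.Poly_Mapping"
    "HOL-Library.Extended_Nat"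
    "HOL-Algebra.UnivPoly"
    "HOL-Algebra.QuotRing"
    "HOL-Algebra.Ideal_Product"
begin

section \<open>Multivariate polynomials\<close>

text \<open>A monomial is a finitely supported exponent vector; multiplication of polynomials is the
  convolution product of \<^theory>\<open>HOL-Library.Poly_Mapping\<close>.\<close>

type_synonym ('v, 'k) mpoly = "('v \<Rightarrow>\<^sub>0 nat) \<Rightarrow>\<^sub>0 'k"

definition const_poly :: "'k::zero \<Rightarrow> ('v, 'k) mpoly" where
  "const_poly c = Poly_Mapping.single 0 c"

definition const_term :: "('v, 'k::zero) mpoly \<Rightarrow> 'k" where
  "const_term p = Poly_Mapping.lookup p 0"

definition polys_in :: "'v set \<Rightarrow> ('v, 'k::zero) mpoly set" where
  "polys_in V = {p. \<forall>m\<in>Poly_Mapping.keys p. Poly_Mapping.keys m \<subseteq> V}"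

definition wdeg :: "('v \<Rightarrow> nat) \<Rightarrow> ('v \<Rightarrow>\<^sub>0 nat) \<Rightarrow> nat" where
  "wdeg w m = (\<Sum>v\<in>Poly_Mapping.keys m. Poly_Mapping.lookup m v * w v)"

text \<open>The zero polynomial is homogeneous of every degree.\<close>

definition homog :: "('v \<Rightarrow> nat) \<Rightarrow> nat \<Rightarrow> ('v, 'k::zero) mpoly \<Rightarrow> bool" where
  "homog w e p \<longleftrightarrow> (\<forall>m\<in>Poly_Mapping.keys p. wdeg w m = e)"

definition peval :: "('v \<Rightarrow> 'k::comm_ring_1) \<Rightarrow> ('v, 'k) mpoly \<Rightarrow> 'k" where
  "peval a p = (\<Sum>m\<in>Poly_Mapping.keys p. Poly_Mapping.lookup p m *
     (\<Prod>v\<in>Poly_Mapping.keys m. a v ^ Poly_Mapping.lookup m v))"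


section \<open>Smooth projective curves\<close>

text \<open>Points of projective n-space are given by homogeneous coordinate vectors
  (indexed by 0, ..., n, and zero beyond). A subset of projective space is represented by the set
  of all coordinate vectors of its points, that is, by its affine cone without the origin.\<close>

definition proj_vecs :: "nat \<Rightarrow> (nat \<Rightarrow> 'k::field) set" where
  "proj_vecs n = {a. (\<exists>i. a i \<noteq> 0) \<and> (\<forall>i>n. a i = 0)}"

definition same_point :: "(nat \<Rightarrow> 'k::field) \<Rightarrow> (nat \<Rightarrow> 'k) \<Rightarrow> bool" where
  "same_point P Q \<longleftrightarrow> (\<exists>c. c \<noteq> 0 \<and> Q = (\<lambda>i. c * P i))"

definition forms :: "nat \<Rightarrow> nat \<Rightarrow> (nat, 'k::field) mpoly set" where
  "forms n e = {F \<in> polys_in {..n}. homog (\<lambda>_. 1) e F}"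

definition zero_locus :: "nat \<Rightarrow> (nat, 'k::field) mpoly set \<Rightarrow> (nat \<Rightarrow> 'k) set" where
  "zero_locus n T = {a \<in> proj_vecs n. \<forall>F\<in>T. peval a F = 0}"

definition proj_closed :: "nat \<Rightarrow> (nat \<Rightarrow> 'k::field) set \<Rightarrow> bool" where
  "proj_closed n Z \<longleftrightarrow> (\<exists>T \<subseteq> (\<Union>e. forms n e). Z = zero_locus n T)"

definition proj_variety :: "nat \<Rightarrow> (nat \<Rightarrow> 'k::field) set \<Rightarrow> bool" where
  "proj_variety n Z \<longleftrightarrow> proj_closed n Z \<and> Z \<noteq> {} \<and>
     (\<forall>Z1 Z2. proj_closed n Z1 \<and> proj_closed n Z2 \<and> Z = Z1 \<union> Z2 \<longrightarrow> Z = Z1 \<or> Z = Z2)"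

definition proj_dim :: "nat \<Rightarrow> (nat \<Rightarrow> 'k::field) set \<Rightarrow> enat" where
  "proj_dim n Z = Sup {enat r | r. \<exists>c. (\<forall>i\<le>r. proj_variety n (c i) \<and> c i \<subseteq> Z) \<and>
     (\<forall>i<r. c i \<subset> c (Suc i))}"

definition vanishing_ideal :: "nat \<Rightarrow> (nat \<Rightarrow> 'k::field) set \<Rightarrow> (nat, 'k) mpoly set" where
  "vanishing_ideal n Z = {F \<in> polys_in {..n}. \<forall>a\<in>Z. peval a F = 0}"

text \<open>The function field: classes of fractions F/G of forms of equal degree with G not vanishing
  identically on C.\<close>

type_synonym 'k ratfun = "((nat, 'k) mpoly \<times> (nat, 'k) mpoly) set"

definition fractions ::
  "nat \<Rightarrow> (nat \<Rightarrow> 'k::field) set \<Rightarrow> ((nat, 'k) mpoly \<times> (nat, 'k) mpoly) set" where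
  "fractions n C = {(F, G). (\<exists>e. F \<in> forms n e \<and> G \<in> forms n e) \<and> G \<notin> vanishing_ideal n C}"

definition frac_rel ::
  "nat \<Rightarrow> (nat \<Rightarrow> 'k::field) set \<Rightarrow> ((nat, 'k) mpoly \<times> (nat, 'k) mpoly) rel" where
  "frac_rel n C = {((F, G), (F', G')). (F, G) \<in> fractions n C \<and> (F', G') \<in> fractions n C \<and>
     F * G' - F' * G \<in> vanishing_ideal n C}"

definition frac_class ::
  "nat \<Rightarrow> (nat \<Rightarrow> 'k::field) set \<Rightarrow> (nat, 'k) mpoly \<Rightarrow> (nat, 'k) mpoly \<Rightarrow> 'k ratfun" where
  "frac_class n C F G = frac_rel n C `` {(F, G)}"

definition function_field :: "nat \<Rightarrow> (nat \<Rightarrow> 'k::field) set \<Rightarrow> 'k ratfun ring" where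
  "function_field n C = \<lparr>
     carrier = fractions n C // frac_rel n C,
     mult = (\<lambda>f f'. \<Union>(F, G)\<in>f. \<Union>(F', G')\<in>f'. frac_class n C (F * F') (G * G')),
     one = frac_class n C 1 1,
     zero = frac_class n C 0 1,
     add = (\<lambda>f f'. \<Union>(F, G)\<in>f. \<Union>(F', G')\<in>f'. frac_class n C (F * G' + F' * G) (G * G'))\<rparr>"

definition const_fun :: "nat \<Rightarrow> (nat \<Rightarrow> 'k::field) set \<Rightarrow> 'k \<Rightarrow> 'k ratfun" where
  "const_fun n C c = frac_class n C (const_poly c) 1"

definition local_ring :: "nat \<Rightarrow> (nat \<Rightarrow> 'k::field) set \<Rightarrow> (nat \<Rightarrow> 'k) \<Rightarrow> 'k ratfun ring" where
  "local_ring n C P = (function_field n C)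
     \<lparr>carrier := {f \<in> carrier (function_field n C). \<exists>(F, G)\<in>f. peval P G \<noteq> 0}\<rparr>"

definition local_max :: "nat \<Rightarrow> (nat \<Rightarrow> 'k::field) set \<Rightarrow> (nat \<Rightarrow> 'k) \<Rightarrow> 'k ratfun set" where
  "local_max n C P =
     {f \<in> carrier (function_field n C). \<exists>(F, G)\<in>f. peval P G \<noteq> 0 \<and> peval P F = 0}"

primrec local_max_power ::
  "nat \<Rightarrow> (nat \<Rightarrow> 'k::field) set \<Rightarrow> (nat \<Rightarrow> 'k) \<Rightarrow> nat \<Rightarrow> 'k ratfun set" where
  "local_max_power n C P 0 = carrier (local_ring n C P)"
| "local_max_power n C P (Suc r) =
     ideal_prod (local_ring n C P) (local_max n C P) (local_max_power n C P r)"

text \<open>Regularity of the local ring of a curve at P: the cotangent space, i.e. the maximal ideal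
  modulo its square, is one-dimensional over k (spanned by the class of t, which is nonzero).\<close>

definition smooth_curve_at :: "nat \<Rightarrow> (nat \<Rightarrow> 'k::field) set \<Rightarrow> (nat \<Rightarrow> 'k) \<Rightarrow> bool" where
  "smooth_curve_at n C P \<longleftrightarrow>
     (\<exists>t \<in> local_max n C P. t \<notin> local_max_power n C P 2 \<and>
        (\<forall>f \<in> local_max n C P. \<exists>c. \<exists>u \<in> local_max_power n C P 2.
           f = (const_fun n C c \<otimes>\<^bsub>function_field n C\<^esub> t) \<oplus>\<^bsub>function_field n C\<^esub> u))"

definition smooth_projective_curve :: "nat \<Rightarrow> (nat \<Rightarrow> 'k::field) set \<Rightarrow> bool" where
  "smooth_projective_curve n C \<longleftrightarrow>
     proj_variety n C \<and> proj_dim n C = 1 \<and> (\<forall>Q\<in>C. smooth_curve_at n C Q)"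

text \<open>The genus as arithmetic genus: the Hilbert polynomial of C is (deg C) m + 1 - g.\<close>

definition hilbert_function :: "nat \<Rightarrow> (nat \<Rightarrow> 'k::field) set \<Rightarrow> nat \<Rightarrow> int" where
  "hilbert_function n C m =
     int (vector_space.dim (\<lambda>c p. const_poly c * p) (forms n m :: (nat, 'k) mpoly set)) -
     int (vector_space.dim (\<lambda>c p. const_poly c * p) (forms n m \<inter> vanishing_ideal n C))"

definition has_genus :: "nat \<Rightarrow> (nat \<Rightarrow> 'k::field) set \<Rightarrow> nat \<Rightarrow> bool" where
  "has_genus n C g \<longleftrightarrow>
     (\<exists>\<delta> M. \<forall>m\<ge>M. hilbert_function n C m = \<delta> * int m + 1 - int g)"


section \<open>Order of vanishing, Weierstrass semigroup\<close>

definition local_ord :: "nat \<Rightarrow> (nat \<Rightarrow> 'k::field) set \<Rightarrow> (nat \<Rightarrow> 'k) \<Rightarrow> 'k ratfun \<Rightarrow> nat" where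
  "local_ord n C P a = (LEAST r. a \<notin> local_max_power n C P (Suc r))"

text \<open>Extension of \<^const>\<open>local_ord\<close> from the local ring to nonzero elements f = a/b
  of its fraction field.\<close>

definition ord_at :: "nat \<Rightarrow> (nat \<Rightarrow> 'k::field) set \<Rightarrow> (nat \<Rightarrow> 'k) \<Rightarrow> 'k ratfun \<Rightarrow> int" where
  "ord_at n C P f = (THE r. \<exists>a \<in> carrier (local_ring n C P). \<exists>b \<in> carrier (local_ring n C P).
     a \<noteq> \<zero>\<^bsub>function_field n C\<^esub> \<and> b \<noteq> \<zero>\<^bsub>function_field n C\<^esub> \<and>
     f \<otimes>\<^bsub>function_field n C\<^esub> b = a \<and>
     r = int (local_ord n C P a) - int (local_ord n C P b))"

definition regular_away :: "nat \<Rightarrow> (nat \<Rightarrow> 'k::field) set \<Rightarrow> (nat \<Rightarrow> 'k) \<Rightarrow> 'k ratfun set" where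
  "regular_away n C P = {f \<in> carrier (function_field n C).
     \<forall>Q\<in>C. \<not> same_point P Q \<longrightarrow> f \<in> carrier (local_ring n C Q)}"

text \<open>The global sections of O(rP).\<close>

definition sections :: "nat \<Rightarrow> (nat \<Rightarrow> 'k::field) set \<Rightarrow> (nat \<Rightarrow> 'k) \<Rightarrow> nat \<Rightarrow> 'k ratfun set" where
  "sections n C P r = {f \<in> regular_away n C P.
     f = \<zero>\<^bsub>function_field n C\<^esub> \<or> ord_at n C P f \<ge> - int r}"

definition weierstrass :: "nat \<Rightarrow> (nat \<Rightarrow> 'k::field) set \<Rightarrow> (nat \<Rightarrow> 'k) \<Rightarrow> nat set" where
  "weierstrass n C P = {r. \<exists>f \<in> regular_away n C P.
     f \<noteq> \<zero>\<^bsub>function_field n C\<^esub> \<and> int r = - ord_at n C P f}"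

definition ordinary :: "nat \<Rightarrow> (nat \<Rightarrow> 'k::field) set \<Rightarrow> (nat \<Rightarrow> 'k) \<Rightarrow> nat \<Rightarrow> bool" where
  "ordinary n C P g \<longleftrightarrow> UNIV - weierstrass n C P = {1..g}"

definition is_q :: "nat \<Rightarrow> (nat \<Rightarrow> 'k::field) set \<Rightarrow> (nat \<Rightarrow> 'k) \<Rightarrow> nat \<Rightarrow> nat \<Rightarrow> bool" where
  "is_q n C P d q \<longleftrightarrow> q \<ge> 1 \<and> q * d \<in> weierstrass n C P \<and>
     (\<forall>q'\<ge>1. q' * d \<in> weierstrass n C P \<longrightarrow> q \<le> q')"


section \<open>Section ring\<close>

text \<open>The section ring, as the subring of K[T] (K the function field) of polynomials whose
  coefficient of the m-th power of T lies in the space of sections of O(mdP).\<close>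

definition section_ring ::
  "nat \<Rightarrow> (nat \<Rightarrow> 'k::field) set \<Rightarrow> (nat \<Rightarrow> 'k) \<Rightarrow> nat \<Rightarrow> (nat \<Rightarrow> 'k ratfun) ring" where
  "section_ring n C P d = \<lparr>
     carrier = {p \<in> carrier (UP (function_field n C)).
       \<forall>m. coeff (UP (function_field n C)) p m \<in> sections n C P (m * d)},
     mult = mult (UP (function_field n C)),
     one = one (UP (function_field n C)),
     zero = zero (UP (function_field n C)),
     add = add (UP (function_field n C))\<rparr>"

text \<open>The homogeneous element of degree m given by a rational function f.\<close>

definition homog_elt ::
  "nat \<Rightarrow> (nat \<Rightarrow> 'k::field) set \<Rightarrow> nat \<Rightarrow> 'k ratfun \<Rightarrow> (nat \<Rightarrow> 'k ratfun)" where
  "homog_elt n C m f = monom (UP (function_field n C)) f m"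

definition x_elt :: "nat \<Rightarrow> (nat \<Rightarrow> 'k::field) set \<Rightarrow> (nat \<Rightarrow> 'k ratfun)" where
  "x_elt n C = homog_elt n C 1 \<one>\<^bsub>function_field n C\<^esub>"

definition xz_ideal ::
  "nat \<Rightarrow> (nat \<Rightarrow> 'k::field) set \<Rightarrow> (nat \<Rightarrow> 'k) \<Rightarrow> nat \<Rightarrow> nat \<Rightarrow> 'k ratfun \<Rightarrow>
   (nat \<Rightarrow> 'k ratfun) set" where
  "xz_ideal n C P d q \<zeta> =
     genideal (section_ring n C P d) {x_elt n C, homog_elt n C q \<zeta>}"

definition A_ring ::
  "nat \<Rightarrow> (nat \<Rightarrow> 'k::field) set \<Rightarrow> (nat \<Rightarrow> 'k) \<Rightarrow> nat \<Rightarrow> nat \<Rightarrow> 'k ratfun \<Rightarrow>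
   (nat \<Rightarrow> 'k ratfun) set ring" where
  "A_ring n C P d q \<zeta> = section_ring n C P d Quot xz_ideal n C P d q \<zeta>"

text \<open>The grading of the quotient is induced from the section ring, so its ideal of
  positive-degree elements consists of the classes of elements with zero degree-0 part.\<close>

definition A_plus ::
  "nat \<Rightarrow> (nat \<Rightarrow> 'k::field) set \<Rightarrow> (nat \<Rightarrow> 'k) \<Rightarrow> nat \<Rightarrow> nat \<Rightarrow> 'k ratfun \<Rightarrow>
   (nat \<Rightarrow> 'k ratfun) set set" where
  "A_plus n C P d q \<zeta> =
     (\<lambda>r. xz_ideal n C P d q \<zeta> +>\<^bsub>section_ring n C P d\<^esub> r) `
       {r \<in> carrier (section_ring n C P d).
          coeff (UP (function_field n C)) r 0 = \<zero>\<^bsub>function_field n C\<^esub>}"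


section \<open>Minimal weighted presentation\<close>

datatype var = X | Z | Y nat

definition pvars :: "nat \<Rightarrow> var set" where
  "pvars s = {X, Z} \<union> Y ` {1..s}"

definition pweight :: "nat \<Rightarrow> (nat \<Rightarrow> nat) \<Rightarrow> var \<Rightarrow> nat" where
  "pweight q v u = (case u of X \<Rightarrow> 1 | Z \<Rightarrow> q | Y a \<Rightarrow> v a)"

definition pgen ::
  "nat \<Rightarrow> (nat \<Rightarrow> 'k::field) set \<Rightarrow> nat \<Rightarrow> 'k ratfun \<Rightarrow> (nat \<Rightarrow> nat) \<Rightarrow> (nat \<Rightarrow> 'k ratfun) \<Rightarrow>
   var \<Rightarrow> (nat \<Rightarrow> 'k ratfun)" where
  "pgen n C q \<zeta> v \<eta> u =
     (case u of X \<Rightarrow> x_elt n C | Z \<Rightarrow> homog_elt n C q \<zeta> | Y a \<Rightarrow> homog_elt n C (v a) (\<eta> a))"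

text \<open>The k-algebra homomorphism from the polynomial ring to the section ring that sends
  each variable u to \<open>gen u\<close>.\<close>

definition pres_map ::
  "nat \<Rightarrow> (nat \<Rightarrow> 'k::field) set \<Rightarrow> (nat \<Rightarrow> 'k) \<Rightarrow> nat \<Rightarrow> (var \<Rightarrow> (nat \<Rightarrow> 'k ratfun)) \<Rightarrow>
   (var, 'k) mpoly \<Rightarrow> (nat \<Rightarrow> 'k ratfun)" where
  "pres_map n C P d gen p =
     (\<Oplus>\<^bsub>section_ring n C P d\<^esub> m \<in> Poly_Mapping.keys p.
        homog_elt n C 0 (const_fun n C (Poly_Mapping.lookup p m)) \<otimes>\<^bsub>section_ring n C P d\<^esub>
        (\<Otimes>\<^bsub>section_ring n C P d\<^esub> u \<in> Poly_Mapping.keys m.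
           gen u [^]\<^bsub>section_ring n C P d\<^esub> Poly_Mapping.lookup m u))"

text \<open>The generators x, z, y_1, ..., y_s form a minimal generating set: they generate the section
  ring as a k-algebra, but no proper subfamily does. Here z and the y_a are the homogeneous
  elements given by the rational functions \<open>\<zeta>\<close> and \<open>\<eta> a\<close> in degrees q and v a.\<close>

definition min_presentation ::
  "nat \<Rightarrow> (nat \<Rightarrow> 'k::field) set \<Rightarrow> (nat \<Rightarrow> 'k) \<Rightarrow> nat \<Rightarrow> nat \<Rightarrow> 'k ratfun \<Rightarrow>
   nat \<Rightarrow> (nat \<Rightarrow> nat) \<Rightarrow> (nat \<Rightarrow> 'k ratfun) \<Rightarrow> bool" where
  "min_presentation n C P d q \<zeta> s v \<eta> \<longleftrightarrow>
     is_q n C P d q \<and>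
     \<zeta> \<in> sections n C P (q * d) \<and> \<zeta> \<noteq> \<zero>\<^bsub>function_field n C\<^esub> \<and>
     ord_at n C P \<zeta> = - int (q * d) \<and>
     (\<forall>a\<in>{1..s}. \<eta> a \<in> sections n C P (v a * d)) \<and>
     (\<forall>a\<in>{1..s}. \<forall>b\<in>{1..s}. a \<le> b \<longrightarrow> v a \<le> v b) \<and>
     pres_map n C P d (pgen n C q \<zeta> v \<eta>) ` polys_in (pvars s) = carrier (section_ring n C P d) \<and>
     (\<forall>U. U \<subset> pvars s \<longrightarrow>
        pres_map n C P d (pgen n C q \<zeta> v \<eta>) ` polys_in U \<noteq> carrier (section_ring n C P d))"


section \<open>Graded free resolutions and Betti numbers\<close>

text \<open>The i-th free module has basis \<open>basis F i\<close> with degrees \<open>bdeg F i\<close>; its elements are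
  finitely supported coefficient vectors over the polynomial ring. The basis element b of the
  (i+1)-st module is sent by the differential to \<open>diff F i b\<close> in the i-th module, and the
  basis element b of the 0-th module is sent by the augmentation to the homogeneous element
  of the section ring given by the rational function \<open>aug F b\<close>.\<close>

record (overloaded) ('k::zero) resolution =
  basis :: "nat \<Rightarrow> nat set"
  bdeg :: "nat \<Rightarrow> nat \<Rightarrow> nat"
  diff :: "nat \<Rightarrow> nat \<Rightarrow> (nat \<Rightarrow>\<^sub>0 (var, 'k) mpoly)"
  aug :: "nat \<Rightarrow> 'k ratfun"

definition free_mod :: "nat \<Rightarrow> nat set \<Rightarrow> (nat \<Rightarrow>\<^sub>0 (var, 'k::field) mpoly) set" where
  "free_mod s B = {u. Poly_Mapping.keys u \<subseteq> B \<and> (\<forall>b. Poly_Mapping.lookup u b \<in> polys_in (pvars s))}"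

text \<open>The linear extension of a map given on basis elements.\<close>

definition lin_ext :: "(nat \<Rightarrow> (nat \<Rightarrow>\<^sub>0 'r::comm_ring_1)) \<Rightarrow> (nat \<Rightarrow>\<^sub>0 'r) \<Rightarrow> (nat \<Rightarrow>\<^sub>0 'r)" where
  "lin_ext D u = (\<Sum>b\<in>Poly_Mapping.keys u.
     Poly_Mapping.map (\<lambda>r. Poly_Mapping.lookup u b * r) (D b))"

definition aug_map ::
  "nat \<Rightarrow> (nat \<Rightarrow> 'k::field) set \<Rightarrow> (nat \<Rightarrow> 'k) \<Rightarrow> nat \<Rightarrow> (var \<Rightarrow> (nat \<Rightarrow> 'k ratfun)) \<Rightarrow>
   'k resolution \<Rightarrow> (nat \<Rightarrow>\<^sub>0 (var, 'k) mpoly) \<Rightarrow> (nat \<Rightarrow> 'k ratfun)" where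
  "aug_map n C P d gen F u =
     (\<Oplus>\<^bsub>section_ring n C P d\<^esub> b \<in> Poly_Mapping.keys u.
        pres_map n C P d gen (Poly_Mapping.lookup u b) \<otimes>\<^bsub>section_ring n C P d\<^esub>
        homog_elt n C (bdeg F 0 b) (aug F b))"

definition free_resolution ::
  "nat \<Rightarrow> (nat \<Rightarrow> 'k::field) set \<Rightarrow> (nat \<Rightarrow> 'k) \<Rightarrow> nat \<Rightarrow> nat \<Rightarrow> 'k ratfun \<Rightarrow>
   nat \<Rightarrow> (nat \<Rightarrow> nat) \<Rightarrow> (nat \<Rightarrow> 'k ratfun) \<Rightarrow> 'k resolution \<Rightarrow> bool" where
  "free_resolution n C P d q \<zeta> s v \<eta> F \<longleftrightarrow>
     (let gen = pgen n C q \<zeta> v \<eta>; w = pweight q v; M = (\<lambda>i. free_mod s (basis F i)) in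
      \<comment> \<open>finitely many basis elements in each degree\<close>
      (\<forall>i j. finite {b \<in> basis F i. bdeg F i b = j}) \<and>
      \<comment> \<open>the differentials and the augmentation are homogeneous of degree 0\<close>
      (\<forall>i. \<forall>b \<in> basis F (Suc i). diff F i b \<in> M i \<and>
         (\<forall>c \<in> Poly_Mapping.keys (diff F i b).
            bdeg F i c \<le> bdeg F (Suc i) b \<and>
            homog w (bdeg F (Suc i) b - bdeg F i c) (Poly_Mapping.lookup (diff F i b) c))) \<and>
      (\<forall>b \<in> basis F 0. aug F b \<in> sections n C P (bdeg F 0 b * d)) \<and>
      \<comment> \<open>exactness\<close>
      aug_map n C P d gen F ` M 0 = carrier (section_ring n C P d) \<and>
      {u \<in> M 0. aug_map n C P d gen F u = \<zero>\<^bsub>section_ring n C P d\<^esub>} =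
        lin_ext (diff F 0) ` M 1 \<and>
      (\<forall>i. {u \<in> M (Suc i). lin_ext (diff F i) u = 0} = lin_ext (diff F (Suc i)) ` M (i + 2)))"

text \<open>A resolution is minimal if the image of each differential lies in the (irrelevant maximal
  ideal) times the next module.\<close>

definition min_free_resolution ::
  "nat \<Rightarrow> (nat \<Rightarrow> 'k::field) set \<Rightarrow> (nat \<Rightarrow> 'k) \<Rightarrow> nat \<Rightarrow> nat \<Rightarrow> 'k ratfun \<Rightarrow>
   nat \<Rightarrow> (nat \<Rightarrow> nat) \<Rightarrow> (nat \<Rightarrow> 'k ratfun) \<Rightarrow> 'k resolution \<Rightarrow> bool" where
  "min_free_resolution n C P d q \<zeta> s v \<eta> F \<longleftrightarrow>
     free_resolution n C P d q \<zeta> s v \<eta> F \<and>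
     (\<forall>i. \<forall>b \<in> basis F (Suc i). \<forall>c. const_term (Poly_Mapping.lookup (diff F i b) c) = 0)"

definition is_pure :: "'k::zero resolution \<Rightarrow> bool" where
  "is_pure F \<longleftrightarrow> (\<forall>i. \<exists>j. \<forall>b \<in> basis F i. bdeg F i b = j)"

text \<open>Existence is included so that the assertion is not vacuous; minimal graded free resolutions
  are unique up to isomorphism.\<close>

definition min_resolution_pure ::
  "nat \<Rightarrow> (nat \<Rightarrow> 'k::field) set \<Rightarrow> (nat \<Rightarrow> 'k) \<Rightarrow> nat \<Rightarrow> nat \<Rightarrow> 'k ratfun \<Rightarrow>
   nat \<Rightarrow> (nat \<Rightarrow> nat) \<Rightarrow> (nat \<Rightarrow> 'k ratfun) \<Rightarrow> bool" where
  "min_resolution_pure n C P d q \<zeta> s v \<eta> \<longleftrightarrow>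
     (\<exists>F. min_free_resolution n C P d q \<zeta> s v \<eta> F) \<and>
     (\<forall>F. min_free_resolution n C P d q \<zeta> s v \<eta> F \<longrightarrow> is_pure F)"

text \<open>Tensoring a free resolution with k = S / (irrelevant maximal ideal) leaves the k-vector
  spaces on the bases, with the constant terms of the matrix entries as differentials;
  \<open>tensor_piece F i j\<close> is the degree-j part of the i-th term.\<close>

definition tensor_piece :: "'k::field resolution \<Rightarrow> nat \<Rightarrow> nat \<Rightarrow> (nat \<Rightarrow>\<^sub>0 'k) set" where
  "tensor_piece F i j = {u. Poly_Mapping.keys u \<subseteq> {b \<in> basis F i. bdeg F i b = j}}"

definition tensor_diff :: "'k::field resolution \<Rightarrow> nat \<Rightarrow> (nat \<Rightarrow>\<^sub>0 'k) \<Rightarrow> (nat \<Rightarrow>\<^sub>0 'k)" where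
  "tensor_diff F i = lin_ext (\<lambda>b. Poly_Mapping.map const_term (diff F i b))"

definition tensor_cycles :: "'k::field resolution \<Rightarrow> nat \<Rightarrow> nat \<Rightarrow> (nat \<Rightarrow>\<^sub>0 'k) set" where
  "tensor_cycles F i j =
     (case i of 0 \<Rightarrow> tensor_piece F 0 j
      | Suc i' \<Rightarrow> {u \<in> tensor_piece F (Suc i') j. tensor_diff F i' u = 0})"

definition tensor_boundaries :: "'k::field resolution \<Rightarrow> nat \<Rightarrow> nat \<Rightarrow> (nat \<Rightarrow>\<^sub>0 'k) set" where
  "tensor_boundaries F i j = tensor_diff F i ` tensor_piece F (Suc i) j"

definition tensor_homology_dim :: "'k::field resolution \<Rightarrow> nat \<Rightarrow> nat \<Rightarrow> int" where
  "tensor_homology_dim F i j =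
     int (vector_space.dim (\<lambda>c. Poly_Mapping.map (\<lambda>r. c * r)) (tensor_cycles F i j)) -
     int (vector_space.dim (\<lambda>c. Poly_Mapping.map (\<lambda>r. c * r)) (tensor_boundaries F i j))"

text \<open>The dimension of the degree-j part of the i-th Tor of the section ring with k, computed
  from a chosen (not necessarily minimal) graded free resolution.\<close>

definition betti ::
  "nat \<Rightarrow> (nat \<Rightarrow> 'k::field) set \<Rightarrow> (nat \<Rightarrow> 'k) \<Rightarrow> nat \<Rightarrow> nat \<Rightarrow> 'k ratfun \<Rightarrow>
   nat \<Rightarrow> (nat \<Rightarrow> nat) \<Rightarrow> (nat \<Rightarrow> 'k ratfun) \<Rightarrow> nat \<Rightarrow> nat \<Rightarrow> int" where
  "betti n C P d q \<zeta> s v \<eta> i j =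
     tensor_homology_dim (SOME F. free_resolution n C P d q \<zeta> s v \<eta> F) i j"

end

theory Submission
  imports Defs "HOL-Computational_Algebra.Formal_Laurent_Series" "HOL-Library.Function_Algebras"
begin

text \<open>Expansion in a local parameter at \<open>P\<close> embeds the function field into the field of Laurent series.
  It is injective because the Hilbert function of the curve is linear, and a function regular
  everywhere is constant because places can be extended (Chevalley). So \<open>R_d\<close> becomes
  a ring of polynomials over Laurent series, filtered by pole order.

  If the square of \<open>\<aa>\<close> vanishes and all \<open>y_a\<close> have weight \<open>v\<close>, then every product \<open>y_f y_c\<close>
  is congruent to a polynomial of degree at most 1 in the \<open>y\<close>, and by minimality of the generators
  the polynomials of degree at most 1 in the \<open>y\<close> meet the kernel of \<open>S_d \<rightarrow> R_d\<close> trivially.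
  The relations obtained in this way form a Pommaret basis of the kernel; the relations between
  them have the same shape, with non-multiplicative variables \<open>y_b\<close> for \<open>b\<close> smaller than the class.
  The resulting free resolution has a basis of sequences \<open>f \<le> c > b_2 > ... > b_i\<close> in step \<open>i\<close>,
  all of degree \<open>(i+1)v\<close>, and is therefore minimal. Any two graded free resolutions are homotopy
  equivalent, so this one determines the Betti numbers and the degrees in every minimal resolution.

  At an ordinary point and \<open>d = g + 1\<close> every pole order greater than \<open>2d\<close> is \<open>d\<close> plus another
  pole order. Hence \<open>q = 1\<close>, the ideal \<open>(x,z)\<close> contains all elements of degree at least 3, and all \<open>y_a\<close>
  have weight 2.\<close>

section \<open>Multivariate polynomials\<close>

text \<open>The shape of the resolution comes from freeness: under the hypotheses on \<aa> and the
  weights, \<open>R_d\<close> is free over \<open>k[x,z]\<close> with basis 1 and the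
  \<open>y_a\<close>. Modulo x and z what remains is the polynomial ring in the y modulo the square
  of its maximal ideal, and the Betti numbers are those of that quotient: c choices for f,
  \<open>(c - 1) choose (i - 1)\<close> choices for the smaller b, and summation over c gives
  \<open>i * ((s + 1) choose (i + 1))\<close>. Treating x and z as multiplicative variables of every
  class avoids an actual reduction modulo a regular sequence.

  The other obstacle is the language: orders, sections and the section ring are given by classes of
  fractions, choices and definite descriptions. Laurent series replace these by one computable
  invariant, the subdegree: being a section of a multiple of P becomes an inequality, and leading
  coefficients can be cancelled. The price is two geometric facts, injectivity of the expansion and
  constancy of global functions. The second one rules out generators of weight 0 and so yields the
  positive degree jumps on which minimality of the resolution rests.\<close>

lemma restr_lookup: "Poly_Mapping.lookup (Poly_Mapping.mapp (\<lambda>k c. c when k \<in> S) p) k = (Poly_Mapping.lookup p k when k \<in> S)"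
  by (simp add: lookup_mapp when_def in_keys_iff)

lemma sum_singles: "(\<Sum>m\<in>Poly_Mapping.keys p. Poly_Mapping.single m (Poly_Mapping.lookup p m)) = p"
proof (rule poly_mapping_eqI)
  fix k
  show "Poly_Mapping.lookup (\<Sum>m\<in>Poly_Mapping.keys p. Poly_Mapping.single m (Poly_Mapping.lookup p m)) k = Poly_Mapping.lookup p k"
    by (simp add: lookup_sum lookup_single when_def in_keys_iff)
qed

text \<open>Additive properties need to be checked on single terms only. Restricting the last
  hypothesis to keys of \<open>p\<close> lets support and degree conditions on \<open>p\<close>
  enter each case.\<close>

lemma poly_mapping_closure:
  fixes p :: "'a \<Rightarrow>\<^sub>0 'b::comm_monoid_add"
  assumes "P 0" "\<And>a b. P a \<Longrightarrow> P b \<Longrightarrow> P (a + b)"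
    and "\<And>m. m \<in> Poly_Mapping.keys p \<Longrightarrow> P (Poly_Mapping.single m (Poly_Mapping.lookup p m))"
  shows "P p"
proof -
  have "finite F \<Longrightarrow> F \<subseteq> Poly_Mapping.keys p \<Longrightarrow> P (\<Sum>m\<in>F. Poly_Mapping.single m (Poly_Mapping.lookup p m))" for F
    by (induction F rule: finite_induct) (auto intro: assms)
  from this[of "Poly_Mapping.keys p"] show ?thesis by (simp add: sum_singles)
qed

definition mon :: "('v \<Rightarrow> 'r::comm_monoid_mult) \<Rightarrow> ('v \<Rightarrow>\<^sub>0 nat) \<Rightarrow> 'r" where
  "mon a m = (\<Prod>v\<in>Poly_Mapping.keys m. a v ^ Poly_Mapping.lookup m v)"

lemma mon_superset: "finite V \<Longrightarrow> Poly_Mapping.keys m \<subseteq> V \<Longrightarrow> mon a m = (\<Prod>v\<in>V. a v ^ Poly_Mapping.lookup m v)"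
  unfolding mon_def by (rule prod.mono_neutral_left) (auto simp: in_keys_iff)

lemma keys_plus_nat: "Poly_Mapping.keys (m + m') = Poly_Mapping.keys m \<union> Poly_Mapping.keys (m' :: 'v \<Rightarrow>\<^sub>0 nat)"
  by (auto simp: in_keys_iff lookup_add)

lemma mon_0 [simp]: "mon a 0 = 1" by (simp add: mon_def)

lemma mon_add: "mon a (m + m') = mon a m * mon a m'"
proof -
  let ?V = "Poly_Mapping.keys m \<union> Poly_Mapping.keys m'"
  have "mon a (m + m') = (\<Prod>v\<in>?V. a v ^ Poly_Mapping.lookup (m+m') v)"
    by (rule mon_superset) (auto simp: keys_plus_nat)
  also have "\<dots> = mon a m * mon a m'"
    by (simp add: mon_superset[of ?V m] mon_superset[of ?V m'] lookup_add power_add prod.distrib)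
  finally show ?thesis .
qed

lemma mon_single [simp]: "mon a (Poly_Mapping.single v k) = a v ^ k"
  by (cases "k = 0") (simp_all add: mon_def)

text \<open>Coefficients reach the target through \<open>h\<close>, so that one development serves
  evaluation at points, expansion in power series and Laurent series, and polynomials over Laurent
  series.\<close>

locale scalar_hom =
  fixes h :: "'k::comm_ring_1 \<Rightarrow> 'r::comm_ring_1"
  assumes h0: "h 0 = 0" and h1: "h 1 = 1"
    and hadd: "h (a + b) = h a + h b" and hmult: "h (a * b) = h a * h b"
begin

definition ev :: "('v \<Rightarrow> 'r) \<Rightarrow> ('v, 'k) mpoly \<Rightarrow> 'r" where
  "ev a p = (\<Sum>m\<in>Poly_Mapping.keys p. h (Poly_Mapping.lookup p m) * mon a m)"

lemma ev_superset: "finite M \<Longrightarrow> Poly_Mapping.keys p \<subseteq> M \<Longrightarrow> ev a p = (\<Sum>m\<in>M. h (Poly_Mapping.lookup p m) * mon a m)"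
  unfolding ev_def by (rule sum.mono_neutral_left) (auto simp: in_keys_iff h0)

lemma ev_0 [simp]: "ev a 0 = 0" by (simp add: ev_def)

lemma ev_single [simp]: "ev a (Poly_Mapping.single m c) = h c * mon a m"
  by (cases "c = 0") (simp_all add: ev_def h0)

lemma ev_1 [simp]: "ev a 1 = 1" using ev_single[of a 0 1] by (simp add: h1)

lemma ev_add: "ev a (p + q) = ev a p + ev a q"
proof -
  let ?V = "Poly_Mapping.keys p \<union> Poly_Mapping.keys q"
  have "ev a (p + q) = (\<Sum>m\<in>?V. h (Poly_Mapping.lookup (p+q) m) * mon a m)"
    by (rule ev_superset) (auto simp: keys_add)
  also have "\<dots> = ev a p + ev a q"
    by (simp add: ev_superset[of ?V p] ev_superset[of ?V q] lookup_add hadd distrib_right sum.distrib)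
  finally show ?thesis .
qed

lemma ev_sum: "ev a (sum f A) = (\<Sum>x\<in>A. ev a (f x))"
  by (induction A rule: infinite_finite_induct) (auto simp: ev_add)

lemma ev_mult: "ev a (p * q) = ev a p * ev a q"
proof (rule poly_mapping_closure[of _ p])
  show "ev a (0 * q) = ev a 0 * ev a q" by simp
  fix x y assume "ev a (x * q) = ev a x * ev a q" "ev a (y * q) = ev a y * ev a q"
  then show "ev a ((x + y) * q) = ev a (x + y) * ev a q" by (simp add: distrib_right ev_add)
next
  fix m let ?s = "Poly_Mapping.single m (Poly_Mapping.lookup p m)"
  show "ev a (?s * q) = ev a ?s * ev a q"
  proof (rule poly_mapping_closure[of _ q])
    fix x y assume "ev a (?s * x) = ev a ?s * ev a x" "ev a (?s * y) = ev a ?s * ev a y"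
    then show "ev a (?s * (x + y)) = ev a ?s * ev a (x + y)" by (simp add: distrib_left ev_add)
  qed (simp_all add: mult_single hmult mon_add algebra_simps)
qed

lemma huminus: "h (- x) = - h x"
  using hadd[of x "-x"] by (simp add: eq_neg_iff_add_eq_0 add.commute h0)

lemma ev_uminus: "ev a (- p) = - ev a p"
  using ev_add[of a p "-p"] by (simp add: eq_neg_iff_add_eq_0 add.commute)

lemma ev_diff: "ev a (p - q) = ev a p - ev a q"
  using ev_add[of a p "-q"] by (simp add: ev_uminus)

lemma ev_power: "ev a (p ^ n) = ev a p ^ n"
  by (induction n) (auto simp: ev_mult)

end

interpretation idh: scalar_hom "\<lambda>x. x :: 'k::comm_ring_1"
  by unfold_locales auto

lemma peval_ev: "peval a p = idh.ev a p"
  by (simp add: peval_def idh.ev_def mon_def)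

lemma peval_simps [simp]:
  "peval a 0 = 0" "peval a 1 = 1" "peval a (p + q) = peval a p + peval a q"
  "peval a (p * q) = peval a p * peval a q" "peval a (- p) = - peval a p"
  "peval a (p - q) = peval a p - peval a q" "peval a (p ^ n) = peval a p ^ n"
  "peval a (Poly_Mapping.single m c) = c * mon a m"
  "peval a (const_poly c) = c"
  unfolding peval_ev const_poly_def idh.ev_add idh.ev_mult idh.ev_diff idh.ev_uminus idh.ev_power
    idh.ev_single by simp_all

lemma const_poly_simps [simp]:
  "const_poly 0 = 0" "const_poly 1 = 1" "const_poly (a + b) = const_poly a + const_poly b"
  "const_poly (a * b) = const_poly a * const_poly b"
  for a b :: "'k::comm_ring_1"
  by (simp_all add: const_poly_def single_add mult_single)


lemma polys_in_simps [simp, intro]: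
  "0 \<in> polys_in V"
  "p \<in> polys_in V \<Longrightarrow> q \<in> polys_in V \<Longrightarrow> p + q \<in> polys_in V"
  "p \<in> polys_in V \<Longrightarrow> - p \<in> polys_in V"
  "p \<in> polys_in V \<Longrightarrow> q \<in> polys_in V \<Longrightarrow> p - q \<in> polys_in V"
  "p \<in> polys_in V \<Longrightarrow> q \<in> polys_in V \<Longrightarrow> p * q \<in> polys_in V"
  "1 \<in> polys_in V"
  "const_poly c \<in> polys_in V"
  for p q :: "('v, 'k::comm_ring_1) mpoly"
proof -
  show "p + q \<in> polys_in V" if "p \<in> polys_in V" "q \<in> polys_in V"
    using that keys_add[of p q] unfolding polys_in_def by blast
  show "- p \<in> polys_in V" if "p \<in> polys_in V"
    using that by (simp add: polys_in_def)
  show "p - q \<in> polys_in V" if "p \<in> polys_in V" "q \<in> polys_in V"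
    using that keys_diff[of p q] unfolding polys_in_def by blast
  show "p * q \<in> polys_in V" if "p \<in> polys_in V" "q \<in> polys_in V"
    using that keys_mult[of p q] unfolding polys_in_def by (fastforce simp: keys_plus_nat)
qed (auto simp: polys_in_def const_poly_def)

lemma polys_in_single [simp]: "Poly_Mapping.single m c \<in> polys_in V \<longleftrightarrow> c = 0 \<or> Poly_Mapping.keys m \<subseteq> V"
  by (cases "c = 0") (auto simp: polys_in_def)

lemma polys_in_sum: "(\<And>x. x \<in> A \<Longrightarrow> f x \<in> polys_in V) \<Longrightarrow> sum f A \<in> polys_in V"
  for f :: "_ \<Rightarrow> ('v, 'k::comm_ring_1) mpoly"
  by (induction A rule: infinite_finite_induct) auto

lemma polys_in_power: "p \<in> polys_in V \<Longrightarrow> p ^ n \<in> polys_in V"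
  for p :: "('v, 'k::comm_ring_1) mpoly"
  by (induction n) auto

lemma polys_in_mono: "V \<subseteq> V' \<Longrightarrow> p \<in> polys_in V \<Longrightarrow> p \<in> polys_in V'"
  by (auto simp: polys_in_def)

lemma wdeg_superset: "finite V \<Longrightarrow> Poly_Mapping.keys m \<subseteq> V \<Longrightarrow> wdeg w m = (\<Sum>v\<in>V. Poly_Mapping.lookup m v * w v)"
  unfolding wdeg_def by (rule sum.mono_neutral_left) (auto simp: in_keys_iff)

lemma wdeg_0 [simp]: "wdeg w 0 = 0" by (simp add: wdeg_def)

lemma wdeg_add: "wdeg w (m + m') = wdeg w m + wdeg w m'"
proof -
  let ?V = "Poly_Mapping.keys m \<union> Poly_Mapping.keys m'"
  have "wdeg w (m + m') = (\<Sum>v\<in>?V. Poly_Mapping.lookup (m+m') v * w v)"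
    by (rule wdeg_superset) (auto simp: keys_plus_nat)
  also have "\<dots> = wdeg w m + wdeg w m'"
    by (simp add: wdeg_superset[of ?V m] wdeg_superset[of ?V m'] lookup_add distrib_right sum.distrib)
  finally show ?thesis .
qed

lemma wdeg_single [simp]: "wdeg w (Poly_Mapping.single v k) = k * w v"
  by (cases "k = 0") (simp_all add: wdeg_def)

lemma homog_simps [simp, intro]:
  "homog w e 0"
  "homog w e p \<Longrightarrow> homog w e q \<Longrightarrow> homog w e (p + q)"
  "homog w e p \<Longrightarrow> homog w e (- p)"
  "homog w e p \<Longrightarrow> homog w e q \<Longrightarrow> homog w e (p - q)"
  "homog w e p \<Longrightarrow> homog w e' q \<Longrightarrow> homog w (e + e') (p * q)"
  "homog w 0 1"
  "homog w 0 (const_poly c)"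
  for p q :: "('v, 'k::comm_ring_1) mpoly"
proof -
  show "homog w e (p + q)" if "homog w e p" "homog w e q"
    using that keys_add[of p q] unfolding homog_def by blast
  show "homog w e (- p)" if "homog w e p"
    using that by (simp add: homog_def)
  show "homog w e (p - q)" if "homog w e p" "homog w e q"
    using that keys_diff[of p q] unfolding homog_def by blast
  show "homog w (e + e') (p * q)" if "homog w e p" "homog w e' q"
    using that keys_mult[of p q] unfolding homog_def by (fastforce simp: wdeg_add)
qed (auto simp: homog_def const_poly_def)

lemma homog_single [simp]: "homog w e (Poly_Mapping.single m c) \<longleftrightarrow> c = 0 \<or> wdeg w m = e"
  by (cases "c = 0") (auto simp: homog_def)

lemma homog_const_mult: "homog w e p \<Longrightarrow> homog w e (const_poly c * p)"
  for p :: "('v, 'k::comm_ring_1) mpoly"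
  using homog_simps(5)[of w 0 "const_poly c" e p] by simp

lemma homog_sum: "(\<And>x. x \<in> A \<Longrightarrow> homog w e (f x)) \<Longrightarrow> homog w e (sum f A)"
  for f :: "_ \<Rightarrow> ('v, 'k::comm_ring_1) mpoly"
  by (induction A rule: infinite_finite_induct) auto

lemma homog_power: "homog w e p \<Longrightarrow> homog w (n * e) (p ^ n)"
  for p :: "('v, 'k::comm_ring_1) mpoly"
  by (induction n) (auto intro: homog_simps)


definition hcomp :: "('v \<Rightarrow> nat) \<Rightarrow> nat \<Rightarrow> ('v, 'k::comm_ring_1) mpoly \<Rightarrow> ('v, 'k) mpoly" where
  "hcomp w j p = Poly_Mapping.mapp (\<lambda>m c. c when m \<in> {m. wdeg w m = j}) p"

lemma hcomp_lookup: "Poly_Mapping.lookup (hcomp w j p) m = (Poly_Mapping.lookup p m when wdeg w m = j)"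
  unfolding hcomp_def restr_lookup by simp

lemma hcomp_add: "hcomp w j (p + q) = hcomp w j p + hcomp w j q"
  by (rule poly_mapping_eqI) (simp add: hcomp_lookup lookup_add when_def)

lemma hcomp_0 [simp]: "hcomp w j 0 = 0"
  by (rule poly_mapping_eqI) (simp add: hcomp_lookup)

lemma hcomp_sum: "hcomp w j (sum f A) = (\<Sum>x\<in>A. hcomp w j (f x))"
  by (induction A rule: infinite_finite_induct) (auto simp: hcomp_add)

lemma hcomp_homog: "homog w j (hcomp w j p)"
  by (auto simp: homog_def in_keys_iff hcomp_lookup)

lemma hcomp_of_homog: "homog w e p \<Longrightarrow> hcomp w j p = (if j = e then p else 0)"
  by (rule poly_mapping_eqI) (auto simp: hcomp_lookup homog_def when_def in_keys_iff)

lemma hcomp_polys_in: "p \<in> polys_in V \<Longrightarrow> hcomp w j p \<in> polys_in V"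
  by (auto simp: polys_in_def in_keys_iff hcomp_lookup)

lemma sum_hcomp: "(\<Sum>j\<in>wdeg w ` Poly_Mapping.keys p. hcomp w j p) = p"
proof (rule poly_mapping_eqI)
  fix m
  show "Poly_Mapping.lookup (\<Sum>j\<in>wdeg w ` Poly_Mapping.keys p. hcomp w j p) m = Poly_Mapping.lookup p m"
    by (cases "m \<in> Poly_Mapping.keys p") (auto simp: lookup_sum hcomp_lookup when_def in_keys_iff)
qed

text \<open>Multiplication by \<open>p\<close> shifts degrees by \<open>e\<close>, so only the
  component of \<open>q\<close> of degree \<open>j - e\<close> contributes. The test
  \<open>e \<le> j\<close> guards against truncated subtraction, which would select the component of
  degree 0.\<close>

lemma hcomp_mult_homog:
  assumes "homog w e p"
  shows "hcomp w j (p * q) = (if e \<le> j then p * hcomp w (j - e) q else 0)"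
proof -
  have "hcomp w j (p * q) = (\<Sum>i\<in>wdeg w ` Poly_Mapping.keys q. hcomp w j (p * hcomp w i q))"
    by (subst (1) sum_hcomp[of w q, symmetric]) (simp only: sum_distrib_left hcomp_sum)
  also have "\<dots> = (\<Sum>i\<in>wdeg w ` Poly_Mapping.keys q. if j = e + i then p * hcomp w i q else 0)"
    by (intro sum.cong refl hcomp_of_homog homog_simps(5) assms hcomp_homog)
  also have "\<dots> = (if e \<le> j then p * hcomp w (j - e) q else 0)"
  proof (cases "e \<le> j \<and> j - e \<in> wdeg w ` Poly_Mapping.keys q")
    case True
    then have "(\<Sum>i\<in>wdeg w ` Poly_Mapping.keys q. if j = e + i then p * hcomp w i q else 0)
        = (\<Sum>i\<in>wdeg w ` Poly_Mapping.keys q. if i = j - e then p * hcomp w i q else 0)"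
      by (intro sum.cong) auto
    with True show ?thesis by simp
  next
    case False
    have "hcomp w (j - e) q = 0" if "e \<le> j"
    proof (rule poly_mapping_eqI)
      fix m
      have "m \<notin> Poly_Mapping.keys q" if "wdeg w m = j - e"
        using False \<open>e \<le> j\<close> that by (auto simp: image_iff)
      then show "Poly_Mapping.lookup (hcomp w (j - e) q) m = Poly_Mapping.lookup 0 m"
        by (auto simp: hcomp_lookup when_def in_keys_iff)
    qed
    moreover have "(\<Sum>i\<in>wdeg w ` Poly_Mapping.keys q. if j = e + i then p * hcomp w i q else 0) = 0"
      using False by (intro sum.neutral) auto
    ultimately show ?thesis by auto
  qed
  finally show ?thesis .
qed

text \<open>Formulated for a subspace of a finitely generated span, because the ambient spaces of
  all polynomials or all series have infinite dimension. A basis \<open>B\<close> of the kernel is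
  extended to a basis \<open>D\<close> of \<open>V\<close>, and the images of \<open>D - B\<close>
  form a basis of the image.\<close>

lemma (in vector_space_pair) rank_nullity:
  assumes f: "Vector_Spaces.linear s1 s2 f" and V: "vs1.subspace V" and W: "finite W" "V \<subseteq> vs1.span W"
  shows "vs1.dim V = vs1.dim {v \<in> V. f v = 0} + vs2.dim (f ` V)"
proof -
  interpret f: Vector_Spaces.linear s1 s2 f by (rule f)
  let ?K = "{v \<in> V. f v = 0}"
  obtain B where B: "B \<subseteq> ?K" "vs1.independent B" "?K \<subseteq> vs1.span B"
    using vs1.maximal_independent_subset[of ?K] by blast
  obtain D where D: "B \<subseteq> D" "D \<subseteq> V" "vs1.independent D" "V \<subseteq> vs1.span D"
    using vs1.maximal_independent_subset_extend[of B V] B by blast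
  have finD: "finite D"
    using vs1.independent_span_bound[OF W(1) D(3)] D(2) W(2) by blast
  have dimV: "vs1.dim V = card D" using vs1.basis_card_eq_dim[OF D(2,4,3)] by simp
  have dimK: "vs1.dim ?K = card B" using vs1.basis_card_eq_dim[OF B(1,3,2)] by simp
  let ?E = "D - B"
  \<comment> \<open>A vanishing combination of images is the image of a kernel element, hence of a
    combination of \<open>B\<close>; independence of \<open>D\<close> then kills all
    coefficients.\<close>
  have key: "\<forall>v\<in>?E. c v = 0" if "(\<Sum>v\<in>?E. s2 (c v) (f v)) = 0" for c
  proof -
    let ?u = "\<Sum>v\<in>?E. s1 (c v) v"
    have "f ?u = 0" using that by (simp add: f.sum f.scale)
    moreover have "?u \<in> V" using D(2) V by (intro vs1.subspace_sum vs1.subspace_scale) auto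
    ultimately have "?u \<in> vs1.span B" using B(3) by auto
    then have "?u \<in> Set.range (\<lambda>b. \<Sum>v\<in>B. s1 (b v) v)"
      by (simp only: vs1.span_finite[OF finite_subset[OF D(1) finD]])
    then obtain b where b: "?u = (\<Sum>v\<in>B. s1 (b v) v)" by (rule rangeE)
    let ?g = "\<lambda>v. if v \<in> B then - b v else c v"
    have "(\<Sum>v\<in>D. s1 (?g v) v) = (\<Sum>v\<in>?E. s1 (?g v) v) + (\<Sum>v\<in>B. s1 (?g v) v)"
      by (rule sum.subset_diff[OF D(1) finD])
    also have "(\<Sum>v\<in>?E. s1 (?g v) v) = ?u" by (rule sum.cong) auto
    also have "(\<Sum>v\<in>B. s1 (?g v) v) = (\<Sum>v\<in>B. - s1 (b v) v)" by (rule sum.cong) auto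
    also have "\<dots> = - ?u" by (simp only: b sum_negf)
    finally have "(\<Sum>v\<in>D. s1 (?g v) v) = 0" by simp
    with D(3) finD have "\<forall>v\<in>D. ?g v = 0"
      using vs1.independentD[of D D ?g] by blast
    then show ?thesis by auto
  qed
  have inj: "inj_on f ?E"
  proof (rule inj_onI)
    fix x y assume xy: "x \<in> ?E" "y \<in> ?E" "f x = f y"
    show "x = y"
    proof (rule ccontr)
      assume "x \<noteq> y"
      let ?c = "\<lambda>v. if v = x then 1 else if v = y then -1 else (0::'a)"
      have "(\<Sum>v\<in>?E. s2 (?c v) (f v)) = (\<Sum>v\<in>{x,y}. s2 (?c v) (f v))"
        using xy finD by (intro sum.mono_neutral_right) auto
      also have "\<dots> = 0" using xy \<open>x \<noteq> y\<close> by simp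
      finally have "\<forall>v\<in>?E. ?c v = 0" by (rule key)
      with xy(1) show False by (auto dest: bspec[of _ _ x])
    qed
  qed
  have ind: "vs2.independent (f ` ?E)"
  proof (rule vs2.independent_if_scalars_zero)
    show "finite (f ` ?E)" using finD by simp
    fix c x assume c: "(\<Sum>x\<in>f ` ?E. s2 (c x) x) = 0" and x: "x \<in> f ` ?E"
    have "(\<Sum>v\<in>?E. s2 (c (f v)) (f v)) = 0" using c by (simp add: sum.reindex[OF inj])
    from key[OF this] show "c x = 0" using x by auto
  qed
  have span: "f ` V \<subseteq> vs2.span (f ` ?E)"
  proof
    fix y assume "y \<in> f ` V"
    then obtain v where v: "v \<in> V" "y = f v" by auto
    then have "v \<in> Set.range (\<lambda>b. \<Sum>v\<in>D. s1 (b v) v)"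
      using D(4) by (auto simp only: vs1.span_finite[OF finD])
    then obtain c where c: "v = (\<Sum>x\<in>D. s1 (c x) x)" by (rule rangeE)
    have "y = (\<Sum>x\<in>D. s2 (c x) (f x))" by (simp add: v c f.sum f.scale)
    also have "\<dots> = (\<Sum>x\<in>?E. s2 (c x) (f x))"
      using finD B(1) by (intro sum.mono_neutral_right) auto
    also have "\<dots> \<in> vs2.span (f ` ?E)"
      by (rule vs2.span_sum, rule vs2.span_scale, rule vs2.span_base, rule imageI)
    finally show "y \<in> vs2.span (f ` ?E)" .
  qed
  have "vs2.dim (f ` V) = card (f ` ?E)"
    using vs2.basis_card_eq_dim[OF _ span ind] D(2) by (metis Diff_subset image_mono order_trans)
  also have "\<dots> = card D - card B"
    using card_image[OF inj] D(1) finD by (simp add: card_Diff_subset finite_subset)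
  finally show ?thesis using dimV dimK card_mono[OF finD D(1)] by simp
qed

section \<open>The function field and the local rings\<close>

lemma forms_simps [simp, intro]:
  "0 \<in> forms n e"
  "F \<in> forms n e \<Longrightarrow> G \<in> forms n e \<Longrightarrow> F + G \<in> forms n e"
  "F \<in> forms n e \<Longrightarrow> G \<in> forms n e \<Longrightarrow> F - G \<in> forms n e"
  "F \<in> forms n e \<Longrightarrow> - F \<in> forms n e"
  "F \<in> forms n e \<Longrightarrow> G \<in> forms n e' \<Longrightarrow> F * G \<in> forms n (e + e')"
  "1 \<in> forms n 0"
  "const_poly c \<in> forms n 0"
  "F \<in> forms n e \<Longrightarrow> const_poly c * F \<in> forms n e"
  by (auto simp: forms_def intro: homog_const_mult)

lemma forms_mult_comm: "F \<in> forms n e \<Longrightarrow> G \<in> forms n e' \<Longrightarrow> F * G \<in> forms n (e' + e)"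
  using forms_simps(5)[of F n e G e'] by (simp add: add.commute)

lemma forms_power: "F \<in> forms n e \<Longrightarrow> F ^ r \<in> forms n (r * e)"
  by (auto simp: forms_def intro: homog_power polys_in_power)


lemma mon_scale: "mon (\<lambda>i. c * a i) m = c ^ wdeg (\<lambda>_. 1) m * mon a m"
  for c :: "'k::comm_semiring_1"
  by (simp add: mon_def wdeg_def power_mult_distrib prod.distrib power_sum)

lemma peval_homog_scale:
  assumes "homog (\<lambda>_. 1) e F"
  shows "peval (\<lambda>i. c * a i) F = c ^ e * peval a F"
proof -
  have "peval (\<lambda>i. c * a i) F = (\<Sum>m\<in>Poly_Mapping.keys F. Poly_Mapping.lookup F m * (c ^ e * mon a m))"
    unfolding peval_ev idh.ev_def using assms
    by (intro sum.cong refl) (simp add: mon_scale homog_def)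
  also have "\<dots> = c ^ e * peval a F"
    by (simp add: peval_ev idh.ev_def sum_distrib_left algebra_simps)
  finally show ?thesis .
qed

text \<open>The operations of the function field are unions over all pairs of representatives;
  well-definedness collapses such a union to a single class.\<close>

lemma UN_pair_const:
  assumes "\<And>A B A' B'. (A, B) \<in> S \<Longrightarrow> (A', B') \<in> S' \<Longrightarrow> f A B A' B' = c"
    and "(a, b) \<in> S" "(a', b') \<in> S'"
  shows "(\<Union>(A, B)\<in>S. \<Union>(A', B')\<in>S'. f A B A' B') = c"
proof
  show "(\<Union>(A, B)\<in>S. \<Union>(A', B')\<in>S'. f A B A' B') \<subseteq> c" using assms(1) by auto
  show "c \<subseteq> (\<Union>(A, B)\<in>S. \<Union>(A', B')\<in>S'. f A B A' B')" using assms(1)[OF assms(2,3)] assms(2,3) by blast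
qed

locale proj_var =
  fixes n :: nat and C :: "(nat \<Rightarrow> 'k::field) set"
  assumes proj_variety: "proj_variety n C"
begin

abbreviation "I \<equiv> vanishing_ideal n C"
abbreviation "K \<equiv> function_field n C"
abbreviation "fr \<equiv> fractions n C"
abbreviation "cl \<equiv> frac_class n C"

lemma I_simps [intro]:
  "0 \<in> I" "F \<in> I \<Longrightarrow> G \<in> I \<Longrightarrow> F + G \<in> I" "F \<in> I \<Longrightarrow> G \<in> I \<Longrightarrow> F - G \<in> I" "F \<in> I \<Longrightarrow> - F \<in> I"
  "F \<in> I \<Longrightarrow> G \<in> polys_in {..n} \<Longrightarrow> G * F \<in> I"
  "F \<in> I \<Longrightarrow> G \<in> polys_in {..n} \<Longrightarrow> F * G \<in> I"
  by (auto simp: vanishing_ideal_def)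

lemma forms_polys: "F \<in> forms n e \<Longrightarrow> F \<in> polys_in {..n}" by (simp add: forms_def)

lemma C_closed: "\<exists>T \<subseteq> (\<Union>e. forms n e). C = zero_locus n T"
  and C_ne: "C \<noteq> {}"
  using proj_variety by (auto simp: proj_variety_def proj_closed_def)

lemma C_proj_vecs: "Q \<in> C \<Longrightarrow> Q \<in> proj_vecs n"
  using C_closed by (auto simp: zero_locus_def)

lemma one_notin_I: "1 \<notin> I"
  using C_ne by (auto simp: vanishing_ideal_def)

text \<open>\<open>C\<close> is the union of its sections by \<open>F = 0\<close> and
  \<open>G = 0\<close>, and irreducibility makes one of these everything. Both factors are forms
  because closed sets are cut out by forms.\<close>

lemma prime:
  assumes F: "F \<in> forms n e" and G: "G \<in> forms n e'" and FG: "F * G \<in> I"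
  shows "F \<in> I \<or> G \<in> I"
proof -
  obtain T where T: "T \<subseteq> (\<Union>e. forms n e)" "C = zero_locus n T" using C_closed by blast
  have cl: "proj_closed n (zero_locus n (insert H T))" if "H \<in> forms n e''" for H e''
    unfolding proj_closed_def using T that by (intro exI[of _ "insert H T"]) auto
  have "C = zero_locus n (insert F T) \<union> zero_locus n (insert G T)"
    using FG unfolding T(2) by (auto simp: zero_locus_def vanishing_ideal_def)
  then have "C = zero_locus n (insert F T) \<or> C = zero_locus n (insert G T)"
    using proj_variety cl[OF F] cl[OF G] unfolding proj_variety_def by blast
  moreover have "F \<in> I" if "C = zero_locus n (insert F T)"
    using F that by (auto simp: vanishing_ideal_def zero_locus_def forms_polys)
  moreover have "G \<in> I" if "C = zero_locus n (insert G T)"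
    using G that by (auto simp: vanishing_ideal_def zero_locus_def forms_polys)
  ultimately show ?thesis by blast
qed

lemma frE:
  assumes "(F, G) \<in> fr"
  obtains e where "F \<in> forms n e" "G \<in> forms n e" "G \<notin> I"
  using assms by (auto simp: fractions_def)

lemma frI: "F \<in> forms n e \<Longrightarrow> G \<in> forms n e \<Longrightarrow> G \<notin> I \<Longrightarrow> (F, G) \<in> fr"
  by (auto simp: fractions_def)

lemma fr_polys: "(F, G) \<in> fr \<Longrightarrow> F \<in> polys_in {..n}" "(F, G) \<in> fr \<Longrightarrow> G \<in> polys_in {..n}"
  by (auto elim!: frE intro: forms_polys)

lemma fr_mult: "(F, G) \<in> fr \<Longrightarrow> (F', G') \<in> fr \<Longrightarrow> (F * F', G * G') \<in> fr"
  by (elim frE, rule frI) (auto dest: prime)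

lemma fr_add: "(F, G) \<in> fr \<Longrightarrow> (F', G') \<in> fr \<Longrightarrow> (F * G' + F' * G, G * G') \<in> fr"
  by (elim frE, rule frI) (auto dest: prime intro: forms_mult_comm)

lemma fr_const: "(const_poly c, 1) \<in> fr"
  by (rule frI[of _ 0]) (auto simp: one_notin_I)

lemma fr_01: "(0, 1) \<in> fr" "(1, 1) \<in> fr"
  using fr_const[of 0] fr_const[of 1] by simp_all

text \<open>The denominator \<open>G'\<close> of the middle fraction has to be cancelled; this is
  where primality of the ideal of the curve enters the construction of the function field.\<close>

lemma rel_trans:
  assumes "(F, G) \<in> fr" "(F', G') \<in> fr" "(F'', G'') \<in> fr"
    and 1: "F * G' - F' * G \<in> I" and 2: "F' * G'' - F'' * G' \<in> I"
  shows "F * G'' - F'' * G \<in> I"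
proof -
  obtain e where e: "F \<in> forms n e" "G \<in> forms n e" "G \<notin> I" using assms(1) by (rule frE)
  obtain e' where e': "F' \<in> forms n e'" "G' \<in> forms n e'" "G' \<notin> I" using assms(2) by (rule frE)
  obtain e'' where e'': "F'' \<in> forms n e''" "G'' \<in> forms n e''" "G'' \<notin> I" using assms(3) by (rule frE)
  have "G' * (F * G'' - F'' * G) = G'' * (F * G' - F' * G) + G * (F' * G'' - F'' * G')"
    by (simp add: algebra_simps)
  also have "\<dots> \<in> I" using 1 2 e e'' by (intro I_simps(2) I_simps(5)) (auto intro: forms_polys)
  finally have "G' * (F * G'' - F'' * G) \<in> I" .
  moreover have "F * G'' - F'' * G \<in> forms n (e + e'')"
    using e e'' by (auto intro: forms_mult_comm)
  ultimately show ?thesis using prime[OF e'(2)] e'(3) by blast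
qed

lemma mem_cl: "(F', G') \<in> cl F G \<longleftrightarrow> (F, G) \<in> fr \<and> (F', G') \<in> fr \<and> F * G' - F' * G \<in> I"
  by (auto simp: frac_class_def frac_rel_def)

lemma cl_self: "(F, G) \<in> fr \<Longrightarrow> (F, G) \<in> cl F G"
  by (auto simp: mem_cl)

lemma cl_eq: "(F, G) \<in> fr \<Longrightarrow> (F', G') \<in> fr \<Longrightarrow> cl F G = cl F' G' \<longleftrightarrow> F * G' - F' * G \<in> I"
proof
  assume a: "(F, G) \<in> fr" "(F', G') \<in> fr" "cl F G = cl F' G'"
  then show "F * G' - F' * G \<in> I" using cl_self[of F' G'] by (simp add: mem_cl flip: a(3))
next
  have sym: "A * B' - A' * B \<in> I \<Longrightarrow> A' * B - A * B' \<in> I" for A B A' B'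
    using I_simps(4)[of "A * B' - A' * B"] by simp
  assume a: "(F, G) \<in> fr" "(F', G') \<in> fr" "F * G' - F' * G \<in> I"
  show "cl F G = cl F' G'"
  proof (rule Set.set_eqI)
    fix z :: "(nat, 'k) mpoly \<times> (nat, 'k) mpoly"
    obtain F'' G'' where z: "z = (F'', G'')" by (cases z)
    show "z \<in> cl F G \<longleftrightarrow> z \<in> cl F' G'"
      unfolding z mem_cl
      using rel_trans[OF a(1,2) _ a(3), of F'' G''] rel_trans[OF a(2,1) _ sym[OF a(3)], of F'' G''] a(1,2) by blast
  qed
qed

lemma cl_eqI: "(F, G) \<in> fr \<Longrightarrow> (F', G') \<in> fr \<Longrightarrow> F * G' = F' * G \<Longrightarrow> cl F G = cl F' G'"
  by (subst cl_eq) auto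

lemma carrier_K: "carrier K = {cl F G | F G. (F, G) \<in> fr}"
  by (auto simp: function_field_def quotient_def frac_class_def)

lemma cl_carrier [simp]: "(F, G) \<in> fr \<Longrightarrow> cl F G \<in> carrier K"
  by (auto simp: carrier_K)

lemma carrierE:
  assumes "f \<in> carrier K" obtains F G where "(F, G) \<in> fr" "f = cl F G"
  using assms by (auto simp: carrier_K)

lemma cl_mem_eq: "(F', G') \<in> cl F G \<Longrightarrow> cl F' G' = cl F G"
  by (subst cl_eq) (auto simp: mem_cl dest: I_simps(4))

lemma mult_cl:
  assumes "(F, G) \<in> fr" "(F', G') \<in> fr"
  shows "cl F G \<otimes>\<^bsub>K\<^esub> cl F' G' = cl (F * F') (G * G')" (is "_ = ?rhs")
proof -
  have eq: "cl (A * A') (B * B') = cl (F * F') (G * G')" if "(A, B) \<in> cl F G" "(A', B') \<in> cl F' G'" for A B A' B'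
  proof (subst cl_eq)
    have "A * A' * (G * G') - F * F' * (B * B') = - (A' * G') * (F * B - A * G) + - (F * B) * (F' * B' - A' * G')"
      by (simp add: algebra_simps)
    also have "\<dots> \<in> I" using that by (intro I_simps(2) I_simps(5)) (auto simp: mem_cl dest: fr_polys)
    finally show "A * A' * (G * G') - F * F' * (B * B') \<in> I" .
  qed (use that in \<open>auto simp: mem_cl intro: fr_mult\<close>)
  have "cl F G \<otimes>\<^bsub>K\<^esub> cl F' G' = (\<Union>(A, B)\<in>cl F G. \<Union>(A', B')\<in>cl F' G'. cl (A * A') (B * B'))"
    by (simp add: function_field_def)
  also have "\<dots> = ?rhs"
    by (rule UN_pair_const[OF eq cl_self[OF assms(1)] cl_self[OF assms(2)]])
  finally show ?thesis .
qed

lemma add_cl: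
  assumes "(F, G) \<in> fr" "(F', G') \<in> fr"
  shows "cl F G \<oplus>\<^bsub>K\<^esub> cl F' G' = cl (F * G' + F' * G) (G * G')" (is "_ = ?rhs")
proof -
  have eq: "cl (A * B' + A' * B) (B * B') = cl (F * G' + F' * G) (G * G')"
    if "(A, B) \<in> cl F G" "(A', B') \<in> cl F' G'" for A B A' B'
  proof (subst cl_eq)
    have "(A * B' + A' * B) * (G * G') - (F * G' + F' * G) * (B * B')
        = - (B' * G') * (F * B - A * G) + - (B * G) * (F' * B' - A' * G')"
      by (simp add: algebra_simps)
    also have "\<dots> \<in> I" using that by (intro I_simps(2) I_simps(5)) (auto simp: mem_cl dest: fr_polys)
    finally show "(A * B' + A' * B) * (G * G') - (F * G' + F' * G) * (B * B') \<in> I" .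
  qed (use that in \<open>auto simp: mem_cl intro: fr_mult fr_add\<close>)
  have "cl F G \<oplus>\<^bsub>K\<^esub> cl F' G' = (\<Union>(A, B)\<in>cl F G. \<Union>(A', B')\<in>cl F' G'. cl (A * B' + A' * B) (B * B'))"
    by (simp add: function_field_def)
  also have "\<dots> = ?rhs"
    by (rule UN_pair_const[OF eq cl_self[OF assms(1)] cl_self[OF assms(2)]])
  finally show ?thesis .
qed

lemma zero_K: "\<zero>\<^bsub>K\<^esub> = cl 0 1" and one_K: "\<one>\<^bsub>K\<^esub> = cl 1 1"
  by (simp_all add: function_field_def)

lemma cl_zero_iff: "(F, G) \<in> fr \<Longrightarrow> cl F G = \<zero>\<^bsub>K\<^esub> \<longleftrightarrow> F \<in> I"
  unfolding zero_K by (subst cl_eq) (auto simp: fr_01)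

lemma K_cring: "cring K"
proof (intro cringI abelian_groupI comm_monoidI)
  note fr_mult [intro] fr_add [intro] fr_01 [intro]
  fix x y z assume x: "x \<in> carrier K" and y: "y \<in> carrier K" and z: "z \<in> carrier K"
  from x y z obtain F G F' G' F'' G'' where *: "(F, G) \<in> fr" "x = cl F G" "(F', G') \<in> fr" "y = cl F' G'"
     "(F'', G'') \<in> fr" "z = cl F'' G''" by (elim carrierE)
  show "x \<oplus>\<^bsub>K\<^esub> y \<in> carrier K" "x \<otimes>\<^bsub>K\<^esub> y \<in> carrier K"
    by (auto simp: * add_cl mult_cl intro!: cl_carrier)
  show "x \<oplus>\<^bsub>K\<^esub> y \<oplus>\<^bsub>K\<^esub> z = x \<oplus>\<^bsub>K\<^esub> (y \<oplus>\<^bsub>K\<^esub> z)"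
    by (simp add: * add_cl fr_add) (rule cl_eqI; ((intro fr_add fr_mult fr_01 *; fail) | simp add: algebra_simps))
  show "x \<oplus>\<^bsub>K\<^esub> y = y \<oplus>\<^bsub>K\<^esub> x"
    by (simp add: * add_cl fr_add) (rule cl_eqI; ((intro fr_add fr_mult fr_01 *; fail) | simp add: algebra_simps))
  show "x \<otimes>\<^bsub>K\<^esub> y \<otimes>\<^bsub>K\<^esub> z = x \<otimes>\<^bsub>K\<^esub> (y \<otimes>\<^bsub>K\<^esub> z)"
    by (simp add: * mult_cl fr_mult algebra_simps)
  show "x \<otimes>\<^bsub>K\<^esub> y = y \<otimes>\<^bsub>K\<^esub> x"
    by (simp add: * mult_cl fr_mult algebra_simps)
  show "(x \<oplus>\<^bsub>K\<^esub> y) \<otimes>\<^bsub>K\<^esub> z = x \<otimes>\<^bsub>K\<^esub> z \<oplus>\<^bsub>K\<^esub> y \<otimes>\<^bsub>K\<^esub> z"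
    by (simp add: * mult_cl add_cl fr_mult fr_add) (rule cl_eqI; ((intro fr_add fr_mult fr_01 *; fail) | simp add: algebra_simps))
  show "\<zero>\<^bsub>K\<^esub> \<oplus>\<^bsub>K\<^esub> x = x" "\<one>\<^bsub>K\<^esub> \<otimes>\<^bsub>K\<^esub> x = x"
    by (simp_all add: * zero_K one_K fr_01 add_cl mult_cl)
  have m: "(- F, G) \<in> fr" using *(1) by (auto elim!: frE intro: frI)
  show "\<exists>y\<in>carrier K. y \<oplus>\<^bsub>K\<^esub> x = \<zero>\<^bsub>K\<^esub>"
  proof (rule bexI[of _ "cl (- F) G"])
    have "(0, G * G) \<in> fr" using fr_add[OF m *(1)] by simp
    then have "cl 0 (G * G) = \<zero>\<^bsub>K\<^esub>" by (simp add: cl_zero_iff I_simps(1))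
    then show "cl (- F) G \<oplus>\<^bsub>K\<^esub> x = \<zero>\<^bsub>K\<^esub>" using m * by (simp add: add_cl)
  qed (use m in simp)
qed (auto simp: zero_K one_K fr_01)

lemma fr_inv: "(F, G) \<in> fr \<Longrightarrow> F \<notin> I \<Longrightarrow> (G, F) \<in> fr"
  by (auto elim!: frE intro: frI)

lemma cl_inverse: "(F, G) \<in> fr \<Longrightarrow> F \<notin> I \<Longrightarrow> cl F G \<otimes>\<^bsub>K\<^esub> cl G F = \<one>\<^bsub>K\<^esub>"
  by (simp add: mult_cl fr_inv one_K) (rule cl_eqI, auto intro: fr_inv fr_mult fr_01)

lemma K_field: "field K"
proof (rule cring.cring_fieldI[OF K_cring])
  interpret cring K by (rule K_cring)
  have one0: "\<one>\<^bsub>K\<^esub> \<noteq> \<zero>\<^bsub>K\<^esub>" using one_notin_I by (simp add: one_K cl_zero_iff fr_01)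
  show "Units K = carrier K - {\<zero>\<^bsub>K\<^esub>}"
  proof (rule Set.set_eqI)
    fix x
    show "x \<in> Units K \<longleftrightarrow> x \<in> carrier K - {\<zero>\<^bsub>K\<^esub>}"
    proof
      assume x: "x \<in> Units K"
      then obtain y where "y \<in> carrier K" "y \<otimes>\<^bsub>K\<^esub> x = \<one>\<^bsub>K\<^esub>" using Units_l_inv_ex by blast
      then show "x \<in> carrier K - {\<zero>\<^bsub>K\<^esub>}" using x one0 by auto
    next
      assume x: "x \<in> carrier K - {\<zero>\<^bsub>K\<^esub>}"
      then obtain F G where F: "(F, G) \<in> fr" "x = cl F G" by (meson DiffD1 carrierE)
      then have "F \<notin> I" using x by (simp add: cl_zero_iff)
      then have i: "cl F G \<otimes>\<^bsub>K\<^esub> cl G F = \<one>\<^bsub>K\<^esub>" and c: "cl G F \<in> carrier K" "cl F G \<in> carrier K"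
        using F by (simp_all add: cl_inverse fr_inv)
      have "cl G F \<otimes>\<^bsub>K\<^esub> cl F G = \<one>\<^bsub>K\<^esub>" using m_comm[OF c] i by (rule trans)
      with i c show "x \<in> Units K" unfolding Units_def F(2) by blast
    qed
  qed
qed

lemma const_fun_simps [simp]:
  "const_fun n C c \<in> carrier K"
  "const_fun n C 0 = \<zero>\<^bsub>K\<^esub>" "const_fun n C 1 = \<one>\<^bsub>K\<^esub>"
  "const_fun n C (a + b) = const_fun n C a \<oplus>\<^bsub>K\<^esub> const_fun n C b"
  "const_fun n C (a * b) = const_fun n C a \<otimes>\<^bsub>K\<^esub> const_fun n C b"
  by (simp_all add: const_fun_def zero_K one_K fr_const mult_cl add_cl)

end

section \<open>Functions regular at a point\<close>

context proj_var
begin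

sublocale K: field "function_field n C" by (rule K_field)

abbreviation kadd (infixl "[+]" 65) where "a [+] b \<equiv> a \<oplus>\<^bsub>K\<^esub> b"
abbreviation kmult (infixl "[*]" 70) where "a [*] b \<equiv> a \<otimes>\<^bsub>K\<^esub> b"
abbreviation "cf \<equiv> const_fun n C"
abbreviation "OQ Q \<equiv> carrier (local_ring n C Q)"

lemma OQ_def: "OQ Q = {f \<in> carrier K. \<exists>(F, G)\<in>f. peval Q G \<noteq> 0}"
  by (simp add: local_ring_def)

lemma LR_ops [simp]: "mult (local_ring n C Q) = mult K" "add (local_ring n C Q) = add K"
  by (simp_all add: local_ring_def)

lemma OQ_iff: "f \<in> OQ Q \<longleftrightarrow> (\<exists>F G. (F, G) \<in> fr \<and> peval Q G \<noteq> 0 \<and> f = cl F G)"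
proof
  assume "f \<in> OQ Q"
  then obtain F G where f: "f \<in> carrier K" "(F, G) \<in> f" "peval Q G \<noteq> 0" by (auto simp: OQ_def)
  obtain A B where "(A, B) \<in> fr" "f = cl A B" using f(1) by (rule carrierE)
  with f(2) have "(F, G) \<in> fr" "f = cl F G" using cl_mem_eq[of F G A B] by (auto simp: mem_cl)
  with f(3) show "\<exists>F G. (F, G) \<in> fr \<and> peval Q G \<noteq> 0 \<and> f = cl F G" by blast
next
  assume "\<exists>F G. (F, G) \<in> fr \<and> peval Q G \<noteq> 0 \<and> f = cl F G"
  then obtain F G where *: "(F, G) \<in> fr" "peval Q G \<noteq> 0" "f = cl F G" by blast
  then have "(F, G) \<in> f" by (simp add: cl_self)
  with * show "f \<in> OQ Q" unfolding OQ_def by auto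
qed

lemma OQE:
  assumes "f \<in> OQ Q" obtains F G where "(F, G) \<in> fr" "peval Q G \<noteq> 0" "f = cl F G"
  using assms unfolding OQ_iff by blast

lemma OQ_carrier: "f \<in> OQ Q \<Longrightarrow> f \<in> carrier K"
  by (simp add: OQ_def)

lemma OQ_add: "a \<in> OQ Q \<Longrightarrow> b \<in> OQ Q \<Longrightarrow> a [+] b \<in> OQ Q"
proof (elim OQE)
  fix F G F' G' assume *: "(F, G) \<in> fr" "peval Q G \<noteq> 0" "a = cl F G" "(F', G') \<in> fr" "peval Q G' \<noteq> 0" "b = cl F' G'"
  show "a [+] b \<in> OQ Q" unfolding OQ_iff
    by (rule exI[of _ "F * G' + F' * G"], rule exI[of _ "G * G'"]) (simp add: * fr_add add_cl)
qed

lemma OQ_mult: "a \<in> OQ Q \<Longrightarrow> b \<in> OQ Q \<Longrightarrow> a [*] b \<in> OQ Q"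
proof (elim OQE)
  fix F G F' G' assume *: "(F, G) \<in> fr" "peval Q G \<noteq> 0" "a = cl F G" "(F', G') \<in> fr" "peval Q G' \<noteq> 0" "b = cl F' G'"
  show "a [*] b \<in> OQ Q" unfolding OQ_iff
    by (rule exI[of _ "F * F'"], rule exI[of _ "G * G'"]) (simp add: * fr_mult mult_cl)
qed

lemma OQ_const: "cf c \<in> OQ Q"
  unfolding OQ_iff const_fun_def
  by (rule exI[of _ "const_poly c"], rule exI[of _ 1]) (simp add: fr_const)

lemma cf_minus_one_mult: "a \<in> carrier K \<Longrightarrow> cf (- 1) [*] a = \<ominus>\<^bsub>K\<^esub> a"
proof -
  assume a: "a \<in> carrier K"
  have "cf (- 1) [+] \<one>\<^bsub>K\<^esub> = \<zero>\<^bsub>K\<^esub>" using const_fun_simps(4)[of "-1" 1] by (simp del: const_fun_simps(4))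
  then have "cf (- 1) = \<ominus>\<^bsub>K\<^esub> \<one>\<^bsub>K\<^esub>" by (metis K.minus_equality K.one_closed const_fun_simps(1))
  with a show ?thesis by (simp add: K.l_minus)
qed

lemma OQ_uminus: "a \<in> OQ Q \<Longrightarrow> \<ominus>\<^bsub>K\<^esub> a \<in> OQ Q"
  using OQ_mult[OF OQ_const[of "-1"], of a] by (simp add: cf_minus_one_mult OQ_carrier)

end

section \<open>The local ring at P: values, Nakayama's lemma, generators of the maximal
  ideal\<close>

locale smooth_point = proj_var n C for n and C :: "(nat \<Rightarrow> 'k::alg_closed_field) set" +
  fixes P :: "nat \<Rightarrow> 'k" and g :: nat
  assumes P: "P \<in> C" and smooth: "smooth_curve_at n C P" and genus: "has_genus n C g"
begin

abbreviation "R \<equiv> OQ P"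
abbreviation "M \<equiv> local_max n C P"

definition evP :: "'k ratfun \<Rightarrow> 'k" where
  "evP f = (SOME c. \<exists>F G. (F, G) \<in> fr \<and> peval P G \<noteq> 0 \<and> f = cl F G \<and> c = peval P F / peval P G)"

text \<open>Cross products of two fractions of one class differ by an element of the ideal of the
  curve, which vanishes at \<open>P\<close>; hence the chosen value does not depend on the
  representative.\<close>

lemma evP_cl:
  assumes "(F, G) \<in> fr" "peval P G \<noteq> 0" shows "evP (cl F G) = peval P F / peval P G"
  unfolding evP_def
proof (rule some_equality)
  show "\<exists>F' G'. (F', G') \<in> fr \<and> peval P G' \<noteq> 0 \<and> cl F G = cl F' G' \<and> peval P F / peval P G = peval P F' / peval P G'"
    using assms by blast
  fix c assume "\<exists>F' G'. (F', G') \<in> fr \<and> peval P G' \<noteq> 0 \<and> cl F G = cl F' G' \<and> c = peval P F' / peval P G'"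
  then obtain F' G' where *: "(F', G') \<in> fr" "peval P G' \<noteq> 0" "cl F G = cl F' G'" "c = peval P F' / peval P G'" by blast
  then have "F * G' - F' * G \<in> I" using cl_eq assms(1) by blast
  then have "peval P (F * G' - F' * G) = 0" using P unfolding vanishing_ideal_def by blast
  then have "peval P F * peval P G' = peval P F' * peval P G" by simp
  then show "c = peval P F / peval P G" using assms(2) *(2) by (simp add: *(4) frac_eq_eq)
qed

lemma evP_add: "a \<in> R \<Longrightarrow> b \<in> R \<Longrightarrow> evP (a [+] b) = evP a + evP b"
  by (elim OQE) (simp add: add_cl evP_cl fr_add add_frac_eq)

lemma evP_mult: "a \<in> R \<Longrightarrow> b \<in> R \<Longrightarrow> evP (a [*] b) = evP a * evP b"
  by (elim OQE) (simp add: mult_cl evP_cl fr_mult)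

lemma evP_cf [simp]: "evP (cf c) = c"
  unfolding const_fun_def by (subst evP_cl) (simp_all add: fr_const)

lemma R_ops [simp, intro]: 
  "a \<in> R \<Longrightarrow> a \<in> carrier K"
  "a \<in> R \<Longrightarrow> b \<in> R \<Longrightarrow> a [+] b \<in> R" "a \<in> R \<Longrightarrow> b \<in> R \<Longrightarrow> a [*] b \<in> R" "cf c \<in> R" 
  by (auto intro: OQ_carrier OQ_add OQ_mult OQ_const)

lemma R_01 [simp, intro]: "\<zero>\<^bsub>K\<^esub> \<in> R" "\<one>\<^bsub>K\<^esub> \<in> R"
  using R_ops(4)[of 0] R_ops(4)[of 1] by simp_all

lemma evP_01 [simp]: "evP \<zero>\<^bsub>K\<^esub> = 0" "evP \<one>\<^bsub>K\<^esub> = 1"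
  using evP_cf[of 0] evP_cf[of 1] by simp_all

lemma M_iff: "f \<in> M \<longleftrightarrow> f \<in> R \<and> evP f = 0"
proof
  assume "f \<in> M"
  then obtain F G where f: "f \<in> carrier K" "(F, G) \<in> f" "peval P G \<noteq> 0" "peval P F = 0" by (auto simp: local_max_def)
  obtain A B where "(A, B) \<in> fr" "f = cl A B" using f(1) by (rule carrierE)
  with f(2) have "(F, G) \<in> fr" "f = cl F G" using cl_mem_eq[of F G A B] by (auto simp: mem_cl)
  with f show "f \<in> R \<and> evP f = 0" by (auto simp: OQ_iff evP_cl)
next
  assume "f \<in> R \<and> evP f = 0"
  then obtain F G where *: "(F, G) \<in> fr" "peval P G \<noteq> 0" "f = cl F G" "peval P F = 0" by (auto elim!: OQE simp: evP_cl)
  then have "(F, G) \<in> f" by (simp add: cl_self)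
  with * show "f \<in> M" unfolding local_max_def by auto
qed

lemma R_unit:
  assumes "a \<in> R" "evP a \<noteq> 0" obtains b where "b \<in> R" "a [*] b = \<one>\<^bsub>K\<^esub>"
proof -
  from assms(1) obtain F G where *: "(F, G) \<in> fr" "peval P G \<noteq> 0" "a = cl F G" by (rule OQE)
  then have F: "peval P F \<noteq> 0" using assms(2) by (simp add: evP_cl)
  then have FI: "F \<notin> I" using P by (auto simp: vanishing_ideal_def)
  have "cl G F \<in> R" unfolding OQ_iff using * F FI fr_inv by blast
  moreover have "a [*] cl G F = \<one>\<^bsub>K\<^esub>" using * FI by (simp add: cl_inverse)
  ultimately show thesis by (rule that)
qed

text \<open>With \<open>B = R\<close> this is the module generated by the list, with
  \<open>B = M\<close> the maximal ideal times that module. A list of generators is what the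
  induction in Nakayama's lemma runs over.\<close>

primrec gen :: "'k ratfun set \<Rightarrow> 'k ratfun list \<Rightarrow> 'k ratfun set" where
  "gen B [] = {\<zero>\<^bsub>K\<^esub>}"
| "gen B (s # ss) = {b [*] s [+] y | b y. b \<in> B \<and> y \<in> gen B ss}"

definition submod :: "'k ratfun set \<Rightarrow> bool" where
  "submod N \<longleftrightarrow> N \<subseteq> R \<and> \<zero>\<^bsub>K\<^esub> \<in> N \<and> (\<forall>a\<in>N. \<forall>b\<in>N. a [+] b \<in> N) \<and> (\<forall>r\<in>R. \<forall>a\<in>N. r [*] a \<in> N)"

lemma submodD:
  assumes "submod N"
  shows "a \<in> N \<Longrightarrow> a \<in> R" "\<zero>\<^bsub>K\<^esub> \<in> N" "a \<in> N \<Longrightarrow> b \<in> N \<Longrightarrow> a [+] b \<in> N" "r \<in> R \<Longrightarrow> a \<in> N \<Longrightarrow> r [*] a \<in> N"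
  using assms by (auto simp: submod_def)

lemma submod_R: "submod R" by (auto simp: submod_def)

lemma submod_M: "submod M" by (auto simp: submod_def M_iff evP_add evP_mult)

lemma submod_gen:
  assumes B: "submod B" shows "set ss \<subseteq> R \<Longrightarrow> submod (gen B ss)"
proof (induction ss)
  case Nil show ?case by (auto simp: submod_def)
next
  case (Cons s ss)
  then have IH: "submod (gen B ss)" and s: "s \<in> R" by auto
  note [simp] = submodD[OF B] submodD[OF IH]
  have 1: "gen B (s # ss) \<subseteq> R" using s by auto
  have 2: "\<zero>\<^bsub>K\<^esub> \<in> gen B (s # ss)"
    using s by (auto intro!: exI[of _ "\<zero>\<^bsub>K\<^esub>"])
  have 3: "a [+] b \<in> gen B (s # ss)" if ab: "a \<in> gen B (s # ss)" "b \<in> gen B (s # ss)" for a b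
  proof -
    from ab obtain p y q z where *: "a = p [*] s [+] y" "b = q [*] s [+] z" "p \<in> B" "q \<in> B" "y \<in> gen B ss" "z \<in> gen B ss" by auto
    have "p \<in> R" "q \<in> R" "y \<in> R" "z \<in> R" using * by auto
    then have "a [+] b = (p [+] q) [*] s [+] (y [+] z)"
      using * s by (simp add: K.l_distr K.a_ac)
    then show ?thesis using * by (auto intro: submodD(3)[OF B] submodD(3)[OF IH])
  qed
  have 4: "r [*] a \<in> gen B (s # ss)" if r: "r \<in> R" and a: "a \<in> gen B (s # ss)" for r a
  proof -
    from a obtain p y where *: "a = p [*] s [+] y" "p \<in> B" "y \<in> gen B ss" by auto
    have "p \<in> R" "y \<in> R" using * by auto
    then have "r [*] a = (r [*] p) [*] s [+] (r [*] y)"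
      using * s r by (simp add: K.r_distr K.m_assoc)
    then show ?thesis using * r by (auto intro: submodD(4)[OF B] submodD(4)[OF IH])
  qed
  show ?case unfolding submod_def using 1 2 3 4 by blast
qed

lemma gen_mem: "set ss \<subseteq> R \<Longrightarrow> s \<in> set ss \<Longrightarrow> s \<in> gen R ss"
proof (induction ss)
  case (Cons a ss)
  have z: "\<zero>\<^bsub>K\<^esub> \<in> gen R ss" using submod_gen[OF submod_R, of ss] Cons.prems by (auto simp: submod_def)
  show ?case
  proof (cases "s = a")
    case True
    have "s = \<one>\<^bsub>K\<^esub> [*] a [+] \<zero>\<^bsub>K\<^esub>" using Cons.prems True by auto
    then show ?thesis using z by auto
  next
    case False
    then have s: "s \<in> gen R ss" using Cons by auto
    have "s = \<zero>\<^bsub>K\<^esub> [*] a [+] s" using Cons.prems by auto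
    then show ?thesis using s by auto
  qed
qed simp

lemma gen_M_mult: "set ss \<subseteq> R \<Longrightarrow> b \<in> M \<Longrightarrow> y \<in> gen R ss \<Longrightarrow> b [*] y \<in> gen M ss"
proof (induction ss arbitrary: y)
  case Nil then show ?case by (auto simp: M_iff)
next
  case (Cons s ss)
  then obtain p z where *: "y = p [*] s [+] z" "p \<in> R" "z \<in> gen R ss" by auto
  have ss: "set ss \<subseteq> R" and s: "s \<in> R" using Cons.prems by auto
  have z: "z \<in> R" by (rule submodD(1)[OF submod_gen[OF submod_R ss] *(3)])
  have b: "b \<in> R" using Cons.prems by (simp add: M_iff)
  have "b [*] y = (b [*] p) [*] s [+] (b [*] z)" using *(1,2) z s b by (simp add: K.r_distr K.m_assoc)
  moreover have "b [*] p \<in> M" using Cons.prems * by (auto simp: M_iff evP_mult)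
  ultimately show ?case using Cons * by auto
qed

lemma gen_sub: "submod N \<Longrightarrow> B \<subseteq> R \<Longrightarrow> set ss \<subseteq> N \<Longrightarrow> gen B ss \<subseteq> N"
proof (induction ss)
  case (Cons a ss)
  then have IH: "gen B ss \<subseteq> N" "a \<in> N" by simp_all
  show ?case
  proof
    fix x assume "x \<in> gen B (a # ss)"
    then obtain b y where x: "x = b [*] a [+] y" "b \<in> B" "y \<in> gen B ss" by auto
    have b: "b \<in> R" using x(2) Cons.prems(2) by blast
    have y: "y \<in> N" using x(3) IH(1) by blast
    show "x \<in> N" unfolding x(1)
      by (rule submodD(3)[OF Cons.prems(1) submodD(4)[OF Cons.prems(1) b IH(2)] y])
  qed
qed (simp add: submodD)

text \<open>Each generator is an element of \<open>N\<close> plus a combination with coefficients in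
  the maximal ideal. The equation of one generator can be solved for it, since 1 minus an element of
  \<open>M\<close> is a unit, and the generator is then eliminated from the others.\<close>

lemma nakayama:
  assumes N: "submod N"
  shows "set ss \<subseteq> R \<Longrightarrow> (\<And>s. s \<in> set ss \<Longrightarrow> \<exists>y\<in>N. \<exists>w\<in>gen M ss. s = y [+] w) \<Longrightarrow> set ss \<subseteq> N"
proof (induction ss)
  case (Cons x ss)
  have ssR: "set ss \<subseteq> R" and xR: "x \<in> R" using Cons.prems by auto
  note gM = submod_gen[OF submod_M ssR]
  obtain y w where yw: "y \<in> N" "w \<in> gen M (x # ss)" "x = y [+] w" using Cons.prems(2)[of x] by auto
  then obtain b w' where w: "w = b [*] x [+] w'" "b \<in> M" "w' \<in> gen M ss" by auto
  have yR: "y \<in> R" by (rule submodD(1)[OF N yw(1)])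
  have w'R: "w' \<in> R" by (rule submodD(1)[OF gM w(3)])
  have bR: "b \<in> R" using w(2) by (simp add: M_iff)
  have mb: "\<ominus>\<^bsub>K\<^esub> b \<in> R" using bR by (rule OQ_uminus)
  have evmb: "evP (\<ominus>\<^bsub>K\<^esub> b) = 0"
    using w(2) bR evP_mult[of "cf (-1)" b] by (simp add: cf_minus_one_mult M_iff)
  \<comment> \<open>\<open>1 - b\<close> has value 1 at \<open>P\<close>, hence is a unit; its
    inverse \<open>v\<close> solves the equation of \<open>x\<close> for \<open>x\<close>.\<close>
  obtain v where v: "v \<in> R" "(\<one>\<^bsub>K\<^esub> [+] \<ominus>\<^bsub>K\<^esub> b) [*] v = \<one>\<^bsub>K\<^esub>"
    by (rule R_unit[of "\<one>\<^bsub>K\<^esub> [+] \<ominus>\<^bsub>K\<^esub> b"]) (use mb evmb in \<open>auto simp: evP_add\<close>)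
  have e1: "x = b [*] x [+] (y [+] w')" using yw(3) w(1) xR bR yR w'R by (simp add: K.a_ac)
  have "(\<one>\<^bsub>K\<^esub> [+] \<ominus>\<^bsub>K\<^esub> b) [*] x = x [+] \<ominus>\<^bsub>K\<^esub> (b [*] x)"
    using xR bR mb by (simp add: K.l_distr K.l_minus)
  also have "\<dots> = (b [*] x [+] (y [+] w')) [+] \<ominus>\<^bsub>K\<^esub> (b [*] x)" using e1 by simp
  also have "\<dots> = y [+] w'" using xR bR yR w'R by (simp add: K.a_ac K.r_neg K.r_neg1 K.r_neg2)
  finally have "v [*] ((\<one>\<^bsub>K\<^esub> [+] \<ominus>\<^bsub>K\<^esub> b) [*] x) = v [*] (y [+] w')" by simp
  moreover have "v [*] ((\<one>\<^bsub>K\<^esub> [+] \<ominus>\<^bsub>K\<^esub> b) [*] x) = x"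
  proof -
    have q: "\<one>\<^bsub>K\<^esub> [+] \<ominus>\<^bsub>K\<^esub> b \<in> carrier K" and vx: "v \<in> carrier K" "x \<in> carrier K" using mb v xR by simp_all
    have "v [*] ((\<one>\<^bsub>K\<^esub> [+] \<ominus>\<^bsub>K\<^esub> b) [*] x) = (v [*] (\<one>\<^bsub>K\<^esub> [+] \<ominus>\<^bsub>K\<^esub> b)) [*] x"
      by (rule K.m_assoc[symmetric, OF vx(1) q vx(2)])
    also have "\<dots> = x" unfolding K.m_comm[OF vx(1) q] v(2) by (rule K.l_one[OF vx(2)])
    finally show ?thesis .
  qed
  ultimately have x: "x = v [*] y [+] v [*] w'" using v xR yR w'R by (simp add: K.r_distr)
  \<comment> \<open>Substituting the solved \<open>x\<close> into the remaining equations shows that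
    the shorter list satisfies the hypothesis as well.\<close>
  have "set ss \<subseteq> N"
  proof (rule Cons.IH[OF ssR])
    fix s assume s: "s \<in> set ss"
    then obtain ys ws where yws: "ys \<in> N" "ws \<in> gen M (x # ss)" "s = ys [+] ws" using Cons.prems(2)[of s] by auto
    then obtain bs ws' where ws: "ws = bs [*] x [+] ws'" "bs \<in> M" "ws' \<in> gen M ss" by auto
    have R: "ys \<in> R" "ws' \<in> R" "bs \<in> R"
      using submodD(1)[OF N yws(1)] submodD(1)[OF gM ws(3)] ws(2) by (simp_all add: M_iff)
    have "s = ys [+] (bs [*] (v [*] y [+] v [*] w') [+] ws')" using yws ws x by simp
    also have "\<dots> = (ys [+] (bs [*] v) [*] y) [+] ((bs [*] v) [*] w' [+] ws')"
      using R v yR w'R by (simp add: K.r_distr K.m_assoc K.a_ac)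
    finally have "s = (ys [+] (bs [*] v) [*] y) [+] ((bs [*] v) [*] w' [+] ws')" .
    moreover have bv: "bs [*] v \<in> R" using R v by simp
    moreover have "ys [+] (bs [*] v) [*] y \<in> N" by (rule submodD(3)[OF N yws(1) submodD(4)[OF N bv yw(1)]])
    moreover have "(bs [*] v) [*] w' [+] ws' \<in> gen M ss" by (rule submodD(3)[OF gM submodD(4)[OF gM bv w(3)] ws(3)])
    ultimately show "\<exists>y\<in>N. \<exists>w\<in>gen M ss. s = y [+] w" by blast
  qed
  moreover have "x \<in> N"
  proof -
    have "gen M ss \<subseteq> N" by (rule gen_sub[OF N _ calculation]) (simp add: M_iff subset_iff)
    then have "w' \<in> N" using w(3) by blast
    then show ?thesis by (subst x, intro submodD(3)[OF N] submodD(4)[OF N v(1)] yw(1))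
  qed
  ultimately show ?case by simp
qed simp

definition jP :: nat where "jP = (SOME j. P j \<noteq> 0)"

lemma jP: "P jP \<noteq> 0" and jPn: "jP \<le> n"
proof -
  have "P \<in> proj_vecs n" using P C_proj_vecs by blast
  then have "\<exists>j. P j \<noteq> 0" "\<And>i. i > n \<Longrightarrow> P i = 0" by (auto simp: proj_vecs_def)
  then show *: "P jP \<noteq> 0" unfolding jP_def by - (rule someI_ex)
  show "jP \<le> n" using * \<open>\<And>i. i > n \<Longrightarrow> P i = 0\<close> by (meson leI)
qed

definition var :: "nat \<Rightarrow> (nat, 'k) mpoly" where "var i = Poly_Mapping.single (Poly_Mapping.single i 1) 1"
abbreviation "xj \<equiv> var jP"

lemma var_forms: "i \<le> n \<Longrightarrow> var i \<in> forms n 1"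
  by (simp add: var_def forms_def)

lemma peval_var [simp]: "peval a (var i) = a i"
  by (simp add: var_def)

lemma xj_pow_forms: "xj ^ e \<in> forms n e"
  using forms_power[OF var_forms[OF jPn], of e] by simp

lemma xj_pow_I: "xj ^ e \<notin> I"
  using P jP by (auto simp: vanishing_ideal_def intro!: bexI[of _ P])

text \<open>Dehomogenization with respect to a coordinate that is nonzero at \<open>P\<close>, which
  turns forms into elements of the local ring.\<close>

definition Nf :: "nat \<Rightarrow> (nat, 'k) mpoly \<Rightarrow> 'k ratfun" where "Nf e F = cl F (xj ^ e)"

lemma Nf_fr: "F \<in> forms n e \<Longrightarrow> (F, xj ^ e) \<in> fr"
  by (rule frI[OF _ xj_pow_forms xj_pow_I])

lemma Nf_R: "F \<in> forms n e \<Longrightarrow> Nf e F \<in> R"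
  unfolding Nf_def OQ_iff using Nf_fr jP by (intro exI[of _ F] exI[of _ "xj ^ e"]) auto

lemma Nf_add:
  assumes "F \<in> forms n e" "G \<in> forms n e"
  shows "Nf e (F + G) = Nf e F [+] Nf e G"
  unfolding Nf_def add_cl[OF Nf_fr[OF assms(1)] Nf_fr[OF assms(2)]]
  by (rule cl_eqI[OF Nf_fr[OF forms_simps(2)[OF assms]] fr_add[OF Nf_fr[OF assms(1)] Nf_fr[OF assms(2)]]])
    (simp add: algebra_simps)

lemma Nf_mult: "F \<in> forms n e \<Longrightarrow> G \<in> forms n e' \<Longrightarrow> Nf (e + e') (F * G) = Nf e F [*] Nf e' G"
  unfolding Nf_def by (simp add: mult_cl Nf_fr power_add)

lemma Nf_const: "Nf 0 (const_poly c) = cf c"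
  by (simp add: Nf_def const_fun_def)

lemma evP_Nf: "F \<in> forms n e \<Longrightarrow> evP (Nf e F) = peval P F / P jP ^ e"
  unfolding Nf_def using jP by (simp add: evP_cl Nf_fr)

text \<open>Dehomogenized forms are built from constants and quotients of coordinates by sums and
  products. The predicate relates the function to the polynomial it comes from, so that two
  evaluations can be compared along the way.\<close>

lemma Nf_closure:
  assumes c: "\<And>c. Q (cf c) (const_poly c)" and v: "\<And>i. i \<le> n \<Longrightarrow> Q (Nf 1 (var i)) (var i)"
    and a: "\<And>a b p q. Q a p \<Longrightarrow> Q b q \<Longrightarrow> Q (a [+] b) (p + q)"
    and m: "\<And>a b p q. Q a p \<Longrightarrow> Q b q \<Longrightarrow> Q (a [*] b) (p * q)"
    and F: "F \<in> forms n e"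
  shows "Q (Nf e F) F"
proof -
  have mono: "Q (Nf (wdeg (\<lambda>_. 1) m) (Poly_Mapping.single m 1)) (Poly_Mapping.single m 1)"
    if "Poly_Mapping.keys m \<subseteq> {..n}" for m
    using that
  proof (induction "wdeg (\<lambda>_. 1) m" arbitrary: m)
    case 0
    then have "m = 0"
      by (intro poly_mapping_eqI) (auto simp: wdeg_def in_keys_iff)
    then show ?case using c[of 1] Nf_const[of 1] by simp
  next
    case (Suc r)
    then have "Poly_Mapping.keys m \<noteq> {}" by (auto simp: wdeg_def)
    then obtain i where i: "i \<in> Poly_Mapping.keys m" by blast
    define m' where "m' = m - Poly_Mapping.single i 1"
    have mm: "m = m' + Poly_Mapping.single i 1"
    proof (rule poly_mapping_eqI)
      fix k show "Poly_Mapping.lookup m k = Poly_Mapping.lookup (m' + Poly_Mapping.single i 1) k"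
        using i by (auto simp: m'_def lookup_add lookup_minus lookup_single when_def in_keys_iff)
    qed
    have km: "Poly_Mapping.keys m' \<subseteq> {..n}" "i \<le> n" using Suc.prems mm i by (auto simp: keys_plus_nat)
    have wm: "wdeg (\<lambda>_. 1) m' = r" using Suc.hyps(2) by (simp add: mm wdeg_add)
    have "Q (Nf r (Poly_Mapping.single m' 1)) (Poly_Mapping.single m' 1)"
      using Suc.hyps(1)[of m'] wm km by simp
    from m[OF this v[OF km(2)]] have "Q (Nf (r + 1) (Poly_Mapping.single m' 1 * var i)) (Poly_Mapping.single m' 1 * var i)"
      using km wm by (subst Nf_mult) (auto simp: forms_def var_def)
    moreover have "Poly_Mapping.single m' 1 * var i = Poly_Mapping.single m (1::'k)"
      by (simp add: var_def mult_single mm)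
    ultimately show ?case using Suc.hyps(2) by simp
  qed
  have single: "Q (Nf e (Poly_Mapping.single m b)) (Poly_Mapping.single m b)"
    if "Poly_Mapping.keys m \<subseteq> {..n}" "wdeg (\<lambda>_. 1) m = e" for m b
  proof -
    have "const_poly b * Poly_Mapping.single m 1 = Poly_Mapping.single m b"
      by (simp add: const_poly_def mult_single)
    then show ?thesis
      using m[OF c[of b] mono[OF that(1)]] Nf_mult[of "const_poly b" 0 "Poly_Mapping.single m 1" e] that
      by (auto simp: Nf_const forms_def)
  qed
  \<comment> \<open>The zero form of degree \<open>e\<close> arises as the constant 0 times a power
    of a coordinate, because constants are available in degree 0 only.\<close>
  have 0: "Q (Nf e 0) 0"
    using m[OF c[of 0] single[of "Poly_Mapping.single jP e" 1]] Nf_mult[of 0 0 "Poly_Mapping.single (Poly_Mapping.single jP e) 1" e] jPn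
    by (auto simp: Nf_const[of 0, simplified] forms_def)
  have "F \<in> forms n e \<and> Q (Nf e F) F"
  proof (rule poly_mapping_closure[of "\<lambda>F. F \<in> forms n e \<and> Q (Nf e F) F"])
    fix p q assume "p \<in> forms n e \<and> Q (Nf e p) p" "q \<in> forms n e \<and> Q (Nf e q) q"
    then show "p + q \<in> forms n e \<and> Q (Nf e (p + q)) (p + q)" by (simp add: Nf_add a)
  next
    fix m assume "m \<in> Poly_Mapping.keys F"
    then have "Poly_Mapping.keys m \<subseteq> {..n}" "wdeg (\<lambda>_. 1) m = e"
      using F by (auto simp: forms_def polys_in_def homog_def)
    then show "Poly_Mapping.single m (Poly_Mapping.lookup F m) \<in> forms n e \<and>
      Q (Nf e (Poly_Mapping.single m (Poly_Mapping.lookup F m))) (Poly_Mapping.single m (Poly_Mapping.lookup F m))"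
      using single by (simp add: forms_def)
  qed (use 0 in simp)
  then show ?thesis ..
qed

text \<open>Affine coordinates at \<open>P\<close>, translated so that they vanish there.\<close>

definition U :: "'k ratfun list" where
  "U = map (\<lambda>i. Nf 1 (var i - const_poly (P i / P jP) * xj)) [0..<Suc n]"

lemma U_forms: "i \<le> n \<Longrightarrow> var i - const_poly (P i / P jP) * xj \<in> forms n 1"
  using var_forms jPn by (intro forms_simps(3,8)) auto

lemma U_R: "set U \<subseteq> R"
proof
  fix x assume "x \<in> set U"
  then obtain i where i: "i \<in> {0..<Suc n}" "x = Nf 1 (var i - const_poly (P i / P jP) * xj)"
    unfolding U_def set_map set_upt by (rule imageE)
  then show "x \<in> R" using Nf_R[OF U_forms[of i]] by simp
qed

lemma Nf_cmult: "F \<in> forms n e \<Longrightarrow> Nf e (const_poly c * F) = cf c [*] Nf e F"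
  using Nf_mult[of "const_poly c" 0 F e] by (simp add: Nf_const)

lemma Nf_xj: "Nf e (xj ^ e) = \<one>\<^bsub>K\<^esub>"
  unfolding Nf_def one_K by (rule cl_eqI) (auto intro: Nf_fr[OF xj_pow_forms] fr_01)

text \<open>A function built from constants and coordinates equals its value at \<open>P\<close> up
  to the ideal generated by the translated coordinates. A fraction in the maximal ideal has such a
  numerator of value 0, and its denominator is a unit.\<close>

lemma M_gen: "M \<subseteq> gen R U"
proof
  let ?J = "gen R U"
  have J: "submod ?J" by (rule submod_gen[OF submod_R U_R])
  note JD = submodD[OF J]
  define Q where "Q a p \<longleftrightarrow> a \<in> R \<and> (\<exists>y\<in>?J. a = cf (evP a) [+] y)" for a and p :: "(nat, 'k) mpoly"
  have Qc: "Q (cf c) (const_poly c)" for c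
    unfolding Q_def by (auto intro!: bexI[of _ "\<zero>\<^bsub>K\<^esub>"] JD(2))
  have Qv: "Q (Nf 1 (var i)) (var i)" if i: "i \<le> n" for i
  proof -
    let ?u = "Nf 1 (var i - const_poly (P i / P jP) * xj)"
    have "var i = const_poly (P i / P jP) * xj + (var i - const_poly (P i / P jP) * xj)" by simp
    then have "Nf 1 (var i) = Nf 1 (const_poly (P i / P jP) * xj) [+] ?u"
      using Nf_add[OF forms_simps(8)[OF var_forms[OF jPn]] U_forms[OF i], of "P i / P jP"] by simp
    also have "Nf 1 (const_poly (P i / P jP) * xj) = cf (P i / P jP)"
      using Nf_cmult[OF var_forms[OF jPn]] Nf_xj[of 1] by simp
    finally have "Nf 1 (var i) = cf (P i / P jP) [+] ?u" .
    moreover have "?u \<in> set U" unfolding U_def set_map set_upt by (rule imageI) (use i in simp)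
    then have "?u \<in> ?J" by (rule gen_mem[OF U_R])
    moreover have "evP (Nf 1 (var i)) = P i / P jP" using evP_Nf[OF var_forms[OF i]] by simp
    ultimately show ?thesis unfolding Q_def using Nf_R[OF var_forms[OF i]] by auto
  qed
  have Qa: "Q (a [+] b) (p + q)" if ab: "Q a p" "Q b q" for a b p q
  proof -
    from ab obtain y z where *: "a \<in> R" "b \<in> R" "y \<in> ?J" "z \<in> ?J" "a = cf (evP a) [+] y" "b = cf (evP b) [+] z"
      unfolding Q_def by blast
    have "a [+] b = (cf (evP a) [+] y) [+] (cf (evP b) [+] z)" using * by simp
    also have "\<dots> = cf (evP (a [+] b)) [+] (y [+] z)" using *(1,2) JD(1)[OF *(3)] JD(1)[OF *(4)] by (simp add: evP_add K.a_ac)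
    finally show ?thesis unfolding Q_def using * JD(3) by blast
  qed
  have Qm: "Q (a [*] b) (p * q)" if ab: "Q a p" "Q b q" for a b p q
  proof -
    from ab obtain y z where *: "a \<in> R" "b \<in> R" "y \<in> ?J" "z \<in> ?J" "a = cf (evP a) [+] y" "b = cf (evP b) [+] z"
      unfolding Q_def by blast
    have yz: "y \<in> R" "z \<in> R" using * JD(1) by auto
    have "a [*] b = a [*] (cf (evP b) [+] z)" using *(6) by simp
    also have "\<dots> = a [*] cf (evP b) [+] a [*] z" using *(1,2) yz by (simp add: K.r_distr)
    also have "a [*] cf (evP b) = (cf (evP a) [+] y) [*] cf (evP b)" using *(5) by simp
    also have "\<dots> = cf (evP (a [*] b)) [+] cf (evP b) [*] y" using *(1,2) yz by (simp add: K.l_distr evP_mult K.m_comm[of y])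
    also have "\<dots> [+] a [*] z = cf (evP (a [*] b)) [+] (cf (evP b) [*] y [+] a [*] z)"
      using *(1,2) yz by (simp add: K.a_assoc)
    finally show ?thesis unfolding Q_def using * JD(3,4) by blast
  qed
  fix f assume "f \<in> M"
  then obtain F G where f: "(F, G) \<in> fr" "peval P G \<noteq> 0" "f = cl F G" "peval P F = 0"
    by (auto simp: M_iff elim!: OQE simp: evP_cl)
  from f(1) obtain e where e: "F \<in> forms n e" "G \<in> forms n e" "G \<notin> I" by (rule frE)
  have "Q (Nf e F) F" by (rule Nf_closure[OF Qc Qv Qa Qm e(1)])
  then have NF: "Nf e F \<in> ?J" using f e JD(1) by (auto simp: Q_def evP_Nf)
  obtain v where v: "v \<in> R" "Nf e G [*] v = \<one>\<^bsub>K\<^esub>"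
    by (rule R_unit[of "Nf e G"]) (use e f jP in \<open>auto simp: evP_Nf Nf_R\<close>)
  have "f [*] Nf e G = Nf e F"
    unfolding f(3) Nf_def using f e by (simp add: mult_cl Nf_fr) (rule cl_eqI, auto intro: fr_mult Nf_fr)
  then have "f = Nf e F [*] v"
    using v f e by (metis K.m_assoc K.r_one Nf_R R_ops(1) cl_carrier)
  then show "f \<in> ?J" using v NF JD by (simp add: K.m_comm)
qed

end

section \<open>Expansion in a local parameter\<close>

context smooth_point
begin

definition tP :: "'k ratfun" where
  "tP = (SOME t. t \<in> M \<and> t \<notin> local_max_power n C P 2 \<and>
      (\<forall>f\<in>M. \<exists>c. \<exists>u\<in>local_max_power n C P 2. f = cf c [*] t [+] u))"

lemma tP: "tP \<in> M" "tP \<notin> local_max_power n C P 2"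
  "f \<in> M \<Longrightarrow> \<exists>c. \<exists>u\<in>local_max_power n C P 2. f = cf c [*] tP [+] u"
proof -
  have "\<exists>t. t \<in> M \<and> t \<notin> local_max_power n C P 2 \<and>
      (\<forall>f\<in>M. \<exists>c. \<exists>u\<in>local_max_power n C P 2. f = cf c [*] t [+] u)"
    using smooth unfolding smooth_curve_at_def by blast
  from someI_ex[OF this, folded tP_def]
  show "tP \<in> M" "tP \<notin> local_max_power n C P 2"
    "f \<in> M \<Longrightarrow> \<exists>c. \<exists>u\<in>local_max_power n C P 2. f = cf c [*] tP [+] u" by blast+
qed

abbreviation "t \<equiv> tP"

lemma t_R: "t \<in> R" and evP_t: "evP t = 0" using tP(1) by (simp_all add: M_iff)

lemma ideal_prod_sub:
  assumes N: "submod N" and m: "\<And>a b. a \<in> A \<Longrightarrow> b \<in> B \<Longrightarrow> a [*] b \<in> N"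
  shows "ideal_prod (local_ring n C P) A B \<subseteq> N"
proof
  fix x assume "x \<in> ideal_prod (local_ring n C P) A B"
  then show "x \<in> N" by induction (use m submodD(3)[OF N] in auto)
qed

lemma max_power_1: "local_max_power n C P 1 \<subseteq> M"
proof -
  have "ideal_prod (local_ring n C P) M R \<subseteq> M"
    by (rule ideal_prod_sub[OF submod_M]) (auto simp: M_iff evP_mult)
  then show ?thesis by simp
qed

text \<open>Nakayama's lemma needs the square of the maximal ideal in the form of combinations of a
  finite list with coefficients in \<open>M\<close>.\<close>

lemma max_power_2: "local_max_power n C P 2 \<subseteq> gen M U"
proof -
  have "ideal_prod (local_ring n C P) M (local_max_power n C P 1) \<subseteq> gen M U"
    by (rule ideal_prod_sub[OF submod_gen[OF submod_M U_R]], rule gen_M_mult[OF U_R])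
      (use max_power_1 M_gen in auto)
  then show ?thesis by (simp add: numeral_2_eq_2)
qed

abbreviation tpow :: "nat \<Rightarrow> 'k ratfun" where "tpow r \<equiv> t [^]\<^bsub>K\<^esub> r"
definition tR :: "nat \<Rightarrow> 'k ratfun set" where "tR r = {tpow r [*] a | a. a \<in> R}"

lemma tpow_R: "tpow r \<in> R"
  by (induction r) (auto intro: t_R)

lemma submod_tR: "submod (tR r)"
proof -
  have "a [+] b \<in> tR r" if ab: "a \<in> tR r" "b \<in> tR r" for a b
  proof -
    from ab obtain x y where *: "a = tpow r [*] x" "b = tpow r [*] y" "x \<in> R" "y \<in> R" by (auto simp: tR_def)
    then have "a [+] b = tpow r [*] (x [+] y)" using tpow_R by (simp add: K.r_distr)
    then show ?thesis using * unfolding tR_def by blast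
  qed
  moreover have "q [*] a \<in> tR r" if q: "q \<in> R" "a \<in> tR r" for q a
  proof -
    from q obtain x where *: "a = tpow r [*] x" "x \<in> R" by (auto simp: tR_def)
    then have "q [*] a = tpow r [*] (q [*] x)" using tpow_R q by (simp add: K.m_lcomm)
    then show ?thesis using * q unfolding tR_def by blast
  qed
  moreover have "\<zero>\<^bsub>K\<^esub> = tpow r [*] \<zero>\<^bsub>K\<^esub>" using tpow_R by simp
  then have "\<zero>\<^bsub>K\<^esub> \<in> tR r" unfolding tR_def by blast
  ultimately show ?thesis unfolding submod_def by (auto simp: tR_def tpow_R)
qed

text \<open>Smoothness says that the maximal ideal is spanned by \<open>t\<close> modulo its square;
  Nakayama's lemma, applied to the generators \<open>U\<close>, makes it principal.\<close>

lemma M_eq: "M = tR 1"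
proof -
  have "M \<subseteq> tR 1"
  proof -
    have "set U \<subseteq> tR 1"
    proof (rule nakayama[OF submod_tR U_R])
      fix s assume s: "s \<in> set U"
      have "s \<in> M"
      proof -
        obtain i where i: "i \<in> {0..<Suc n}" "s = Nf 1 (var i - const_poly (P i / P jP) * xj)"
          using s unfolding U_def set_map set_upt by (rule imageE)
        have "evP s = 0" unfolding i(2) using i(1) U_forms[of i] jP by (subst evP_Nf) auto
        then show ?thesis using s U_R by (auto simp: M_iff)
      qed
      then obtain c u where cu: "u \<in> local_max_power n C P 2" "s = cf c [*] t [+] u" using tP(3) by blast
      have "cf c [*] t = tpow 1 [*] cf c" using t_R by (simp add: K.m_comm)
      then have "cf c [*] t \<in> tR 1" unfolding tR_def by blast
      then show "\<exists>y\<in>tR 1. \<exists>w\<in>gen M U. s = y [+] w" using cu max_power_2 by blast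
    qed
    then show ?thesis using gen_sub[OF submod_tR, of R U 1] M_gen by blast
  qed
  moreover have "tR 1 \<subseteq> M" using t_R evP_t by (auto simp: tR_def M_iff evP_mult)
  ultimately show ?thesis by blast
qed

lemma max_power_eq: "local_max_power n C P r = tR r"
proof (induction r)
  case 0
  have "tR 0 = R"
  proof -
    have "a = tpow 0 [*] a" if "a \<in> R" for a using that by simp
    then have "R \<subseteq> tR 0" unfolding tR_def by blast
    then show ?thesis using submod_tR[of 0] unfolding submod_def by blast
  qed
  then show ?case by simp
next
  case (Suc r)
  have "ideal_prod (local_ring n C P) M (tR r) \<subseteq> tR (Suc r)"
  proof (rule ideal_prod_sub[OF submod_tR])
    fix a b assume "a \<in> M" "b \<in> tR r"
    then obtain x y where *: "a = t [*] x" "b = tpow r [*] y" "x \<in> R" "y \<in> R" using t_R by (auto simp: M_eq tR_def)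
    then have "a [*] b = tpow (Suc r) [*] (x [*] y)" using t_R tpow_R[of r] by (simp add: K.m_ac)
    then show "a [*] b \<in> tR (Suc r)" using * unfolding tR_def by blast
  qed
  moreover have "tR (Suc r) \<subseteq> ideal_prod (local_ring n C P) M (tR r)"
  proof
    fix a assume "a \<in> tR (Suc r)"
    then obtain x where x: "a = tpow (Suc r) [*] x" "x \<in> R" by (auto simp: tR_def)
    then have "a = t [*] (tpow r [*] x)" using t_R tpow_R[of r] by (simp add: K.m_ac)
    moreover have "tpow r [*] x \<in> tR r" using x unfolding tR_def by blast
    ultimately show "a \<in> ideal_prod (local_ring n C P) M (tR r)"
      using ideal_prod.prod[of t M "tpow r [*] x" "tR r" "local_ring n C P"] tP(1) by simp
  qed
  ultimately show ?case using Suc by simp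
qed

lemma t_nonzero: "t \<noteq> \<zero>\<^bsub>K\<^esub>"
  using tP(2) submodD(2)[OF submod_tR[of 2]] by (auto simp: max_power_eq)

lemma t_cancel: "a \<in> R \<Longrightarrow> b \<in> R \<Longrightarrow> t [*] a = t [*] b \<Longrightarrow> a = b"
  using t_nonzero t_R by (simp add: K.m_lcancel)

text \<open>The quotient of \<open>a - a(P)\<close> by \<open>t\<close>. Iterating it and taking
  values at \<open>P\<close> reads off the Taylor coefficients.\<close>

definition sh :: "'k ratfun \<Rightarrow> 'k ratfun" where
  "sh a = (SOME b. b \<in> R \<and> a = cf (evP a) [+] t [*] b)"

lemma sh: assumes "a \<in> R" shows sh_R: "sh a \<in> R" and sh_eq: "a = cf (evP a) [+] t [*] sh a"
proof -
  let ?a = "a [+] cf (- evP a)"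
  have "?a \<in> M" using assms by (simp add: M_iff evP_add)
  then obtain b where b: "b \<in> R" "?a = t [*] b" using t_R by (auto simp: M_eq tR_def)
  have z: "cf (evP a) [+] cf (- evP a) = \<zero>\<^bsub>K\<^esub>"
    using const_fun_simps(4)[of "evP a" "- evP a"] by (simp del: const_fun_simps(4))
  have "cf (evP a) [+] ?a = a [+] (cf (evP a) [+] cf (- evP a))" using assms by (simp add: K.a_ac)
  then have "a = cf (evP a) [+] t [*] b" using assms by (simp add: z b(2))
  then have "\<exists>b. b \<in> R \<and> a = cf (evP a) [+] t [*] b" using b by blast
  from someI_ex[OF this, folded sh_def] show "sh a \<in> R" "a = cf (evP a) [+] t [*] sh a" by blast+
qed

lemma sh_eqI:
  assumes "b \<in> R" "a = cf (evP a) [+] t [*] b" shows "sh a = b"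
proof -
  have a: "a \<in> R" by (subst assms(2)) (use assms(1) t_R in auto)
  have eq: "cf (evP a) [+] t [*] sh a = cf (evP a) [+] t [*] b"
    by (rule trans[OF sh_eq[OF a, symmetric] assms(2)])
  have X: "t [*] sh a \<in> carrier K" "t [*] b \<in> carrier K" using assms(1) sh_R[OF a] t_R by auto
  have "t [*] sh a = \<ominus>\<^bsub>K\<^esub> cf (evP a) [+] (cf (evP a) [+] t [*] sh a)"
    by (rule K.r_neg1[OF const_fun_simps(1) X(1), symmetric])
  also have "\<dots> = \<ominus>\<^bsub>K\<^esub> cf (evP a) [+] (cf (evP a) [+] t [*] b)" by (simp only: eq)
  also have "\<dots> = t [*] b" by (rule K.r_neg1[OF const_fun_simps(1) X(2)])
  finally have "t [*] sh a = t [*] b" .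
  then show ?thesis by (rule t_cancel[OF sh_R[OF a] assms(1)])
qed

lemma sh_add: assumes a: "a \<in> R" and b: "b \<in> R" shows "sh (a [+] b) = sh a [+] sh b"
proof (rule sh_eqI)
  note [simp] = sh_R[OF a] sh_R[OF b] t_R a b
  have "a [+] b = (cf (evP a) [+] t [*] sh a) [+] (cf (evP b) [+] t [*] sh b)"
    using sh_eq[OF a] sh_eq[OF b] by simp
  also have "\<dots> = cf (evP (a [+] b)) [+] t [*] (sh a [+] sh b)"
    by (simp add: evP_add K.r_distr K.a_ac)
  finally show "a [+] b = cf (evP (a [+] b)) [+] t [*] (sh a [+] sh b)" .
qed (use sh_R[OF a] sh_R[OF b] in simp)

text \<open>A twisted Leibniz rule, the reason why Taylor coefficients of a product satisfy the
  convolution formula.\<close>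

lemma sh_mult: assumes a: "a \<in> R" and b: "b \<in> R" shows "sh (a [*] b) = cf (evP a) [*] sh b [+] sh a [*] b"
proof (rule sh_eqI)
  note [simp] = sh_R[OF a] sh_R[OF b] t_R a b
  have "a [*] b = (cf (evP a) [+] t [*] sh a) [*] b" using sh_eq[OF a] by simp
  also have "\<dots> = cf (evP a) [*] b [+] t [*] (sh a [*] b)" by (simp add: K.l_distr K.m_assoc)
  also have "cf (evP a) [*] b = cf (evP a) [*] (cf (evP b) [+] t [*] sh b)" using sh_eq[OF b] by simp
  also have "\<dots> = cf (evP (a [*] b)) [+] t [*] (cf (evP a) [*] sh b)"
    by (simp add: K.r_distr K.m_lcomm evP_mult)
  also have "\<dots> [+] t [*] (sh a [*] b) = cf (evP (a [*] b)) [+] t [*] (cf (evP a) [*] sh b [+] sh a [*] b)"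
    by (simp add: K.r_distr K.a_assoc)
  finally show "a [*] b = cf (evP (a [*] b)) [+] t [*] (cf (evP a) [*] sh b [+] sh a [*] b)" .
qed (use sh_R[OF a] sh_R[OF b] a b in simp)

lemma sh_cf: "sh (cf c) = \<zero>\<^bsub>K\<^esub>"
  by (rule sh_eqI) (use t_R in auto)

lemma sh_tmult: "a \<in> R \<Longrightarrow> sh (t [*] a) = a"
  by (rule sh_eqI) (use t_R in \<open>auto simp: evP_mult evP_t\<close>)

definition ex :: "'k ratfun \<Rightarrow> 'k fps" where "ex a = Abs_fps (\<lambda>i. evP ((sh ^^ i) a))"

lemma ex_0 [simp]: "fps_nth (ex a) 0 = evP a" by (simp add: ex_def)
lemma ex_Suc: "fps_nth (ex a) (Suc i) = fps_nth (ex (sh a)) i" by (simp add: ex_def funpow_Suc_right del: funpow.simps)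

lemma ex_add: "a \<in> R \<Longrightarrow> b \<in> R \<Longrightarrow> ex (a [+] b) = ex a + ex b"
proof -
  have "\<forall>a\<in>R. \<forall>b\<in>R. fps_nth (ex (a [+] b)) i = fps_nth (ex a) i + fps_nth (ex b) i" for i
    by (induction i) (simp_all add: evP_add ex_Suc sh_add sh_R)
  then show "a \<in> R \<Longrightarrow> b \<in> R \<Longrightarrow> ex (a [+] b) = ex a + ex b" by (simp add: fps_eq_iff)
qed

lemma ex_cf: "ex (cf c) = fps_const c"
proof -
  have "\<forall>i. fps_nth (ex \<zero>\<^bsub>K\<^esub>) i = 0"
  proof
    fix i show "fps_nth (ex \<zero>\<^bsub>K\<^esub>) i = 0"
      by (induction i) (use sh_cf[of 0] in \<open>simp_all add: ex_Suc\<close>)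
  qed
  note z = this
  show ?thesis
  proof (rule fps_ext)
    fix i show "fps_nth (ex (cf c)) i = fps_nth (fps_const c) i"
      by (cases i) (simp_all add: ex_Suc sh_cf z)
  qed
qed

lemma ex_zero [simp]: "ex \<zero>\<^bsub>K\<^esub> = 0" and ex_one [simp]: "ex \<one>\<^bsub>K\<^esub> = 1"
  using ex_cf[of 0] ex_cf[of 1] by simp_all

text \<open>The induction is on the index of the coefficient, for all pairs at once, since shifting
  replaces the first factor \<open>a\<close> by \<open>sh a\<close>.\<close>

lemma ex_mult: "a \<in> R \<Longrightarrow> b \<in> R \<Longrightarrow> ex (a [*] b) = ex a * ex b"
proof -
  have cm: "\<forall>a\<in>R. fps_nth (ex (cf c [*] a)) i = c * fps_nth (ex a) i" for c i
    by (induction i) (simp_all add: evP_mult ex_Suc sh_mult sh_cf sh_R)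
  have "\<forall>a\<in>R. \<forall>b\<in>R. fps_nth (ex (a [*] b)) i = (\<Sum>j=0..i. fps_nth (ex a) j * fps_nth (ex b) (i - j))" for i
  proof (induction i)
    case 0 then show ?case by (simp add: evP_mult)
  next
    case (Suc i)
    show ?case
    proof (intro ballI)
      fix a b assume a: "a \<in> R" and b: "b \<in> R"
      note [simp] = sh_R[OF a] sh_R[OF b] a b
      have "fps_nth (ex (a [*] b)) (Suc i) = evP a * fps_nth (ex b) (Suc i) + fps_nth (ex (sh a [*] b)) i"
        by (simp add: ex_Suc sh_mult ex_add cm)
      also have "fps_nth (ex (sh a [*] b)) i = (\<Sum>j=0..i. fps_nth (ex a) (Suc j) * fps_nth (ex b) (i - j))"
        using Suc by (simp add: ex_Suc)
      also have "evP a * fps_nth (ex b) (Suc i) + \<dots> = (\<Sum>j=0..Suc i. fps_nth (ex a) j * fps_nth (ex b) (Suc i - j))"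
        by (subst sum.atLeast0_atMost_Suc_shift) simp
      finally show "fps_nth (ex (a [*] b)) (Suc i) = (\<Sum>j=0..Suc i. fps_nth (ex a) j * fps_nth (ex b) (Suc i - j))" .
    qed
  qed
  then show "a \<in> R \<Longrightarrow> b \<in> R \<Longrightarrow> ex (a [*] b) = ex a * ex b" by (simp add: fps_eq_iff fps_mult_nth)
qed

lemma ex_t: "ex t = fps_X"
proof -
  have "sh t = \<one>\<^bsub>K\<^esub>" using sh_tmult[of "\<one>\<^bsub>K\<^esub>"] t_R by simp
  note z = this
  show ?thesis
  proof (rule fps_ext)
    fix i show "fps_nth (ex t) i = fps_nth fps_X i"
      by (cases i) (simp_all add: ex_Suc z evP_t)
  qed
qed

lemma ex_tpow: "ex (tpow r) = fps_X ^ r"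
  by (induction r) (simp_all add: ex_mult t_R tpow_R ex_t mult.commute)

text \<open>Every vanishing coefficient splits off one factor \<open>t\<close>, and the remaining
  coefficients move down by one.\<close>

lemma ex_low: "a \<in> R \<Longrightarrow> (\<forall>i<r. fps_nth (ex a) i = 0) \<Longrightarrow> \<exists>b\<in>R. a = tpow r [*] b \<and> (\<forall>i. fps_nth (ex b) i = fps_nth (ex a) (r + i))"
proof (induction r arbitrary: a)
  case 0 then show ?case by (intro bexI[of _ a]) auto
next
  case (Suc r)
  have "evP a = 0" using Suc.prems(2) ex_0[of a] by auto
  then have a: "a = t [*] sh a" using sh_eq[OF Suc.prems(1)] sh_R[OF Suc.prems(1)] t_R by simp
  have "\<forall>i<r. fps_nth (ex (sh a)) i = 0" using Suc.prems(2) by (auto simp: ex_Suc[symmetric])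
  then obtain b where b: "b \<in> R" "sh a = tpow r [*] b" "\<forall>i. fps_nth (ex b) i = fps_nth (ex (sh a)) (r + i)"
    using Suc.IH[OF sh_R[OF Suc.prems(1)]] by blast
  have "a = tpow (Suc r) [*] b" using a b t_R tpow_R[of r] by (simp add: K.m_ac)
  then show ?case using b by (auto simp: ex_Suc)
qed

end

section \<open>Dimensions of spaces of forms and injectivity of the expansion\<close>

lemma (in vector_space) dim_mono_finite:
  assumes "A \<subseteq> B" "B \<subseteq> span W" "finite W" shows "dim A \<le> dim B"
proof -
  obtain D where D: "D \<subseteq> B" "independent D" "B \<subseteq> span D" using maximal_independent_subset[of B] by blast
  have "finite D" using independent_span_bound[OF assms(3) D(2)] D(1) assms(2) by blast
  then have "dim A \<le> card D" using dim_le_card[of A D] D(3) assms(1) by blast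
  then show ?thesis using basis_card_eq_dim[OF D(1,3,2)] by simp
qed

lemma finite_bounded_monomials: "finite {m :: nat \<Rightarrow>\<^sub>0 nat. Poly_Mapping.keys m \<subseteq> {..n} \<and> wdeg (\<lambda>_. 1) m = e}" (is "finite ?S")
proof -
  have "Poly_Mapping.lookup ` ?S \<subseteq> {f. \<forall>x. (x \<in> {..n} \<longrightarrow> f x \<in> {..e}) \<and> (x \<notin> {..n} \<longrightarrow> f x = 0)}"
  proof (clarsimp, intro conjI impI)
    fix m :: "nat \<Rightarrow>\<^sub>0 nat" and x
    assume m: "Poly_Mapping.keys m \<subseteq> {..n}" "e = wdeg (\<lambda>_. Suc 0) m"
    show "Poly_Mapping.lookup m x \<le> wdeg (\<lambda>_. Suc 0) m"
      by (cases "x \<in> Poly_Mapping.keys m") (auto simp: wdeg_def in_keys_iff intro: member_le_sum)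
    assume "\<not> x \<le> n"
    then have "x \<notin> Poly_Mapping.keys m" using m(1) by auto
    then show "Poly_Mapping.lookup m x = 0" by (simp add: in_keys_iff)
  qed
  moreover have "finite {f::nat \<Rightarrow> nat. \<forall>x. (x \<in> {..n} \<longrightarrow> f x \<in> {..e}) \<and> (x \<notin> {..n} \<longrightarrow> f x = 0)}"
    by (rule finite_set_of_finite_funs) auto
  ultimately have "finite (Poly_Mapping.lookup ` ?S)" by (rule finite_subset)
  moreover have "inj_on Poly_Mapping.lookup ?S" by (rule inj_onI) (simp only: poly_mapping_eq_iff)
  ultimately show ?thesis by (rule finite_imageD)
qed

lemma vector_space_mpoly: "vector_space (\<lambda>c p. const_poly c * p :: ('v, 'k::field) mpoly)"
  by unfold_locales (simp_all add: algebra_simps)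

lemma vector_space_fps: "vector_space (\<lambda>c f. fps_const c * f :: 'k::field fps)"
  by unfold_locales (simp_all add: algebra_simps flip: fps_const_add fps_const_mult)

lemma vector_space_fun: "vector_space (\<lambda>c f a. c * f a :: 'k::field)"
  by unfold_locales (simp_all add: fun_eq_iff algebra_simps)

interpretation VM: vector_space "\<lambda>c p. const_poly c * p :: ('v, 'k::field) mpoly" by (rule vector_space_mpoly)
interpretation VF: vector_space "\<lambda>c f. fps_const c * f :: 'k::field fps" by (rule vector_space_fps)
interpretation VG: vector_space "\<lambda>c f a. c * f a :: 'k::field" by (rule vector_space_fun)
interpretation VMF: vector_space_pair "\<lambda>c p. const_poly c * p :: ('v, 'k::field) mpoly" "\<lambda>c f. fps_const c * f :: 'k fps" ..
interpretation VMG: vector_space_pair "\<lambda>c p. const_poly c * p :: ('v, 'k::field) mpoly" "\<lambda>c f a. c * f a :: 'k" ..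
interpretation VGG: vector_space_pair "\<lambda>c f a. c * f a :: 'k::field" "\<lambda>c f a. c * f a :: 'k" ..

interpretation fpsh: scalar_hom "fps_const :: 'k::comm_ring_1 \<Rightarrow> 'k fps"
  by unfold_locales simp_all

lemma forms_subspace: "VM.subspace (forms n e :: (nat, 'k::field) mpoly set)"
  by (auto simp: VM.subspace_def)

lemma forms_span: "forms n e \<subseteq> VM.span ((\<lambda>m. Poly_Mapping.single m (1::'k::field)) ` {m. Poly_Mapping.keys m \<subseteq> {..n} \<and> wdeg (\<lambda>_. 1) m = e})"
  (is "_ \<subseteq> VM.span ?B")
proof
  fix F :: "(nat, 'k) mpoly" assume F: "F \<in> forms n e"
  have "(\<Sum>m\<in>Poly_Mapping.keys F. const_poly (Poly_Mapping.lookup F m) * Poly_Mapping.single m 1) \<in> VM.span ?B"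
    using F by (intro VM.span_sum VM.span_scale VM.span_base imageI) (auto simp: forms_def polys_in_def homog_def)
  then show "F \<in> VM.span ?B" by (simp add: const_poly_def mult_single sum_singles)
qed

text \<open>Comparing constant coefficients gives \<open>c 0 = 0\<close>; a factor \<open>s\<close>
  cancels and the remaining coefficients follow by induction.\<close>

lemma powers_independent:
  fixes s :: "'k::field fps"
  assumes "s \<noteq> 0" "fps_nth s 0 = 0"
  shows "(\<Sum>i\<le>m. fps_const (c i) * s ^ i) = 0 \<Longrightarrow> i \<le> m \<Longrightarrow> c i = 0"
proof (induction m arbitrary: c i)
  case 0 then show ?case by simp
next
  case (Suc m)
  have e: "(\<Sum>i\<le>Suc m. fps_const (c i) * s ^ i) = fps_const (c 0) + s * (\<Sum>i\<le>m. fps_const (c (Suc i)) * s ^ i)"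
    by (subst sum.atMost_Suc_shift) (simp add: sum_distrib_left mult_ac)
  have c0: "c 0 = 0"
  proof -
    have "fps_nth (fps_const (c 0) + s * (\<Sum>i\<le>m. fps_const (c (Suc i)) * s ^ i)) 0 = 0"
      unfolding e[symmetric] Suc.prems(1) by simp
    then show ?thesis using assms(2) by simp
  qed
  then have "s * (\<Sum>i\<le>m. fps_const (c (Suc i)) * s ^ i) = 0" using e unfolding Suc.prems(1) by simp
  then have "(\<Sum>i\<le>m. fps_const (c (Suc i)) * s ^ i) = 0" using assms(1) by simp
  from Suc.IH[OF this] have "\<And>i. i \<le> m \<Longrightarrow> c (Suc i) = 0" by simp
  then show ?case using c0 Suc.prems(2) by (cases i) auto
qed

context smooth_point
begin

text \<open>The expansion on polynomials instead of functions: each variable is replaced by the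
  expansion of its quotient by the coordinate \<open>xj\<close>, which itself goes to 1. Degrees of
  forms are lost on purpose.\<close>

definition EV :: "(nat, 'k) mpoly \<Rightarrow> 'k fps" where "EV = fpsh.ev (\<lambda>i. ex (Nf 1 (var i)))"

lemma EV_simps [simp]: "EV 0 = 0" "EV 1 = 1" "EV (p + q) = EV p + EV q" "EV (p * q) = EV p * EV q"
   "EV (p - q) = EV p - EV q" "EV (p ^ k) = EV p ^ k" "EV (const_poly c) = fps_const c"
  unfolding EV_def const_poly_def
  by (simp_all add: fpsh.ev_add fpsh.ev_mult fpsh.ev_diff fpsh.ev_power)

lemma EV_var: "EV (var i) = ex (Nf 1 (var i))"
  by (simp add: EV_def var_def)

lemma EV_Nf: assumes "F \<in> forms n e" shows "ex (Nf e F) = EV F"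
proof -
  define Q where "Q a p \<longleftrightarrow> a \<in> R \<and> ex a = EV p" for a p
  have "Q (Nf e F) F"
    by (rule Nf_closure[of Q]) (use assms Nf_R[OF var_forms] in \<open>auto simp: Q_def ex_cf EV_var ex_add ex_mult\<close>)
  then show ?thesis by (simp add: Q_def)
qed

lemma Nf_zero_iff: "F \<in> forms n e \<Longrightarrow> Nf e F = \<zero>\<^bsub>K\<^esub> \<longleftrightarrow> F \<in> I"
  unfolding Nf_def by (rule cl_zero_iff[OF Nf_fr])

lemma EV_I: "F \<in> forms n e \<Longrightarrow> F \<in> I \<Longrightarrow> EV F = 0"
  using EV_Nf[of F e] Nf_zero_iff[of F e] ex_zero by metis

lemma EV_xj: "EV xj = 1"
  unfolding EV_var using Nf_xj[of 1] by simp

lemma gen_ex_zero: "(\<forall>u\<in>set ss. ex u = 0) \<Longrightarrow> set ss \<subseteq> R \<Longrightarrow> y \<in> gen R ss \<Longrightarrow> ex y = 0"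
proof (induction ss arbitrary: y)
  case (Cons s ss)
  then obtain b z where *: "y = b [*] s [+] z" "b \<in> R" "z \<in> gen R ss" by auto
  have ss: "set ss \<subseteq> R" and s: "s \<in> R" and s0: "ex s = 0" and z0: "ex z = 0" using Cons * by auto
  have "z \<in> R" by (rule submodD(1)[OF submod_gen[OF submod_R ss] *(3)])
  then show ?case using * s s0 z0 by (simp add: ex_add ex_mult)
qed simp

text \<open>If all translated coordinates had expansion 0, so would everything in the maximal ideal;
  but \<open>t\<close> expands to the variable of the power series ring.\<close>

lemma nonconst_linear: obtains l where "l \<in> forms n 1" "EV l \<noteq> 0" "fps_nth (EV l) 0 = 0"
proof -
  have "\<exists>u\<in>set U. ex u \<noteq> 0"
  proof (rule ccontr)
    assume "\<not> (\<exists>u\<in>set U. ex u \<noteq> 0)"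
    then have "ex t = 0" using gen_ex_zero[OF _ U_R, of t] M_gen tP(1) by blast
    then show False by (simp add: ex_t)
  qed
  then obtain u where u: "u \<in> set U" "ex u \<noteq> 0" by blast
  obtain i where i: "i \<in> {0..<Suc n}" "u = Nf 1 (var i - const_poly (P i / P jP) * xj)"
    using u(1) unfolding U_def set_map set_upt by (rule imageE)
  let ?l = "var i - const_poly (P i / P jP) * xj"
  have l: "?l \<in> forms n 1" using U_forms[of i] i by simp
  have "fps_nth (EV ?l) 0 = evP (Nf 1 ?l)" using EV_Nf[OF l] by (metis ex_0)
  also have "\<dots> = 0" using jP by (subst evP_Nf[OF l]) simp
  finally show thesis using that[OF l] u(2) EV_Nf[OF l] i(2) by metis
qed

text \<open>Were the kernel of the expansion larger than the ideal of the curve, the image would have a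
  bounded Hilbert function, the difference of two linear ones; but it contains all powers of a local
  coordinate.\<close>

lemma EV_injective:
  assumes F: "F \<in> forms n e" and EF: "EV F = 0" shows "F \<in> I"
proof (rule ccontr)
  assume FI: "F \<notin> I"
  \<comment> \<open>Restriction to the points of the curve: on forms its kernel is the ideal of the
    curve, so its rank is the Hilbert function.\<close>
  define \<rho> :: "(nat, 'k) mpoly \<Rightarrow> (nat \<Rightarrow> 'k) \<Rightarrow> 'k" where "\<rho> p = (\<lambda>a. if a \<in> C then peval a p else 0)" for p
  have \<rho>lin: "Vector_Spaces.linear (\<lambda>c p. const_poly c * p) (\<lambda>c f a. c * f a) \<rho>"
    by unfold_locales (auto simp: \<rho>_def fun_eq_iff)
  have EVlin: "Vector_Spaces.linear (\<lambda>c p. const_poly c * p) (\<lambda>c f. fps_const c * f) EV"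
    by unfold_locales auto
  have \<rho>0: "\<rho> p = 0 \<longleftrightarrow> p \<in> I" if "p \<in> forms n m" for p m
    using that by (auto simp: \<rho>_def fun_eq_iff vanishing_ideal_def forms_def)
  let ?B = "\<lambda>m. (\<lambda>m. Poly_Mapping.single m (1::'k)) ` {\<mu>. Poly_Mapping.keys \<mu> \<subseteq> {..n} \<and> wdeg (\<lambda>_. 1) \<mu> = m}"
  have finB: "finite (?B m)" for m using finite_bounded_monomials by simp
  have fs: "forms n m \<subseteq> VM.span (?B m)" for m by (rule forms_span)
  let ?h = "\<lambda>m. VG.dim (\<rho> ` forms n m)"
  have h: "hilbert_function n C m = int (?h m)" for m
  proof -
    have "VM.dim (forms n m :: (nat, 'k) mpoly set) = VM.dim {v \<in> forms n m. \<rho> v = 0} + ?h m"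
      by (rule VMG.rank_nullity[OF \<rho>lin, of "forms n m" "?B m", OF forms_subspace finB fs])
    moreover have "{v \<in> forms n m. \<rho> v = 0} = forms n m \<inter> I" using \<rho>0 by blast
    ultimately show ?thesis by (simp add: hilbert_function_def)
  qed
  have im_span: "\<rho> ` forms n m \<subseteq> VG.span (\<rho> ` ?B m)" for m
    using image_mono[OF fs[of m], of \<rho>] VMG.linear_span_image[OF \<rho>lin, of "?B m"] by simp
  \<comment> \<open>Modulo the ideal of the curve, the forms of degree \<open>m\<close> split into
    the image of the expansion, of dimension at least \<open>m + 1\<close>, and its kernel, which
    contains \<open>F\<close> times all forms of degree \<open>m - e\<close>.\<close>
  have step: "m + 1 + ?h (m - e) \<le> ?h m" if m: "e \<le> m" for m
  proof -
    let ?Ker = "{v \<in> forms n m. EV v = 0}"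
    have Kersub: "VM.subspace ?Ker" by (auto simp: VM.subspace_def)
    have 1: "VM.dim (forms n m :: (nat, 'k) mpoly set) = VM.dim ?Ker + VF.dim (EV ` forms n m)"
      by (rule VMF.rank_nullity[OF EVlin, of "forms n m" "?B m", OF forms_subspace finB fs])
    have "?Ker \<subseteq> VM.span (?B m)" using fs by blast
    then have 2: "VM.dim ?Ker = VM.dim {v \<in> ?Ker. \<rho> v = 0} + VG.dim (\<rho> ` ?Ker)"
      by (rule VMG.rank_nullity[OF \<rho>lin Kersub finB])
    have 3: "VM.dim (forms n m :: (nat, 'k) mpoly set) = VM.dim {v \<in> forms n m. \<rho> v = 0} + ?h m"
      by (rule VMG.rank_nullity[OF \<rho>lin, of "forms n m" "?B m", OF forms_subspace finB fs])
    have 4: "{v \<in> ?Ker. \<rho> v = 0} = {v \<in> forms n m. \<rho> v = 0}" using EV_I \<rho>0 by blast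
    have 5: "m + 1 \<le> VF.dim (EV ` forms n m)"
    proof -
      obtain l where l: "l \<in> forms n 1" "EV l \<noteq> 0" "fps_nth (EV l) 0 = 0" by (rule nonconst_linear)
      let ?s = "EV l"
      have sub: "(\<lambda>i. ?s ^ i) ` {..m} \<subseteq> EV ` forms n m"
      proof (clarify)
        fix i assume i: "i \<le> m"
        have "l ^ i * xj ^ (m - i) \<in> forms n m"
          using forms_simps(5)[OF forms_power[OF l(1), of i] xj_pow_forms[of "m - i"]] i by simp
        moreover have "EV (l ^ i * xj ^ (m - i)) = ?s ^ i" by (simp add: EV_xj)
        ultimately show "?s ^ i \<in> EV ` forms n m" by (metis imageI)
      qed
      have inj: "inj_on (\<lambda>i. ?s ^ i) {..m}"
      proof (rule inj_onI, rule ccontr)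
        fix i j assume ij: "i \<in> {..m}" "j \<in> {..m}" "?s ^ i = ?s ^ j" "i \<noteq> j"
        let ?c = "\<lambda>k. if k = i then 1 else if k = j then -1 else (0::'k)"
        have "(\<Sum>k\<le>m. fps_const (?c k) * ?s ^ k) = (\<Sum>k\<in>{i,j}. fps_const (?c k) * ?s ^ k)"
          using ij by (intro sum.mono_neutral_right) auto
        also have "\<dots> = 0" using ij(3,4) by (simp flip: fps_const_neg)
        finally have "?c i = 0" using powers_independent[OF l(2,3), of ?c m i] ij by auto
        then show False by simp
      qed
      have ind: "VF.independent ((\<lambda>i. ?s ^ i) ` {..m})"
      proof (rule VF.independent_if_scalars_zero)
        fix c x assume "(\<Sum>x\<in>(\<lambda>i. ?s ^ i) ` {..m}. fps_const (c x) * x) = 0" "x \<in> (\<lambda>i. ?s ^ i) ` {..m}"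
        then show "c x = 0"
          using powers_independent[OF l(2,3), of "\<lambda>i. c (?s ^ i)" m] by (auto simp: sum.reindex[OF inj])
      qed simp
      have "VF.dim ((\<lambda>i. ?s ^ i) ` {..m}) = m + 1"
        unfolding VF.dim_eq_card_independent[OF ind] card_image[OF inj] by simp
      moreover have sp: "EV ` forms n m \<subseteq> VF.span (EV ` ?B m)"
        using image_mono[OF fs[of m], of EV] VMF.linear_span_image[OF EVlin, of "?B m"] by simp
      moreover note VF.dim_mono_finite[OF sub sp finite_imageI[OF finB]]
      ultimately show ?thesis by (simp only:)
    qed
    \<comment> \<open>Multiplication by \<open>F\<close> is injective modulo the ideal of the curve,
      as this ideal is prime and does not contain \<open>F\<close>, and its image is killed by the
      expansion.\<close>
    have 6: "?h (m - e) \<le> VG.dim (\<rho> ` ?Ker)"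
    proof -
      define mu where "mu = (\<lambda>(f :: (nat \<Rightarrow> 'k) \<Rightarrow> 'k) a. \<rho> F a * f a)"
      have mulin: "Vector_Spaces.linear (\<lambda>c f a. c * f a) (\<lambda>c f a. c * f a) mu"
        by unfold_locales (auto simp: mu_def fun_eq_iff algebra_simps)
      have V: "VG.subspace (\<rho> ` forms n (m - e))"
        by (rule VMG.linear_subspace_image[OF \<rho>lin forms_subspace])
      have mu_rho: "mu (\<rho> H) = \<rho> (F * H)" for H by (auto simp: mu_def \<rho>_def fun_eq_iff)
      have "?h (m - e) = VG.dim {v \<in> \<rho> ` forms n (m - e). mu v = 0} + VG.dim (mu ` \<rho> ` forms n (m - e))"
        by (rule VGG.rank_nullity[OF mulin V finite_imageI[OF finB] im_span])
      moreover have z: "{v \<in> \<rho> ` forms n (m - e). mu v = 0} \<subseteq> VG.span {}"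
        unfolding VG.span_empty
      proof clarify
        fix H assume H: "H \<in> forms n (m - e)" "mu (\<rho> H) = 0"
        then have "F * H \<in> I" using \<rho>0[of "F * H" m] mu_rho forms_simps(5)[OF F H(1)] m by simp
        then have "H \<in> I" using prime[OF F H(1)] FI by blast
        then show "\<rho> H = 0" using \<rho>0[OF H(1)] by blast
      qed
      then have "VG.dim {v \<in> \<rho> ` forms n (m - e). mu v = 0} = 0"
        using VG.dim_le_card[OF z finite.emptyI] by simp
      moreover have "VG.dim (mu ` \<rho> ` forms n (m - e)) \<le> VG.dim (\<rho> ` ?Ker)"
      proof (rule VG.dim_mono_finite[OF _ _ finite_imageI[OF finB]])
        show "mu ` \<rho> ` forms n (m - e) \<subseteq> \<rho> ` ?Ker"
        proof clarify
          fix H :: "(nat, 'k) mpoly" assume H: "H \<in> forms n (m - e)"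
          have "F * H \<in> ?Ker" using forms_simps(5)[OF F H] m EF by simp
          then show "mu (\<rho> H) \<in> \<rho> ` ?Ker" unfolding mu_rho by (rule imageI)
        qed
        show "\<rho> ` ?Ker \<subseteq> VG.span (\<rho> ` ?B m)" using im_span[of m] by blast
      qed
      ultimately show ?thesis by simp
    qed
    show ?thesis using 1 2 3 4 5 6 by simp
  qed
  obtain \<delta> M0 where *: "\<And>m. m \<ge> M0 \<Longrightarrow> hilbert_function n C m = \<delta> * int m + 1 - int g"
    using genus unfolding has_genus_def by blast
  \<comment> \<open>Linearity makes the two Hilbert function values differ by \<delta> times
    \<open>e\<close>; this \<open>m\<close> is at least that large, against a difference of at least
    \<open>m + 1\<close>. The summands \<open>M0 + e\<close> keep \<open>m\<close> and
    \<open>m - e\<close> in the linear range.\<close>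
  define m where "m = M0 + e + nat (\<delta> * int e)"
  have "m + 1 + ?h (m - e) \<le> ?h m" by (rule step) (simp add: m_def)
  then have "int m + 1 + int (?h (m - e)) \<le> int (?h m)" by linarith
  moreover have "int (?h m) = \<delta> * int m + 1 - int g" unfolding h[symmetric] by (rule *) (simp add: m_def)
  moreover have "int (?h (m - e)) = \<delta> * int (m - e) + 1 - int g" unfolding h[symmetric] by (rule *) (simp add: m_def)
  moreover have "int (m - e) = int m - int e" by (simp add: m_def)
  then have "\<delta> * int (m - e) = \<delta> * int m - \<delta> * int e" by (simp add: right_diff_distrib)
  moreover have "\<delta> * int e \<le> int (nat (\<delta> * int e))" by simp
  then have "\<delta> * int e \<le> int m" unfolding m_def of_nat_add by linarith
  ultimately show False by linarith
qed

end

section \<open>Extension of places\<close>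

text \<open>A place of the field 'l with values in 'k is represented by its graph, a subring of the
  product that is single valued over 0.\<close>

definition place_graph :: "('l::field \<times> 'k::field) set \<Rightarrow> bool" where
  "place_graph B \<longleftrightarrow> (1, 1) \<in> B \<and> (\<forall>a b a' b'. (a, b) \<in> B \<longrightarrow> (a', b') \<in> B \<longrightarrow>
     (a + a', b + b') \<in> B \<and> (a * a', b * b') \<in> B \<and> (- a, - b) \<in> B) \<and> (\<forall>c. (0, c) \<in> B \<longrightarrow> c = 0)"

lemma place_graphD:
  assumes "place_graph B"
  shows "(1, 1) \<in> B" "(0, 0) \<in> B" "(a, b) \<in> B \<Longrightarrow> (a', b') \<in> B \<Longrightarrow> (a + a', b + b') \<in> B"
    "(a, b) \<in> B \<Longrightarrow> (a', b') \<in> B \<Longrightarrow> (a * a', b * b') \<in> B" "(a, b) \<in> B \<Longrightarrow> (- a, - b) \<in> B"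
    "(0, c) \<in> B \<Longrightarrow> c = 0" "(a, b) \<in> B \<Longrightarrow> (a', b') \<in> B \<Longrightarrow> (a - a', b - b') \<in> B"
    "(a, b) \<in> B \<Longrightarrow> (a ^ k, b ^ k) \<in> B"
proof -
  note d = assms[unfolded place_graph_def]
  show 1: "(1, 1) \<in> B" using d by blast
  show 3: "\<And>a b a' b'. (a, b) \<in> B \<Longrightarrow> (a', b') \<in> B \<Longrightarrow> (a + a', b + b') \<in> B" using d by blast
  show 4: "\<And>a b a' b'. (a, b) \<in> B \<Longrightarrow> (a', b') \<in> B \<Longrightarrow> (a * a', b * b') \<in> B" using d by blast
  show 5: "\<And>a b. (a, b) \<in> B \<Longrightarrow> (- a, - b) \<in> B" using d by blast
  show "(0, c) \<in> B \<Longrightarrow> c = 0" using d by blast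
  show "(0, 0) \<in> B" using 3[OF 1 5[OF 1]] by simp
  show "(a, b) \<in> B \<Longrightarrow> (a', b') \<in> B \<Longrightarrow> (a - a', b - b') \<in> B" using 3[OF _ 5, of a b a' b'] by simp
  show "(a, b) \<in> B \<Longrightarrow> (a ^ k, b ^ k) \<in> B" by (induction k) (auto intro: 1 4)
qed

lemma place_graph_Union:
  assumes "subset.chain {B. place_graph B} CC" "CC \<noteq> {}"
  shows "place_graph (\<Union>CC)"
proof -
  have pg: "\<And>B. B \<in> CC \<Longrightarrow> place_graph B" and tot: "\<And>A B. A \<in> CC \<Longrightarrow> B \<in> CC \<Longrightarrow> A \<subseteq> B \<or> B \<subseteq> A"
    using assms(1) by (auto simp: subset_chain_def)
  have two: "\<exists>B\<in>CC. x \<in> B \<and> y \<in> B" if "x \<in> \<Union>CC" "y \<in> \<Union>CC" for x y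
    using that tot by blast
  obtain B0 where "B0 \<in> CC" using assms(2) by blast
  then have one: "(1, 1) \<in> \<Union>CC" using place_graphD(1)[OF pg] by blast
  show ?thesis unfolding place_graph_def
  proof (intro conjI allI impI)
    fix a b a' b' assume ab: "(a, b) \<in> \<Union>CC" "(a', b') \<in> \<Union>CC"
    obtain B where B: "B \<in> CC" "(a, b) \<in> B" "(a', b') \<in> B" using two[OF ab] by blast
    show "(a + a', b + b') \<in> \<Union>CC" "(a * a', b * b') \<in> \<Union>CC" "(- a, - b) \<in> \<Union>CC"
      using place_graphD(3,4,5)[OF pg[OF B(1)]] B by blast+
  next
    fix c assume "(0, c) \<in> \<Union>CC"
    then obtain B where "B \<in> CC" "(0, c) \<in> B" by blast
    then show "c = 0" using place_graphD(6)[OF pg] by blast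
  qed (rule one)
qed

text \<open>A polynomial together with a coefficientwise reduction. Evaluating both at
  \<open>t\<close> and \<open>c\<close> is how \<open>t\<close> is adjoined with value
  \<open>c\<close>.\<close>

definition graph_polys :: "('l::field \<times> 'k::field) set \<Rightarrow> ('l poly \<times> 'k poly) set" where
  "graph_polys B = {(p, q). \<forall>i. (poly.coeff p i, poly.coeff q i) \<in> B}"

context
  fixes B :: "('l::field \<times> 'k::field) set"
  assumes pg: "place_graph B"
begin

lemma graph_polys_closed:
  assumes "(p, q) \<in> graph_polys B" "(p', q') \<in> graph_polys B"
  shows "(p + p', q + q') \<in> graph_polys B" "(p * p', q * q') \<in> graph_polys B" "(- p, - q) \<in> graph_polys B"
proof -
  show "(p + p', q + q') \<in> graph_polys B" "(- p, - q) \<in> graph_polys B"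
    using assms place_graphD(3,5)[OF pg] by (auto simp: graph_polys_def)
  have "(\<Sum>i\<in>A. poly.coeff p i * poly.coeff p' (k - i), \<Sum>i\<in>A. poly.coeff q i * poly.coeff q' (k - i)) \<in> B" if "finite A" for k A
    using that by (induction A rule: finite_induct)
      (use assms place_graphD(2,3,4)[OF pg] in \<open>auto simp: graph_polys_def\<close>)
  then show "(p * p', q * q') \<in> graph_polys B" by (auto simp: graph_polys_def coeff_mult)
qed

lemma graph_polys_monom: "(a, b) \<in> B \<Longrightarrow> (Polynomial.monom a k, Polynomial.monom b k) \<in> graph_polys B"
  using place_graphD(2)[OF pg] by (auto simp: graph_polys_def)


lemma graph_polys_diff: "(p, q) \<in> graph_polys B \<Longrightarrow> (p', q') \<in> graph_polys B \<Longrightarrow> (p - p', q - q') \<in> graph_polys B"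
  using graph_polys_closed(1)[of p q "-p'" "-q'"] graph_polys_closed(3)[of p' q' p' q'] by simp

text \<open>The only danger in prescribing the value \<open>c\<close> for \<open>t\<close> is that 0
  receives a nonzero value; the hypothesis excludes exactly this.\<close>

lemma place_graph_adjoin:
  assumes "\<And>p q. (p, q) \<in> graph_polys B \<Longrightarrow> poly p t = 0 \<Longrightarrow> poly q c = 0"
  shows "place_graph {(poly p t, poly q c) | p q. (p, q) \<in> graph_polys B}" (is "place_graph ?B'")
    and "B \<subseteq> {(poly p t, poly q c) | p q. (p, q) \<in> graph_polys B}"
    and "(t, c) \<in> {(poly p t, poly q c) | p q. (p, q) \<in> graph_polys B}"
proof -
  show sub: "B \<subseteq> ?B'"
  proof clarify
    fix a b assume "(a, b) \<in> B"
    from graph_polys_monom[OF this, of 0] show "\<exists>p q. (a, b) = (poly p t, poly q c) \<and> (p, q) \<in> graph_polys B"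
      by (intro exI[of _ "Polynomial.monom a 0"] exI[of _ "Polynomial.monom b 0"]) (simp add: poly_monom)
  qed
  show "(t, c) \<in> ?B'"
  proof -
    have "(t, c) = (poly (Polynomial.monom 1 1) t, poly (Polynomial.monom 1 1) c)" by (simp add: poly_monom)
    then show ?thesis using graph_polys_monom[OF place_graphD(1)[OF pg], of 1] by blast
  qed
  show "place_graph ?B'" unfolding place_graph_def
  proof (intro conjI allI impI)
    show "(1, 1) \<in> ?B'" using sub place_graphD(1)[OF pg] by blast
    fix a b a' b' assume "(a, b) \<in> ?B'" "(a', b') \<in> ?B'"
    then obtain p q p' q' where *: "a = poly p t" "b = poly q c" "a' = poly p' t" "b' = poly q' c"
      "(p, q) \<in> graph_polys B" "(p', q') \<in> graph_polys B" by blast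
    show "(a + a', b + b') \<in> ?B'"
      using graph_polys_closed(1)[OF *(5,6)] unfolding *(1-4) poly_add[symmetric] by blast
    show "(a * a', b * b') \<in> ?B'"
      using graph_polys_closed(2)[OF *(5,6)] unfolding *(1-4) poly_mult[symmetric] by blast
    show "(- a, - b) \<in> ?B'"
      using graph_polys_closed(3)[OF *(5,6)] unfolding *(1-4) poly_minus[symmetric] by blast
  next
    fix b assume "(0, b) \<in> ?B'"
    then obtain p q where "0 = poly p t" "b = poly q c" "(p, q) \<in> graph_polys B" by blast
    then show "b = 0" using assms by metis
  qed
qed

end

text \<open>A ring homomorphism from a subring of \<open>'l\<close> to \<open>'k\<close> that cannot
  be extended to a larger subring with values in the same \<open>'k\<close>.\<close>

locale maximal_place =
  fixes B :: "('l::field \<times> 'k::alg_closed_field) set"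
  assumes pg: "place_graph B" and max: "place_graph B' \<Longrightarrow> B \<subseteq> B' \<Longrightarrow> B' = B"
begin

lemmas D = place_graphD[OF pg]

text \<open>Since \<open>b\<close> is invertible, the place extends to the localization at the
  powers of \<open>a\<close>; by maximality nothing new is added.\<close>

lemma inverse_mem:
  assumes ab: "(a, b) \<in> B" "b \<noteq> 0" shows "(inverse a, inverse b) \<in> B"
proof -
  have a: "a \<noteq> 0" using ab D(6) by blast
  let ?B' = "{(x / a ^ k, y / b ^ k) | x y k. (x, y) \<in> B}"
  have "place_graph ?B'" unfolding place_graph_def
  proof (intro conjI allI impI)
    have "(1, 1) = (1 / a ^ 0, 1 / b ^ 0)" by simp
    then show "(1, 1) \<in> ?B'" using D(1) by blast
    fix u v u' v' assume "(u, v) \<in> ?B'" "(u', v') \<in> ?B'"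
    then obtain x y k x' y' k' where *: "u = x / a ^ k" "v = y / b ^ k" "u' = x' / a ^ k'" "v' = y' / b ^ k'"
      "(x, y) \<in> B" "(x', y') \<in> B" by blast
    have "(x * a ^ k' + x' * a ^ k, y * b ^ k' + y' * b ^ k) \<in> B"
      using D(3)[OF D(4)[OF *(5) D(8)[OF ab(1)]] D(4)[OF *(6) D(8)[OF ab(1)]]] .
    moreover have "u + u' = (x * a ^ k' + x' * a ^ k) / a ^ (k + k')" "v + v' = (y * b ^ k' + y' * b ^ k) / b ^ (k + k')"
      using a ab(2) by (simp_all add: * add_frac_eq power_add)
    ultimately show "(u + u', v + v') \<in> ?B'" by blast
    have "u * u' = (x * x') / a ^ (k + k')" "v * v' = (y * y') / b ^ (k + k')" by (simp_all add: * power_add)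
    then show "(u * u', v * v') \<in> ?B'" using D(4)[OF *(5,6)] by blast
    have "- u = (- x) / a ^ k" "- v = (- y) / b ^ k" by (simp_all add: *)
    then show "(- u, - v) \<in> ?B'" using D(5)[OF *(5)] by blast
  next
    fix c assume "(0, c) \<in> ?B'"
    then obtain x y k where "0 = x / a ^ k" "c = y / b ^ k" "(x, y) \<in> B" by blast
    then show "c = 0" using a D(6) by auto
  qed
  moreover have "B \<subseteq> ?B'"
  proof clarify
    fix x y assume "(x, y) \<in> B"
    then show "\<exists>x' y' k. (x, y) = (x' / a ^ k, y' / b ^ k) \<and> (x', y') \<in> B"
      by (intro exI[of _ x] exI[of _ y] exI[of _ 0]) simp
  qed
  ultimately have "?B' = B" by (rule max)
  moreover have "(inverse a, inverse b) = (1 / a ^ 1, 1 / b ^ 1)" by (simp add: inverse_eq_divide)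
  then have "(inverse a, inverse b) \<in> ?B'" using D(1) by blast
  ultimately show ?thesis by blast
qed

lemma graph_polys_smult: "(a, b) \<in> B \<Longrightarrow> (p, q) \<in> graph_polys B \<Longrightarrow> (Polynomial.smult a p, Polynomial.smult b q) \<in> graph_polys B"
  using D(4) by (auto simp: graph_polys_def)

text \<open>If \<open>t\<close> admits no value, the reductions of the polynomials vanishing at
  \<open>t\<close> have no common root. They are all multiples of one \<open>h\<close>, which is
  constant because \<open>'k\<close> is algebraically closed. After normalization, 1 minus the
  corresponding polynomial has reduction 0 and takes the value 1 at \<open>t\<close>.\<close>

lemma unit_relation:
  assumes "\<And>c. (t, c) \<notin> B"
  shows "\<exists>p. (p, 0) \<in> graph_polys B \<and> poly p t = 1"
proof -
  have no: "\<exists>p q. (p, q) \<in> graph_polys B \<and> poly p t = 0 \<and> poly q c \<noteq> 0" for c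
  proof (rule ccontr)
    assume "\<not> ?thesis"
    then have *: "\<And>p q. (p, q) \<in> graph_polys B \<Longrightarrow> poly p t = 0 \<Longrightarrow> poly q c = 0" by blast
    have eq: "{(poly p t, poly q c) | p q. (p, q) \<in> graph_polys B} = B"
      by (rule max[OF place_graph_adjoin(1)[OF pg *] place_graph_adjoin(2)[OF pg *]])
    have "(t, c) \<in> {(poly p t, poly q c) | p q. (p, q) \<in> graph_polys B}"
      by (rule place_graph_adjoin(3)[OF pg *])
    then show False unfolding eq using assms by simp
  qed
  define J where "J = {q. \<exists>p. (p, q) \<in> graph_polys B \<and> poly p t = 0}"
  obtain q0 where q0: "q0 \<in> J" "q0 \<noteq> 0" using no[of 0] unfolding J_def by force
  obtain h where h: "h \<in> J" "h \<noteq> 0" "\<And>q. q \<in> J \<Longrightarrow> q \<noteq> 0 \<Longrightarrow> Polynomial.degree h \<le> Polynomial.degree q"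
    using ex_has_least_nat[of "\<lambda>q. q \<in> J \<and> q \<noteq> 0" q0 Polynomial.degree] q0 by blast
  have surj: "\<exists>a. (a, b) \<in> B" if "\<exists>a q i. q \<in> J \<and> b = poly.coeff q i" for b
    using that by (auto simp: J_def graph_polys_def)
  obtain ph where ph: "(ph, h) \<in> graph_polys B" "poly ph t = 0" using h(1) by (auto simp: J_def)
  obtain a0 where a0: "(a0, lead_coeff h) \<in> B" using ph(1) by (auto simp: graph_polys_def)
  have dvd: "h dvd q" if "q \<in> J" for q
    using that
  proof (induction "Polynomial.degree q" arbitrary: q rule: less_induct)
    case less
    obtain p where p: "(p, q) \<in> graph_polys B" "poly p t = 0" using less.prems by (auto simp: J_def)
    show ?case
    proof (cases "q = 0")
      case False
      let ?k = "Polynomial.degree q - Polynomial.degree h"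
      let ?m = "lead_coeff q / lead_coeff h"
      obtain a1 where a1: "(a1, lead_coeff q) \<in> B" using p(1) by (auto simp: graph_polys_def)
      \<comment> \<open>The quotient of the leading coefficients is again a residue, by
        \<open>inverse_mem\<close>, so Euclidean division by \<open>h\<close> does not leave
        \<open>J\<close>.\<close>
      have am: "(a1 * inverse a0, ?m) \<in> B"
        using D(4)[OF a1 inverse_mem[OF a0]] h(2) by (simp add: field_class.field_divide_inverse)
      let ?q' = "q - Polynomial.monom ?m ?k * h"
      have "(p - Polynomial.monom (a1 * inverse a0) ?k * ph, ?q') \<in> graph_polys B"
        by (rule graph_polys_diff[OF pg p(1) graph_polys_closed(2)[OF pg graph_polys_monom[OF pg am] ph(1)]])
      then have J': "?q' \<in> J" unfolding J_def using p(2) ph(2) by force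
      have deg: "Polynomial.degree h \<le> Polynomial.degree q" using h(3) less.prems False by blast
      have "h dvd ?q'"
      proof (cases "?q' = 0")
        case nz: False
        have "Polynomial.degree (Polynomial.monom ?m ?k * h) = Polynomial.degree q"
          using False h(2) deg by (subst degree_mult_eq) (auto simp: degree_monom_eq monom_eq_0_iff)
        moreover have "poly.coeff (Polynomial.monom ?m ?k * h) (Polynomial.degree q) = lead_coeff q"
          using h(2) deg by (simp add: coeff_monom_mult)
        ultimately have "Polynomial.degree ?q' < Polynomial.degree q"
          using nz by (metis (no_types, lifting) coeff_diff degree_diff_le eq_iff_diff_eq_0 leading_coeff_0_iff nat_less_le order_refl)
        then show ?thesis using less.hyps J' by blast
      qed simp
      then have "h dvd ?q' + Polynomial.monom ?m ?k * h" by (rule dvd_add) simp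
      then show ?thesis by simp
    qed simp
  qed
  have "Polynomial.degree h = 0"
  proof (rule ccontr)
    assume "Polynomial.degree h \<noteq> 0"
    then obtain c where "poly h c = 0" using alg_closed_imp_poly_has_root[of h] by auto
    moreover obtain p q where "(p, q) \<in> graph_polys B" "poly p t = 0" "poly q c \<noteq> 0" using no by blast
    moreover have "h dvd q" using dvd calculation by (auto simp: J_def)
    ultimately show False by (auto elim!: dvdE)
  qed
  then obtain b where b: "h = [:b:]" by (meson degree_eq_zeroE)
  then have b0: "b \<noteq> 0" "(a0, b) \<in> B" using h(2) a0 by auto
  note ia = inverse_mem[OF b0(2,1)]
  have "(Polynomial.smult (inverse a0) ph, [:1:]) \<in> graph_polys B"
    using graph_polys_smult[OF ia ph(1)] b b0 by simp
  moreover have "(1, 1) \<in> graph_polys B"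
    using graph_polys_monom[OF pg D(1), of 0] by (simp add: monom_0 one_pCons)
  ultimately have "(1 - Polynomial.smult (inverse a0) ph, 0) \<in> graph_polys B"
    using graph_polys_diff[OF pg, of 1 1] by (metis diff_self one_pCons)
  then show ?thesis using ph(2) by (intro exI[of _ "1 - Polynomial.smult (inverse a0) ph"]) simp
qed

text \<open>Chevalley: relations of minimal degree for t and for its inverse can be played off against
  each other.\<close>

lemma valuation_ring:
  assumes "t \<noteq> 0" shows "(\<exists>c. (t, c) \<in> B) \<or> (\<exists>c. (inverse t, c) \<in> B)"
proof (rule ccontr)
  assume "\<not> ?thesis"
  then have no: "\<And>c. (t, c) \<notin> B" "\<And>c. (inverse t, c) \<notin> B" by auto
  define Rel where "Rel s p \<longleftrightarrow> (p, 0) \<in> graph_polys B \<and> poly p s = 1" for s :: 'l and p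
  \<comment> \<open>Formulated for \<open>s\<close> and its inverse, so that it covers both cases:
    \<open>s\<close> is whichever of \<open>t\<close> and \<open>inverse t\<close> has the minimal
    relation of larger degree.\<close>
  have main: False
    if s: "s \<noteq> 0" and p: "Rel s p" and q: "Rel (inverse s) q" and dle: "Polynomial.degree q \<le> Polynomial.degree p"
      and minp: "\<And>p'. Rel s p' \<Longrightarrow> Polynomial.degree p \<le> Polynomial.degree p'" for s p q
  proof -
    let ?N = "Polynomial.degree p"
    have c: "(poly.coeff p i, 0) \<in> B" "(poly.coeff q i, 0) \<in> B" for i
      using p q by (auto simp: Rel_def graph_polys_def)
    have N: "?N > 0"
    proof (rule ccontr)
      assume "\<not> ?N > 0"
      then obtain b where b: "p = [:b:]" by (metis degree_eq_zeroE neq0_conv)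
      then have "(1, 0) \<in> B" using p c(1)[of 0] by (simp add: Rel_def)
      then have "(1 - 1, 1 - 0) \<in> B" using D(7)[OF D(1)] by blast
      then show False using D(6) by fastforce
    qed
    let ?u = "1 - poly.coeff q 0"
    have "(?u, 1) \<in> B" using D(7)[OF D(1) c(2)] by simp
    from inverse_mem[OF this] have iu: "(inverse ?u, 1) \<in> B" by simp
    have u0: "?u \<noteq> 0" using \<open>(?u, 1) \<in> B\<close> D(6) by force
    \<comment> \<open>Multiplying the relation for \<open>inverse s\<close> by \<open>s ^ ?N\<close>
      and solving for \<open>s ^ ?N\<close>, whose coefficient is the unit \<open>?u\<close>,
      expresses it by lower powers with coefficients of residue 0.\<close>
    define r where "r = (\<Sum>i\<in>{1..Polynomial.degree q}. Polynomial.monom (inverse ?u * poly.coeff q i) (?N - i))"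
    have "(Polynomial.monom (inverse ?u * poly.coeff q i) (?N - i), Polynomial.monom 0 (?N - i)) \<in> graph_polys B" for i
      by (rule graph_polys_monom[OF pg]) (use D(4)[OF iu c(2)] in simp)
    then have m: "(Polynomial.monom (inverse ?u * poly.coeff q i) (?N - i), 0) \<in> graph_polys B" for i by simp
    have z: "(0, 0) \<in> graph_polys B" using D(2) by (simp add: graph_polys_def)
    have "finite A \<Longrightarrow> (\<Sum>i\<in>A. Polynomial.monom (inverse ?u * poly.coeff q i) (?N - i), 0) \<in> graph_polys B" for A
    proof (induction A rule: finite_induct)
      case (insert x A)
      then show ?case using graph_polys_closed(1)[OF pg m[of x] insert.IH] by simp
    qed (use z in simp)
    then have r: "(r, 0) \<in> graph_polys B" by (simp add: r_def)
    have "s ^ ?N = poly r s"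
    proof -
      have "1 = (\<Sum>i\<le>Polynomial.degree q. poly.coeff q i * inverse s ^ i)"
        using q by (simp add: Rel_def poly_altdef)
      also have "\<dots> = poly.coeff q 0 + (\<Sum>i\<in>{1..Polynomial.degree q}. poly.coeff q i * inverse s ^ i)"
        by (simp add: sum.atMost_shift sum.atLeast1_atMost_eq lessThan_Suc_atMost flip: atLeast1_atMost_eq_remove0)
      finally have "1 = poly.coeff q 0 + (\<Sum>i\<in>{1..Polynomial.degree q}. poly.coeff q i * inverse s ^ i)" .
      then have "?u = (\<Sum>i\<in>{1..Polynomial.degree q}. poly.coeff q i * inverse s ^ i)"
        by (simp only: diff_eq_eq add.commute)
      then have "s ^ ?N = inverse ?u * s ^ ?N * (\<Sum>i\<in>{1..Polynomial.degree q}. poly.coeff q i * inverse s ^ i)"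
        using u0 by simp
      also have "\<dots> = (\<Sum>i\<in>{1..Polynomial.degree q}. inverse ?u * poly.coeff q i * s ^ (?N - i))"
        unfolding sum_distrib_left
      proof (rule sum.cong)
        fix i assume "i \<in> {1..Polynomial.degree q}"
        then have "s ^ ?N = s ^ (?N - i) * s ^ i" using dle by (simp flip: power_add)
        then show "inverse ?u * s ^ ?N * (poly.coeff q i * inverse s ^ i) = inverse ?u * poly.coeff q i * s ^ (?N - i)"
          using s by (simp add: power_inverse field_simps)
      qed simp
      also have "\<dots> = poly r s" by (simp add: r_def poly_sum poly_monom)
      finally show ?thesis .
    qed
    \<comment> \<open>Exchanging the leading monomial of \<open>p\<close> for this expression lowers
      the degree and preserves the relation, against minimality.\<close>
    moreover define p' where "p' = p - Polynomial.monom (lead_coeff p) ?N + Polynomial.smult (lead_coeff p) r"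
    ultimately have "poly p' s = 1" using p by (simp add: Rel_def poly_monom)
    moreover have "(p', 0) \<in> graph_polys B"
    proof -
      have "(Polynomial.monom (lead_coeff p) ?N, 0) \<in> graph_polys B"
        using graph_polys_monom[OF pg c(1)[of ?N], of ?N] by simp
      then have "(p - Polynomial.monom (lead_coeff p) ?N, 0) \<in> graph_polys B"
        using graph_polys_diff[OF pg] p by (fastforce simp: Rel_def)
      moreover have "(Polynomial.smult (lead_coeff p) r, 0) \<in> graph_polys B" using graph_polys_smult[OF c(1) r] by simp
      ultimately show ?thesis unfolding p'_def using graph_polys_closed(1)[OF pg] by fastforce
    qed
    ultimately have "?N \<le> Polynomial.degree p'" using minp by (simp add: Rel_def)
    moreover have "Polynomial.degree p' \<le> ?N - 1"
    proof (rule degree_le, intro allI impI)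
      fix i assume i: "i > ?N - 1"
      have "poly.coeff r i = 0" unfolding r_def using i N by (auto simp: coeff_sum intro!: sum.neutral)
      moreover have "poly.coeff (p - Polynomial.monom (lead_coeff p) ?N) i = 0"
        using i N by (cases "i = ?N") (auto intro: coeff_eq_0)
      ultimately show "poly.coeff p' i = 0" by (simp add: p'_def)
    qed
    ultimately show False using N by simp
  qed
  have ex: "\<exists>p. Rel s p \<and> (\<forall>p'. Rel s p' \<longrightarrow> Polynomial.degree p \<le> Polynomial.degree p')"
    if "\<And>c. (s, c) \<notin> B" for s
    using unit_relation[OF that] ex_has_least_nat[of "Rel s" _ Polynomial.degree] by (auto simp: Rel_def)
  obtain p where p: "Rel t p" "\<And>p'. Rel t p' \<Longrightarrow> Polynomial.degree p \<le> Polynomial.degree p'" using ex[OF no(1)] by blast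
  obtain q where q: "Rel (inverse t) q" "\<And>p'. Rel (inverse t) p' \<Longrightarrow> Polynomial.degree q \<le> Polynomial.degree p'" using ex[OF no(2)] by blast
  show False
  proof (cases "Polynomial.degree q \<le> Polynomial.degree p")
    case True then show False using main[OF assms p(1) q(1)] p(2) by blast
  next
    case False
    then show False using main[of "inverse t" q p] assms p(1) q by simp
  qed
qed

end

lemma place_extension:
  assumes "place_graph (B0 :: ('l::field \<times> 'k::alg_closed_field) set)"
  obtains B where "B0 \<subseteq> B" "maximal_place B"
proof -
  have "\<exists>M\<in>{B. place_graph B \<and> B0 \<subseteq> B}. \<forall>X\<in>{B. place_graph B \<and> B0 \<subseteq> B}. M \<subseteq> X \<longrightarrow> X = M"
  proof (rule subset_Zorn_nonempty)
    show "{B. place_graph B \<and> B0 \<subseteq> B} \<noteq> {}" using assms by blast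
    fix CC assume CC: "CC \<noteq> {}" "subset.chain {B. place_graph B \<and> B0 \<subseteq> B} CC"
    then have "subset.chain {B. place_graph B} CC" by (auto simp: subset_chain_def)
    then have "place_graph (\<Union>CC)" using CC(1) by (rule place_graph_Union)
    moreover obtain X where "X \<in> CC" using CC(1) by blast
    then have "B0 \<subseteq> \<Union>CC" using CC(2) unfolding subset_chain_def by blast
    ultimately show "\<Union>CC \<in> {B. place_graph B \<and> B0 \<subseteq> B}" by blast
  qed
  then obtain B where B: "B \<in> {B. place_graph B \<and> B0 \<subseteq> B}"
    and max: "\<forall>X\<in>{B. place_graph B \<and> B0 \<subseteq> B}. B \<subseteq> X \<longrightarrow> X = B" by (rule bexE)
  have "maximal_place B"
  proof
    show "place_graph B" using B by simp
    fix B' :: "('l \<times> 'k) set" assume B': "place_graph B'" "B \<subseteq> B'"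
    then have m: "B' \<in> {B. place_graph B \<and> B0 \<subseteq> B}" using B by blast
    show "B' = B" by (rule mp[OF bspec[OF max m] B'(2)])
  qed
  with B show thesis by (intro that) simp_all
qed

section \<open>Comparison of graded free resolutions\<close>

text \<open>Index 0 is neutral for addition of indices, so convolution with a vector concentrated
  there is scalar multiplication, and the ring laws of the convolution product apply to it.\<close>

definition sc :: "'r::comm_ring_1 \<Rightarrow> (nat \<Rightarrow>\<^sub>0 'r) \<Rightarrow> (nat \<Rightarrow>\<^sub>0 'r)" where
  "sc r u = Poly_Mapping.single 0 r * u"

lemma map_eq_sc: "Poly_Mapping.map (\<lambda>x. r * x) u = sc r u"
  unfolding sc_def by (rule mult_map_scale_conv_mult)

lemma sc_lookup [simp]: "Poly_Mapping.lookup (sc r u) b = r * Poly_Mapping.lookup u b"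
  unfolding map_eq_sc[symmetric] by (simp add: map.rep_eq when_def)

lemma sc_simps [simp]: "sc r (u + v) = sc r u + sc r v" "sc r 0 = 0" "sc 0 u = 0" "sc 1 u = u"
  "sc r (sc r' u) = sc (r * r') u" "sc (r + r') u = sc r u + sc r' u" "sc r (- u) = - sc r u"
  "sc r (u - v) = sc r u - sc r v" "sc r (Poly_Mapping.single b p) = Poly_Mapping.single b (r * p)"
  by (auto intro!: poly_mapping_eqI simp: lookup_add lookup_minus lookup_single when_def algebra_simps)

lemma sc_sum: "sc r (sum f A) = (\<Sum>x\<in>A. sc r (f x))"
  by (induction A rule: infinite_finite_induct) auto

lemma lin_ext_alt: "lin_ext D u = (\<Sum>b\<in>Poly_Mapping.keys u. sc (Poly_Mapping.lookup u b) (D b))"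
  by (simp add: lin_ext_def map_eq_sc)

lemma lin_ext_superset: "finite A \<Longrightarrow> Poly_Mapping.keys u \<subseteq> A \<Longrightarrow> lin_ext D u = (\<Sum>b\<in>A. sc (Poly_Mapping.lookup u b) (D b))"
  unfolding lin_ext_alt by (rule sum.mono_neutral_left) (auto simp: in_keys_iff)

lemma lin_ext_0 [simp]: "lin_ext D 0 = 0" by (simp add: lin_ext_alt)

lemma lin_ext_add: "lin_ext D (u + v) = lin_ext D u + lin_ext D v"
proof -
  let ?A = "Poly_Mapping.keys u \<union> Poly_Mapping.keys v"
  have "lin_ext D (u + v) = (\<Sum>b\<in>?A. sc (Poly_Mapping.lookup (u + v) b) (D b))"
    by (rule lin_ext_superset) (auto simp: keys_add)
  then show ?thesis
    by (simp add: lin_ext_superset[of ?A u] lin_ext_superset[of ?A v] lookup_add sum.distrib)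
qed

lemma lin_ext_sc: "lin_ext D (sc r u) = sc r (lin_ext D u)"
proof -
  have "lin_ext D (sc r u) = (\<Sum>b\<in>Poly_Mapping.keys u. sc (Poly_Mapping.lookup (sc r u) b) (D b))"
    by (rule lin_ext_superset) (auto simp: in_keys_iff)
  then show ?thesis by (simp add: lin_ext_alt sc_sum)
qed

lemma lin_ext_uminus: "lin_ext D (- u) = - lin_ext D u"
  using lin_ext_add[of D u "- u"] by (simp add: eq_neg_iff_add_eq_0 add.commute)

lemma lin_ext_diff: "lin_ext D (u - v) = lin_ext D u - lin_ext D v"
  using lin_ext_add[of D u "- v"] by (simp add: lin_ext_uminus)

lemma lin_ext_sum: "lin_ext D (sum f A) = (\<Sum>x\<in>A. lin_ext D (f x))"
  by (induction A rule: infinite_finite_induct) (auto simp: lin_ext_add)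

lemma lin_ext_single [simp]: "lin_ext D (Poly_Mapping.single b p) = sc p (D b)"
  by (cases "p = 0") (simp_all add: lin_ext_alt)

lemma lin_ext_comp: "lin_ext (\<lambda>b. lin_ext D (E b)) u = lin_ext D (lin_ext E u)"
  by (simp add: lin_ext_alt[of E] lin_ext_sum lin_ext_sc) (simp add: lin_ext_alt[of "\<lambda>b. lin_ext D (E b)"])

lemma lin_ext_minus_fun: "lin_ext (\<lambda>b. D b - E b) u = lin_ext D u - lin_ext E u"
  by (simp add: lin_ext_alt sum_subtractf)

lemma lin_ext_cong: "(\<And>b. b \<in> Poly_Mapping.keys u \<Longrightarrow> D b = E b) \<Longrightarrow> lin_ext D u = lin_ext E u"
  by (simp add: lin_ext_alt)

lemma lin_ext_unit [simp]: "lin_ext (\<lambda>b. Poly_Mapping.single b 1) u = u"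
  by (simp add: lin_ext_alt sum_singles)

lemma free_mod_simps [simp, intro]:
  "0 \<in> free_mod s B" "u \<in> free_mod s B \<Longrightarrow> v \<in> free_mod s B \<Longrightarrow> u + v \<in> free_mod s B"
  "u \<in> free_mod s B \<Longrightarrow> v \<in> free_mod s B \<Longrightarrow> u - v \<in> free_mod s B"
  "p \<in> polys_in (pvars s) \<Longrightarrow> u \<in> free_mod s B \<Longrightarrow> sc p u \<in> free_mod s B"
  for u v :: "nat \<Rightarrow>\<^sub>0 (var, 'k::field) mpoly"
proof -
  assume uv: "u \<in> free_mod s B" "v \<in> free_mod s B"
  show "u + v \<in> free_mod s B" using uv keys_add[of u v] unfolding free_mod_def by (auto simp: lookup_add)
  show "u - v \<in> free_mod s B" using uv keys_diff[of u v] unfolding free_mod_def by (auto simp: lookup_minus)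
next
  assume "p \<in> polys_in (pvars s)" "u \<in> free_mod s B"
  moreover have "Poly_Mapping.keys (sc p u) \<subseteq> Poly_Mapping.keys u" by (auto simp: in_keys_iff)
  ultimately show "sc p u \<in> free_mod s B" unfolding free_mod_def by auto
qed (auto simp: free_mod_def)

lemma free_mod_single [simp]: "b \<in> B \<Longrightarrow> p \<in> polys_in (pvars s) \<Longrightarrow> Poly_Mapping.single b p \<in> free_mod s B"
  for p :: "(var, 'k::field) mpoly"
  by (auto simp: free_mod_def lookup_single when_def)

lemma free_mod_sum: "(\<And>x. x \<in> A \<Longrightarrow> f x \<in> free_mod s B) \<Longrightarrow> sum f A \<in> free_mod s B"
  for f :: "_ \<Rightarrow> nat \<Rightarrow>\<^sub>0 (var, 'k::field) mpoly"
  by (induction A rule: infinite_finite_induct) auto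

lemma lin_ext_free_mod:
  "u \<in> free_mod s B \<Longrightarrow> (\<And>b. b \<in> B \<Longrightarrow> D b \<in> free_mod s B') \<Longrightarrow> lin_ext D u \<in> free_mod s B'"
  for u :: "nat \<Rightarrow>\<^sub>0 (var, 'k::field) mpoly"
  unfolding lin_ext_alt by (intro free_mod_sum free_mod_simps) (auto simp: free_mod_def)

definition mhom :: "(var \<Rightarrow> nat) \<Rightarrow> (nat \<Rightarrow> nat) \<Rightarrow> nat \<Rightarrow> (nat \<Rightarrow>\<^sub>0 (var, 'k::field) mpoly) \<Rightarrow> bool" where
  "mhom w bd j u \<longleftrightarrow> (\<forall>c\<in>Poly_Mapping.keys u. bd c \<le> j \<and> homog w (j - bd c) (Poly_Mapping.lookup u c))"

definition mcomp :: "(var \<Rightarrow> nat) \<Rightarrow> (nat \<Rightarrow> nat) \<Rightarrow> nat \<Rightarrow> (nat \<Rightarrow>\<^sub>0 (var, 'k::field) mpoly) \<Rightarrow> (nat \<Rightarrow>\<^sub>0 (var, 'k) mpoly)" where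
  "mcomp w bd j u = Poly_Mapping.mapp (\<lambda>c p. if bd c \<le> j then hcomp w (j - bd c) p else 0) u"

lemma mcomp_lookup: "Poly_Mapping.lookup (mcomp w bd j u) c = (if bd c \<le> j then hcomp w (j - bd c) (Poly_Mapping.lookup u c) else 0)"
  by (auto simp: mcomp_def lookup_mapp when_def in_keys_iff)

lemma mcomp_add: "mcomp w bd j (u + v) = mcomp w bd j u + mcomp w bd j v"
  by (rule poly_mapping_eqI) (simp add: mcomp_lookup lookup_add hcomp_add)

lemma mcomp_0 [simp]: "mcomp w bd j 0 = 0"
  by (rule poly_mapping_eqI) (simp add: mcomp_lookup)

lemma mcomp_sum: "mcomp w bd j (sum f A) = (\<Sum>x\<in>A. mcomp w bd j (f x))"
  by (induction A rule: infinite_finite_induct) (auto simp: mcomp_add)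

lemma mcomp_mhom: "mhom w bd j (mcomp w bd j u)"
  by (auto simp: mhom_def mcomp_lookup in_keys_iff hcomp_homog split: if_splits)

lemma mcomp_of_mhom: "mhom w bd j u \<Longrightarrow> mcomp w bd j u = u"
proof (rule poly_mapping_eqI)
  fix c assume u: "mhom w bd j u"
  show "Poly_Mapping.lookup (mcomp w bd j u) c = Poly_Mapping.lookup u c"
  proof (cases "c \<in> Poly_Mapping.keys u")
    case True
    then have "bd c \<le> j" "homog w (j - bd c) (Poly_Mapping.lookup u c)" using u by (auto simp: mhom_def)
    then show ?thesis using hcomp_of_homog[of w "j - bd c" "Poly_Mapping.lookup u c" "j - bd c"] by (simp add: mcomp_lookup)
  next
    case False then show ?thesis by (simp add: mcomp_lookup in_keys_iff)
  qed
qed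

lemma mcomp_free_mod: "u \<in> free_mod s B \<Longrightarrow> mcomp w bd j u \<in> free_mod s B"
proof -
  assume u: "u \<in> free_mod s B"
  have "Poly_Mapping.keys (mcomp w bd j u) \<subseteq> Poly_Mapping.keys u"
    by (auto simp: mcomp_lookup in_keys_iff split: if_splits)
  with u show ?thesis unfolding free_mod_def by (auto simp: mcomp_lookup intro: hcomp_polys_in)
qed


lemma mcomp_sc_mhom:
  assumes "mhom w bd e v"
  shows "mcomp w bd j (sc p v) = sc (if e \<le> j then hcomp w (j - e) p else 0) v"
proof (rule poly_mapping_eqI)
  fix c
  show "Poly_Mapping.lookup (mcomp w bd j (sc p v)) c = Poly_Mapping.lookup (sc (if e \<le> j then hcomp w (j - e) p else 0) v) c"
  proof (cases "c \<in> Poly_Mapping.keys v")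
    case True
    then have c: "bd c \<le> e" "homog w (e - bd c) (Poly_Mapping.lookup v c)" using assms by (auto simp: mhom_def)
    show ?thesis
    proof (cases "bd c \<le> j")
      case True
      then show ?thesis
        using hcomp_mult_homog[OF c(2), of "j - bd c" p] c(1) by (auto simp: mcomp_lookup mult.commute)
    next
      case False then show ?thesis using c(1) by (simp add: mcomp_lookup)
    qed
  next
    case False then show ?thesis by (simp add: mcomp_lookup in_keys_iff)
  qed
qed

lemma mcomp_lin_ext:
  assumes "\<And>b. b \<in> Poly_Mapping.keys u \<Longrightarrow> mhom w bd' (bd b) (D b)"
  shows "mcomp w bd' j (lin_ext D u) = lin_ext D (mcomp w bd j u)"
proof -
  have "lin_ext D (mcomp w bd j u) = (\<Sum>b\<in>Poly_Mapping.keys u. sc (Poly_Mapping.lookup (mcomp w bd j u) b) (D b))"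
    by (rule lin_ext_superset) (auto simp: mcomp_lookup in_keys_iff split: if_splits)
  then show ?thesis by (simp add: lin_ext_alt mcomp_sum mcomp_lookup mcomp_sc_mhom[OF assms])
qed

text \<open>Being homogeneous of degree \<open>j\<close> means being fixed by the projection to
  degree \<open>j\<close>, and that projection is additive.\<close>

lemma mhom_diff: "mhom w bd j u \<Longrightarrow> mhom w bd j v \<Longrightarrow> mhom w bd j (u - v)"
proof -
  assume u: "mhom w bd j u" and v: "mhom w bd j v"
  have "mcomp w bd j (u - v) + mcomp w bd j v = mcomp w bd j u"
    unfolding mcomp_add[symmetric] by simp
  then have "mcomp w bd j (u - v) = u - v" by (simp add: mcomp_of_mhom[OF u] mcomp_of_mhom[OF v] eq_diff_eq)
  then show ?thesis by (metis mcomp_mhom)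
qed

lemma mhom_lin_ext:
  assumes "mhom w bd j u" "\<And>b. b \<in> Poly_Mapping.keys u \<Longrightarrow> mhom w bd' (bd b) (D b)"
  shows "mhom w bd' j (lin_ext D u)"
proof -
  have "mcomp w bd' j (lin_ext D u) = lin_ext D (mcomp w bd j u)" by (rule mcomp_lin_ext[OF assms(2)])
  then have "mcomp w bd' j (lin_ext D u) = lin_ext D u" by (simp only: mcomp_of_mhom[OF assms(1)])
  then show ?thesis using mcomp_mhom[of w bd' j "lin_ext D u"] by (simp only:)
qed

lemma mhom_single: "mhom w bd (bd b) (Poly_Mapping.single b 1)"
  by (auto simp: mhom_def)

section \<open>Lifting of chain maps and homotopies between graded resolutions\<close>

locale graded_setup =
  fixes s :: nat and w :: "var \<Rightarrow> nat" and \<theta> :: "(var, 'k::field) mpoly \<Rightarrow> 'h::comm_ring_1"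
    and hc :: "nat \<Rightarrow> 'h \<Rightarrow> 'h"
  assumes \<theta>_simps [simp]: "\<theta> 1 = 1" "\<theta> (p + q) = \<theta> p + \<theta> q" "\<theta> (p * q) = \<theta> p * \<theta> q"
begin

lemma \<theta>_0 [simp]: "\<theta> 0 = 0" using \<theta>_simps(2)[of 0 0] by simp

definition eps :: "(nat \<Rightarrow> 'h) \<Rightarrow> (nat \<Rightarrow>\<^sub>0 (var, 'k) mpoly) \<Rightarrow> 'h" where
  "eps a u = (\<Sum>b\<in>Poly_Mapping.keys u. \<theta> (Poly_Mapping.lookup u b) * a b)"

lemma eps_superset: "finite A \<Longrightarrow> Poly_Mapping.keys u \<subseteq> A \<Longrightarrow> eps a u = (\<Sum>b\<in>A. \<theta> (Poly_Mapping.lookup u b) * a b)"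
  unfolding eps_def by (rule sum.mono_neutral_left) (auto simp: in_keys_iff)

lemma eps_0 [simp]: "eps a 0 = 0" by (simp add: eps_def)

lemma eps_add: "eps a (u + v) = eps a u + eps a v"
proof -
  let ?A = "Poly_Mapping.keys u \<union> Poly_Mapping.keys v"
  have "eps a (u + v) = (\<Sum>b\<in>?A. \<theta> (Poly_Mapping.lookup (u + v) b) * a b)"
    by (rule eps_superset) (auto simp: keys_add)
  then show ?thesis
    by (simp add: eps_superset[of ?A u] eps_superset[of ?A v] lookup_add sum.distrib distrib_right)
qed

lemma eps_diff: "eps a (u - v) = eps a u - eps a v"
  using eps_add[of a "u - v" v] by simp

lemma eps_sc: "eps a (sc r u) = \<theta> r * eps a u"
proof -
  have "eps a (sc r u) = (\<Sum>b\<in>Poly_Mapping.keys u. \<theta> (Poly_Mapping.lookup (sc r u) b) * a b)"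
    by (rule eps_superset) (auto simp: in_keys_iff)
  then show ?thesis by (simp add: eps_def sum_distrib_left mult.assoc)
qed

lemma eps_sum: "eps a (sum f A) = (\<Sum>x\<in>A. eps a (f x))"
  by (induction A rule: infinite_finite_induct) (auto simp: eps_add)

lemma eps_single [simp]: "eps a (Poly_Mapping.single b p) = \<theta> p * a b"
  by (cases "p = 0") (simp_all add: eps_def)

lemma eps_lin_ext: "eps a (lin_ext D u) = eps (\<lambda>b. eps a (D b)) u"
  by (simp add: lin_ext_alt eps_sum eps_sc) (simp add: eps_def)

text \<open>A graded free resolution of \<open>H\<close> whose augmentation sends the basis element
  \<open>b\<close> to \<open>a b\<close>. The grading of the target enters through compatibility of
  the augmentation with the projections \<open>hc j\<close>.\<close>

definition gres :: "'k resolution \<Rightarrow> (nat \<Rightarrow> 'h) \<Rightarrow> 'h set \<Rightarrow> bool" where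
  "gres F a H \<longleftrightarrow>
     (\<forall>i j. finite {b \<in> basis F i. bdeg F i b = j}) \<and>
     (\<forall>i. \<forall>b \<in> basis F (Suc i). diff F i b \<in> free_mod s (basis F i) \<and> mhom w (bdeg F i) (bdeg F (Suc i) b) (diff F i b)) \<and>
     (\<forall>u\<in>free_mod s (basis F 0). \<forall>j. eps a (mcomp w (bdeg F 0) j u) = hc j (eps a u)) \<and>
     eps a ` free_mod s (basis F 0) = H \<and>
     {u \<in> free_mod s (basis F 0). eps a u = 0} = lin_ext (diff F 0) ` free_mod s (basis F 1) \<and>
     (\<forall>i. {u \<in> free_mod s (basis F (Suc i)). lin_ext (diff F i) u = 0} =
        lin_ext (diff F (Suc i)) ` free_mod s (basis F (i + 2)))"

lemma gresD:
  assumes "gres F a H"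
  shows "finite {b \<in> basis F i. bdeg F i b = j}"
    "b \<in> basis F (Suc i) \<Longrightarrow> diff F i b \<in> free_mod s (basis F i)"
    "b \<in> basis F (Suc i) \<Longrightarrow> mhom w (bdeg F i) (bdeg F (Suc i) b) (diff F i b)"
    "u \<in> free_mod s (basis F 0) \<Longrightarrow> eps a (mcomp w (bdeg F 0) j u) = hc j (eps a u)"
    "eps a ` free_mod s (basis F 0) = H"
    "{u \<in> free_mod s (basis F 0). eps a u = 0} = lin_ext (diff F 0) ` free_mod s (basis F 1)"
    "{u \<in> free_mod s (basis F (Suc i)). lin_ext (diff F i) u = 0} =
        lin_ext (diff F (Suc i)) ` free_mod s (basis F (i + 2))"
  using assms unfolding gres_def by auto

text \<open>The augmentation plays the role of the differential out of step 0, which gives exactness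
  one form for all steps.\<close>

fun cyc :: "'k resolution \<Rightarrow> (nat \<Rightarrow> 'h) \<Rightarrow> nat \<Rightarrow> (nat \<Rightarrow>\<^sub>0 (var, 'k) mpoly) \<Rightarrow> bool" where
  "cyc F a 0 u \<longleftrightarrow> eps a u = 0"
| "cyc F a (Suc i) u \<longleftrightarrow> lin_ext (diff F i) u = 0"

abbreviation "fm F i \<equiv> free_mod s (basis F i)"

lemma exact: "gres F a H \<Longrightarrow> {u \<in> fm F i. cyc F a i u} = lin_ext (diff F i) ` fm F (Suc i)"
  using gresD(6)[of F a H] gresD(7)[of F a H "i - 1"] by (cases i) auto


lemma dF_cyc: "gres F a H \<Longrightarrow> u \<in> fm F (Suc i) \<Longrightarrow> cyc F a i (lin_ext (diff F i) u)"
  using exact[of F a H i] by auto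

lemma mcomp_dF:
  "gres F a H \<Longrightarrow> u \<in> fm F (Suc i) \<Longrightarrow> mcomp w (bdeg F i) j (lin_ext (diff F i) u) = lin_ext (diff F i) (mcomp w (bdeg F (Suc i)) j u)"
  by (rule mcomp_lin_ext) (auto simp: free_mod_def intro: gresD(3))

text \<open>The component of the right degree of any preimage is again a preimage, because the
  differentials commute with projection to a degree.\<close>

lemma homogeneous_preimage:
  assumes F: "gres F a H" and y: "y \<in> fm F i" "cyc F a i y" "mhom w (bdeg F i) j y"
  shows "\<exists>u\<in>fm F (Suc i). mhom w (bdeg F (Suc i)) j u \<and> lin_ext (diff F i) u = y"
proof -
  have "y \<in> {u \<in> fm F i. cyc F a i u}" using y by simp
  then have "y \<in> lin_ext (diff F i) ` fm F (Suc i)" unfolding exact[OF F] .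
  then obtain v where v: "v \<in> fm F (Suc i)" "lin_ext (diff F i) v = y" by (rule imageE) simp
  let ?u = "mcomp w (bdeg F (Suc i)) j v"
  have "lin_ext (diff F i) ?u = y" by (simp only: mcomp_dF[OF F v(1), symmetric] v mcomp_of_mhom[OF y(3)])
  then show ?thesis using mcomp_free_mod[OF v(1)] mcomp_mhom by (intro bexI[of _ ?u] conjI) simp_all
qed

definition gmap :: "'k resolution \<Rightarrow> nat \<Rightarrow> 'k resolution \<Rightarrow> nat \<Rightarrow> (nat \<Rightarrow> (nat \<Rightarrow>\<^sub>0 (var, 'k) mpoly)) \<Rightarrow> bool" where
  "gmap F i G k f \<longleftrightarrow> (\<forall>b\<in>basis F i. f b \<in> fm G k \<and> mhom w (bdeg G k) (bdeg F i b) (f b))"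

lemma gmap_mem: "gmap F i G k f \<Longrightarrow> u \<in> fm F i \<Longrightarrow> lin_ext f u \<in> fm G k"
  by (erule lin_ext_free_mod) (auto simp: gmap_def)

lemma gmap_mhom: "gmap F i G k f \<Longrightarrow> u \<in> fm F i \<Longrightarrow> mhom w (bdeg F i) j u \<Longrightarrow> mhom w (bdeg G k) j (lin_ext f u)"
  by (erule mhom_lin_ext) (auto simp: gmap_def free_mod_def)

lemma gmap_diff: "gres F a H \<Longrightarrow> gmap F (Suc i) F i (diff F i)"
  by (auto simp: gmap_def dest: gresD(2,3))

text \<open>The common step of lifting and homotopy: on a free module it suffices to choose
  homogeneous preimages of cycles for the basis elements.\<close>

lemma choice_lift:
  assumes F: "gres F a H"
    and y: "\<And>b. b \<in> basis G k \<Longrightarrow> y b \<in> fm F i \<and> cyc F a i (y b) \<and> mhom w (bdeg F i) (bdeg G k b) (y b)"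
  shows "\<exists>f. gmap G k F (Suc i) f \<and> (\<forall>u\<in>fm G k. lin_ext (diff F i) (lin_ext f u) = lin_ext y u)"
proof -
  have "\<forall>b\<in>basis G k. \<exists>u. u \<in> fm F (Suc i) \<and> mhom w (bdeg F (Suc i)) (bdeg G k b) u \<and> lin_ext (diff F i) u = y b"
  proof
    fix b assume "b \<in> basis G k"
    then have "y b \<in> fm F i" "cyc F a i (y b)" "mhom w (bdeg F i) (bdeg G k b) (y b)" using y by simp_all
    from homogeneous_preimage[OF F this]
    show "\<exists>u. u \<in> fm F (Suc i) \<and> mhom w (bdeg F (Suc i)) (bdeg G k b) u \<and> lin_ext (diff F i) u = y b" by blast
  qed
  from bchoice[OF this] obtain f where
    f: "\<And>b. b \<in> basis G k \<Longrightarrow> f b \<in> fm F (Suc i) \<and> mhom w (bdeg F (Suc i)) (bdeg G k b) (f b) \<and> lin_ext (diff F i) (f b) = y b"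
    by blast
  have "lin_ext (diff F i) (lin_ext f u) = lin_ext y u" if "u \<in> fm G k" for u
    unfolding lin_ext_comp[symmetric] by (rule lin_ext_cong) (use that f in \<open>auto simp: free_mod_def\<close>)
  then show ?thesis using f by (auto simp: gmap_def)
qed

definition chain_map :: "'k resolution \<Rightarrow> 'k resolution \<Rightarrow> (nat \<Rightarrow> nat \<Rightarrow> (nat \<Rightarrow>\<^sub>0 (var, 'k) mpoly)) \<Rightarrow> bool" where
  "chain_map G F \<phi> \<longleftrightarrow> (\<forall>i. gmap G i F i (\<phi> i)) \<and>
     (\<forall>i. \<forall>u\<in>fm G (Suc i). lin_ext (diff F i) (lin_ext (\<phi> (Suc i)) u) = lin_ext (\<phi> i) (lin_ext (diff G i) u))"

lemma lifting:
  assumes F: "gres F a H" and G: "gres G a' H"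
  shows "\<exists>\<phi>. chain_map G F \<phi> \<and> (\<forall>u\<in>fm G 0. eps a (lin_ext (\<phi> 0) u) = eps a' u)"
proof -
  \<comment> \<open>Sending cycles to cycles is part of the invariant; without it the next step
    could not apply exactness.\<close>
  define P where "P i \<phi> \<longleftrightarrow> gmap G i F i \<phi> \<and> (\<forall>u\<in>fm G i. cyc G a' i u \<longrightarrow> cyc F a i (lin_ext \<phi> u)) \<and>
     (i = 0 \<longrightarrow> (\<forall>u\<in>fm G 0. eps a (lin_ext \<phi> u) = eps a' u))" for i \<phi>
  define Q where "Q i \<phi> \<phi>' \<longleftrightarrow> (\<forall>u\<in>fm G (Suc i). lin_ext (diff F i) (lin_ext \<phi>' u) = lin_ext \<phi> (lin_ext (diff G i) u))" for i \<phi> \<phi>'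
  have base: "\<exists>\<phi>. P 0 \<phi>"
  proof -
    have "\<forall>b\<in>basis G 0. \<exists>u. u \<in> fm F 0 \<and> mhom w (bdeg F 0) (bdeg G 0 b) u \<and> eps a u = a' b"
    proof
      fix b assume b: "b \<in> basis G 0"
      have e: "Poly_Mapping.single b 1 \<in> fm G 0" using b by simp
      then have "eps a' (Poly_Mapping.single b 1) \<in> eps a ` fm F 0"
        unfolding gresD(5)[OF F] gresD(5)[OF G, symmetric] by (rule imageI)
      then obtain v where v: "v \<in> fm F 0" "a' b = eps a v" by (elim imageE) simp
      \<comment> \<open>The image of a basis element is homogeneous of the degree of that element,
        so a preimage may be replaced by its component in this degree.\<close>
      have "hc (bdeg G 0 b) (a' b) = a' b"
        using gresD(4)[OF G e, of "bdeg G 0 b"] by (simp add: mcomp_of_mhom[OF mhom_single])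
      then have "eps a (mcomp w (bdeg F 0) (bdeg G 0 b) v) = a' b" unfolding gresD(4)[OF F v(1)] v(2)[symmetric] .
      then show "\<exists>u. u \<in> fm F 0 \<and> mhom w (bdeg F 0) (bdeg G 0 b) u \<and> eps a u = a' b"
        using mcomp_free_mod[OF v(1)] mcomp_mhom by (intro exI[of _ "mcomp w (bdeg F 0) (bdeg G 0 b) v"] conjI)
    qed
    from bchoice[OF this] obtain \<phi> where \<phi>: "\<And>b. b \<in> basis G 0 \<Longrightarrow> \<phi> b \<in> fm F 0 \<and> mhom w (bdeg F 0) (bdeg G 0 b) (\<phi> b) \<and> eps a (\<phi> b) = a' b"
      by blast
    have "eps a (lin_ext \<phi> u) = eps a' u" if "u \<in> fm G 0" for u
      unfolding eps_lin_ext eps_def[of _ u] by (rule sum.cong) (use that \<phi> in \<open>auto simp: free_mod_def\<close>)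
    then have "P 0 \<phi>" using \<phi> by (auto simp: P_def gmap_def)
    then show ?thesis by (rule exI[of "P 0"])
  qed
  have step: "\<exists>\<phi>'. P (Suc i) \<phi>' \<and> Q i \<phi> \<phi>'" if P: "P i \<phi>" for i \<phi>
  proof -
    have g: "gmap G i F i \<phi>" and c: "\<And>u. u \<in> fm G i \<Longrightarrow> cyc G a' i u \<Longrightarrow> cyc F a i (lin_ext \<phi> u)" using P by (auto simp: P_def)
    have "\<exists>f. gmap G (Suc i) F (Suc i) f \<and> (\<forall>u\<in>fm G (Suc i). lin_ext (diff F i) (lin_ext f u) = lin_ext (\<lambda>b. lin_ext \<phi> (diff G i b)) u)"
    proof (rule choice_lift[OF F])
      fix b assume b: "b \<in> basis G (Suc i)"
      then have e: "Poly_Mapping.single b 1 \<in> fm G (Suc i)" by simp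
      have cy: "cyc G a' i (diff G i b)" using dF_cyc[OF G e] by simp
      have d: "diff G i b \<in> fm G i" using gresD(2)[OF G b] .
      show "lin_ext \<phi> (diff G i b) \<in> fm F i \<and> cyc F a i (lin_ext \<phi> (diff G i b)) \<and> mhom w (bdeg F i) (bdeg G (Suc i) b) (lin_ext \<phi> (diff G i b))"
        by (intro conjI gmap_mem[OF g d] c[OF d cy] gmap_mhom[OF g d gresD(3)[OF G b]])
    qed
    then obtain f where f: "gmap G (Suc i) F (Suc i) f" "Q i \<phi> f" by (auto simp: Q_def lin_ext_comp)
    then have "P (Suc i) f" by (auto simp: P_def Q_def)
    with f show ?thesis by blast
  qed
  obtain \<phi> where "\<And>i. P i (\<phi> i)" "\<And>i. Q i (\<phi> i) (\<phi> (Suc i))"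
    using dependent_nat_choice[of P Q, OF base step] by blast
  then have "chain_map G F \<phi>" "\<forall>u\<in>fm G 0. eps a (lin_ext (\<phi> 0) u) = eps a' u"
    by (auto simp: chain_map_def P_def Q_def)
  then show ?thesis by blast
qed

text \<open>The second summand of the homotopy formula, the homotopy after the differential; it is
  absent in step 0.\<close>

primrec hprev :: "'k resolution \<Rightarrow> (nat \<Rightarrow> nat \<Rightarrow> (nat \<Rightarrow>\<^sub>0 (var, 'k) mpoly)) \<Rightarrow> nat \<Rightarrow> (nat \<Rightarrow>\<^sub>0 (var, 'k) mpoly) \<Rightarrow> (nat \<Rightarrow>\<^sub>0 (var, 'k) mpoly)" where
  "hprev F h 0 u = 0"
| "hprev F h (Suc i) u = lin_ext (h i) (lin_ext (diff F i) u)"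

lemma null_homotopic:
  assumes F: "gres F a H" and G: "gres G a' H" and \<psi>: "chain_map G F \<psi>"
    and 0: "\<And>u. u \<in> fm G 0 \<Longrightarrow> eps a (lin_ext (\<psi> 0) u) = 0"
  shows "\<exists>h. (\<forall>i. gmap G i F (Suc i) (h i)) \<and>
     (\<forall>i. \<forall>u\<in>fm G i. lin_ext (diff F i) (lin_ext (h i) u) + hprev G h i u = lin_ext (\<psi> i) u)"
proof -
  have g\<psi>: "gmap G i F i (\<psi> i)" for i using \<psi> by (simp add: chain_map_def)
  have \<psi>c: "u \<in> fm G (Suc i) \<Longrightarrow> lin_ext (diff F i) (lin_ext (\<psi> (Suc i)) u) = lin_ext (\<psi> i) (lin_ext (diff G i) u)" for i u
    using \<psi> by (simp add: chain_map_def)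
  \<comment> \<open>On cycles the differential of \<open>h\<close> gives back \<psi>. This is what
    makes \<psi> minus \<open>h\<close> after the differential a cycle in the following
    step.\<close>
  define P where "P i h \<longleftrightarrow> gmap G i F (Suc i) h \<and>
     (\<forall>u\<in>fm G i. cyc G a' i u \<longrightarrow> lin_ext (diff F i) (lin_ext h u) = lin_ext (\<psi> i) u) \<and>
     (i = 0 \<longrightarrow> (\<forall>u\<in>fm G i. lin_ext (diff F i) (lin_ext h u) = lin_ext (\<psi> i) u))" for i h
  define Q where "Q i h h' \<longleftrightarrow> (\<forall>u\<in>fm G (Suc i). lin_ext (diff F (Suc i)) (lin_ext h' u) = lin_ext (\<psi> (Suc i)) u - lin_ext h (lin_ext (diff G i) u))" for i h h'
  have base: "\<exists>h. P 0 h"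
  proof -
    have "\<exists>f. gmap G 0 F (Suc 0) f \<and> (\<forall>u\<in>fm G 0. lin_ext (diff F 0) (lin_ext f u) = lin_ext (\<psi> 0) u)"
    proof (rule choice_lift[OF F])
      fix b assume b: "b \<in> basis G 0"
      then have e: "Poly_Mapping.single b 1 \<in> fm G 0" by simp
      show "\<psi> 0 b \<in> fm F 0 \<and> cyc F a 0 (\<psi> 0 b) \<and> mhom w (bdeg F 0) (bdeg G 0 b) (\<psi> 0 b)"
        using g\<psi>[of 0] 0[OF e] b by (auto simp: gmap_def)
    qed
    then show ?thesis by (auto simp: P_def)
  qed
  have step: "\<exists>h'. P (Suc i) h' \<and> Q i h h'" if P: "P i h" for i h
  proof -
    have g: "gmap G i F (Suc i) h" and c: "\<And>u. u \<in> fm G i \<Longrightarrow> cyc G a' i u \<Longrightarrow> lin_ext (diff F i) (lin_ext h u) = lin_ext (\<psi> i) u" using P by (auto simp: P_def)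
    let ?y = "\<lambda>b. \<psi> (Suc i) b - lin_ext h (diff G i b)"
    have "\<exists>f. gmap G (Suc i) F (Suc (Suc i)) f \<and> (\<forall>u\<in>fm G (Suc i). lin_ext (diff F (Suc i)) (lin_ext f u) = lin_ext ?y u)"
    proof (rule choice_lift[OF F])
      fix b assume b: "b \<in> basis G (Suc i)"
      then have e: "Poly_Mapping.single b 1 \<in> fm G (Suc i)" by simp
      have cy: "cyc G a' i (diff G i b)" using dF_cyc[OF G e] by simp
      have d: "diff G i b \<in> fm G i" using gresD(2)[OF G b] .
      have "lin_ext (diff F i) (?y b) = 0"
        using \<psi>c[OF e] c[OF d cy] by (simp add: lin_ext_diff)
      moreover have "?y b \<in> fm F (Suc i)" using g\<psi>[of "Suc i"] b gmap_mem[OF g d] by (auto simp: gmap_def)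
      moreover have "mhom w (bdeg F (Suc i)) (bdeg G (Suc i) b) (?y b)"
        using g\<psi>[of "Suc i"] b gmap_mhom[OF g d gresD(3)[OF G b]] by (auto simp: gmap_def intro: mhom_diff)
      ultimately show "?y b \<in> fm F (Suc i) \<and> cyc F a (Suc i) (?y b) \<and> mhom w (bdeg F (Suc i)) (bdeg G (Suc i) b) (?y b)" by simp
    qed
    then obtain f where f: "gmap G (Suc i) F (Suc (Suc i)) f" "Q i h f"
      by (auto simp: Q_def lin_ext_minus_fun lin_ext_comp)
    then have "P (Suc i) f" by (auto simp: P_def Q_def)
    with f show ?thesis by blast
  qed
  obtain h where h: "\<And>i. P i (h i)" "\<And>i. Q i (h i) (h (Suc i))"
    using dependent_nat_choice[of P Q, OF base step] by blast
  have "lin_ext (diff F i) (lin_ext (h i) u) + hprev G h i u = lin_ext (\<psi> i) u" if "u \<in> fm G i" for i u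
  proof (cases i)
    case 0 then show ?thesis using h(1)[of 0] that by (simp add: P_def)
  next
    case (Suc i') then show ?thesis using h(2)[of i'] that by (simp add: Q_def)
  qed
  moreover have "\<And>i. gmap G i F (Suc i) (h i)" using h(1) by (simp add: P_def)
  ultimately show ?thesis by blast
qed

lemma chain_map_comp_id:
  assumes F: "gres F a H" and f: "chain_map G F f" and g: "chain_map F G g"
  shows "chain_map F F (\<lambda>i b. lin_ext (f i) (g i b) - Poly_Mapping.single b 1)"
proof -
  have gf: "gmap G i F i (f i)" and gg: "gmap F i G i (g i)" for i using f g by (auto simp: chain_map_def)
  have "gmap F i F i (\<lambda>b. lin_ext (f i) (g i b) - Poly_Mapping.single b 1)" for i
    unfolding gmap_def
  proof (intro ballI conjI)
    fix b assume b: "b \<in> basis F i"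
    have gb: "g i b \<in> fm G i" "mhom w (bdeg G i) (bdeg F i b) (g i b)" using gg[of i] b by (auto simp: gmap_def)
    show "lin_ext (f i) (g i b) - Poly_Mapping.single b 1 \<in> fm F i" using gmap_mem[OF gf gb(1)] b by simp
    show "mhom w (bdeg F i) (bdeg F i b) (lin_ext (f i) (g i b) - Poly_Mapping.single b 1)"
      by (rule mhom_diff[OF gmap_mhom[OF gf gb] mhom_single])
  qed
  moreover have "lin_ext (diff F i) (lin_ext (\<lambda>b. lin_ext (f (Suc i)) (g (Suc i) b) - Poly_Mapping.single b 1) u) =
      lin_ext (\<lambda>b. lin_ext (f i) (g i b) - Poly_Mapping.single b 1) (lin_ext (diff F i) u)" if u: "u \<in> fm F (Suc i)" for i u
  proof -
    have "lin_ext (diff F i) (lin_ext (f (Suc i)) (lin_ext (g (Suc i)) u)) = lin_ext (f i) (lin_ext (diff G i) (lin_ext (g (Suc i)) u))"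
      using f gmap_mem[OF gg u] by (simp add: chain_map_def)
    also have "\<dots> = lin_ext (f i) (lin_ext (g i) (lin_ext (diff F i) u))" using g u by (simp add: chain_map_def)
    finally show ?thesis by (simp add: lin_ext_minus_fun lin_ext_comp lin_ext_diff)
  qed
  ultimately show ?thesis unfolding chain_map_def by blast
qed

lemma homotopy_inverse:
  assumes F: "gres F a H" and f: "chain_map G F f" and g: "chain_map F G g"
    and ef: "\<forall>u\<in>fm G 0. eps a (lin_ext (f 0) u) = eps a' u" and eg: "\<forall>u\<in>fm F 0. eps a' (lin_ext (g 0) u) = eps a u"
  shows "\<exists>h. (\<forall>i. gmap F i F (Suc i) (h i)) \<and>
     (\<forall>i. \<forall>u\<in>fm F i. lin_ext (diff F i) (lin_ext (h i) u) + hprev F h i u = lin_ext (f i) (lin_ext (g i) u) - u)"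
proof -
  have gg: "gmap F 0 G 0 (g 0)" using g by (auto simp: chain_map_def)
  have "\<exists>h. (\<forall>i. gmap F i F (Suc i) (h i)) \<and>
     (\<forall>i. \<forall>u\<in>fm F i. lin_ext (diff F i) (lin_ext (h i) u) + hprev F h i u = lin_ext (\<lambda>b. lin_ext (f i) (g i b) - Poly_Mapping.single b 1) u)"
    by (rule null_homotopic[OF F F chain_map_comp_id[OF F f g]])
      (use ef eg gmap_mem[OF gg] in \<open>simp add: lin_ext_minus_fun lin_ext_comp eps_diff\<close>)
  then show ?thesis by (simp add: lin_ext_minus_fun lin_ext_comp)
qed

end

section \<open>Tensoring with the residue field and Betti numbers\<close>

definition tens :: "(nat \<Rightarrow>\<^sub>0 (var, 'k::field) mpoly) \<Rightarrow> (nat \<Rightarrow>\<^sub>0 'k)" where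
  "tens u = Poly_Mapping.map const_term u"

definition untens :: "(nat \<Rightarrow>\<^sub>0 'k::field) \<Rightarrow> (nat \<Rightarrow>\<^sub>0 (var, 'k) mpoly)" where
  "untens z = Poly_Mapping.map const_poly z"

lemma const_term_ev: "const_term p = peval (\<lambda>_. 0) p" for p :: "('v, 'k::comm_ring_1) mpoly"
proof -
  have "mon (\<lambda>_. 0) m = (0 :: 'k)" if "m \<noteq> 0" for m :: "'v \<Rightarrow>\<^sub>0 nat"
  proof -
    have "Poly_Mapping.keys m \<noteq> {}" using that by simp
    then obtain v where v: "v \<in> Poly_Mapping.keys m" by blast
    then have "(0::'k) ^ Poly_Mapping.lookup m v = 0" by (simp add: in_keys_iff zero_power)
    then show ?thesis unfolding mon_def using v by (intro prod_zero) auto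
  qed
  then have "peval (\<lambda>_. 0) p = (\<Sum>m\<in>Poly_Mapping.keys p. if m = 0 then Poly_Mapping.lookup p 0 else 0)"
    unfolding peval_ev idh.ev_def by (intro sum.cong) auto
  then show ?thesis by (auto simp: const_term_def in_keys_iff)
qed

lemma const_term_simps [simp]: "const_term (p + q) = const_term p + const_term q" "const_term (p * q) = const_term p * const_term q"
   "const_term (0 :: ('v, 'k) mpoly) = 0" "const_term (const_poly c :: ('v, 'k) mpoly) = c"
   "const_term (1 :: ('v, 'k) mpoly) = 1"
  for p q :: "('v, 'k::comm_ring_1) mpoly"
  by (simp_all add: const_term_ev)

lemma const_poly_eq_0 [simp]: "const_poly c = 0 \<longleftrightarrow> c = 0"
  unfolding const_poly_def by (metis lookup_single_eq lookup_zero single_zero)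

lemma tens_lookup: "Poly_Mapping.lookup (tens u) b = const_term (Poly_Mapping.lookup u b)"
  by (simp add: tens_def map.rep_eq when_def)

lemma untens_lookup: "Poly_Mapping.lookup (untens z) b = const_poly (Poly_Mapping.lookup z b)"
  by (simp add: untens_def map.rep_eq when_def)

lemma keys_untens [simp]: "Poly_Mapping.keys (untens z) = Poly_Mapping.keys z"
  by (auto simp: in_keys_iff untens_lookup)

lemma tens_untens [simp]: "tens (untens z) = z"
  by (rule poly_mapping_eqI) (simp add: tens_lookup untens_lookup)

lemma tens_add: "tens (u + v) = tens u + tens v"
  by (rule poly_mapping_eqI) (simp add: tens_lookup lookup_add)

lemma tens_diff: "tens (u - v) = tens u - tens v"
  using tens_add[of "u - v" v] by simp

lemma tens_0 [simp]: "tens 0 = 0"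
  by (rule poly_mapping_eqI) (simp add: tens_lookup)

lemma tens_sum: "tens (sum f A) = (\<Sum>x\<in>A. tens (f x))"
  by (induction A rule: infinite_finite_induct) (auto simp: tens_add)

lemma tens_sc: "tens (sc p u) = sc (const_term p) (tens u)"
  by (rule poly_mapping_eqI) (simp add: tens_lookup)

lemma tens_lin_ext: "tens (lin_ext D u) = lin_ext (\<lambda>b. tens (D b)) (tens u)"
proof -
  have "lin_ext (\<lambda>b. tens (D b)) (tens u) = (\<Sum>b\<in>Poly_Mapping.keys u. sc (Poly_Mapping.lookup (tens u) b) (tens (D b)))"
    by (rule lin_ext_superset) (auto simp: tens_lookup in_keys_iff)
  then show ?thesis by (simp add: lin_ext_alt[of D] tens_sum tens_sc tens_lookup)
qed

lemma tensor_diff_alt: "tensor_diff F i = lin_ext (\<lambda>b. tens (diff F i b))"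
  by (simp add: tensor_diff_def tens_def fun_eq_iff)

lemma vector_space_sc: "vector_space (sc :: 'k::field \<Rightarrow> _)"
  by unfold_locales simp_all

interpretation VT: vector_space "sc :: 'k::field \<Rightarrow> _" by (rule vector_space_sc)
interpretation VTT: vector_space_pair "sc :: 'k::field \<Rightarrow> _" "sc :: 'k \<Rightarrow> _" ..

lemma tensor_homology_dim_alt:
  "tensor_homology_dim F i j = int (VT.dim (tensor_cycles F i j)) - int (VT.dim (tensor_boundaries F i j))"
proof -
  have "(\<lambda>c :: 'a. Poly_Mapping.map (\<lambda>r. c * r)) = sc" by (simp add: fun_eq_iff map_eq_sc)
  then show ?thesis by (simp add: tensor_homology_dim_def)
qed

definition supp_in :: "nat set \<Rightarrow> (nat \<Rightarrow>\<^sub>0 'k::field) set" where "supp_in B = {z. Poly_Mapping.keys z \<subseteq> B}"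

lemma supp_in_subspace: "VT.subspace (supp_in B :: (nat \<Rightarrow>\<^sub>0 'k::field) set)"
  unfolding VT.subspace_def supp_in_def
proof (intro conjI ballI allI)
  fix x y :: "nat \<Rightarrow>\<^sub>0 'k" assume "x \<in> {z. Poly_Mapping.keys z \<subseteq> B}" "y \<in> {z. Poly_Mapping.keys z \<subseteq> B}"
  then show "x + y \<in> {z. Poly_Mapping.keys z \<subseteq> B}" using keys_add[of x y] by blast
qed (auto simp: in_keys_iff)

lemma supp_in_span: "supp_in B = VT.span ((\<lambda>b. Poly_Mapping.single b 1) ` B)"
proof
  show "supp_in B \<subseteq> VT.span ((\<lambda>b. Poly_Mapping.single b 1) ` B)"
  proof
    fix z :: "nat \<Rightarrow>\<^sub>0 'b" assume "z \<in> supp_in B"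
    then have "(\<Sum>b\<in>Poly_Mapping.keys z. sc (Poly_Mapping.lookup z b) (Poly_Mapping.single b 1)) \<in> VT.span ((\<lambda>b. Poly_Mapping.single b 1) ` B)"
      by (intro VT.span_sum VT.span_scale VT.span_base) (auto simp: supp_in_def)
    then show "z \<in> VT.span ((\<lambda>b. Poly_Mapping.single b 1) ` B)" by (simp add: sum_singles)
  qed
  show "VT.span ((\<lambda>b. Poly_Mapping.single b 1) ` B) \<subseteq> supp_in B"
    by (rule VT.span_minimal[OF _ supp_in_subspace]) (auto simp: supp_in_def)
qed

lemma supp_in_dim: assumes "finite B" shows "VT.dim (supp_in B :: (nat \<Rightarrow>\<^sub>0 'k::field) set) = card B"
proof -
  let ?e = "\<lambda>b. Poly_Mapping.single b (1::'k)"
  have inj: "inj_on ?e B" by (rule inj_onI) (metis keys_single singleton_inject zero_neq_one)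
  have "VT.independent (?e ` B)"
  proof (rule VT.independent_if_scalars_zero)
    fix c x assume c: "(\<Sum>x\<in>?e ` B. sc (c x) x) = 0" and x: "x \<in> ?e ` B"
    obtain b where b: "b \<in> B" "x = ?e b" using x by blast
    have "0 = Poly_Mapping.lookup (\<Sum>x\<in>?e ` B. sc (c x) x) b" by (simp add: c)
    also have "\<dots> = (\<Sum>b'\<in>B. if b' = b then c (?e b') else 0)"
      by (simp add: sum.reindex[OF inj] lookup_sum lookup_single when_def)
    also have "\<dots> = c x" using b assms by simp
    finally show "c x = 0" by simp
  qed (use assms in simp)
  then have "VT.dim (VT.span (?e ` B)) = card (?e ` B)" by (rule VT.dim_span_eq_card_independent)
  then show ?thesis by (simp only: supp_in_span card_image[OF inj])
qed

context graded_setup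
begin

definition pc :: "'k resolution \<Rightarrow> nat \<Rightarrow> nat \<Rightarrow> nat set" where "pc F i j = {b \<in> basis F i. bdeg F i b = j}"

lemma tensor_piece_alt: "tensor_piece F i j = supp_in (pc F i j)"
  by (simp add: tensor_piece_def supp_in_def pc_def)

definition tmap :: "(nat \<Rightarrow> (nat \<Rightarrow>\<^sub>0 (var, 'k) mpoly)) \<Rightarrow> (nat \<Rightarrow>\<^sub>0 'k) \<Rightarrow> (nat \<Rightarrow>\<^sub>0 'k)" where
  "tmap f = lin_ext (\<lambda>b. tens (f b))"

lemma tmap_alt: "tmap f z = tens (lin_ext f (untens z))"
  by (simp add: tmap_def tens_lin_ext)

lemma tmap_tens: "tmap f (tens u) = tens (lin_ext f u)"
  by (simp add: tmap_def tens_lin_ext)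

lemma untens_fm: "z \<in> supp_in (pc F i j) \<Longrightarrow> untens z \<in> fm F i"
  by (auto simp: free_mod_def supp_in_def pc_def untens_lookup)

text \<open>A matrix entry keeps a constant term only if its degree is 0, that is, if it connects
  basis elements of equal degree.\<close>

lemma tmap_piece:
  assumes f: "gmap G i F k f" and z: "z \<in> supp_in (pc G i j)"
  shows "tmap f z \<in> supp_in (pc F k j)"
proof -
  have u: "untens z \<in> fm G i" by (rule untens_fm[OF z])
  have "mhom w (bdeg G i) j (untens z)"
    using z by (auto simp: mhom_def supp_in_def pc_def untens_lookup)
  then have m: "mhom w (bdeg F k) j (lin_ext f (untens z))" by (rule gmap_mhom[OF f u])
  have fr: "lin_ext f (untens z) \<in> fm F k" by (rule gmap_mem[OF f u])
  have "c \<in> pc F k j" if c: "c \<in> Poly_Mapping.keys (tmap f z)" for c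
  proof -
    let ?p = "Poly_Mapping.lookup (lin_ext f (untens z)) c"
    have p: "const_term ?p \<noteq> 0" using c by (simp add: in_keys_iff tmap_alt tens_lookup)
    then have "?p \<noteq> 0" by auto
    then have ck: "c \<in> Poly_Mapping.keys (lin_ext f (untens z))" by (simp add: in_keys_iff)
    then have h: "bdeg F k c \<le> j" "homog w (j - bdeg F k c) ?p" using m by (auto simp: mhom_def)
    have "0 \<in> Poly_Mapping.keys ?p" using p by (simp add: const_term_def in_keys_iff)
    then have "j - bdeg F k c = 0" using h(2) unfolding homog_def by (metis wdeg_0)
    then show ?thesis using h(1) ck fr by (auto simp: pc_def free_mod_def)
  qed
  then show ?thesis by (auto simp: supp_in_def)
qed

lemma tmap_linear: "Vector_Spaces.linear sc sc (tmap f)"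
  by unfold_locales (simp_all add: tmap_def lin_ext_add lin_ext_sc)

lemma tensor_diff_tmap: "tensor_diff F i = tmap (diff F i)"
  by (simp add: tensor_diff_alt tmap_def)

lemma tmap_0 [simp]: "tmap f 0 = 0" by (simp add: tmap_def)

definition tcyc :: "'k resolution \<Rightarrow> nat \<Rightarrow> (nat \<Rightarrow>\<^sub>0 'k) \<Rightarrow> bool" where
  "tcyc F i z \<longleftrightarrow> (case i of 0 \<Rightarrow> True | Suc i' \<Rightarrow> tmap (diff F i') z = 0)"

lemma tensor_cycles_alt: "tensor_cycles F i j = {z \<in> supp_in (pc F i j). tcyc F i z}"
  by (cases i) (simp_all add: tensor_cycles_def tcyc_def tensor_piece_alt tensor_diff_tmap)

lemma tensor_boundaries_alt: "tensor_boundaries F i j = tmap (diff F i) ` supp_in (pc F (Suc i) j)"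
  by (simp add: tensor_boundaries_def tensor_piece_alt tensor_diff_tmap)

lemma chain_map_tmap:
  assumes "chain_map G F f" "z \<in> supp_in (pc G (Suc i) j)"
  shows "tmap (diff F i) (tmap (f (Suc i)) z) = tmap (f i) (tmap (diff G i) z)"
  using assms untens_fm[OF assms(2)] by (simp add: tmap_alt[of _ z] tmap_tens chain_map_def)

lemma diff_squared:
  assumes F: "gres F a H" and z: "z \<in> supp_in (pc F (Suc i) j)"
  shows "tcyc F i (tmap (diff F i) z)"
proof (cases i)
  case (Suc i')
  then have "lin_ext (diff F i') (lin_ext (diff F i) (untens z)) = 0" using dF_cyc[OF F untens_fm[OF z]] by simp
  then show ?thesis using Suc by (simp add: tcyc_def tmap_alt[of "diff F (Suc i')" z] tmap_tens)
qed (simp add: tcyc_def)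

text \<open>On a cycle of the tensored complex the summand containing the previous differential
  dies, leaving a boundary.\<close>

lemma homotopy_tmap:
  assumes h: "\<forall>u\<in>fm F i. lin_ext (diff F i) (lin_ext (h i) u) + hprev F h i u = lin_ext (f i) (lin_ext (g i) u) - u"
    and z: "z \<in> supp_in (pc F i j)" "tcyc F i z"
  shows "tmap (diff F i) (tmap (h i) z) = tmap (f i) (tmap (g i) z) - z"
proof -
  have "tens (hprev F h i (untens z)) = 0"
  proof (cases i)
    case (Suc i')
    then show ?thesis using z(2) tmap_tens[of "h i'" "lin_ext (diff F i') (untens z)"]
      by (simp add: tcyc_def tmap_alt[of "diff F i'" z])
  qed simp
  moreover have "tens (lin_ext (diff F i) (lin_ext (h i) (untens z)) + hprev F h i (untens z)) =
      tens (lin_ext (f i) (lin_ext (g i) (untens z)) - untens z)"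
    using h untens_fm[OF z(1)] by simp
  ultimately show ?thesis by (simp add: tens_add tens_diff tmap_alt[of _ z] tmap_tens)
qed

text \<open>After tensoring, the minimal resolution \<open>G\<close> has zero differentials. The
  comparison map from the cycles of \<open>F\<close> to the piece of \<open>G\<close> therefore
  kills boundaries; the homotopy on \<open>F\<close> shows that it kills nothing else, the homotopy
  on \<open>G\<close> that it is onto. Rank and nullity give the dimension.\<close>

theorem tensor_homology_eq:
  assumes F: "gres F a H" and G: "gres G a' H"
    and min: "\<And>i b c. b \<in> basis G (Suc i) \<Longrightarrow> const_term (Poly_Mapping.lookup (diff G i b) c) = 0"
  shows "tensor_homology_dim F i j = int (card (pc G i j))"
proof -
  obtain f where f: "chain_map G F f" "\<forall>u\<in>fm G 0. eps a (lin_ext (f 0) u) = eps a' u" using lifting[OF F G] by blast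
  obtain g where g: "chain_map F G g" "\<forall>u\<in>fm F 0. eps a' (lin_ext (g 0) u) = eps a u" using lifting[OF G F] by blast
  obtain h where h: "\<And>i. gmap F i F (Suc i) (h i)"
    "\<And>i. \<forall>u\<in>fm F i. lin_ext (diff F i) (lin_ext (h i) u) + hprev F h i u = lin_ext (f i) (lin_ext (g i) u) - u"
    using homotopy_inverse[OF F f(1) g(1) f(2) g(2)] by blast
  obtain h' where h': "\<And>i. gmap G i G (Suc i) (h' i)"
    "\<And>i. \<forall>u\<in>fm G i. lin_ext (diff G i) (lin_ext (h' i) u) + hprev G h' i u = lin_ext (g i) (lin_ext (f i) u) - u"
    using homotopy_inverse[OF G g(1) f(1) g(2) f(2)] by blast
  have gf: "gmap G i F i (f i)" and gg: "gmap F i G i (g i)" for i using f g by (auto simp: chain_map_def)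
  have zero: "tmap (diff G i) z = 0" if z: "z \<in> supp_in (pc G (Suc i) j)" for z i
  proof -
    have "tens (diff G i b) = 0" if "b \<in> basis G (Suc i)" for b
      by (rule poly_mapping_eqI) (simp add: tens_lookup min[OF that])
    then have "lin_ext (\<lambda>b. tens (diff G i b)) z = lin_ext (\<lambda>b. 0) z"
      using z by (intro lin_ext_cong) (auto simp: supp_in_def pc_def)
    then show ?thesis by (simp add: tmap_def lin_ext_alt)
  qed
  have cycG: "tcyc G i z" if "z \<in> supp_in (pc G i j)" for z
    using zero that by (cases i) (auto simp: tcyc_def)
  let ?Z = "tensor_cycles F i j"
  have Zsub: "VT.subspace ?Z"
  proof -
    have "VT.subspace {z. tcyc F i z}"
      by (cases i) (auto simp: tcyc_def VT.subspace_def tmap_def lin_ext_add lin_ext_sc)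
    moreover have "?Z = supp_in (pc F i j) \<inter> {z. tcyc F i z}" by (auto simp: tensor_cycles_alt)
    ultimately show ?thesis using VT.subspace_inter[OF supp_in_subspace] by metis
  qed
  have fin: "finite (pc F i j)" "finite (pc G i j)" using gresD(1)[OF F] gresD(1)[OF G] by (simp_all add: pc_def)
  have span: "?Z \<subseteq> VT.span ((\<lambda>b. Poly_Mapping.single b 1) ` pc F i j)"
    by (auto simp: tensor_cycles_alt supp_in_span)
  have "VT.dim ?Z = VT.dim {z \<in> ?Z. tmap (g i) z = 0} + VT.dim (tmap (g i) ` ?Z)"
    by (rule VTT.rank_nullity[OF tmap_linear Zsub finite_imageI[OF fin(1)] span])
  moreover have "{z \<in> ?Z. tmap (g i) z = 0} = tensor_boundaries F i j"
  proof (intro equalityI subsetI)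
    fix z assume "z \<in> {z \<in> ?Z. tmap (g i) z = 0}"
    then have z: "z \<in> supp_in (pc F i j)" "tcyc F i z" "tmap (g i) z = 0" by (auto simp: tensor_cycles_alt)
    have "tmap (diff F i) (tmap (h i) z) = - z" using homotopy_tmap[where F = F and i = i and h = h and f = f and g = g, OF h(2) z(1,2)] z(3) by simp
    then have "z = tmap (diff F i) (- tmap (h i) z)" by (simp add: tmap_def lin_ext_uminus)
    moreover have "- tmap (h i) z \<in> supp_in (pc F (Suc i) j)"
      using VT.subspace_neg[OF supp_in_subspace tmap_piece[OF h(1) z(1)]] .
    ultimately show "z \<in> tensor_boundaries F i j" unfolding tensor_boundaries_alt by blast
  next
    fix z assume "z \<in> tensor_boundaries F i j"
    then obtain y where y: "y \<in> supp_in (pc F (Suc i) j)" "z = tmap (diff F i) y" by (auto simp: tensor_boundaries_alt)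
    have "tmap (g i) z = tmap (diff G i) (tmap (g (Suc i)) y)" using chain_map_tmap[OF g(1) y(1)] y(2) by simp
    also have "\<dots> = 0" by (rule zero[OF tmap_piece[OF gg y(1)]])
    finally show "z \<in> {z \<in> ?Z. tmap (g i) z = 0}"
      using diff_squared[OF F y(1)] tmap_piece[OF gmap_diff[OF F] y(1)] y(2) by (auto simp: tensor_cycles_alt)
  qed
  moreover have "tmap (g i) ` ?Z = supp_in (pc G i j)"
  proof (intro equalityI subsetI)
    fix y assume "y \<in> tmap (g i) ` ?Z"
    then show "y \<in> supp_in (pc G i j)" using tmap_piece[OF gg] by (auto simp: tensor_cycles_alt)
  next
    fix y :: "nat \<Rightarrow>\<^sub>0 'k" assume y: "y \<in> supp_in (pc G i j)"
    have "tmap (g i) (tmap (f i) y) - y = tmap (diff G i) (tmap (h' i) y)"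
      using homotopy_tmap[where F = G and i = i and h = h' and f = g and g = f, OF h'(2) y cycG[OF y]] by simp
    also have "\<dots> = 0" by (rule zero[OF tmap_piece[OF h'(1) y]])
    finally have "y = tmap (g i) (tmap (f i) y)" by simp
    moreover have "tcyc F i (tmap (f i) y)"
    proof (cases i)
      case (Suc i')
      then show ?thesis using chain_map_tmap[OF f(1), of y i' j] zero[of y i'] y by (simp add: tcyc_def)
    qed (simp add: tcyc_def)
    then have "tmap (f i) y \<in> ?Z" using tmap_piece[OF gf y] by (simp add: tensor_cycles_alt)
    ultimately show "y \<in> tmap (g i) ` ?Z" by (rule image_eqI)
  qed
  ultimately show ?thesis using supp_in_dim[OF fin(2), where 'k = 'k] by (simp add: tensor_homology_dim_alt)
qed

end

section \<open>Laurent expansions and global functions\<close>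

abbreviation (input) "fl \<equiv> fps_to_fls"

interpretation flsh: scalar_hom "fls_const :: 'k::comm_ring_1 \<Rightarrow> 'k fls"
  by unfold_locales (simp_all add: fls_plus_const)

lemma fl_mult: "fl (f * g) = fl f * fl g" for f g :: "'k::field fps"
  by (simp add: fls_times_fps_to_fls)

lemma fl_prod: "fl (prod f A) = (\<Prod>x\<in>A. fl (f x))" for f :: "_ \<Rightarrow> 'k::field fps"
  by (induction A rule: infinite_finite_induct) (simp_all add: fl_mult)

lemma fl_sum: "fl (sum f A) = (\<Sum>x\<in>A. fl (f x))" for f :: "_ \<Rightarrow> 'k::field fps"
  by (induction A rule: infinite_finite_induct) simp_all

context smooth_point
begin

text \<open>Numerator and denominator have equal degree, so dehomogenizing both by the same
  coordinate does not change the fraction. Denominators vanishing at \<open>P\<close> are inverted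
  among Laurent series.\<close>

definition \<Phi> :: "'k ratfun \<Rightarrow> 'k fls" where
  "\<Phi> f = (SOME v. \<exists>F G. (F, G) \<in> fr \<and> f = cl F G \<and> v = fl (EV F) / fl (EV G))"

lemma EV_nz: "(F, G) \<in> fr \<Longrightarrow> EV G \<noteq> 0"
  by (metis EV_injective frE)

lemma \<Phi>_cl: assumes "(F, G) \<in> fr" shows "\<Phi> (cl F G) = fl (EV F) / fl (EV G)"
  unfolding \<Phi>_def
proof (rule some_equality)
  show "\<exists>F' G'. (F', G') \<in> fr \<and> cl F G = cl F' G' \<and> fl (EV F) / fl (EV G) = fl (EV F') / fl (EV G')"
    using assms by blast
  fix v assume "\<exists>F' G'. (F', G') \<in> fr \<and> cl F G = cl F' G' \<and> v = fl (EV F') / fl (EV G')"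
  then obtain F' G' where *: "(F', G') \<in> fr" "cl F G = cl F' G'" "v = fl (EV F') / fl (EV G')" by blast
  obtain e where e: "F \<in> forms n e" "G \<in> forms n e" "G \<notin> I" using assms by (rule frE)
  obtain e' where e': "F' \<in> forms n e'" "G' \<in> forms n e'" "G' \<notin> I" using *(1) by (rule frE)
  have "F * G' - F' * G \<in> forms n (e + e')" using e e' by (intro forms_simps(3) forms_simps(5) forms_mult_comm)
  moreover have "F * G' - F' * G \<in> I" using cl_eq[OF assms *(1)] *(2) by simp
  ultimately have "EV (F * G' - F' * G) = 0" by (rule EV_I)
  then have "EV F * EV G' = EV F' * EV G" by simp
  then have "fl (EV F) * fl (EV G') = fl (EV F') * fl (EV G)" by (simp flip: fl_mult)
  then show "v = fl (EV F) / fl (EV G)"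
    using EV_nz[OF assms] EV_nz[OF *(1)] *(3) by (simp add: frac_eq_eq)
qed

lemma \<Phi>_add: "a \<in> carrier K \<Longrightarrow> b \<in> carrier K \<Longrightarrow> \<Phi> (a [+] b) = \<Phi> a + \<Phi> b"
  by (elim carrierE) (simp add: add_cl \<Phi>_cl fr_add fl_mult add_frac_eq EV_nz)

lemma \<Phi>_mult: "a \<in> carrier K \<Longrightarrow> b \<in> carrier K \<Longrightarrow> \<Phi> (a [*] b) = \<Phi> a * \<Phi> b"
  by (elim carrierE) (simp add: mult_cl \<Phi>_cl fr_mult fl_mult)

lemma \<Phi>_cf [simp]: "\<Phi> (cf c) = fls_const c"
  unfolding const_fun_def by (simp add: \<Phi>_cl fr_const)

lemma \<Phi>_01 [simp]: "\<Phi> \<zero>\<^bsub>K\<^esub> = 0" "\<Phi> \<one>\<^bsub>K\<^esub> = 1"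
  using \<Phi>_cf[of 0] \<Phi>_cf[of 1] by simp_all

lemma \<Phi>_inj: "a \<in> carrier K \<Longrightarrow> b \<in> carrier K \<Longrightarrow> \<Phi> a = \<Phi> b \<Longrightarrow> a = b"
proof (elim carrierE)
  fix F G F' G' assume *: "\<Phi> a = \<Phi> b" "(F, G) \<in> fr" "a = cl F G" "(F', G') \<in> fr" "b = cl F' G'"
  obtain e where e: "F \<in> forms n e" "G \<in> forms n e" "G \<notin> I" using *(2) by (rule frE)
  obtain e' where e': "F' \<in> forms n e'" "G' \<in> forms n e'" "G' \<notin> I" using *(4) by (rule frE)
  have "fl (EV F) / fl (EV G) = fl (EV F') / fl (EV G')" using * by (simp add: \<Phi>_cl)
  then have "fl (EV F) * fl (EV G') = fl (EV F') * fl (EV G)" using EV_nz[OF *(2)] EV_nz[OF *(4)] by (simp add: frac_eq_eq)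
  then have "EV F * EV G' = EV F' * EV G" by (simp flip: fl_mult)
  then have "EV (F * G' - F' * G) = 0" by simp
  moreover have "F * G' - F' * G \<in> forms n (e + e')" using e e' by (intro forms_simps(3) forms_simps(5) forms_mult_comm)
  ultimately have "F * G' - F' * G \<in> I" using EV_injective by blast
  then show "a = b" using cl_eq[OF *(2,4)] *(3,5) by simp
qed

lemma \<Phi>_eq_0: "a \<in> carrier K \<Longrightarrow> \<Phi> a = 0 \<longleftrightarrow> a = \<zero>\<^bsub>K\<^esub>"
  using \<Phi>_inj[of a "\<zero>\<^bsub>K\<^esub>"] by auto

lemma \<Phi>_Nf: "F \<in> forms n e \<Longrightarrow> \<Phi> (Nf e F) = fl (EV F)"
  unfolding Nf_def by (simp add: \<Phi>_cl Nf_fr EV_xj)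

text \<open>Multiplying by the denominator turns both sides into the expansion of the numerator.
  This connects \<open>ex\<close>, which sees divisibility by \<open>t\<close>, with the expansion
  defined on the whole field.\<close>

lemma \<Phi>_R: assumes "a \<in> R" shows "\<Phi> a = fl (ex a)"
proof -
  obtain F G where f: "(F, G) \<in> fr" "peval P G \<noteq> 0" "a = cl F G" using assms by (rule OQE)
  obtain e where e: "F \<in> forms n e" "G \<in> forms n e" "G \<notin> I" using f(1) by (rule frE)
  have "\<Phi> (a [*] Nf e G) = \<Phi> (Nf e F)"
    using assms EV_nz[OF f(1)] by (simp add: \<Phi>_mult Nf_R e f(3) \<Phi>_cl f(1) \<Phi>_Nf)
  then have eq: "a [*] Nf e G = Nf e F" by (rule \<Phi>_inj[rotated 2]) (use assms e in \<open>simp_all add: Nf_R\<close>)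
  then have "ex a * EV G = EV F" using ex_mult[OF assms Nf_R[OF e(2)]] EV_Nf e by simp
  then have "fl (ex a) * fl (EV G) = fl (EV F)" by (simp flip: fl_mult)
  then show ?thesis using EV_nz[OF f(1)] by (simp add: f(3) \<Phi>_cl[OF f(1)] nonzero_eq_divide_eq divide_eq_eq)
qed

lemma ex_nz: "a \<in> R \<Longrightarrow> a \<noteq> \<zero>\<^bsub>K\<^esub> \<Longrightarrow> ex a \<noteq> 0"
  using \<Phi>_R[of a] \<Phi>_eq_0[of a] by auto

lemma tR_iff: assumes "a \<in> R" "a \<noteq> \<zero>\<^bsub>K\<^esub>" shows "a \<in> tR r \<longleftrightarrow> r \<le> subdegree (ex a)"
proof
  assume "a \<in> tR r"
  then obtain x where x: "a = tpow r [*] x" "x \<in> R" by (auto simp: tR_def)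
  then have "ex a = fps_X ^ r * ex x" by (simp add: ex_mult tpow_R ex_tpow)
  then show "r \<le> subdegree (ex a)" using ex_nz[OF assms]
    by (intro subdegree_geI) (auto simp: fps_X_power_mult_nth)
next
  assume "r \<le> subdegree (ex a)"
  then have "\<forall>i<r. fps_nth (ex a) i = 0" by (auto intro: nth_less_subdegree_zero)
  then show "a \<in> tR r" using ex_low[OF assms(1)] unfolding tR_def by blast
qed

text \<open>\<open>local_ord\<close> looks for the least \<open>r\<close> such that the power
  \<open>r + 1\<close> of the maximal ideal misses \<open>a\<close>, and membership in the power
  \<open>r\<close> means subdegree at least \<open>r\<close>.\<close>

lemma local_ord_eq: assumes "a \<in> R" "a \<noteq> \<zero>\<^bsub>K\<^esub>" shows "local_ord n C P a = subdegree (ex a)"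
  unfolding local_ord_def max_power_eq tR_iff[OF assms]
  by (rule Least_equality) auto

lemma fraction_R: assumes "f \<in> carrier K"
  obtains a b where "a \<in> R" "b \<in> R" "b \<noteq> \<zero>\<^bsub>K\<^esub>" "f [*] b = a"
proof -
  obtain F G where f: "(F, G) \<in> fr" "f = cl F G" using assms by (rule carrierE)
  obtain e where e: "F \<in> forms n e" "G \<in> forms n e" "G \<notin> I" using f(1) by (rule frE)
  have "\<Phi> (f [*] Nf e G) = \<Phi> (Nf e F)"
    using assms EV_nz[OF f(1)] by (simp add: \<Phi>_mult Nf_R e f(2) \<Phi>_cl f(1) \<Phi>_Nf)
  then have "f [*] Nf e G = Nf e F" by (rule \<Phi>_inj[rotated 2]) (use assms e in \<open>simp_all add: Nf_R\<close>)
  then show thesis using that[OF Nf_R[OF e(1)] Nf_R[OF e(2)]] Nf_zero_iff[OF e(2)] e(3) by blast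
qed

text \<open>Any two representations of \<open>f\<close> as a quotient yield the same difference of
  orders, so the definite description in \<open>ord_at\<close> denotes.\<close>

lemma subdegree_\<Phi>_fraction:
  assumes "f \<in> carrier K" "a \<in> R" "b \<in> R" "a \<noteq> \<zero>\<^bsub>K\<^esub>" "b \<noteq> \<zero>\<^bsub>K\<^esub>" "f [*] b = a"
  shows "fls_subdegree (\<Phi> f) = int (local_ord n C P a) - int (local_ord n C P b)"
proof -
  have e: "\<Phi> f * fl (ex b) = fl (ex a)" using assms \<Phi>_mult[of f b] by (simp add: \<Phi>_R)
  have "\<Phi> f \<noteq> 0" using e ex_nz[OF assms(2,4)] by auto
  then have "fls_subdegree (\<Phi> f) + fls_subdegree (fl (ex b)) = fls_subdegree (fl (ex a))"
    using ex_nz[OF assms(3,5)] by (simp flip: e)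
  then show ?thesis using assms by (simp add: local_ord_eq fls_subdegree_fls_to_fps)
qed

lemma ord_at_eq: assumes f: "f \<in> carrier K" "f \<noteq> \<zero>\<^bsub>K\<^esub>" shows "ord_at n C P f = fls_subdegree (\<Phi> f)"
  unfolding ord_at_def
proof (rule the_equality)
  obtain a b where ab: "a \<in> R" "b \<in> R" "b \<noteq> \<zero>\<^bsub>K\<^esub>" "f [*] b = a" using f(1) by (rule fraction_R)
  have "a \<noteq> \<zero>\<^bsub>K\<^esub>" using ab f K.integral[of f b] by auto
  then show "\<exists>a\<in>R. \<exists>b\<in>R. a \<noteq> \<zero>\<^bsub>K\<^esub> \<and> b \<noteq> \<zero>\<^bsub>K\<^esub> \<and> f [*] b = a \<and>
      fls_subdegree (\<Phi> f) = int (local_ord n C P a) - int (local_ord n C P b)"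
    using subdegree_\<Phi>_fraction[OF f(1) ab(1,2) _ ab(3,4)] ab by blast
next
  fix r assume "\<exists>a\<in>R. \<exists>b\<in>R. a \<noteq> \<zero>\<^bsub>K\<^esub> \<and> b \<noteq> \<zero>\<^bsub>K\<^esub> \<and> f [*] b = a \<and> r = int (local_ord n C P a) - int (local_ord n C P b)"
  then obtain a b where ab: "a \<in> R" "b \<in> R" "a \<noteq> \<zero>\<^bsub>K\<^esub>" "b \<noteq> \<zero>\<^bsub>K\<^esub>" "f [*] b = a"
    and r: "r = int (local_ord n C P a) - int (local_ord n C P b)" by blast
  show "r = fls_subdegree (\<Phi> f)" unfolding r by (rule subdegree_\<Phi>_fraction[OF f(1) ab, symmetric])
qed

text \<open>The power of \<open>t\<close> given by the order of the denominator divides the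
  numerator too; after cancelling it the denominator is a unit.\<close>

lemma nonneg_subdegree_R:
  assumes f: "f \<in> carrier K" "fls_subdegree (\<Phi> f) \<ge> 0" shows "f \<in> R"
proof (cases "f = \<zero>\<^bsub>K\<^esub>")
  case nz: False
  obtain a b where ab: "a \<in> R" "b \<in> R" "b \<noteq> \<zero>\<^bsub>K\<^esub>" "f [*] b = a" using f(1) by (rule fraction_R)
  have a0: "a \<noteq> \<zero>\<^bsub>K\<^esub>" using ab f nz K.integral[of f b] by auto
  let ?r = "subdegree (ex b)"
  have "?r \<le> subdegree (ex a)"
    using subdegree_\<Phi>_fraction[OF f(1) ab(1,2) a0 ab(3,4)] f(2) by (simp add: local_ord_eq ab a0)
  then have "\<forall>i<?r. fps_nth (ex a) i = 0" by (auto intro: nth_less_subdegree_zero)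
  from ex_low[OF ab(1) this] obtain a' where a': "a' \<in> R" "a = tpow ?r [*] a'" by blast
  have "\<forall>i<?r. fps_nth (ex b) i = 0" by (auto intro: nth_less_subdegree_zero)
  from ex_low[OF ab(2) this] obtain b' where
    b': "b' \<in> R" "b = tpow ?r [*] b'" "\<forall>i. fps_nth (ex b') i = fps_nth (ex b) (?r + i)" by blast
  have "evP b' \<noteq> 0" using spec[OF b'(3), of 0] ex_nz[OF ab(2,3)] by simp
  then obtain v where v: "v \<in> R" "b' [*] v = \<one>\<^bsub>K\<^esub>" by (rule R_unit[OF b'(1)])
  have t0: "\<Phi> (tpow ?r) \<noteq> 0" using \<Phi>_R[OF tpow_R] by (simp add: ex_tpow)
  have "\<Phi> f * (\<Phi> (tpow ?r) * \<Phi> b') = \<Phi> (tpow ?r) * \<Phi> a'"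
    using ab(4) f(1) a' b' tpow_R \<Phi>_mult by (metis R_ops(1) R_ops(3))
  then have e1: "\<Phi> f * \<Phi> b' = \<Phi> a'" using t0 by (simp add: mult.left_commute)
  have e2: "\<Phi> b' * \<Phi> v = 1" using \<Phi>_mult[of b' v] v b'(1) by simp
  have "\<Phi> f = \<Phi> f * (\<Phi> b' * \<Phi> v)" using e2 by simp
  also have "\<dots> = \<Phi> a' * \<Phi> v" by (simp only: mult.assoc[symmetric] e1)
  also have "\<dots> = \<Phi> (a' [*] v)" using a'(1) v(1) by (simp add: \<Phi>_mult)
  finally have "\<Phi> f = \<Phi> (a' [*] v)" .
  then have "f = a' [*] v" using a' v f(1) by (intro \<Phi>_inj) auto
  then show ?thesis using a' v by simp
qed simp

lemma regular_away_iff: "f \<in> regular_away n C P \<longleftrightarrow> f \<in> carrier K \<and> (\<forall>Q\<in>C. \<not> same_point P Q \<longrightarrow> f \<in> OQ Q)"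
  by (simp add: regular_away_def)

lemma regular_away_closed:
  "a \<in> regular_away n C P \<Longrightarrow> b \<in> regular_away n C P \<Longrightarrow> a [+] b \<in> regular_away n C P"
  "a \<in> regular_away n C P \<Longrightarrow> b \<in> regular_away n C P \<Longrightarrow> a [*] b \<in> regular_away n C P"
  "cf c \<in> regular_away n C P"
  unfolding regular_away_iff by (simp_all add: OQ_add OQ_mult OQ_const)

text \<open>Points are given by coordinate vectors, and \<open>regular_away\<close> is silent about
  the multiples of \<open>P\<close>; at those a form is scaled by a nonzero factor.\<close>

lemma regular_everywhere:
  assumes "f \<in> regular_away n C P" "fls_subdegree (\<Phi> f) \<ge> 0" "Q \<in> C" shows "f \<in> OQ Q"
proof (cases "same_point P Q")
  case True
  then obtain c where c: "c \<noteq> 0" "Q = (\<lambda>i. c * P i)" by (auto simp: same_point_def)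
  have "f \<in> R" using assms nonneg_subdegree_R by (simp add: regular_away_iff)
  then obtain F G where f: "(F, G) \<in> fr" "peval P G \<noteq> 0" "f = cl F G" by (rule OQE)
  obtain e where e: "F \<in> forms n e" "G \<in> forms n e" "G \<notin> I" using f(1) by (rule frE)
  have "peval Q G = c ^ e * peval P G" unfolding c(2) using e(2) by (intro peval_homog_scale) (simp add: forms_def)
  then have "peval Q G \<noteq> 0" using f(2) c(1) by simp
  then show ?thesis unfolding OQ_iff using f(1,3) by blast
qed (use assms in \<open>simp add: regular_away_iff\<close>)

end

definition const_graph :: "('k fls \<times> 'k::field) set" where "const_graph = {(fls_const c, c) | c. True}"

lemma const_graph_iff [simp]: "(a, b) \<in> const_graph \<longleftrightarrow> a = fls_const b"
  by (auto simp: const_graph_def)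

lemma place_graph_const: "place_graph const_graph"
  unfolding place_graph_def by (auto simp: fls_plus_const)

text \<open>\<open>p\<close> is \<open>q\<close> with its coefficients read as constant series. Over
  an algebraically closed field \<open>q\<close> splits into linear factors, so every root of
  \<open>p\<close> is one of the constant roots of \<open>q\<close>.\<close>

lemma algebraic_over_const:
  fixes p :: "'k::alg_closed_field fls poly"
  assumes "(p, q) \<in> graph_polys const_graph" "q \<noteq> 0" "poly p x = 0"
  shows "\<exists>c. x = fls_const c"
  using assms
proof (induction "Polynomial.degree q" arbitrary: p q rule: less_induct)
  case less
  note pc = place_graph_const
  have pq: "poly.coeff p i = fls_const (poly.coeff q i)" for i using less.prems(1) by (simp add: graph_polys_def)
  show ?case
  proof (cases "Polynomial.degree q = 0")
    case True
    then obtain b where b: "q = [:b:]" by (meson degree_eq_zeroE)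
    then have "p = [:fls_const b:]" by (intro poly_eqI) (simp add: pq coeff_pCons split: nat.splits)
    then show ?thesis using less.prems b by simp
  next
    case False
    then obtain c where "poly q c = 0" using alg_closed_imp_poly_has_root[of q] by auto
    then obtain q' where q': "q = [:-c, 1:] * q'" by (auto simp: poly_eq_0_iff_dvd elim: dvdE)
    define p' where "p' = map_poly fls_const q'"
    have g': "(p', q') \<in> graph_polys const_graph" by (simp add: graph_polys_def p'_def coeff_map_poly)
    have g1: "([:- fls_const c, 1:], [:-c, 1:]) \<in> graph_polys const_graph"
      by (simp add: graph_polys_def coeff_pCons split: nat.splits)
    have pe: "p = [:- fls_const c, 1:] * p'"
    proof (rule poly_eqI)
      fix i
      have "poly.coeff ([:- fls_const c, 1:] * p') i = fls_const (poly.coeff ([:-c, 1:] * q') i)"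
        using graph_polys_closed(2)[OF pc g1 g'] by (simp add: graph_polys_def del: mult_pCons_left)
      then show "poly.coeff p i = poly.coeff ([:- fls_const c, 1:] * p') i" by (simp only: pq q')
    qed
    have "poly p x = (x - fls_const c) * poly p' x" unfolding pe poly_mult by simp
    then have "(x - fls_const c) * poly p' x = 0" using less.prems(3) by simp
    then consider "x = fls_const c" | "poly p' x = 0" by auto
    then show ?thesis
    proof cases
      case 2
      have q'0: "q' \<noteq> 0" using less.prems(2) q' by auto
      have "Polynomial.degree q' < Polynomial.degree q" unfolding q' using q'0 by (subst degree_mult_eq) auto
      from less.hyps[OF this g' q'0 2] show ?thesis .
    qed auto
  qed
qed

context smooth_point
begin

text \<open>A nonconstant function regular everywhere would have a pole at the center of a place that
  sends its inverse to 0.\<close>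

lemma global_const:
  assumes f: "f \<in> regular_away n C P" "fls_subdegree (\<Phi> f) \<ge> 0"
  shows "\<exists>c. f = cf c"
proof (rule ccontr)
  assume nc: "\<nexists>c. f = cf c"
  have fK: "f \<in> carrier K" using f by (simp add: regular_away_iff)
  define L where "L = \<Phi> f"
  have Lc: "L \<noteq> fls_const c" for c using nc \<Phi>_inj[OF fK, of "cf c"] by (auto simp: L_def)
  have L0: "L \<noteq> 0" using Lc[of 0] by simp
  \<comment> \<open>\<open>inverse L\<close> is not constant, hence transcendental over the
    constants, so the value 0 may be prescribed for it.\<close>
  have alg: "poly q 0 = 0" if pq: "(p, q) \<in> graph_polys const_graph" "poly p (inverse L) = 0" for p and q :: "'k poly"
  proof (rule ccontr)
    assume "poly q 0 \<noteq> 0"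
    then have q: "q \<noteq> 0" by auto
    obtain c where c: "inverse L = fls_const c" using algebraic_over_const[OF pq(1) q pq(2)] by blast
    then have "c \<noteq> 0" using L0 by auto
    have "L = inverse (fls_const c)" by (metis c inverse_inverse_eq)
    also have "\<dots> = fls_const (inverse c)"
      by (rule inverse_unique) (simp add: \<open>c \<noteq> 0\<close>)
    finally show False using Lc by blast
  qed
  obtain B where B: "{(poly p (inverse L), poly q (0::'k)) | p q. (p, q) \<in> graph_polys const_graph} \<subseteq> B" "maximal_place B"
    by (rule place_extension[OF place_graph_adjoin(1)[OF place_graph_const alg]])
  interpret maximal_place B by (rule B(2))
  have cB: "(fls_const c, c) \<in> B" for c
    using place_graph_adjoin(2)[OF place_graph_const alg] B(1) by (simp add: subset_iff)
  have LB: "(inverse L, 0) \<in> B"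
    by (rule subsetD[OF B(1) place_graph_adjoin(3)[OF place_graph_const alg]])
  define \<xi> where "\<xi> i = fl (EV (var i))" for i
  \<comment> \<open>A coordinate of least valuation: every quotient by it has a residue. The
    candidate is updated by one comparison per coordinate, beginning with \<open>jP\<close>, whose
    expansion is 1.\<close>
  have "\<exists>j\<in>insert jP A. \<xi> j \<noteq> 0 \<and> (\<forall>i\<in>A. \<exists>c. (\<xi> i / \<xi> j, c) \<in> B)" if "finite A" for A
    using that
  proof (induction A rule: finite_induct)
    case empty then show ?case by (simp add: \<xi>_def EV_xj)
  next
    case (insert i A)
    then obtain j where j: "j \<in> insert jP A" "\<xi> j \<noteq> 0" "\<And>i. i \<in> A \<Longrightarrow> \<exists>c. (\<xi> i / \<xi> j, c) \<in> B" by blast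
    show ?case
    proof (cases "\<exists>c. (\<xi> i / \<xi> j, c) \<in> B")
      case True then show ?thesis using j by (intro bexI[of _ j]) auto
    next
      case False
      have i0: "\<xi> i \<noteq> 0" using False D(2) by auto
      then obtain c where c: "(\<xi> j / \<xi> i, c) \<in> B"
        using valuation_ring[of "\<xi> i / \<xi> j"] False j(2) by auto
      have "\<exists>c. (\<xi> i' / \<xi> i, c) \<in> B" if i': "i' \<in> insert i A" for i'
      proof (cases "i' = i")
        case True then show ?thesis using D(1) i0 by auto
      next
        case False
        then obtain c' where "(\<xi> i' / \<xi> j, c') \<in> B" using i' j(3) by blast
        from D(4)[OF this c] show ?thesis using j(2) by auto
      qed
      then show ?thesis using i0 by blast
    qed
  qed
  from this[of "{..n}"] obtain j where j: "j \<in> insert jP {..n}" "\<xi> j \<noteq> 0" "\<And>i. i \<in> {..n} \<Longrightarrow> \<exists>c. (\<xi> i / \<xi> j, c) \<in> B" by blast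
  have jn: "j \<le> n" using j(1) jPn by auto
  \<comment> \<open>The center of the place, formed by the residues of the coordinate quotients; its
    coordinate \<open>j\<close> is 1, so it is a point of projective space.\<close>
  define Q where "Q i = (if i \<le> n then SOME c. (\<xi> i / \<xi> j, c) \<in> B else 0)" for i
  have QB: "(\<xi> i / \<xi> j, Q i) \<in> B" if "i \<le> n" for i
    using someI_ex[OF j(3)[of i]] that by (simp add: Q_def)
  have "(1, Q j) \<in> B" using QB[OF jn] j(2) by simp
  from D(7)[OF this D(1)] have Qj: "Q j = 1" using D(6)[of "Q j - 1"] by simp
  define HV where "HV = flsh.ev (\<lambda>i. \<xi> i / \<xi> j)"
  have HVB: "(HV H, peval Q H) \<in> B" if "H \<in> polys_in {..n}" for H
  proof (rule poly_mapping_closure[of "\<lambda>H. (HV H, peval Q H) \<in> B" H])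
    fix m assume "m \<in> Poly_Mapping.keys H"
    then have m: "Poly_Mapping.keys m \<subseteq> {..n}" using that by (auto simp: polys_in_def)
    have "(\<Prod>i\<in>A. (\<xi> i / \<xi> j) ^ Poly_Mapping.lookup m i, \<Prod>i\<in>A. Q i ^ Poly_Mapping.lookup m i) \<in> B"
      if "finite A" "A \<subseteq> {..n}" for A
      using that by (induction A rule: finite_induct) (auto intro: D(1,4,8) QB)
    from D(4)[OF cB this[OF finite_keys m]]
    show "(HV (Poly_Mapping.single m (Poly_Mapping.lookup H m)), peval Q (Poly_Mapping.single m (Poly_Mapping.lookup H m))) \<in> B"
      by (simp add: HV_def mon_def)
  qed (auto simp: HV_def flsh.ev_add D(2) intro: D(3))
  \<comment> \<open>By homogeneity, evaluating a form at the coordinate quotients divides its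
    expansion by a power of the chosen coordinate.\<close>
  have HV_EV: "HV H * \<xi> j ^ e = fl (EV H)" if "H \<in> forms n e" for H e
  proof -
    have m: "mon (\<lambda>i. \<xi> i / \<xi> j) m * \<xi> j ^ wdeg (\<lambda>_. 1) m = fl (mon (\<lambda>i. EV (var i)) m)" for m
    proof -
      have "mon (\<lambda>i. \<xi> i / \<xi> j) m * \<xi> j ^ wdeg (\<lambda>_. 1) m =
          (\<Prod>v\<in>Poly_Mapping.keys m. (\<xi> v / \<xi> j) ^ Poly_Mapping.lookup m v * \<xi> j ^ Poly_Mapping.lookup m v)"
        by (simp add: mon_def wdeg_def power_sum prod.distrib)
      also have "\<dots> = (\<Prod>v\<in>Poly_Mapping.keys m. fl (EV (var v) ^ Poly_Mapping.lookup m v))"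
        by (rule prod.cong) (simp_all add: power_divide j(2) fps_to_fls_power flip: \<xi>_def)
      also have "\<dots> = fl (mon (\<lambda>i. EV (var i)) m)" by (simp add: fl_prod mon_def)
      finally show ?thesis .
    qed
    have "HV H * \<xi> j ^ e = (\<Sum>m\<in>Poly_Mapping.keys H. fls_const (Poly_Mapping.lookup H m) * (mon (\<lambda>i. \<xi> i / \<xi> j) m * \<xi> j ^ wdeg (\<lambda>_. 1) m))"
      unfolding HV_def flsh.ev_def sum_distrib_right using that
      by (intro sum.cong) (auto simp: forms_def homog_def mult.assoc)
    also have "\<dots> = (\<Sum>m\<in>Poly_Mapping.keys H. fl (fps_const (Poly_Mapping.lookup H m) * mon (\<lambda>i. EV (var i)) m))"
      by (simp only: m fl_mult fps_const_to_fls)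
    also have "\<dots> = fl (EV H)"
      unfolding EV_var fl_sum[symmetric] unfolding EV_def fpsh.ev_def by (rule refl)
    finally show ?thesis .
  qed
  obtain T where T: "T \<subseteq> (\<Union>e. forms n e)" "C = zero_locus n T" using C_closed by blast
  \<comment> \<open>Equations of the curve have expansion 0, and 0 has residue 0, so they vanish at
    the center.\<close>
  have "Q \<in> C" unfolding T(2) zero_locus_def
  proof (intro CollectI conjI ballI)
    have "Q j \<noteq> 0" "\<forall>i>n. Q i = 0" using Qj by (simp_all add: Q_def)
    then show "Q \<in> proj_vecs n" unfolding proj_vecs_def by blast
    fix H assume H: "H \<in> T"
    then obtain e where e: "H \<in> forms n e" using T by blast
    have "H \<in> I" using H e unfolding vanishing_ideal_def T(2) zero_locus_def by (auto simp: forms_def)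
    then have "HV H = 0" using HV_EV[OF e] EV_I[OF e] j(2) by simp
    then show "peval Q H = 0" using HVB[of H] e D(6) by (simp add: forms_def)
  qed
  then have "f \<in> OQ Q" using regular_everywhere f by blast
  then obtain F G where FG: "(F, G) \<in> fr" "peval Q G \<noteq> 0" "f = cl F G" by (rule OQE)
  obtain e where e: "F \<in> forms n e" "G \<in> forms n e" "G \<notin> I" using FG(1) by (rule frE)
  \<comment> \<open>This contradicts regularity at the center: \<open>HV G\<close> equals
    \<open>HV F\<close> times \<open>inverse L\<close>, and the latter has residue 0, so the
    denominator vanishes at \<open>Q\<close>.\<close>
  have "L * HV G = HV F"
  proof -
    have "L * fl (EV G) = fl (EV F)" using EV_nz[OF FG(1)] by (simp add: L_def FG(3) \<Phi>_cl[OF FG(1)])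
    then have "(L * HV G) * \<xi> j ^ e = HV F * \<xi> j ^ e"
      by (simp only: mult.assoc HV_EV[OF e(1)] HV_EV[OF e(2)])
    then show ?thesis using j(2) by simp
  qed
  then have "HV G = HV F * inverse L" using L0 by (simp add: field_simps)
  then have "(HV G, peval Q F * 0) \<in> B" using D(4)[OF HVB LB, of F] e(1) by (simp add: forms_def)
  from D(7)[OF HVB[of G] this] have "(0, peval Q G) \<in> B" using e(2) by (simp add: forms_def)
  then show False using D(6) FG(2) by blast
qed

end

section \<open>Pommaret resolutions\<close>

definition trm :: "((var \<Rightarrow>\<^sub>0 nat) \<Rightarrow> nat \<Rightarrow> bool) \<Rightarrow> (nat \<Rightarrow>\<^sub>0 (var, 'k::field) mpoly) \<Rightarrow> bool" where
  "trm Q u \<longleftrightarrow> (\<forall>e. \<forall>m\<in>Poly_Mapping.keys (Poly_Mapping.lookup u e). Q m e)"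

lemma trm_0 [simp]: "trm Q 0" by (simp add: trm_def)

lemma trm_add: assumes "trm Q u" "trm Q v" shows "trm Q (u + v)"
  unfolding trm_def lookup_add
proof (intro allI ballI)
  fix e m assume "m \<in> Poly_Mapping.keys (Poly_Mapping.lookup u e + Poly_Mapping.lookup v e)"
  from subsetD[OF keys_add this] show "Q m e" using assms by (auto simp: trm_def)
qed

lemma trm_diff: assumes "trm Q u" "trm Q v" shows "trm Q (u - v)"
  unfolding trm_def lookup_minus
proof (intro allI ballI)
  fix e m assume "m \<in> Poly_Mapping.keys (Poly_Mapping.lookup u e - Poly_Mapping.lookup v e)"
  from subsetD[OF keys_diff this] show "Q m e" using assms by (auto simp: trm_def)
qed

lemma trm_single [simp]: "trm Q (Poly_Mapping.single e (Poly_Mapping.single m c)) \<longleftrightarrow> c = 0 \<or> Q m e"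
  by (auto simp: trm_def lookup_single when_def)

lemma trm_mono: "trm Q u \<Longrightarrow> (\<And>m e. Q m e \<Longrightarrow> Q' m e) \<Longrightarrow> trm Q' u"
  by (auto simp: trm_def)

lemma trm_conj: "trm Q u \<Longrightarrow> trm Q' u \<Longrightarrow> trm (\<lambda>m e. Q m e \<and> Q' m e) u"
  by (auto simp: trm_def)

lemma trm_sc: "trm Q u \<Longrightarrow> (\<And>\<mu> e. Q \<mu> e \<Longrightarrow> Q' (m + \<mu>) e) \<Longrightarrow> trm Q' (sc (Poly_Mapping.single m c) u)"
proof -
  assume u: "trm Q u" "\<And>\<mu> e. Q \<mu> e \<Longrightarrow> Q' (m + \<mu>) e"
  have "Q' k e" if k: "k \<in> Poly_Mapping.keys (Poly_Mapping.single m c * Poly_Mapping.lookup u e)" for k e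
  proof -
    obtain a b where ab: "k = a + b" "a \<in> Poly_Mapping.keys (Poly_Mapping.single m c)" "b \<in> Poly_Mapping.keys (Poly_Mapping.lookup u e)"
      using keys_mult[of "Poly_Mapping.single m c" "Poly_Mapping.lookup u e"] k by blast
    then have "a = m" by (auto split: if_splits)
    then show ?thesis using ab u by (auto simp: trm_def)
  qed
  then show ?thesis by (simp add: trm_def)
qed

lemma trm_mcomp: "trm Q u \<Longrightarrow> trm Q (mcomp w bd j u)"
  by (auto simp: trm_def mcomp_lookup in_keys_iff hcomp_lookup split: if_splits)

lemma free_mod_trm: "u \<in> free_mod s E \<longleftrightarrow> trm (\<lambda>m e. e \<in> E \<and> Poly_Mapping.keys m \<subseteq> pvars s) u"
proof
  assume u: "trm (\<lambda>m e. e \<in> E \<and> Poly_Mapping.keys m \<subseteq> pvars s) u"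
  have "Poly_Mapping.keys u \<subseteq> E"
  proof
    fix e assume "e \<in> Poly_Mapping.keys u"
    then have "Poly_Mapping.keys (Poly_Mapping.lookup u e) \<noteq> {}" by (simp add: in_keys_iff)
    then show "e \<in> E" using u unfolding trm_def by blast
  qed
  then show "u \<in> free_mod s E" using u by (auto simp: free_mod_def trm_def polys_in_def)
next
  assume u: "u \<in> free_mod s E"
  show "trm (\<lambda>m e. e \<in> E \<and> Poly_Mapping.keys m \<subseteq> pvars s) u"
    unfolding trm_def
  proof (intro allI ballI)
    fix e m assume m: "m \<in> Poly_Mapping.keys (Poly_Mapping.lookup u e)"
    then have "Poly_Mapping.lookup u e \<noteq> 0" by auto
    then have "e \<in> Poly_Mapping.keys u" by (simp add: in_keys_iff)
    then show "e \<in> E \<and> Poly_Mapping.keys m \<subseteq> pvars s" using u m by (auto simp: free_mod_def polys_in_def)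
  qed
qed

lemma trm_closure:
  assumes "P 0" "\<And>a b. P a \<Longrightarrow> P b \<Longrightarrow> P (a + b)"
    and "trm Q u" "\<And>m e c. Q m e \<Longrightarrow> P (Poly_Mapping.single e (Poly_Mapping.single m c))"
  shows "P u"
proof (rule poly_mapping_closure[of P u])
  fix e
  let ?p = "Poly_Mapping.lookup u e"
  show "P (Poly_Mapping.single e ?p)"
  proof (rule poly_mapping_closure[of "\<lambda>p. P (Poly_Mapping.single e p)" ?p])
    fix m assume "m \<in> Poly_Mapping.keys ?p"
    then show "P (Poly_Mapping.single e (Poly_Mapping.single m (Poly_Mapping.lookup ?p m)))"
      using assms(3,4) by (simp add: trm_def)
  qed (use assms(1,2) in \<open>simp_all add: single_add\<close>)
qed (use assms(1,2) in auto)

definition ydeg :: "(var \<Rightarrow>\<^sub>0 nat) \<Rightarrow> nat" where "ydeg = wdeg (\<lambda>u. case u of Y a \<Rightarrow> 1 | _ \<Rightarrow> 0)"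

lemma ydeg_add: "ydeg (m + m') = ydeg m + ydeg m'" by (simp add: ydeg_def wdeg_add)

definition mY :: "nat \<Rightarrow> (var \<Rightarrow>\<^sub>0 nat)" where "mY a = Poly_Mapping.single (Y a) 1"

lemma keys_mY [simp]: "Poly_Mapping.keys (mY a) = {Y a}" by (simp add: mY_def)

lemma wdeg_mY [simp]: "wdeg w (mY a) = w (Y a)" by (simp add: mY_def)

lemma ydeg_mY [simp]: "ydeg (mY a) = 1"
  by (simp add: ydeg_def)

text \<open>The multiplicative variables of a generator of class \<open>c\<close>.\<close>

definition Vc :: "nat \<Rightarrow> nat \<Rightarrow> var set" where "Vc s c = {X, Z} \<union> Y ` {c..s}"

lemma Vc_pvars: "c \<ge> 1 \<Longrightarrow> Vc s c \<subseteq> pvars s" by (auto simp: Vc_def pvars_def)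

lemma split_mY: "Y a \<in> Poly_Mapping.keys m \<Longrightarrow> m = (m - mY a) + mY a"
  by (rule poly_mapping_eqI) (auto simp: mY_def lookup_add lookup_minus lookup_single when_def in_keys_iff)

lemma mono_mcomp_diff: "mcomp w bd j (u - v) = mcomp w bd j u - mcomp w bd j v"
  using mcomp_add[of w bd j "u - v" v] by simp

text \<open>One step of the resolution: \<open>Ker\<close> is a submodule of the free module on \<open>E\<close>. The elements
  \<open>e'\<close> of \<open>E'\<close> index generators of \<open>Ker\<close> with leading term \<open>mm e'\<close> times the basis vector \<open>ee e'\<close>, class \<open>cls e'\<close>
  and normal remainder \<open>\<nu> e'\<close>; terms \<open>m e\<close> are compared by \<open>ydeg m * K + e\<close>. By T1 and T2 every term either
  satisfies \<open>N\<close> (is normal) or is in a unique way a multiplicative multiple of a leading term.\<close>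

locale pommaret_step =
  fixes s :: nat and w :: "var \<Rightarrow> nat" and v :: nat and E E' :: "nat set" and K K' :: nat
    and mm :: "nat \<Rightarrow> (var \<Rightarrow>\<^sub>0 nat)" and ee cls :: "nat \<Rightarrow> nat"
    and Ker :: "(nat \<Rightarrow>\<^sub>0 (var, 'k::field) mpoly) set"
    and N :: "(var \<Rightarrow>\<^sub>0 nat) \<Rightarrow> nat \<Rightarrow> bool" and \<nu> :: "nat \<Rightarrow> (nat \<Rightarrow>\<^sub>0 (var, 'k) mpoly)"
    and bd bd' :: "nat \<Rightarrow> nat"
  assumes Ker_free: "Ker \<subseteq> free_mod s E"
    and Ker_0: "0 \<in> Ker"
    and Ker_add: "x \<in> Ker \<Longrightarrow> y \<in> Ker \<Longrightarrow> x + y \<in> Ker"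
    and Ker_sc: "p \<in> polys_in (pvars s) \<Longrightarrow> x \<in> Ker \<Longrightarrow> sc p x \<in> Ker"
    and main: "e' \<in> E' \<Longrightarrow> ee e' \<in> E \<and> Poly_Mapping.keys (mm e') \<subseteq> pvars s \<and> 1 \<le> cls e'"
    and T1: "Poly_Mapping.keys m \<subseteq> pvars s \<Longrightarrow> e \<in> E \<Longrightarrow>
      N m e \<or> (\<exists>e'\<in>E'. \<exists>m'. Poly_Mapping.keys m' \<subseteq> Vc s (cls e') \<and> m = m' + mm e' \<and> e = ee e')"
    and T2: "e1 \<in> E' \<Longrightarrow> e2 \<in> E' \<Longrightarrow> Poly_Mapping.keys m1 \<subseteq> Vc s (cls e1) \<Longrightarrow> Poly_Mapping.keys m2 \<subseteq> Vc s (cls e2) \<Longrightarrow>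
      m1 + mm e1 = m2 + mm e2 \<Longrightarrow> ee e1 = ee e2 \<Longrightarrow> e1 = e2"
    and T3: "e' \<in> E' \<Longrightarrow> \<nu> e' \<in> free_mod s E \<and> trm (\<lambda>m e. ydeg m * K + e < ydeg (mm e') * K + ee e') (\<nu> e') \<and>
      mhom w bd (bd' e') (\<nu> e') \<and> Poly_Mapping.single (ee e') (Poly_Mapping.single (mm e') 1) - \<nu> e' \<in> Ker"
    and T4: "u \<in> Ker \<Longrightarrow> trm N u \<Longrightarrow> u = 0"
    and bd': "e' \<in> E' \<Longrightarrow> bd' e' = bd (ee e') + wdeg w (mm e')"
    and wY: "1 \<le> a \<Longrightarrow> a \<le> s \<Longrightarrow> w (Y a) = v"
    and cls_s: "e' \<in> E' \<Longrightarrow> cls e' \<le> s"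
    and swap: "e' \<in> E' \<Longrightarrow> 1 \<le> b \<Longrightarrow> b < cls e' \<Longrightarrow> \<exists>e2\<in>E'. \<exists>a. cls e2 \<le> a \<and> a \<le> s \<and>
      mY b + mm e' = mY a + mm e2 \<and> ee e2 = ee e' \<and> e2 < e'"
    and code_less: "e1 \<in> E' \<Longrightarrow> e' \<in> E' \<Longrightarrow> k * K + (ydeg (mm e1) * K + ee e1) < K + (ydeg (mm e') * K + ee e') \<Longrightarrow>
      k * K' + e1 < K' + e'"
begin

abbreviation "rk m e \<equiv> ydeg m * K + e"

definition \<sigma> :: "nat \<Rightarrow> (nat \<Rightarrow>\<^sub>0 (var, 'k) mpoly)" where
  "\<sigma> e' = Poly_Mapping.single (ee e') (Poly_Mapping.single (mm e') 1) - \<nu> e'"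

definition pnormal :: "(var \<Rightarrow>\<^sub>0 nat) \<Rightarrow> nat \<Rightarrow> bool" where
  "pnormal m' e' \<longleftrightarrow> e' \<in> E' \<and> Poly_Mapping.keys m' \<subseteq> Vc s (cls e')"

lemma pnormal_free: "trm pnormal u \<Longrightarrow> u \<in> free_mod s E'"
  unfolding free_mod_trm by (erule trm_mono) (use main Vc_pvars in \<open>fastforce simp: pnormal_def\<close>)

lemma \<sigma>_Ker: "e' \<in> E' \<Longrightarrow> \<sigma> e' \<in> Ker"
  using T3 by (simp add: \<sigma>_def)

lemma Ker_diff: "a \<in> Ker \<Longrightarrow> b \<in> Ker \<Longrightarrow> a - b \<in> Ker"
  using Ker_add[of a "sc (- 1) b"] Ker_sc[of "- 1" b] by (simp add: sc_def single_uminus)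

lemma Ker_sum: "(\<And>x. x \<in> A \<Longrightarrow> f x \<in> Ker) \<Longrightarrow> sum f A \<in> Ker"
  by (induction A rule: infinite_finite_induct) (auto intro: Ker_0 Ker_add)

lemma lin_ext_\<sigma>_Ker: "u \<in> free_mod s E' \<Longrightarrow> lin_ext \<sigma> u \<in> Ker"
  unfolding lin_ext_alt by (rule Ker_sum, rule Ker_sc, auto simp: free_mod_def intro!: \<sigma>_Ker)

lemma sc_\<sigma>: "sc (Poly_Mapping.single m c) (\<sigma> e') =
    Poly_Mapping.single (ee e') (Poly_Mapping.single (m + mm e') c) - sc (Poly_Mapping.single m c) (\<nu> e')"
  by (simp add: \<sigma>_def mult_single)

lemma sc_\<nu>:
  assumes "e' \<in> E'"
  shows "trm (\<lambda>\<mu> e. rk \<mu> e < rk (m + mm e') (ee e')) (sc (Poly_Mapping.single m c) (\<nu> e'))"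
  by (rule trm_sc[of "\<lambda>\<mu> e. rk \<mu> e < rk (mm e') (ee e')"]) (use T3[OF assms] in \<open>auto simp: ydeg_add distrib_right\<close>)

text \<open>Division with remainder: subtracting the right multiple of a generator replaces a term
  by a multiple of \<nu>, whose rank is strictly smaller. Additivity reduces everything to a single
  term.\<close>

lemma reduce:
  assumes "u \<in> free_mod s E" "trm (\<lambda>m e. rk m e < r) u"
  shows "\<exists>x. trm pnormal x \<and> trm (\<lambda>m' e'. rk (m' + mm e') (ee e') < r) x \<and> trm N (u - lin_ext \<sigma> x)"
  using assms
proof (induction r arbitrary: u rule: less_induct)
  case (less r)
  define Pr where "Pr u \<longleftrightarrow> (\<exists>x. trm pnormal x \<and> trm (\<lambda>m' e'. rk (m' + mm e') (ee e') < r) x \<and> trm N (u - lin_ext \<sigma> x))" for u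
  have P0: "Pr 0" unfolding Pr_def by (rule exI[of _ 0]) simp
  have Padd: "Pr (a + b)" if ab: "Pr a" "Pr b" for a b
  proof -
    obtain x where x: "trm pnormal x" "trm (\<lambda>m' e'. rk (m' + mm e') (ee e') < r) x" "trm N (a - lin_ext \<sigma> x)" using ab(1) unfolding Pr_def by blast
    obtain y where y: "trm pnormal y" "trm (\<lambda>m' e'. rk (m' + mm e') (ee e') < r) y" "trm N (b - lin_ext \<sigma> y)" using ab(2) unfolding Pr_def by blast
    have eq: "a + b - lin_ext \<sigma> (x + y) = (a - lin_ext \<sigma> x) + (b - lin_ext \<sigma> y)" by (simp add: lin_ext_add)
    have "trm N (a + b - lin_ext \<sigma> (x + y))" unfolding eq by (rule trm_add[OF x(3) y(3)])
    then show ?thesis unfolding Pr_def using trm_add[OF x(1) y(1)] trm_add[OF x(2) y(2)] by blast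
  qed
  have Psingle: "Pr (Poly_Mapping.single e (Poly_Mapping.single m c))"
    if "(e \<in> E \<and> Poly_Mapping.keys m \<subseteq> pvars s) \<and> rk m e < r" for e m c
  proof -
    have e: "e \<in> E" and m: "Poly_Mapping.keys m \<subseteq> pvars s" and r: "rk m e < r" using that by auto
    consider "N m e" | e' m' where "e' \<in> E'" "Poly_Mapping.keys m' \<subseteq> Vc s (cls e')" "m = m' + mm e'" "e = ee e'"
      using T1[OF m e] by blast
    then show ?thesis
    proof cases
      case 1
      then show ?thesis unfolding Pr_def by (intro exI[of _ 0]) simp
    next
      case 2
      let ?y = "sc (Poly_Mapping.single m' c) (\<nu> e')"
      have "Poly_Mapping.single m' c \<in> polys_in (pvars s)"
        using 2(2) main[OF 2(1)] Vc_pvars[of "cls e'" s] by auto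
      then have "?y \<in> free_mod s E" using T3[OF 2(1)] by simp
      moreover have "trm (\<lambda>\<mu> e0. rk \<mu> e0 < rk m e) ?y" unfolding 2(3,4) by (rule sc_\<nu>[OF 2(1)])
      ultimately obtain x where x: "trm pnormal x" "trm (\<lambda>m' e'. rk (m' + mm e') (ee e') < rk m e) x" "trm N (?y - lin_ext \<sigma> x)"
        using less.IH[OF r] by blast
      let ?x = "Poly_Mapping.single e' (Poly_Mapping.single m' c) + x"
      have eq: "Poly_Mapping.single e (Poly_Mapping.single m c) - lin_ext \<sigma> ?x = ?y - lin_ext \<sigma> x"
        unfolding 2(3,4) by (simp add: lin_ext_add sc_\<sigma>)
      have "trm N (Poly_Mapping.single e (Poly_Mapping.single m c) - lin_ext \<sigma> ?x)" unfolding eq by (rule x(3))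
      moreover have "trm pnormal ?x" using 2(1,2) by (intro trm_add x(1)) (simp add: pnormal_def)
      moreover have "trm (\<lambda>m' e'. rk (m' + mm e') (ee e') < r) ?x"
        using r 2(3,4) by (intro trm_add trm_mono[OF x(2)]) auto
      ultimately show ?thesis unfolding Pr_def by blast
    qed
  qed
  have "Pr u"
    by (rule trm_closure[OF P0 Padd trm_conj[OF less.prems(1)[unfolded free_mod_trm] less.prems(2)] Psingle])
  then show ?case by (simp add: Pr_def)
qed

text \<open>The remainder of a kernel element is normal and again in the kernel, hence 0 by T4. The
  bound on ranks is retained, since it controls the tails of the next relations.\<close>

lemma reduce_Ker:
  assumes "u \<in> Ker" "trm (\<lambda>m e. rk m e < r) u"
  shows "\<exists>x. trm pnormal x \<and> trm (\<lambda>m' e'. rk (m' + mm e') (ee e') < r) x \<and> u = lin_ext \<sigma> x"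
proof -
  have "u \<in> free_mod s E" using assms(1) Ker_free by blast
  then obtain x where x: "trm pnormal x" "trm (\<lambda>m' e'. rk (m' + mm e') (ee e') < r) x" "trm N (u - lin_ext \<sigma> x)"
    using reduce assms(2) by blast
  have "u - lin_ext \<sigma> x = 0" by (rule T4[OF Ker_diff[OF assms(1) lin_ext_\<sigma>_Ker[OF pnormal_free[OF x(1)]]] x(3)])
  then show ?thesis using x by (intro exI[of _ x]) simp
qed

lemma rk_bounded: "\<exists>r. trm (\<lambda>m e. rk m e < r) u"
proof -
  have "finite ((\<lambda>(e, m). rk m e) ` (SIGMA e:Poly_Mapping.keys u. Poly_Mapping.keys (Poly_Mapping.lookup u e)))" (is "finite ?S") by simp
  then have *: "x \<in> ?S \<Longrightarrow> x \<le> Max ?S" for x by (rule Max_ge)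
  have "rk m e < Suc (Max ?S)" if m: "m \<in> Poly_Mapping.keys (Poly_Mapping.lookup u e)" for m e
  proof -
    have "Poly_Mapping.lookup u e \<noteq> 0" using m by auto
    then have "e \<in> Poly_Mapping.keys u" by (simp add: in_keys_iff)
    then have "rk m e \<in> ?S" using m by force
    from *[OF this] show ?thesis by simp
  qed
  then show ?thesis unfolding trm_def by blast
qed

lemma Ker_eq: "Ker = lin_ext \<sigma> ` free_mod s E'"
proof
  show "Ker \<subseteq> lin_ext \<sigma> ` free_mod s E'"
  proof
    fix u assume u: "u \<in> Ker"
    obtain r where "trm (\<lambda>m e. rk m e < r) u" using rk_bounded by blast
    from reduce_Ker[OF u this] obtain x where x: "trm pnormal x" "u = lin_ext \<sigma> x" by blast
    then show "u \<in> lin_ext \<sigma> ` free_mod s E'" using pnormal_free[OF x(1)] by (intro image_eqI) simp_all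
  qed
qed (use lin_ext_\<sigma>_Ker in blast)

text \<open>Distinct multiplicative multiples have distinct leading terms by T2, and the remainders
  have lower rank, so at a highest leading term nothing cancels.\<close>

lemma top_coefficient:
  assumes x: "trm (\<lambda>m' e'. pnormal m' e' \<and> rk (m' + mm e') (ee e') \<le> rk (m0 + mm e0) (ee e0)) x"
    and 0: "pnormal m0 e0"
  shows "Poly_Mapping.lookup (Poly_Mapping.lookup (lin_ext \<sigma> x) (ee e0)) (m0 + mm e0) = Poly_Mapping.lookup (Poly_Mapping.lookup x e0) m0"
proof (rule trm_closure[of "\<lambda>x. Poly_Mapping.lookup (Poly_Mapping.lookup (lin_ext \<sigma> x) (ee e0)) (m0 + mm e0) = Poly_Mapping.lookup (Poly_Mapping.lookup x e0) m0", OF _ _ x])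
  fix m e c assume me: "pnormal m e \<and> rk (m + mm e) (ee e) \<le> rk (m0 + mm e0) (ee e0)"
  then have e: "e \<in> E'" by (simp add: pnormal_def)
  have "m0 + mm e0 \<notin> Poly_Mapping.keys (Poly_Mapping.lookup (sc (Poly_Mapping.single m c) (\<nu> e)) (ee e0))"
    using sc_\<nu>[OF e, of m c] me unfolding trm_def by (meson leD)
  then have z: "Poly_Mapping.lookup (Poly_Mapping.lookup (sc (Poly_Mapping.single m c) (\<nu> e)) (ee e0)) (m0 + mm e0) = 0"
    by (simp add: in_keys_iff)
  have iff: "ee e = ee e0 \<and> m + mm e = m0 + mm e0 \<longleftrightarrow> e = e0 \<and> m = m0"
    using T2[of e e0 m m0] me 0 by (auto simp: pnormal_def)
  have "Poly_Mapping.lookup (Poly_Mapping.lookup (lin_ext \<sigma> (Poly_Mapping.single e (Poly_Mapping.single m c))) (ee e0)) (m0 + mm e0)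
      = (if ee e = ee e0 \<and> m + mm e = m0 + mm e0 then c else 0)"
    unfolding lin_ext_single sc_\<sigma> lookup_minus z by (simp add: lookup_single when_def)
  also have "\<dots> = Poly_Mapping.lookup (Poly_Mapping.lookup (Poly_Mapping.single e (Poly_Mapping.single m c)) e0) m0"
    unfolding iff by (simp add: lookup_single when_def)
  finally show "Poly_Mapping.lookup (Poly_Mapping.lookup (lin_ext \<sigma> (Poly_Mapping.single e (Poly_Mapping.single m c))) (ee e0)) (m0 + mm e0)
      = Poly_Mapping.lookup (Poly_Mapping.lookup (Poly_Mapping.single e (Poly_Mapping.single m c)) e0) m0" .
qed (simp_all add: lin_ext_add lookup_add)

lemma \<sigma>_injective:
  assumes x: "trm pnormal x" and 0: "lin_ext \<sigma> x = 0" shows "x = 0"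
proof (rule ccontr)
  assume "x \<noteq> 0"
  let ?S = "SIGMA e:Poly_Mapping.keys x. Poly_Mapping.keys (Poly_Mapping.lookup x e)"
  let ?f = "\<lambda>(e, m). rk (m + mm e) (ee e)"
  have "Poly_Mapping.keys x \<noteq> {}" using \<open>x \<noteq> 0\<close> by simp
  then obtain e where e: "e \<in> Poly_Mapping.keys x" by blast
  then have "Poly_Mapping.keys (Poly_Mapping.lookup x e) \<noteq> {}" by (simp add: in_keys_iff)
  then obtain m where "m \<in> Poly_Mapping.keys (Poly_Mapping.lookup x e)" by blast
  then have "(e, m) \<in> ?S" using e by simp
  then have "?S \<noteq> {}" by blast
  moreover have "finite ?S" by simp
  ultimately obtain p where p: "p \<in> ?S" "?f p = Max (?f ` ?S)" by (metis (no_types, lifting) Max_in finite_imageI imageE image_is_empty)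
  obtain e0 m0 where em: "p = (e0, m0)" by (cases p)
  have max: "?f y \<le> ?f p" if "y \<in> ?S" for y unfolding p(2) by (rule Max_ge) (use that in auto)
  have "trm (\<lambda>m' e'. pnormal m' e' \<and> rk (m' + mm e') (ee e') \<le> rk (m0 + mm e0) (ee e0)) x"
    unfolding trm_def
  proof (intro allI ballI conjI)
    fix e m assume m: "m \<in> Poly_Mapping.keys (Poly_Mapping.lookup x e)"
    then have "Poly_Mapping.lookup x e \<noteq> 0" by auto
    then have "(e, m) \<in> ?S" using m by (simp add: in_keys_iff)
    from max[OF this] show "rk (m + mm e) (ee e) \<le> rk (m0 + mm e0) (ee e0)" by (simp add: em)
    show "pnormal m e" using x m by (simp add: trm_def)
  qed
  moreover have "pnormal m0 e0" using x p(1) em by (auto simp: trm_def)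
  ultimately have "Poly_Mapping.lookup (Poly_Mapping.lookup (lin_ext \<sigma> x) (ee e0)) (m0 + mm e0) = Poly_Mapping.lookup (Poly_Mapping.lookup x e0) m0"
    by (rule top_coefficient)
  then show False using p(1) em by (simp add: 0 in_keys_iff)
qed

lemma \<sigma>_free: "e' \<in> E' \<Longrightarrow> \<sigma> e' \<in> free_mod s E"
  using \<sigma>_Ker Ker_free by blast

lemma \<sigma>_mhom: assumes "e' \<in> E'" shows "mhom w bd (bd' e') (\<sigma> e')"
  unfolding \<sigma>_def
  by (rule mhom_diff) (use T3[OF assms] bd'[OF assms] in \<open>auto simp: mhom_def\<close>)

text \<open>Multiplying a generator by a non-multiplicative variable gives, by \<open>swap\<close>,
  the leading term of a multiplicative multiple of an earlier generator. The difference has lower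
  rank and lies in \<open>Ker\<close>; reducing it supplies the tail of a syzygy, and
  \<open>code_less\<close> ranks that tail below the new leading term.\<close>

lemma next_relation:
  assumes e': "e' \<in> E'" and b: "1 \<le> b" "b < cls e'"
  shows "\<exists>y\<in>free_mod s E'. trm (\<lambda>m e. ydeg m * K' + e < K' + e') y \<and> mhom w bd' (bd' e' + v) y \<and>
    lin_ext \<sigma> (Poly_Mapping.single e' (Poly_Mapping.single (mY b) 1) - y) = 0"
proof -
  obtain e2 a where e2: "e2 \<in> E'" "cls e2 \<le> a" "a \<le> s" "mY b + mm e' = mY a + mm e2" "ee e2 = ee e'" "e2 < e'"
    using swap[OF e' b] by blast
  have a1: "1 \<le> a" using main[OF e2(1)] e2(2) by simp
  have bs: "b \<le> s" using b cls_s[OF e'] by simp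
  let ?yb = "Poly_Mapping.single (mY b) (1::'k)" and ?ya = "Poly_Mapping.single (mY a) (1::'k)"
  have yp: "?yb \<in> polys_in (pvars s)" "?ya \<in> polys_in (pvars s)" using a1 e2(3) b bs by (auto simp: pvars_def)
  let ?r = "sc ?ya (\<nu> e2) - sc ?yb (\<nu> e')"
  have r: "?r = sc ?yb (\<sigma> e') - sc ?ya (\<sigma> e2)" by (simp only: sc_\<sigma> e2(4,5)) (simp add: algebra_simps)
  have "?r \<in> Ker" unfolding r by (intro Ker_diff Ker_sc yp \<sigma>_Ker e' e2(1))
  moreover have "trm (\<lambda>m e. rk m e < rk (mY b + mm e') (ee e')) ?r"
    by (intro trm_diff sc_\<nu>[OF e'] sc_\<nu>[OF e2(1), of "mY a", unfolded e2(4)[symmetric] e2(5)])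
  ultimately obtain x where x: "trm pnormal x" "trm (\<lambda>m' e1. rk (m' + mm e1) (ee e1) < rk (mY b + mm e') (ee e')) x" "?r = lin_ext \<sigma> x"
    using reduce_Ker by blast
  let ?y = "Poly_Mapping.single e2 ?ya + x"
  let ?t = "Poly_Mapping.single e' ?yb"
  have y: "?y \<in> free_mod s E'" using e2(1) yp(2) pnormal_free[OF x(1)] by simp
  have l: "lin_ext \<sigma> (?t - ?y) = 0"
  proof -
    have "lin_ext \<sigma> (?t - ?y) = sc ?yb (\<sigma> e') - (sc ?ya (\<sigma> e2) + ?r)"
      by (simp only: lin_ext_diff lin_ext_add lin_ext_single x(3)[symmetric])
    also have "\<dots> = 0" unfolding r by simp
    finally show ?thesis .
  qed
  have xk: "trm (\<lambda>m e. ydeg m * K' + e < K' + e') x"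
  proof (rule trm_mono[OF trm_conj[OF x(1,2)]])
    fix m e assume me: "pnormal m e \<and> rk (m + mm e) (ee e) < rk (mY b + mm e') (ee e')"
    show "ydeg m * K' + e < K' + e'"
    proof (rule code_less[OF _ e'])
      show "e \<in> E'" using me by (simp add: pnormal_def)
      show "ydeg m * K + (ydeg (mm e) * K + ee e) < K + (ydeg (mm e') * K + ee e')"
        using me by (simp add: ydeg_add distrib_right add.assoc)
    qed
  qed
  have yk: "trm (\<lambda>m e. ydeg m * K' + e < K' + e') ?y" by (rule trm_add[OF _ xk]) (use e2(6) in simp)
  \<comment> \<open>Only the component of the expected degree is kept; the leading term is
    homogeneous of that degree, so the relation survives the projection.\<close>
  let ?z = "mcomp w bd' (bd' e' + v) ?y"
  have t: "mhom w bd' (bd' e' + v) ?t" using wY[OF b(1) bs] by (auto simp: mhom_def)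
  have tf: "?t - ?y \<in> free_mod s E'" using y e' yp by simp
  have "lin_ext \<sigma> (?t - ?z) = lin_ext \<sigma> (mcomp w bd' (bd' e' + v) (?t - ?y))"
    by (simp only: mono_mcomp_diff mcomp_of_mhom[OF t])
  also have "\<dots> = mcomp w bd (bd' e' + v) (lin_ext \<sigma> (?t - ?y))"
    by (rule mcomp_lin_ext[symmetric]) (use tf \<sigma>_mhom in \<open>auto simp: free_mod_def\<close>)
  also have "\<dots> = 0" by (simp add: l)
  finally have "lin_ext \<sigma> (?t - ?z) = 0" .
  then show ?thesis using mcomp_free_mod[OF y] trm_mcomp[OF yk] mcomp_mhom by blast
qed

end

text \<open>Basis elements are sequences of numbers between 1 and \<open>s\<close>, written as numerals in base \<open>s + 1\<close>.
  The relation with leading term \<open>y_f y_c\<close>, where \<open>f \<le> c\<close>, has the digits \<open>c, f, c\<close>, and each further step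
  appends a number smaller than the last digit, which is the class. The duplicate \<open>c\<close> makes the order
  of the codes compatible with exchanging a non-multiplicative variable.\<close>

definition quadratic_code :: "nat \<Rightarrow> nat \<Rightarrow> nat \<Rightarrow> nat" where "quadratic_code s f c = (c * (s + 1) + f) * (s + 1) + c"

definition quadratic_codes :: "nat \<Rightarrow> nat set" where "quadratic_codes s = {quadratic_code s f c | f c. 1 \<le> f \<and> f \<le> c \<and> c \<le> s}"

primrec pommaret_basis :: "nat \<Rightarrow> nat \<Rightarrow> nat set" where
  "pommaret_basis s 0 = {0}"
| "pommaret_basis s (Suc i) = (if i = 0 then quadratic_codes s else {e * (s + 1) + b | e b. e \<in> pommaret_basis s i \<and> 1 \<le> b \<and> b < e mod (s + 1)})"

text \<open>Codes in step \<open>i\<close> have \<open>i + 2\<close> digits in base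
  \<open>s + 1\<close>, while step 0 has the single code 0. Weighting \<open>ydeg\<close> by this
  bound makes the degree in the y count before the code.\<close>

definition pommaret_bound :: "nat \<Rightarrow> nat \<Rightarrow> nat" where "pommaret_bound s i = (if i = 0 then 1 else (s + 1) ^ (i + 2))"

definition pommaret_degree :: "nat \<Rightarrow> nat \<Rightarrow> nat" where "pommaret_degree v i = (if i = 0 then 0 else (i + 1) * v)"

lemma step_decode:
  fixes b e s :: nat
  assumes "b \<le> s" shows "(e * (s + 1) + b) mod (s + 1) = b" "(e * (s + 1) + b) div (s + 1) = e"
proof -
  have "(b + e * (s + 1)) mod (s + 1) = b mod (s + 1)" by (rule mod_mult_self1)
  moreover have "b mod (s + 1) = b" using assms by (intro mod_less) simp
  ultimately show "(e * (s + 1) + b) mod (s + 1) = b" by (simp only: add.commute[of "e * (s + 1)" b])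
  have "(b + e * (s + 1)) div (s + 1) = e + b div (s + 1)" by (rule div_mult_self1) simp
  moreover have "b div (s + 1) = 0" using assms by (intro div_less) simp
  ultimately show "(e * (s + 1) + b) div (s + 1) = e" by (simp only: add.commute[of "e * (s + 1)" b] add_0_right)
qed

lemma quadratic_decode:
  assumes "f \<le> s" "c \<le> s" shows "quadratic_code s f c mod (s + 1) = c" "quadratic_code s f c div (s + 1) mod (s + 1) = f"
  unfolding quadratic_code_def step_decode[OF assms(2)] step_decode[OF assms(1)] by (rule refl)+

lemma pommaret_basis_class: "e \<in> pommaret_basis s (Suc i) \<Longrightarrow> 1 \<le> e mod (s + 1) \<and> e mod (s + 1) \<le> s"
proof (cases i)
  case 0
  assume "e \<in> pommaret_basis s (Suc i)"
  then obtain f c where "e = quadratic_code s f c" "1 \<le> f" "f \<le> c" "c \<le> s" using 0 by (auto simp: quadratic_codes_def)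
  then show ?thesis using quadratic_decode(1)[of f s c] by simp
next
  case (Suc j)
  assume "e \<in> pommaret_basis s (Suc i)"
  then obtain d b where *: "e = d * (s + 1) + b" "1 \<le> b" "b < d mod (s + 1)" using Suc by auto
  have "d mod (s + 1) < s + 1" by simp
  from this *(3) have "b \<le> s" by linarith
  then show ?thesis using step_decode(1)[of b s d] * by simp
qed

lemma finite_pommaret_basis: "finite (pommaret_basis s i)"
proof (induction i)
  case (Suc i)
  show ?case
  proof (cases "i = 0")
    case True
    have "quadratic_codes s \<subseteq> (\<lambda>(f, c). quadratic_code s f c) ` ({..s} \<times> {..s})" by (force simp: quadratic_codes_def)
    then show ?thesis using True finite_subset by fastforce
  next
    case False
    have "{e * (s + 1) + b | e b. e \<in> pommaret_basis s i \<and> 1 \<le> b \<and> b < e mod (s + 1)} \<subseteq> (\<lambda>(e, b). e * (s + 1) + b) ` (pommaret_basis s i \<times> {..s + 1})"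
    proof clarify
      fix e b assume e: "e \<in> pommaret_basis s i" and b: "b < e mod (s + 1)"
      have "e mod (s + 1) < s + 1" by simp
      from this b have "b \<le> s + 1" by linarith
      with e show "e * (s + 1) + b \<in> (\<lambda>(e, b). e * (s + 1) + b) ` (pommaret_basis s i \<times> {..s + 1})"
        by (intro image_eqI[of _ _ "(e, b)"]) auto
    qed
    then show ?thesis using False Suc finite_subset by fastforce
  qed
qed simp

lemma min_Y:
  assumes "Y a0 \<in> Poly_Mapping.keys m"
  obtains a where "a \<le> a0" "Y a \<in> Poly_Mapping.keys m" "\<And>a'. Y a' \<in> Poly_Mapping.keys m \<Longrightarrow> a \<le> a'"
proof -
  define a where "a = (LEAST a. Y a \<in> Poly_Mapping.keys m)"
  have "Y a \<in> Poly_Mapping.keys m" unfolding a_def by (rule LeastI[of "\<lambda>a. Y a \<in> Poly_Mapping.keys m", OF assms])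
  moreover have "a \<le> a'" if "Y a' \<in> Poly_Mapping.keys m" for a' unfolding a_def by (rule Least_le[of "\<lambda>a. Y a \<in> Poly_Mapping.keys m", OF that])
  ultimately show thesis using that assms by blast
qed

lemma keys_minus_mY: "Poly_Mapping.keys (m - mY a) \<subseteq> Poly_Mapping.keys m"
  by (auto simp: in_keys_iff lookup_minus)

lemma Vc_of_min:
  assumes "Poly_Mapping.keys m \<subseteq> pvars s" "\<And>a'. Y a' \<in> Poly_Mapping.keys m \<Longrightarrow> a \<le> a'"
  shows "Poly_Mapping.keys m \<subseteq> Vc s a"
  using assms by (fastforce simp: pvars_def Vc_def)

text \<open>The least index of a y dividing \<open>m\<close> serves as \<open>a\<close>: it is below
  the class, and what remains of \<open>m\<close> is multiplicative for it.\<close>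

lemma Vc_split:
  assumes "Poly_Mapping.keys m \<subseteq> pvars s" "\<not> Poly_Mapping.keys m \<subseteq> Vc s c"
  obtains a m' where "1 \<le> a" "a < c" "Poly_Mapping.keys m' \<subseteq> Vc s a" "m = m' + mY a"
proof -
  obtain u where u: "u \<in> Poly_Mapping.keys m" "u \<notin> Vc s c" using assms(2) by blast
  then obtain a0 where a0: "u = Y a0" "1 \<le> a0" "a0 \<le> s" using assms(1) by (auto simp: pvars_def Vc_def)
  then have "a0 < c" using u(2) by (auto simp: Vc_def)
  obtain a where a: "a \<le> a0" "Y a \<in> Poly_Mapping.keys m" "\<And>a'. Y a' \<in> Poly_Mapping.keys m \<Longrightarrow> a \<le> a'"
    by (rule min_Y[of a0 m]) (use u(1) a0(1) in auto)
  have "1 \<le> a" using a(2) assms(1) by (auto simp: pvars_def)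
  moreover have "Poly_Mapping.keys (m - mY a) \<subseteq> Vc s a"
    using keys_minus_mY[of m a] Vc_of_min[OF assms(1) a(3)] by blast
  ultimately show thesis using that[of a "m - mY a"] split_mY[OF a(2)] a(1) \<open>a0 < c\<close> by simp
qed

text \<open>Both indices are the least index of a y in the common product.\<close>

lemma Vc_mY_unique:
  assumes "m1 + mY a1 = m2 + mY a2" "Poly_Mapping.keys m1 \<subseteq> Vc s a1" "Poly_Mapping.keys m2 \<subseteq> Vc s a2"
  shows "a1 = a2"
proof -
  have k: "Poly_Mapping.keys (m1 + mY a1) = Poly_Mapping.keys m1 \<union> {Y a1}" "Poly_Mapping.keys (m2 + mY a2) = Poly_Mapping.keys m2 \<union> {Y a2}"
    by (simp_all add: keys_plus_nat)
  have "Y a1 \<in> Poly_Mapping.keys m2 \<union> {Y a2}" "Y a2 \<in> Poly_Mapping.keys m1 \<union> {Y a1}" using assms(1) k by (auto simp: set_eq_iff)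
  moreover have "a2 \<le> a1" if "Y a1 \<in> Vc s a2" for a1 a2 using that by (auto simp: Vc_def)
  ultimately have "a2 \<le> a1" "a1 \<le> a2" using assms(2,3) by blast+
  then show ?thesis by simp
qed

lemma Vc_antimono: "a \<le> b \<Longrightarrow> Vc s b \<subseteq> Vc s a" by (auto simp: Vc_def)

lemma pommaret_basis_1 [simp]: "pommaret_basis s (Suc 0) = quadratic_codes s" by simp

lemma pommaret_basis_Suc: "pommaret_basis s (Suc (Suc i)) = {e * (s + 1) + b | e b. e \<in> pommaret_basis s (Suc i) \<and> 1 \<le> b \<and> b < e mod (s + 1)}"
  by (simp only: pommaret_basis.simps(2)[of s "Suc i"] nat.distinct if_False)

declare pommaret_basis.simps(2) [simp del]

lemma ydeg_pos: "ydeg m \<ge> 1 \<Longrightarrow> \<exists>a. Y a \<in> Poly_Mapping.keys m"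
proof (rule ccontr)
  assume "\<nexists>a. Y a \<in> Poly_Mapping.keys m" "ydeg m \<ge> 1"
  then have "(case u of Y a \<Rightarrow> 1 | _ \<Rightarrow> (0::nat)) = 0" if "u \<in> Poly_Mapping.keys m" for u
    using that by (cases u) auto
  then have "ydeg m = 0" unfolding ydeg_def wdeg_def by (intro sum.neutral) simp
  then show False using \<open>ydeg m \<ge> 1\<close> by simp
qed

lemma code_mono: "A < B \<Longrightarrow> a \<le> s \<Longrightarrow> A * (s + 1) + a < B * (s + 1) + (b::nat)"
proof -
  assume "A < B" "a \<le> s"
  then have "(A + 1) * (s + 1) \<le> B * (s + 1)" by (intro mult_right_mono) simp_all
  then show ?thesis using \<open>a \<le> s\<close> by simp
qed

lemma E1_less: "f' \<le> s \<Longrightarrow> c' \<le> s \<Longrightarrow> c' < c \<or> c' = c \<and> f' < f \<Longrightarrow> quadratic_code s f' c' < quadratic_code s f c"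
proof -
  assume a: "f' \<le> s" "c' \<le> s" "c' < c \<or> c' = c \<and> f' < f"
  have "c' * (s + 1) + f' < c * (s + 1) + f" using a(3) code_mono[OF _ a(1), of c' c f] by auto
  then show ?thesis unfolding quadratic_code_def by (rule code_mono[OF _ a(2)])
qed

lemma E1_bound: "f \<le> s \<Longrightarrow> c \<le> s \<Longrightarrow> quadratic_code s f c < (s + 1) ^ 3"
proof -
  assume a: "f \<le> s" "c \<le> s"
  have "c * (s + 1) + f < (s + 1) * (s + 1) + 0" by (rule code_mono) (use a in auto)
  then have "quadratic_code s f c < ((s + 1) * (s + 1)) * (s + 1) + 0" unfolding quadratic_code_def by (intro code_mono) (use a in auto)
  then show ?thesis by (simp only: power3_eq_cube add_0_right)
qed

definition quadratic_mon :: "nat \<Rightarrow> nat \<Rightarrow> (var \<Rightarrow>\<^sub>0 nat)" where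
  "quadratic_mon s e = mY (e div (s + 1) mod (s + 1)) + mY (e mod (s + 1))"

lemma quadratic_mon_code: "f \<le> s \<Longrightarrow> c \<le> s \<Longrightarrow> quadratic_mon s (quadratic_code s f c) = mY f + mY c"
  unfolding quadratic_mon_def quadratic_decode ..

lemma quadratic_codesE:
  assumes "e \<in> quadratic_codes s"
  obtains f c where "e = quadratic_code s f c" "1 \<le> f" "f \<le> c" "c \<le> s" "f \<le> s" "e mod (s + 1) = c" "quadratic_mon s e = mY f + mY c"
proof -
  obtain f c where *: "e = quadratic_code s f c" "1 \<le> f" "f \<le> c" "c \<le> s" using assms by (auto simp: quadratic_codes_def)
  then have f: "f \<le> s" by simp
  show thesis by (rule that[OF * f]) (simp_all only: *(1) quadratic_decode(1)[OF f *(4)] quadratic_mon_code[OF f *(4)])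
qed

text \<open>\<open>f\<close> and \<open>c\<close> are the two least indices of the y in
  \<open>m\<close>, with multiplicity; all other factors are multiplicative for the class
  \<open>c\<close>.\<close>

lemma quadratic_split:
  assumes "Poly_Mapping.keys m \<subseteq> pvars s" "2 \<le> ydeg m"
  obtains f c m' where "1 \<le> f" "f \<le> c" "c \<le> s" "Poly_Mapping.keys m' \<subseteq> Vc s c" "m = m' + (mY f + mY c)"
proof -
  obtain a0 where "Y a0 \<in> Poly_Mapping.keys m" using ydeg_pos[of m] assms(2) by auto
  then obtain f where "f \<le> a0" and f: "Y f \<in> Poly_Mapping.keys m" "\<And>a'. Y a' \<in> Poly_Mapping.keys m \<Longrightarrow> f \<le> a'" by (rule min_Y) blast
  define m1 where "m1 = m - mY f"
  have m: "m = m1 + mY f" unfolding m1_def by (rule split_mY[OF f(1)])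
  have k1: "Poly_Mapping.keys m1 \<subseteq> Poly_Mapping.keys m" unfolding m1_def by (rule keys_minus_mY)
  have "1 \<le> ydeg m1" using assms(2) by (simp add: m ydeg_add)
  then obtain a1 where "Y a1 \<in> Poly_Mapping.keys m1" using ydeg_pos by blast
  then obtain c where "c \<le> a1" and c: "Y c \<in> Poly_Mapping.keys m1" "\<And>a'. Y a' \<in> Poly_Mapping.keys m1 \<Longrightarrow> c \<le> a'" by (rule min_Y) blast
  define m' where "m' = m1 - mY c"
  have m1: "m1 = m' + mY c" unfolding m'_def by (rule split_mY[OF c(1)])
  have "Poly_Mapping.keys m1 \<subseteq> Vc s c" by (rule Vc_of_min[OF order_trans[OF k1 assms(1)] c(2)])
  then have "Poly_Mapping.keys m' \<subseteq> Vc s c" unfolding m'_def using keys_minus_mY by blast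
  moreover have "f \<le> c" using f(2) c(1) k1 by blast
  moreover have "1 \<le> f" "c \<le> s" using f(1) c(1) k1 assms(1) by (auto simp: pvars_def)
  moreover have "m = m' + (mY f + mY c)" unfolding m m1 by (simp add: add_ac)
  ultimately show thesis using that by blast
qed

lemma pommaret_bound_simps: "pommaret_bound s 0 = 1" "pommaret_bound s (Suc 0) = (s + 1) ^ 3" "pommaret_bound s (Suc (Suc i)) = pommaret_bound s (Suc i) * (s + 1)"
  by (simp_all add: pommaret_bound_def numeral_3_eq_3)

lemma pommaret_degree_simps: "pommaret_degree v 0 = 0" "pommaret_degree v (Suc 0) = 2 * v" "pommaret_degree v (Suc (Suc i)) = pommaret_degree v (Suc i) + v"
  by (simp_all add: pommaret_degree_def)

lemma pommaret_basis_SS: "e' \<in> pommaret_basis s (Suc (Suc i)) \<longleftrightarrow> e' div (s + 1) \<in> pommaret_basis s (Suc i) \<and> 1 \<le> e' mod (s + 1) \<and> e' mod (s + 1) < e' div (s + 1) mod (s + 1)"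
  (is "?l \<longleftrightarrow> ?r")
proof
  assume ?l
  then obtain e b where *: "e' = e * (s + 1) + b" "e \<in> pommaret_basis s (Suc i)" "1 \<le> b" "b < e mod (s + 1)"
    unfolding pommaret_basis_Suc by blast
  have "b \<le> s" using *(4) conjunct2[OF pommaret_basis_class[OF *(2)]] by linarith
  then have "e' mod (s + 1) = b" "e' div (s + 1) = e" unfolding *(1) by (rule step_decode)+
  then show ?r using * by simp
next
  assume r: ?r
  have "e' = e' div (s + 1) * (s + 1) + e' mod (s + 1)" by (simp only: div_mult_mod_eq)
  with r show ?l unfolding pommaret_basis_Suc by blast
qed

lemma pommaret_basis_code: "e \<in> pommaret_basis s (Suc i) \<Longrightarrow> 1 \<le> b \<Longrightarrow> b < e mod (s + 1) \<Longrightarrow> e * (s + 1) + b \<in> pommaret_basis s (Suc (Suc i))"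
  unfolding pommaret_basis_Suc by blast

text \<open>The interface between consecutive steps. Injectivity on multiplicative combinations
  becomes T4 of the next step, and the relations for non-multiplicative variables become its
  generators, with \<open>y\<close> as the remainder \<nu>.\<close>

definition pommaret_inv :: "nat \<Rightarrow> (var \<Rightarrow> nat) \<Rightarrow> nat \<Rightarrow> nat \<Rightarrow> (nat \<Rightarrow> (nat \<Rightarrow>\<^sub>0 (var, 'k::field) mpoly)) \<Rightarrow> bool" where
  "pommaret_inv s w v i D \<longleftrightarrow>
    (\<forall>e\<in>pommaret_basis s (Suc i). D e \<in> free_mod s (pommaret_basis s i) \<and> mhom w (\<lambda>_. pommaret_degree v i) (pommaret_degree v (Suc i)) (D e)) \<and>
    (\<forall>x. trm (\<lambda>m e. e \<in> pommaret_basis s (Suc i) \<and> Poly_Mapping.keys m \<subseteq> Vc s (e mod (s + 1))) x \<longrightarrow> lin_ext D x = 0 \<longrightarrow> x = 0) \<and>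
    (\<forall>e\<in>pommaret_basis s (Suc i). \<forall>b. 1 \<le> b \<longrightarrow> b < e mod (s + 1) \<longrightarrow>
      (\<exists>y\<in>free_mod s (pommaret_basis s (Suc i)). trm (\<lambda>m e'. ydeg m * pommaret_bound s (Suc i) + e' < pommaret_bound s (Suc i) + e) y \<and>
        mhom w (\<lambda>_. pommaret_degree v (Suc i)) (pommaret_degree v (Suc i) + v) y \<and> lin_ext D (Poly_Mapping.single e (Poly_Mapping.single (mY b) 1) - y) = 0))"

lemma pommaret_inv_D:
  assumes "pommaret_inv s w v i D"
  shows "e \<in> pommaret_basis s (Suc i) \<Longrightarrow> D e \<in> free_mod s (pommaret_basis s i)"
    "e \<in> pommaret_basis s (Suc i) \<Longrightarrow> mhom w (\<lambda>_. pommaret_degree v i) (pommaret_degree v (Suc i)) (D e)"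
    "trm (\<lambda>m e. e \<in> pommaret_basis s (Suc i) \<and> Poly_Mapping.keys m \<subseteq> Vc s (e mod (s + 1))) x \<Longrightarrow> lin_ext D x = 0 \<Longrightarrow> x = 0"
    "e \<in> pommaret_basis s (Suc i) \<Longrightarrow> 1 \<le> b \<Longrightarrow> b < e mod (s + 1) \<Longrightarrow>
      \<exists>y\<in>free_mod s (pommaret_basis s (Suc i)). trm (\<lambda>m e'. ydeg m * pommaret_bound s (Suc i) + e' < pommaret_bound s (Suc i) + e) y \<and>
        mhom w (\<lambda>_. pommaret_degree v (Suc i)) (pommaret_degree v (Suc i) + v) y \<and> lin_ext D (Poly_Mapping.single e (Poly_Mapping.single (mY b) 1) - y) = 0"
  using assms unfolding pommaret_inv_def by blast+

lemma pommaret_inv_of_step: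
  assumes "pommaret_step s w v (pommaret_basis s i) (pommaret_basis s (Suc i)) K (pommaret_bound s (Suc i)) mm ee (\<lambda>e. e mod (s + 1)) Ker N \<nu> (\<lambda>_. pommaret_degree v i) (\<lambda>_. pommaret_degree v (Suc i))"
  shows "pommaret_inv s w v i (pommaret_step.\<sigma> mm ee \<nu>)" "Ker = lin_ext (pommaret_step.\<sigma> mm ee \<nu>) ` free_mod s (pommaret_basis s (Suc i))"
proof -
  interpret pommaret_step s w v "pommaret_basis s i" "pommaret_basis s (Suc i)" K "pommaret_bound s (Suc i)" mm ee "\<lambda>e. e mod (s + 1)" Ker N \<nu> "\<lambda>_. pommaret_degree v i" "\<lambda>_. pommaret_degree v (Suc i)"
    by (rule assms)
  show "Ker = lin_ext \<sigma> ` free_mod s (pommaret_basis s (Suc i))" by (rule Ker_eq)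
  show "pommaret_inv s w v i \<sigma>" unfolding pommaret_inv_def
  proof (intro conjI ballI allI impI)
    fix x assume x: "trm (\<lambda>m e. e \<in> pommaret_basis s (Suc i) \<and> Poly_Mapping.keys m \<subseteq> Vc s (e mod (s + 1))) x" "lin_ext \<sigma> x = 0"
    have eq: "pnormal = (\<lambda>m e. e \<in> pommaret_basis s (Suc i) \<and> Poly_Mapping.keys m \<subseteq> Vc s (e mod (s + 1)))"
      by (intro ext) (simp only: pnormal_def)
    have "trm pnormal x" using x(1) unfolding eq .
    then show "x = 0" by (rule \<sigma>_injective[OF _ x(2)])
  next
    fix e b assume "e \<in> pommaret_basis s (Suc i)" "1 \<le> b" "b < e mod (s + 1)"
    then show "\<exists>y\<in>free_mod s (pommaret_basis s (Suc i)). trm (\<lambda>m e'. ydeg m * pommaret_bound s (Suc i) + e' < pommaret_bound s (Suc i) + e) y \<and>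
        mhom w (\<lambda>_. pommaret_degree v (Suc i)) (pommaret_degree v (Suc i) + v) y \<and> lin_ext \<sigma> (Poly_Mapping.single e (Poly_Mapping.single (mY b) 1) - y) = 0"
      by (rule next_relation)
  qed (auto intro: \<sigma>_free \<sigma>_mhom)
qed

text \<open>In this and all later steps the leading terms are a single non-multiplicative
  \<open>y_b\<close> times a basis vector, and the normal terms are the multiplicative ones, on
  which the previous differential is injective.\<close>

lemma pommaret_inv_step:
  assumes wY: "\<And>a. 1 \<le> a \<Longrightarrow> a \<le> s \<Longrightarrow> w (Y a) = v" and pommaret_inv: "pommaret_inv s w v i (D :: nat \<Rightarrow> (nat \<Rightarrow>\<^sub>0 (var, 'k::field) mpoly))"
  shows "\<exists>D'. pommaret_inv s w v (Suc i) D' \<and>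
    {u \<in> free_mod s (pommaret_basis s (Suc i)). lin_ext D u = 0} = lin_ext D' ` free_mod s (pommaret_basis s (Suc (Suc i)))"
proof -
  let ?E = "pommaret_basis s (Suc i)" and ?E' = "pommaret_basis s (Suc (Suc i))" and ?K = "pommaret_bound s (Suc i)" and ?K' = "pommaret_bound s (Suc (Suc i))"
  let ?ee = "\<lambda>e. e div (s + 1)" and ?cls = "\<lambda>e. e mod (s + 1)"
  let ?mm = "\<lambda>e. mY (e mod (s + 1))"
  have "\<forall>e\<in>?E'. \<exists>y. y \<in> free_mod s ?E \<and> trm (\<lambda>m e'. ydeg m * ?K + e' < ?K + ?ee e) y \<and>
      mhom w (\<lambda>_. pommaret_degree v (Suc i)) (pommaret_degree v (Suc i) + v) y \<and>
      lin_ext D (Poly_Mapping.single (?ee e) (Poly_Mapping.single (?mm e) 1) - y) = 0"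
  proof
    fix e assume "e \<in> ?E'"
    then have "?ee e \<in> ?E" "1 \<le> ?cls e" "?cls e < ?cls (?ee e)" unfolding pommaret_basis_SS by simp_all
    from pommaret_inv_D(4)[OF pommaret_inv this] show "\<exists>y. y \<in> free_mod s ?E \<and> trm (\<lambda>m e'. ydeg m * ?K + e' < ?K + ?ee e) y \<and>
      mhom w (\<lambda>_. pommaret_degree v (Suc i)) (pommaret_degree v (Suc i) + v) y \<and>
      lin_ext D (Poly_Mapping.single (?ee e) (Poly_Mapping.single (?mm e) 1) - y) = 0" by blast
  qed
  from bchoice[OF this] obtain \<nu> where \<nu>: "\<And>e. e \<in> ?E' \<Longrightarrow> \<nu> e \<in> free_mod s ?E \<and> trm (\<lambda>m e'. ydeg m * ?K + e' < ?K + ?ee e) (\<nu> e) \<and>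
      mhom w (\<lambda>_. pommaret_degree v (Suc i)) (pommaret_degree v (Suc i) + v) (\<nu> e) \<and>
      lin_ext D (Poly_Mapping.single (?ee e) (Poly_Mapping.single (?mm e) 1) - \<nu> e) = 0" by blast
  let ?Ker = "{u \<in> free_mod s ?E. lin_ext D u = 0}"
  let ?N = "\<lambda>m e. e \<in> ?E \<and> Poly_Mapping.keys m \<subseteq> Vc s (e mod (s + 1))"
  have mem: "?ee e \<in> ?E" "1 \<le> ?cls e" "?cls e < ?cls (?ee e)" "?cls e \<le> s" if "e \<in> ?E'" for e
    using that pommaret_basis_class[OF that] unfolding pommaret_basis_SS by simp_all
  have "pommaret_step s w v ?E ?E' ?K ?K' ?mm ?ee ?cls ?Ker ?N \<nu> (\<lambda>_. pommaret_degree v (Suc i)) (\<lambda>_. pommaret_degree v (Suc (Suc i)))"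
  proof
    show "?Ker \<subseteq> free_mod s ?E" "0 \<in> ?Ker" by auto
    show "x + y \<in> ?Ker" if "x \<in> ?Ker" "y \<in> ?Ker" for x y using that by (simp add: lin_ext_add)
    show "sc p x \<in> ?Ker" if "p \<in> polys_in (pvars s)" "x \<in> ?Ker" for p x using that by (simp add: lin_ext_sc)
    show "?ee e' \<in> ?E \<and> Poly_Mapping.keys (?mm e') \<subseteq> pvars s \<and> 1 \<le> ?cls e'" if "e' \<in> ?E'" for e'
      using mem[OF that] by (simp add: pvars_def)
    show "?N m e \<or> (\<exists>e'\<in>?E'. \<exists>m'. Poly_Mapping.keys m' \<subseteq> Vc s (?cls e') \<and> m = m' + ?mm e' \<and> e = ?ee e')"
      if m: "Poly_Mapping.keys m \<subseteq> pvars s" and e: "e \<in> ?E" for m e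
    proof (cases "Poly_Mapping.keys m \<subseteq> Vc s (?cls e)")
      case False
      obtain a m' where a: "1 \<le> a" "a < ?cls e" "Poly_Mapping.keys m' \<subseteq> Vc s a" "m = m' + mY a" by (rule Vc_split[OF m False])
      have as: "a \<le> s" using a(2) conjunct2[OF pommaret_basis_class[OF e]] by linarith
      show ?thesis
        by (intro disjI2 bexI[of _ "e * (s + 1) + a"] exI[of _ m'] pommaret_basis_code e a(1,2))
          (use a(3,4) in \<open>simp add: step_decode[OF as, simplified]\<close>)
    qed (use e in simp)
    show "e1 = e2" if e12: "e1 \<in> ?E'" "e2 \<in> ?E'" and k: "Poly_Mapping.keys m1 \<subseteq> Vc s (?cls e1)" "Poly_Mapping.keys m2 \<subseteq> Vc s (?cls e2)"
      "m1 + ?mm e1 = m2 + ?mm e2" "?ee e1 = ?ee e2" for e1 e2 m1 m2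
      using Vc_mY_unique[OF k(3,1,2)] k(4) by (metis div_mult_mod_eq)
    show "\<nu> e' \<in> free_mod s ?E \<and> trm (\<lambda>m e. ydeg m * ?K + e < ydeg (?mm e') * ?K + ?ee e') (\<nu> e') \<and>
      mhom w (\<lambda>_. pommaret_degree v (Suc i)) (pommaret_degree v (Suc (Suc i))) (\<nu> e') \<and> Poly_Mapping.single (?ee e') (Poly_Mapping.single (?mm e') 1) - \<nu> e' \<in> ?Ker"
      if e': "e' \<in> ?E'" for e'
    proof -
      have "Poly_Mapping.single (?ee e') (Poly_Mapping.single (?mm e') (1::'k)) \<in> free_mod s ?E"
        by (rule free_mod_single) (use mem[OF e'] in \<open>simp_all add: pvars_def\<close>)
      then show ?thesis using \<nu>[OF e'] by (simp add: pommaret_degree_simps)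
    qed
    show "u = 0" if "u \<in> ?Ker" "trm ?N u" for u using pommaret_inv_D(3)[OF pommaret_inv that(2)] that(1) by simp
    show "pommaret_degree v (Suc (Suc i)) = pommaret_degree v (Suc i) + wdeg w (?mm e')" if "e' \<in> ?E'" for e'
      using mem[OF that] wY[of "?cls e'"] by (simp add: pommaret_degree_simps)
    show "w (Y a) = v" if "1 \<le> a" "a \<le> s" for a using wY that by blast
    show "?cls e' \<le> s" if "e' \<in> ?E'" for e' using mem[OF that] by simp
    show "\<exists>e2\<in>?E'. \<exists>a. ?cls e2 \<le> a \<and> a \<le> s \<and> mY b + ?mm e' = mY a + ?mm e2 \<and> ?ee e2 = ?ee e' \<and> e2 < e'"
      if e': "e' \<in> ?E'" and b: "1 \<le> b" "b < ?cls e'" for e' b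
    proof -
      \<comment> \<open>The last digit is exchanged for \<open>b\<close>. The old last digit exceeds
        \<open>b\<close>, so its variable is multiplicative for the new code.\<close>
      let ?e2 = "?ee e' * (s + 1) + b"
      have bs: "b \<le> s" using b(2) mem(4)[OF e'] by linarith
      have d: "?cls ?e2 = b" "?ee ?e2 = ?ee e'" using step_decode[OF bs] by blast+
      have l: "?e2 < e'" using b(2) by (metis div_mult_mod_eq nat_add_left_cancel_less)
      have m: "?e2 \<in> ?E'" by (rule pommaret_basis_code[OF mem(1)[OF e'] b(1)]) (use b(2) mem(3)[OF e'] in linarith)
      show ?thesis
      proof (intro bexI[of _ ?e2] exI[of _ "?cls e'"] conjI)
        show "?cls ?e2 \<le> ?cls e'" unfolding d(1) using b(2) by (rule less_imp_le)
        show "mY b + ?mm e' = mY (?cls e') + ?mm ?e2" unfolding d(1) by (rule add.commute)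
      qed (rule mem(4)[OF e'] d(2) l m)+
    qed
    show "k * ?K' + e1 < ?K' + e'" if e1: "e1 \<in> ?E'" "e' \<in> ?E'"
      and l: "k * ?K + (ydeg (?mm e1) * ?K + ?ee e1) < ?K + (ydeg (?mm e') * ?K + ?ee e')" for e1 e' k
    proof -
      \<comment> \<open>All leading terms here have degree 1 in the y; the comparison becomes one of
        leading digits, to which a final digit is appended on both sides.\<close>
      have "k * ?K + ?ee e1 < ?K + ?ee e'" using l by simp
      from code_mono[OF this mem(4)[OF e1(1)], of "?cls e'"]
      have "k * ?K * (s + 1) + (?ee e1 * (s + 1) + ?cls e1) < ?K * (s + 1) + (?ee e' * (s + 1) + ?cls e')"
        by (simp only: distrib_right add.assoc)
      then show ?thesis by (simp only: pommaret_bound_simps(3) div_mult_mod_eq mult.assoc)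
    qed
  qed
  from pommaret_inv_of_step[OF this] show ?thesis by blast
qed

text \<open>The kernel of the presentation is treated as a submodule of the free module of rank one.
  Normal terms have degree at most 1 in the y: \<open>nf\<close> provides the remainders of the
  quadratic terms, \<open>uniq\<close> is T4.\<close>

lemma pommaret_inv_base:
  fixes I0 :: "(var, 'k::field) mpoly set"
  assumes wY: "\<And>a. 1 \<le> a \<Longrightarrow> a \<le> s \<Longrightarrow> w (Y a) = v"
    and I0: "0 \<in> I0" "\<And>p q. p \<in> I0 \<Longrightarrow> q \<in> I0 \<Longrightarrow> p + q \<in> I0" "\<And>p q. p \<in> polys_in (pvars s) \<Longrightarrow> q \<in> I0 \<Longrightarrow> p * q \<in> I0"
    and nf: "\<And>f c. 1 \<le> f \<Longrightarrow> f \<le> c \<Longrightarrow> c \<le> s \<Longrightarrow> \<exists>p\<in>polys_in (pvars s).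
      (\<forall>m\<in>Poly_Mapping.keys p. ydeg m \<le> 1) \<and> homog w (2 * v) p \<and> Poly_Mapping.single (mY f + mY c) 1 - p \<in> I0"
    and uniq: "\<And>p. p \<in> I0 \<Longrightarrow> p \<in> polys_in (pvars s) \<Longrightarrow> \<forall>m\<in>Poly_Mapping.keys p. ydeg m \<le> 1 \<Longrightarrow> p = 0"
  shows "\<exists>D. pommaret_inv s w v 0 D \<and> {u \<in> free_mod s {0}. Poly_Mapping.lookup u 0 \<in> I0} = lin_ext D ` free_mod s (pommaret_basis s 1)"
proof -
  let ?E' = "pommaret_basis s (Suc 0)" and ?cls = "\<lambda>e. e mod (s + 1)"
  let ?Ker = "{u \<in> free_mod s {0}. Poly_Mapping.lookup u 0 \<in> I0}"
  have "\<forall>e\<in>?E'. \<exists>p. p \<in> polys_in (pvars s) \<and>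
      (\<forall>m\<in>Poly_Mapping.keys p. ydeg m \<le> 1) \<and> homog w (2 * v) p \<and> Poly_Mapping.single (quadratic_mon s e) 1 - p \<in> I0"
  proof
    fix e assume "e \<in> ?E'"
    then have "e \<in> quadratic_codes s" by simp
    then obtain f c where *: "1 \<le> f" "f \<le> c" "c \<le> s" "quadratic_mon s e = mY f + mY c" by (rule quadratic_codesE)
    show "\<exists>p. p \<in> polys_in (pvars s) \<and>
      (\<forall>m\<in>Poly_Mapping.keys p. ydeg m \<le> 1) \<and> homog w (2 * v) p \<and> Poly_Mapping.single (quadratic_mon s e) 1 - p \<in> I0"
      unfolding *(4) using nf[OF *(1-3)] by blast
  qed
  from bchoice[OF this] obtain \<rho> where \<rho>: "\<And>e. e \<in> ?E' \<Longrightarrow> \<rho> e \<in> polys_in (pvars s) \<and>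
      (\<forall>m\<in>Poly_Mapping.keys (\<rho> e). ydeg m \<le> 1) \<and> homog w (2 * v) (\<rho> e) \<and> Poly_Mapping.single (quadratic_mon s e) 1 - \<rho> e \<in> I0" by blast
  define \<nu> where "\<nu> e = Poly_Mapping.single (0::nat) (\<rho> e)" for e
  have E1E: "\<exists>f c. e = quadratic_code s f c \<and> 1 \<le> f \<and> f \<le> c \<and> c \<le> s \<and> f \<le> s \<and> ?cls e = c \<and> quadratic_mon s e = mY f + mY c" if "e \<in> ?E'" for e
  proof -
    have "e \<in> quadratic_codes s" using that by simp
    then show ?thesis by (rule quadratic_codesE) blast
  qed
  have "pommaret_step s w v (pommaret_basis s 0) ?E' 1 (pommaret_bound s (Suc 0)) (quadratic_mon s) (\<lambda>_. 0) ?cls ?Ker (\<lambda>m e. ydeg m \<le> 1) \<nu> (\<lambda>_. pommaret_degree v 0) (\<lambda>_. pommaret_degree v (Suc 0))"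
  proof
    show "?Ker \<subseteq> free_mod s (pommaret_basis s 0)" "0 \<in> ?Ker" using I0(1) by auto
    show "x + y \<in> ?Ker" if "x \<in> ?Ker" "y \<in> ?Ker" for x y using that I0(2) by (simp add: lookup_add)
    show "sc p x \<in> ?Ker" if "p \<in> polys_in (pvars s)" "x \<in> ?Ker" for p x using that I0(3) by simp
    show "0 \<in> pommaret_basis s 0 \<and> Poly_Mapping.keys (quadratic_mon s e') \<subseteq> pvars s \<and> 1 \<le> ?cls e'" if "e' \<in> ?E'" for e'
      using E1E[OF that] by (auto simp: keys_plus_nat pvars_def)
    show "ydeg m \<le> 1 \<or> (\<exists>e'\<in>?E'. \<exists>m'. Poly_Mapping.keys m' \<subseteq> Vc s (?cls e') \<and> m = m' + quadratic_mon s e' \<and> e = 0)"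
      if m: "Poly_Mapping.keys m \<subseteq> pvars s" and e: "e \<in> pommaret_basis s 0" for m e
    proof (cases "ydeg m \<le> 1")
      case False
      then have "2 \<le> ydeg m" by simp
      with m obtain f c m' where *: "1 \<le> f" "f \<le> c" "c \<le> s" "Poly_Mapping.keys m' \<subseteq> Vc s c" "m = m' + (mY f + mY c)" by (rule quadratic_split)
      have fs: "f \<le> s" using * by simp
      have "quadratic_code s f c \<in> ?E'" using * by (auto simp: quadratic_codes_def)
      moreover have "Poly_Mapping.keys m' \<subseteq> Vc s (?cls (quadratic_code s f c))" unfolding quadratic_decode(1)[OF fs *(3)] by (rule *(4))
      moreover have "m = m' + quadratic_mon s (quadratic_code s f c)" unfolding quadratic_mon_code[OF fs *(3)] by (rule *(5))
      ultimately show ?thesis using e by auto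
    qed simp
    show "e1 = e2" if e12: "e1 \<in> ?E'" "e2 \<in> ?E'" and k: "Poly_Mapping.keys m1 \<subseteq> Vc s (?cls e1)" "Poly_Mapping.keys m2 \<subseteq> Vc s (?cls e2)"
      "m1 + quadratic_mon s e1 = m2 + quadratic_mon s e2" for e1 e2 m1 m2
    proof -
      obtain f1 c1 where 1: "e1 = quadratic_code s f1 c1" "1 \<le> f1" "f1 \<le> c1" "c1 \<le> s" "f1 \<le> s" "?cls e1 = c1" "quadratic_mon s e1 = mY f1 + mY c1" using E1E[OF e12(1)] by blast
      obtain f2 c2 where 2: "e2 = quadratic_code s f2 c2" "1 \<le> f2" "f2 \<le> c2" "c2 \<le> s" "f2 \<le> s" "?cls e2 = c2" "quadratic_mon s e2 = mY f2 + mY c2" using E1E[OF e12(2)] by blast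
      have eq: "(m1 + mY c1) + mY f1 = (m2 + mY c2) + mY f2" using k(3) 1(7) 2(7) by (simp add: add_ac)
      \<comment> \<open>Since \<open>f1 \<le> c1\<close>, everything beside \<open>y_f1\<close> is
        multiplicative for the class \<open>f1\<close>; the lower index is thus determined by the
        product, and after cancelling it so is the other.\<close>
      have k1: "Poly_Mapping.keys (m1 + mY c1) \<subseteq> Vc s f1"
        using k(1) 1(3-6) Vc_antimono[OF 1(3), of s] by (auto simp: keys_plus_nat Vc_def)
      have k2: "Poly_Mapping.keys (m2 + mY c2) \<subseteq> Vc s f2"
        using k(2) 2(3-6) Vc_antimono[OF 2(3), of s] by (auto simp: keys_plus_nat Vc_def)
      have f: "f1 = f2" by (rule Vc_mY_unique[OF eq k1 k2])
      then have "m1 + mY c1 = m2 + mY c2" using eq by simp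
      then have "c1 = c2" using Vc_mY_unique k(1,2) 1(6) 2(6) by blast
      with f show ?thesis using 1(1) 2(1) by simp
    qed
    show "\<nu> e' \<in> free_mod s (pommaret_basis s 0) \<and> trm (\<lambda>m e. ydeg m * 1 + e < ydeg (quadratic_mon s e') * 1 + 0) (\<nu> e') \<and>
      mhom w (\<lambda>_. pommaret_degree v 0) (pommaret_degree v (Suc 0)) (\<nu> e') \<and> Poly_Mapping.single 0 (Poly_Mapping.single (quadratic_mon s e') 1) - \<nu> e' \<in> ?Ker"
      if e': "e' \<in> ?E'" for e'
    proof -
      obtain f c where *: "1 \<le> f" "f \<le> c" "c \<le> s" "f \<le> s" "quadratic_mon s e' = mY f + mY c" using E1E[OF e'] by blast
      have p: "Poly_Mapping.single (quadratic_mon s e') (1::'k) \<in> polys_in (pvars s)" using * by (auto simp: keys_plus_nat pvars_def)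
      note r = \<rho>[OF e']
      have a: "\<nu> e' \<in> free_mod s {0}" using r by (simp add: \<nu>_def)
      have b: "trm (\<lambda>m e. ydeg m * 1 + e < ydeg (quadratic_mon s e') * 1 + 0) (\<nu> e')"
        using r by (auto simp: trm_def \<nu>_def lookup_single when_def *(5) ydeg_add split: if_splits)
      have c: "mhom w (\<lambda>_. pommaret_degree v 0) (pommaret_degree v (Suc 0)) (\<nu> e')"
        using r by (auto simp: mhom_def \<nu>_def pommaret_degree_simps split: if_splits)
      have d: "Poly_Mapping.single 0 (Poly_Mapping.single (quadratic_mon s e') 1) - \<nu> e' \<in> ?Ker"
        using r p a by (simp add: \<nu>_def lookup_minus)
      show ?thesis using a b c d by simp
    qed
    show "u = 0" if "u \<in> ?Ker" "trm (\<lambda>m e. ydeg m \<le> 1) u" for u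
    proof -
      have "Poly_Mapping.lookup u 0 = 0" by (rule uniq) (use that in \<open>auto simp: trm_def free_mod_def\<close>)
      moreover have "Poly_Mapping.lookup u e = 0" if "e \<noteq> 0" for e
        using \<open>u \<in> ?Ker\<close> that by (auto simp: free_mod_def in_keys_iff)
      ultimately show ?thesis by (intro poly_mapping_eqI) (metis lookup_zero)
    qed
    show "pommaret_degree v (Suc 0) = pommaret_degree v 0 + wdeg w (quadratic_mon s e')" if "e' \<in> ?E'" for e'
      using E1E[OF that] wY by (auto simp: pommaret_degree_simps wdeg_add)
    show "w (Y a) = v" if "1 \<le> a" "a \<le> s" for a using wY that by blast
    show "?cls e' \<le> s" if "e' \<in> ?E'" for e' using E1E[OF that] by auto
    show "\<exists>e2\<in>?E'. \<exists>a. ?cls e2 \<le> a \<and> a \<le> s \<and> mY b + quadratic_mon s e' = mY a + quadratic_mon s e2 \<and> 0 = (0::nat) \<and> e2 < e'"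
      if e': "e' \<in> ?E'" and b: "1 \<le> b" "b < ?cls e'" for e' b
    proof -
      obtain f c where *: "e' = quadratic_code s f c" "1 \<le> f" "f \<le> c" "c \<le> s" "f \<le> s" "?cls e' = c" "quadratic_mon s e' = mY f + mY c" using E1E[OF e'] by blast
      \<comment> \<open>The product of \<open>y_b\<close>, \<open>y_f\<close> and \<open>y_c\<close>
        is regrouped with \<open>y_c\<close> as multiplier. The new code is smaller: its first digit
        is below \<open>c\<close>, or \<open>f = c\<close> and its second digit \<open>b\<close> is
        below \<open>f\<close>.\<close>
      define f2 c2 where "f2 = min b f" and "c2 = max b f"
      have fc2: "1 \<le> f2" "f2 \<le> c2" "c2 \<le> s" "f2 \<le> s" using b * by (auto simp: f2_def c2_def)
      let ?e2 = "quadratic_code s f2 c2"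
      have "?e2 \<in> ?E'" using fc2 by (auto simp: quadratic_codes_def)
      moreover have "?cls ?e2 \<le> c" unfolding quadratic_decode(1)[OF fc2(4,3)] using b * by (simp add: c2_def)
      moreover have "mY f2 + mY c2 = mY b + mY f" by (cases "b \<le> f") (simp_all add: f2_def c2_def add.commute)
      then have "mY b + quadratic_mon s e' = mY c + quadratic_mon s ?e2" unfolding quadratic_mon_code[OF fc2(4,3)] *(7) by (simp add: add_ac)
      moreover have "?e2 < e'" unfolding *(1)
        by (rule E1_less[OF fc2(4,3)]) (use b * in \<open>auto simp: f2_def c2_def\<close>)
      ultimately show ?thesis using *(4) by blast
    qed
    show "k * pommaret_bound s (Suc 0) + e1 < pommaret_bound s (Suc 0) + e'" if e1: "e1 \<in> ?E'" "e' \<in> ?E'"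
      and l: "k * 1 + (ydeg (quadratic_mon s e1) * 1 + 0) < 1 + (ydeg (quadratic_mon s e') * 1 + 0)" for e1 e' k
    proof -
      obtain f1 c1 where 1: "e1 = quadratic_code s f1 c1" "c1 \<le> s" "f1 \<le> s" "quadratic_mon s e1 = mY f1 + mY c1" using E1E[OF e1(1)] by blast
      obtain f2 c2 where 2: "quadratic_mon s e' = mY f2 + mY c2" using E1E[OF e1(2)] by blast
      \<comment> \<open>All leading terms have degree 2 in the y, so a strict inequality leaves no
        room for a further y.\<close>
      have "k = 0" using l by (simp add: 1(4) 2 ydeg_add)
      moreover have "e1 < (s + 1) ^ 3" unfolding 1(1) by (rule E1_bound[OF 1(3,2)])
      ultimately show ?thesis by (simp only: pommaret_bound_simps)
    qed
  qed
  from pommaret_inv_of_step[OF this] show ?thesis unfolding One_nat_def by blast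
qed

theorem pommaret_resolution:
  fixes I0 :: "(var, 'k::field) mpoly set"
  assumes wY: "\<And>a. 1 \<le> a \<Longrightarrow> a \<le> s \<Longrightarrow> w (Y a) = v"
    and I0: "0 \<in> I0" "\<And>p q. p \<in> I0 \<Longrightarrow> q \<in> I0 \<Longrightarrow> p + q \<in> I0" "\<And>p q. p \<in> polys_in (pvars s) \<Longrightarrow> q \<in> I0 \<Longrightarrow> p * q \<in> I0"
    and nf: "\<And>f c. 1 \<le> f \<Longrightarrow> f \<le> c \<Longrightarrow> c \<le> s \<Longrightarrow> \<exists>p\<in>polys_in (pvars s).
      (\<forall>m\<in>Poly_Mapping.keys p. ydeg m \<le> 1) \<and> homog w (2 * v) p \<and> Poly_Mapping.single (mY f + mY c) 1 - p \<in> I0"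
    and uniq: "\<And>p. p \<in> I0 \<Longrightarrow> p \<in> polys_in (pvars s) \<Longrightarrow> \<forall>m\<in>Poly_Mapping.keys p. ydeg m \<le> 1 \<Longrightarrow> p = 0"
  obtains D where "\<And>i e. e \<in> pommaret_basis s (Suc i) \<Longrightarrow> D i e \<in> free_mod s (pommaret_basis s i)"
    "\<And>i e. e \<in> pommaret_basis s (Suc i) \<Longrightarrow> mhom w (\<lambda>_. pommaret_degree v i) (pommaret_degree v (Suc i)) (D i e)"
    "{u \<in> free_mod s {0}. Poly_Mapping.lookup u 0 \<in> I0} = lin_ext (D 0) ` free_mod s (pommaret_basis s 1)"
    "\<And>i. {u \<in> free_mod s (pommaret_basis s (Suc i)). lin_ext (D i) u = 0} = lin_ext (D (Suc i)) ` free_mod s (pommaret_basis s (Suc (Suc i)))"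
proof -
  define P where "P i D \<longleftrightarrow> pommaret_inv s w v i D \<and>
    (i = 0 \<longrightarrow> {u \<in> free_mod s {0}. Poly_Mapping.lookup u 0 \<in> I0} = lin_ext D ` free_mod s (pommaret_basis s 1))" for i and D :: "nat \<Rightarrow> (nat \<Rightarrow>\<^sub>0 (var, 'k) mpoly)"
  define Q where "Q i D D' \<longleftrightarrow> {u \<in> free_mod s (pommaret_basis s (Suc i)). lin_ext D u = 0} = lin_ext D' ` free_mod s (pommaret_basis s (Suc (Suc i)))"
    for i and D D' :: "nat \<Rightarrow> (nat \<Rightarrow>\<^sub>0 (var, 'k) mpoly)"
  have base: "\<exists>D. P 0 D"
  proof -
    obtain D where "pommaret_inv s w v 0 D" "{u \<in> free_mod s {0}. Poly_Mapping.lookup u 0 \<in> I0} = lin_ext D ` free_mod s (pommaret_basis s 1)"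
      using pommaret_inv_base[of s w v I0, OF wY I0 nf uniq] by blast
    then show ?thesis unfolding P_def by blast
  qed
  have step: "\<exists>D'. P (Suc i) D' \<and> Q i D D'" if "P i D" for i D
  proof -
    have "pommaret_inv s w v i D" using that by (simp add: P_def)
    from pommaret_inv_step[of s w v i D, OF wY this] show ?thesis unfolding P_def Q_def by blast
  qed
  obtain D where D: "\<And>i. P i (D i)" "\<And>i. Q i (D i) (D (Suc i))" using dependent_nat_choice[of P Q, OF base step] by blast
  have pommaret_inv: "pommaret_inv s w v i (D i)" for i using D(1)[of i] by (simp add: P_def)
  show thesis
  proof (rule that)
    show "D i e \<in> free_mod s (pommaret_basis s i)" if "e \<in> pommaret_basis s (Suc i)" for i e using pommaret_inv_D(1)[OF pommaret_inv that] .
    show "mhom w (\<lambda>_. pommaret_degree v i) (pommaret_degree v (Suc i)) (D i e)" if "e \<in> pommaret_basis s (Suc i)" for i e using pommaret_inv_D(2)[OF pommaret_inv that] .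
    show "{u \<in> free_mod s {0}. Poly_Mapping.lookup u 0 \<in> I0} = lin_ext (D 0) ` free_mod s (pommaret_basis s 1)"
      using D(1)[of 0] unfolding P_def by blast
    show "{u \<in> free_mod s (pommaret_basis s (Suc i)). lin_ext (D i) u = 0} = lin_ext (D (Suc i)) ` free_mod s (pommaret_basis s (Suc (Suc i)))" for i
      using D(2)[of i] unfolding Q_def .
  qed
qed

text \<open>An element of class \<open>c\<close> has one successor for each \<open>b\<close> from 1
  to \<open>c - 1\<close>, and summing \<open>(b - 1) choose j\<close> over these b gives
  \<open>(c - 1) choose (Suc j)\<close>. Binomial weights are carried along so that the count
  telescopes down to step 1.\<close>

lemma pommaret_basis_sum:
  "(\<Sum>e\<in>pommaret_basis s (Suc (Suc i)). (e mod (s + 1) - 1) choose j) = (\<Sum>e\<in>pommaret_basis s (Suc i). (e mod (s + 1) - 1) choose (Suc j))"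
proof -
  let ?S = "SIGMA e:pommaret_basis s (Suc i). {1..<e mod (s + 1)}"
  let ?f = "\<lambda>(e, b). e * (s + 1) + b"
  have bs: "b \<le> s" if "(e, b) \<in> ?S" for e b
  proof -
    have "e \<in> pommaret_basis s (Suc i)" "b < e mod (s + 1)" using that by auto
    then show ?thesis using conjunct2[OF pommaret_basis_class[of e s i]] by linarith
  qed
  have inj: "inj_on ?f ?S"
  proof (rule inj_onI, clarify)
    fix e b e' b' assume *: "e \<in> pommaret_basis s (Suc i)" "b \<in> {1..<e mod (s + 1)}" "e' \<in> pommaret_basis s (Suc i)" "b' \<in> {1..<e' mod (s + 1)}" "e * (s + 1) + b = e' * (s + 1) + b'"
    have "b \<le> s" "b' \<le> s" using bs * by auto
    then show "e = e' \<and> b = b'" using step_decode[of b s e] step_decode[of b' s e'] *(5) by metis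
  qed
  have "pommaret_basis s (Suc (Suc i)) = ?f ` ?S" unfolding pommaret_basis_Suc by force
  then have "(\<Sum>e\<in>pommaret_basis s (Suc (Suc i)). (e mod (s + 1) - 1) choose j) = (\<Sum>x\<in>?S. ((?f x) mod (s + 1) - 1) choose j)"
    by (simp only: sum.reindex[OF inj] comp_def)
  also have "\<dots> = (\<Sum>(e, b)\<in>?S. (b - 1) choose j)"
  proof (rule sum.cong, rule refl, clarify)
    fix e b assume "e \<in> pommaret_basis s (Suc i)" "b \<in> {1..<e mod (s + 1)}"
    then have "b \<le> s" using bs by auto
    then show "((e * (s + 1) + b) mod (s + 1) - 1) choose j = (b - 1) choose j" by (simp only: step_decode)
  qed
  also have "\<dots> = (\<Sum>e\<in>pommaret_basis s (Suc i). \<Sum>b\<in>{1..<e mod (s + 1)}. (b - 1) choose j)"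
    by (rule sum.Sigma[symmetric]) (simp_all add: finite_pommaret_basis del: pommaret_basis.simps)
  also have "\<dots> = (\<Sum>e\<in>pommaret_basis s (Suc i). (e mod (s + 1) - 1) choose (Suc j))"
  proof (rule sum.cong[OF refl])
    fix e assume "e \<in> pommaret_basis s (Suc i)"
    then obtain c where c: "e mod (s + 1) = Suc c" using pommaret_basis_class[of e s i] by (cases "e mod (s + 1)") auto
    have "(\<Sum>b\<in>{1..<Suc c}. (b - 1) choose j) = (\<Sum>b<c. b choose j)"
      by (rule sum.reindex_bij_witness[of _ Suc "\<lambda>b. b - 1"]) auto
    also have "\<dots> = c choose (Suc j)"
      by (cases c) (simp_all add: lessThan_Suc_atMost sum_choose_upper)
    finally show "(\<Sum>b\<in>{1..<e mod (s + 1)}. (b - 1) choose j) = (e mod (s + 1) - 1) choose (Suc j)" by (simp only: c diff_Suc_1)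
  qed
  finally show ?thesis .
qed

lemma pommaret_basis_sum_iter: "(\<Sum>e\<in>pommaret_basis s (Suc i). (e mod (s + 1) - 1) choose j) = (\<Sum>e\<in>pommaret_basis s (Suc 0). (e mod (s + 1) - 1) choose (i + j))"
proof (induction i arbitrary: j)
  case (Suc i)
  show ?case unfolding pommaret_basis_sum Suc by simp
qed simp

text \<open>Telescoping leaves \<open>(c - 1) choose i\<close> for each pair
  \<open>f \<le> c\<close>. Summation over \<open>f\<close> gives
  \<open>c * ((c - 1) choose i)\<close>, which is \<open>Suc i * (c choose Suc i)\<close>, and
  summation over \<open>c\<close> is the hockey-stick identity.\<close>

lemma card_pommaret_basis: "card (pommaret_basis s (Suc i)) = Suc i * ((s + 1) choose (Suc i + 1))"
proof -
  let ?S = "SIGMA c:{1..s}. {1..c}"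
  let ?f = "\<lambda>(c, f). quadratic_code s f c"
  have "card (pommaret_basis s (Suc i)) = (\<Sum>e\<in>pommaret_basis s (Suc i). (e mod (s + 1) - 1) choose 0)" by simp
  also have "\<dots> = (\<Sum>e\<in>quadratic_codes s. (e mod (s + 1) - 1) choose i)" using pommaret_basis_sum_iter[where s = s and i = i and j = 0] by (simp only: pommaret_basis_1 add_0_right)
  also have "quadratic_codes s = ?f ` ?S" by (force simp: quadratic_codes_def image_iff)
  also have "(\<Sum>e\<in>?f ` ?S. (e mod (s + 1) - 1) choose i) = (\<Sum>x\<in>?S. ((?f x) mod (s + 1) - 1) choose i)"
  proof (subst sum.reindex)
    show "inj_on ?f ?S"
    proof (rule inj_onI, clarify)
      fix c f c' f' assume *: "c \<in> {1..s}" "f \<in> {1..c}" "c' \<in> {1..s}" "f' \<in> {1..c'}" "quadratic_code s f c = quadratic_code s f' c'"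
      then have "f \<le> s" "c \<le> s" "f' \<le> s" "c' \<le> s" by auto
      then show "c = c' \<and> f = f'" using quadratic_decode[of f s c] quadratic_decode[of f' s c'] *(5) by metis
    qed
  qed (simp add: comp_def)
  also have "\<dots> = (\<Sum>(c, f)\<in>?S. (c - 1) choose i)"
  proof (rule sum.cong, rule refl, clarify)
    fix c f assume "c \<in> {1..s}" "f \<in> {1..c}"
    then have "f \<le> s" "c \<le> s" by auto
    then show "(quadratic_code s f c mod (s + 1) - 1) choose i = (c - 1) choose i" by (simp only: quadratic_decode)
  qed
  also have "\<dots> = (\<Sum>c\<in>{1..s}. \<Sum>f\<in>{1..c}. (c - 1) choose i)" by (rule sum.Sigma[symmetric]) simp_all
  also have "\<dots> = (\<Sum>c\<in>{1..s}. Suc i * (c choose Suc i))"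
  proof (rule sum.cong[OF refl])
    fix c assume "c \<in> {1..s}"
    then obtain c' where c: "c = Suc c'" by (cases c) auto
    show "(\<Sum>f\<in>{1..c}. (c - 1) choose i) = Suc i * (c choose Suc i)"
      unfolding c Suc_times_binomial by simp
  qed
  also have "\<dots> = Suc i * (\<Sum>c\<in>{1..s}. c choose Suc i)" by (simp only: sum_distrib_left)
  also have "(\<Sum>c\<in>{1..s}. c choose Suc i) = (\<Sum>c\<le>s. c choose Suc i)"
    by (rule sum.mono_neutral_left) auto
  also have "\<dots> = Suc s choose Suc (Suc i)" by (rule sum_choose_upper)
  finally show ?thesis by simp
qed

section \<open>Normal forms for filtered algebras of Laurent series\<close>

definition Vr :: "'k::field fls set \<Rightarrow> nat \<Rightarrow> 'k fls set" where
  "Vr W r = {x \<in> W. x = 0 \<or> - int r \<le> fls_subdegree x}"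

text \<open>What the section ring becomes when its coefficients are expanded in Laurent series at
  \<open>P\<close>, with \<open>W\<close> the expansions of the functions regular away from
  \<open>P\<close>.\<close>

definition Rt :: "'k::field fls set \<Rightarrow> nat \<Rightarrow> 'k fls poly set" where
  "Rt W d = {p. \<forall>m. poly.coeff p m \<in> Vr W (m * d)}"

interpretation polyh: scalar_hom "\<lambda>c :: 'k::field. [:fls_const c:]"
  by unfold_locales (simp_all add: fls_plus_const mult.commute)

definition tgen :: "nat \<Rightarrow> 'k::field fls \<Rightarrow> (nat \<Rightarrow> nat) \<Rightarrow> (nat \<Rightarrow> 'k fls) \<Rightarrow> var \<Rightarrow> 'k fls poly" where
  "tgen q \<zeta> v \<eta> u = (case u of X \<Rightarrow> Polynomial.monom 1 1 | Z \<Rightarrow> Polynomial.monom \<zeta> q | Y a \<Rightarrow> Polynomial.monom (\<eta> a) (v a))"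

lemma monom_power: "Polynomial.monom a k ^ r = Polynomial.monom (a ^ r) (r * k)" for a :: "'r::comm_ring_1"
  by (induction r) (simp_all add: mult_monom monom_0 one_pCons)

lemma wdeg_ge: "u \<in> Poly_Mapping.keys m \<Longrightarrow> w u \<le> wdeg w m"
proof -
  assume u: "u \<in> Poly_Mapping.keys m"
  have "1 * w u \<le> Poly_Mapping.lookup m u * w u" using u by (intro mult_right_mono) (auto simp: in_keys_iff)
  also have "\<dots> \<le> wdeg w m" unfolding wdeg_def by (rule member_le_sum) (use u in auto)
  finally show ?thesis by simp
qed

lemma leading_cancel:
  fixes x y :: "'k::field fls"
  assumes "y \<noteq> 0" "fls_subdegree x = n" "fls_subdegree y = n"
  shows "\<exists>c. x - fls_const c * y = 0 \<or> n < fls_subdegree (x - fls_const c * y)"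
proof -
  let ?c = "fls_nth x n / fls_nth y n"
  let ?z = "x - fls_const ?c * y"
  have y: "fls_nth y n \<noteq> 0" using assms(1,3) nth_fls_subdegree_nonzero by blast
  have "fls_nth ?z k = 0" if "k < n + 1" for k
  proof (cases "k = n")
    case True then show ?thesis using y by simp
  next
    case False
    then have "k < n" using that by simp
    then show ?thesis using assms(2,3) by simp
  qed
  then have "?z \<noteq> 0 \<Longrightarrow> n + 1 \<le> fls_subdegree ?z" by (rule fls_subdegree_geI[rotated])
  then show ?thesis by (intro exI[of _ ?c]) linarith
qed

section \<open>Pole order filtrations and minimal generators\<close>

locale filtered_alg =
  fixes W :: "'k::alg_closed_field fls set"
  assumes Wc: "fls_const c \<in> W" and Wadd: "x \<in> W \<Longrightarrow> y \<in> W \<Longrightarrow> x + y \<in> W" and Wmult: "x \<in> W \<Longrightarrow> y \<in> W \<Longrightarrow> x * y \<in> W"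
begin

abbreviation "V r \<equiv> Vr W r"

lemma V_iff: "x \<in> V r \<longleftrightarrow> x \<in> W \<and> (x = 0 \<or> - int r \<le> fls_subdegree x)"
  by (simp add: Vr_def)

lemma W_0: "0 \<in> W" and W_1: "1 \<in> W" using Wc[of 0] Wc[of 1] by simp_all

lemma W_uminus: "x \<in> W \<Longrightarrow> - x \<in> W"
  using Wmult[OF Wc[of "-1"], of x] by (simp add: fls_const_uminus)

lemma V_0: "0 \<in> V r" by (simp add: V_iff W_0)

lemma V_const: "fls_const c \<in> V r" by (simp add: V_iff Wc)

lemma V_add: "x \<in> V r \<Longrightarrow> y \<in> V r \<Longrightarrow> x + y \<in> V r"
proof -
  assume xy: "x \<in> V r" "y \<in> V r"
  have "- int r \<le> fls_subdegree (x + y)" if "x + y \<noteq> 0"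
  proof (cases "x = 0 \<or> y = 0")
    case False
    then show ?thesis using xy fls_plus_subdegree[OF that] by (auto simp: V_iff)
  qed (use xy that in \<open>auto simp: V_iff\<close>)
  then show ?thesis using xy Wadd by (auto simp: V_iff)
qed

lemma V_mult: "x \<in> V r \<Longrightarrow> y \<in> V r' \<Longrightarrow> x * y \<in> V (r + r')"
  unfolding V_iff using Wmult by (cases "x = 0 \<or> y = 0") auto

lemma V_uminus: "x \<in> V r \<Longrightarrow> - x \<in> V r" unfolding V_iff using W_uminus by simp


lemma V_cmult: "x \<in> V r \<Longrightarrow> fls_const c * x \<in> V r" using V_mult[OF V_const[of c 0], of x r] by simp

lemma V_sum: "(\<And>a. a \<in> A \<Longrightarrow> f a \<in> V r) \<Longrightarrow> sum f A \<in> V r"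
  by (induction A rule: infinite_finite_induct) (auto intro: V_0 V_add)


end

text \<open>A minimal presentation after expansion. \<open>W0\<close> is what remains of
  projectivity: an element without pole is constant.\<close>

locale curve_alg = filtered_alg W for W :: "'k::alg_closed_field fls set" +
  fixes d q s :: nat and \<zeta> :: "'k fls" and v :: "nat \<Rightarrow> nat" and \<eta> :: "nat \<Rightarrow> 'k fls"
  assumes W0: "x \<in> W \<Longrightarrow> 0 \<le> fls_subdegree x \<Longrightarrow> \<exists>c. x = fls_const c"
    and d: "1 \<le> d" and q: "1 \<le> q" and \<zeta>W: "\<zeta> \<in> W" and \<zeta>0: "\<zeta> \<noteq> 0" and \<zeta>deg: "fls_subdegree \<zeta> = - int (q * d)"
    and \<eta>V: "a \<in> {1..s} \<Longrightarrow> \<eta> a \<in> Vr W (v a * d)"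
    and gen: "polyh.ev (tgen q \<zeta> v \<eta>) ` polys_in (pvars s) = Rt W d"
    and min: "U \<subset> pvars s \<Longrightarrow> polyh.ev (tgen q \<zeta> v \<eta>) ` polys_in U \<noteq> Rt W d"
begin

abbreviation "\<Theta> \<equiv> polyh.ev (tgen q \<zeta> v \<eta>)"
abbreviation "wt \<equiv> pweight q v"
abbreviation "S \<equiv> polys_in (pvars s) :: (var, 'k) mpoly set"

text \<open>The presentation map with the grading variable set to 1. As x is the function 1 in
  degree 1, it becomes 1, and on forms of a fixed degree no information is lost.\<close>

definition lgen :: "var \<Rightarrow> 'k fls" where "lgen u = (case u of X \<Rightarrow> 1 | Z \<Rightarrow> \<zeta> | Y a \<Rightarrow> \<eta> a)"
definition L :: "(var, 'k) mpoly \<Rightarrow> 'k fls" where "L = flsh.ev lgen"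

lemma L_simps [simp]: "L 0 = 0" "L 1 = 1" "L (p + p') = L p + L p'" "L (p * p') = L p * L p'" "L (p - p') = L p - L p'" "L (- p) = - L p"
  "L (p ^ k) = L p ^ k" "L (const_poly c) = fls_const c" "L (sum f A) = (\<Sum>x\<in>A. L (f x))"
  unfolding L_def const_poly_def by (simp_all add: flsh.ev_add flsh.ev_mult flsh.ev_diff flsh.ev_power flsh.ev_uminus flsh.ev_sum)

lemma L_single: "L (Poly_Mapping.single m c) = fls_const c * mon lgen m"
  by (simp add: L_def)

lemma \<Theta>_simps [simp]: "\<Theta> (p + p') = \<Theta> p + \<Theta> p'" "\<Theta> (p * p') = \<Theta> p * \<Theta> p'" "\<Theta> (p - p') = \<Theta> p - \<Theta> p'"
  by (simp_all add: polyh.ev_add polyh.ev_mult polyh.ev_diff)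

lemma tgen_lgen: "tgen q \<zeta> v \<eta> u = Polynomial.monom (lgen u) (wt u)"
  by (cases u) (simp_all add: tgen_def lgen_def pweight_def)

lemma mon_tgen: "mon (tgen q \<zeta> v \<eta>) m = Polynomial.monom (mon lgen m) (wdeg wt m)"
proof -
  have "(\<Prod>u\<in>A. tgen q \<zeta> v \<eta> u ^ Poly_Mapping.lookup m u) =
      Polynomial.monom (\<Prod>u\<in>A. lgen u ^ Poly_Mapping.lookup m u) (\<Sum>u\<in>A. Poly_Mapping.lookup m u * wt u)" if "finite A" for A
    using that by (induction A rule: finite_induct) (simp_all add: tgen_lgen monom_power mult_monom monom_0 one_pCons)
  then show ?thesis by (simp add: mon_def wdeg_def)
qed

lemma \<Theta>_single: "\<Theta> (Poly_Mapping.single m c) = Polynomial.monom (L (Poly_Mapping.single m c)) (wdeg wt m)"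
  by (simp add: mon_tgen L_single smult_monom)

lemma \<Theta>_hcomp: "\<Theta> (hcomp wt j p) = Polynomial.monom (poly.coeff (\<Theta> p) j) j"
proof (rule poly_mapping_closure[of "\<lambda>p. \<Theta> (hcomp wt j p) = Polynomial.monom (poly.coeff (\<Theta> p) j) j"])
  fix m
  have "hcomp wt j (Poly_Mapping.single m c) = (if wdeg wt m = j then Poly_Mapping.single m c else 0)" for c :: 'k
    by (rule poly_mapping_eqI) (auto simp: hcomp_lookup lookup_single when_def)
  then show "\<Theta> (hcomp wt j (Poly_Mapping.single m (Poly_Mapping.lookup p m))) =
      Polynomial.monom (poly.coeff (\<Theta> (Poly_Mapping.single m (Poly_Mapping.lookup p m))) j) j"
    by (auto simp: \<Theta>_single simp del: polyh.ev_single)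
qed (simp_all add: hcomp_add add_monom)

lemma \<Theta>_homog: "homog wt j p \<Longrightarrow> \<Theta> p = Polynomial.monom (L p) j"
proof -
  assume p: "homog wt j p"
  have "\<Theta> p = Polynomial.monom (L p) j"
    by (rule poly_mapping_closure[of "\<lambda>p. \<Theta> p = Polynomial.monom (L p) j"])
      (use p in \<open>auto simp: \<Theta>_single homog_def add_monom simp del: polyh.ev_single\<close>)
  then show ?thesis .
qed

lemma \<zeta>_pow: "\<zeta> ^ k \<in> V (k * q * d)"
proof -
  have "\<zeta> ^ k \<in> W" by (induction k) (auto intro: W_1 Wmult \<zeta>W)
  then show ?thesis by (simp add: V_iff fls_subdegree_pow \<zeta>deg algebra_simps)
qed

text \<open>The pole order of \<zeta> is exactly \<open>q * d\<close>, so multiplication by its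
  powers shifts pole orders exactly and can be undone.\<close>

lemma \<zeta>_pow_cancel:
  assumes "x \<in> W" "\<zeta> ^ k * x \<in> V ((k * q + r) * d)" shows "x \<in> V (r * d)"
proof (cases "x = 0")
  case False
  then have "fls_subdegree (\<zeta> ^ k * x) = - int (k * q * d) + fls_subdegree x"
    using \<zeta>0 by (simp add: fls_subdegree_pow \<zeta>deg algebra_simps)
  then show ?thesis using assms False \<zeta>0 by (simp add: V_iff algebra_simps)
qed (simp add: V_0)

lemma L_V: assumes "p \<in> S" "homog wt j p" shows "L p \<in> V (j * d)"
proof -
  have "\<Theta> p \<in> Rt W d" using gen assms(1) by blast
  then have "poly.coeff (\<Theta> p) j \<in> V (j * d)" by (simp add: Rt_def)
  then show ?thesis using \<Theta>_homog[OF assms(2)] by simp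
qed

text \<open>Surjectivity of the presentation holds degree by degree: a preimage may be cut down to
  its homogeneous component.\<close>

lemma V_L: assumes "x \<in> V (j * d)" obtains p where "p \<in> S" "homog wt j p" "L p = x"
proof -
  have "Polynomial.monom x j \<in> Rt W d" using assms V_0 by (auto simp: Rt_def)
  then have "Polynomial.monom x j \<in> \<Theta> ` S" unfolding gen .
  then obtain p where p: "p \<in> S" "Polynomial.monom x j = \<Theta> p" by (rule imageE)
  have "\<Theta> (hcomp wt j p) = Polynomial.monom x j" unfolding \<Theta>_hcomp p(2)[symmetric] by simp
  then have "Polynomial.monom (L (hcomp wt j p)) j = Polynomial.monom x j" using \<Theta>_homog[OF hcomp_homog] by metis
  then have "L (hcomp wt j p) = x" by simp
  then show thesis using that[OF hcomp_polys_in[OF p(1)] hcomp_homog] by blast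
qed

abbreviation "vp u \<equiv> Poly_Mapping.single (Poly_Mapping.single u 1) (1::'k)"

lemma L_vp: "L (vp u) = lgen u" unfolding L_single mon_single by simp

lemma vp_S: "u \<in> A \<Longrightarrow> vp u \<in> polys_in A" by simp

lemma vp_homog: "homog wt (wt u) (vp u)" by simp

lemma wt_simps [simp]: "wt X = 1" "wt Z = q" "wt (Y a) = v a" by (simp_all add: pweight_def)

lemma lgen_simps [simp]: "lgen X = 1" "lgen Z = \<zeta>" "lgen (Y a) = \<eta> a" by (simp_all add: lgen_def)

lemma XZ_pvars: "X \<in> pvars s" "Z \<in> pvars s" by (simp_all add: pvars_def)

text \<open>Substituting \<open>p\<close> for \<open>y_a\<close> would let the remaining generators
  produce everything, against minimality.\<close>

lemma redundant:
  assumes a: "a \<in> {1..s}" and p: "p \<in> polys_in (pvars s - {Y a})" and eq: "\<Theta> p = \<Theta> (vp (Y a))"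
  shows False
proof -
  let ?U = "pvars s - {Y a}"
  have gu: "\<exists>p'\<in>polys_in ?U. \<Theta> p' = tgen q \<zeta> v \<eta> u" if u: "u \<in> pvars s" for u
  proof (cases "u = Y a")
    case True
    then show ?thesis using p eq by (intro bexI[of _ p]) simp_all
  next
    case False
    then show ?thesis using u by (intro bexI[of _ "vp u"]) simp_all
  qed
  have "\<Theta> P \<in> \<Theta> ` polys_in ?U" if P: "P \<in> S" for P
  proof (rule poly_mapping_closure[of "\<lambda>P. \<Theta> P \<in> \<Theta> ` polys_in ?U" P])
    show "\<Theta> 0 \<in> \<Theta> ` polys_in ?U" by (intro imageI) simp
    show "\<Theta> (x + y) \<in> \<Theta> ` polys_in ?U" if xy: "\<Theta> x \<in> \<Theta> ` polys_in ?U" "\<Theta> y \<in> \<Theta> ` polys_in ?U" for x y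
    proof -
      obtain x' where x': "x' \<in> polys_in ?U" "\<Theta> x = \<Theta> x'" using xy(1) by blast
      obtain y' where y': "y' \<in> polys_in ?U" "\<Theta> y = \<Theta> y'" using xy(2) by blast
      show ?thesis by (rule image_eqI[of _ _ "x' + y'"]) (use x' y' in simp_all)
    qed
    fix m assume "m \<in> Poly_Mapping.keys P"
    then have m: "Poly_Mapping.keys m \<subseteq> pvars s" using P by (auto simp: polys_in_def)
    have "\<exists>p'\<in>polys_in ?U. \<Theta> p' = (\<Prod>u\<in>A. tgen q \<zeta> v \<eta> u ^ Poly_Mapping.lookup m u)" if "finite A" "A \<subseteq> pvars s" for A
      using that
    proof (induction A rule: finite_induct)
      case empty then show ?case by (intro bexI[of _ 1]) simp_all
    next
      case (insert u A)
      then obtain p1 where p1: "p1 \<in> polys_in ?U" "\<Theta> p1 = (\<Prod>u\<in>A. tgen q \<zeta> v \<eta> u ^ Poly_Mapping.lookup m u)" by auto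
      obtain p2 where p2: "p2 \<in> polys_in ?U" "\<Theta> p2 = tgen q \<zeta> v \<eta> u" using gu insert.prems by blast
      show ?case
        by (rule bexI[of _ "p2 ^ Poly_Mapping.lookup m u * p1"])
          (use insert.hyps p1 p2 in \<open>simp_all add: polyh.ev_power polys_in_power\<close>)
    qed
    from this[OF finite_keys m] obtain p' where p': "p' \<in> polys_in ?U" "\<Theta> p' = mon (tgen q \<zeta> v \<eta>) m"
      by (auto simp: mon_def)
    show "\<Theta> (Poly_Mapping.single m (Poly_Mapping.lookup P m)) \<in> \<Theta> ` polys_in ?U"
      by (rule image_eqI[of _ _ "const_poly (Poly_Mapping.lookup P m) * p'"])
        (use p' in \<open>simp_all add: const_poly_def polyh.ev_mult flip: const_poly_def\<close>, simp add: const_poly_def)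
  qed
  then have "\<Theta> ` S \<subseteq> \<Theta> ` polys_in ?U" by blast
  moreover have "\<Theta> ` polys_in ?U \<subseteq> \<Theta> ` S" by (rule image_mono) (auto intro: polys_in_mono[rotated])
  ultimately have "\<Theta> ` polys_in ?U = Rt W d" using gen by blast
  moreover have "Y a \<in> pvars s" using a by (simp add: pvars_def)
  then have "?U \<subset> pvars s" by blast
  ultimately show False using min by blast
qed

text \<open>A generator of degree 0 is a function without poles, hence constant, and constants need
  no generator.\<close>

lemma v_pos: assumes a: "a \<in> {1..s}" shows "1 \<le> v a"
proof (rule ccontr)
  assume "\<not> 1 \<le> v a"
  then have v0: "v a = 0" by simp
  then have "\<eta> a \<in> V 0" using \<eta>V[OF a] by simp
  then obtain c where "\<eta> a = fls_const c" using W0[of "\<eta> a"] by (auto simp: V_iff)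
  then have "\<Theta> (const_poly c) = \<Theta> (vp (Y a))" using v0 by (simp add: const_poly_def tgen_def monom_0)
  then show False using redundant[OF a] by blast
qed

lemma no_Y: assumes "p \<in> S" "homog wt j p" "j < v a" shows "p \<in> polys_in (pvars s - {Y a})"
  unfolding polys_in_def
proof (intro CollectI ballI)
  fix m assume m: "m \<in> Poly_Mapping.keys p"
  have "Y a \<notin> Poly_Mapping.keys m"
    using wdeg_ge[of "Y a" m wt] assms(2,3) m by (auto simp: homog_def)
  then show "Poly_Mapping.keys m \<subseteq> pvars s - {Y a}" using assms(1) m by (auto simp: polys_in_def)
qed

text \<open>The \<eta> are independent modulo (x,z) within one weight. The elements
  \<open>y1\<close> and \<open>y2\<close> come from smaller degrees, so polynomials representing
  them cannot contain \<open>y_a\<close>, and \<open>y_a\<close> would be redundant.\<close>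

lemma redundant_combination:
  assumes a: "a \<in> {1..s}" and c: "\<And>b. b \<in> B \<Longrightarrow> b \<noteq> a \<and> b \<in> {1..s} \<and> v b = v a"
    and y: "y1 \<in> V ((v a - 1) * d)" "q \<le> v a \<Longrightarrow> y2 \<in> V ((v a - q) * d)" "\<not> q \<le> v a \<Longrightarrow> y2 = 0"
    and eq: "\<eta> a = y1 + \<zeta> * y2 + (\<Sum>b\<in>B. fls_const (c b) * \<eta> b)"
  shows False
proof -
  let ?U = "polys_in (pvars s - {Y a})"
  have va: "1 \<le> v a" by (rule v_pos[OF a])
  obtain p1 where p1: "p1 \<in> S" "homog wt (v a - 1) p1" "L p1 = y1" by (rule V_L[OF y(1)])
  have p1U: "p1 \<in> ?U" by (rule no_Y[OF p1(1,2)]) (use va in simp)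
  have "\<exists>p2\<in>?U. homog wt (v a) (vp Z * p2) \<and> L p2 = y2"
  proof (cases "q \<le> v a")
    case True
    obtain p2 where p2: "p2 \<in> S" "homog wt (v a - q) p2" "L p2 = y2" by (rule V_L[OF y(2)[OF True]])
    have "p2 \<in> ?U" by (rule no_Y[OF p2(1,2)]) (use q True in simp)
    moreover have "homog wt (v a) (vp Z * p2)" using homog_simps(5)[OF vp_homog[of Z] p2(2)] True by simp
    ultimately show ?thesis using p2(3) by blast
  next
    case False
    then show ?thesis using y(3) by (intro bexI[of _ 0]) simp_all
  qed
  then obtain p2 where p2: "p2 \<in> ?U" "homog wt (v a) (vp Z * p2)" "L p2 = y2" by blast
  let ?p3 = "\<Sum>b\<in>B. const_poly (c b) * vp (Y b)"
  have p3: "?p3 \<in> ?U" using c by (intro polys_in_sum polys_in_simps(5) polys_in_simps(7) vp_S) (auto simp: pvars_def)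
  have h3: "homog wt (v a) ?p3"
    using c vp_homog[of "Y b" for b] by (intro homog_sum homog_const_mult) (metis wt_simps(3))
  have h1: "homog wt (v a) (vp X * p1)" using homog_simps(5)[OF vp_homog[of X] p1(2)] va by simp
  let ?p = "vp X * p1 + vp Z * p2 + ?p3"
  have "?p \<in> ?U" using p1U p2(1) p3 XZ_pvars by (intro polys_in_simps(2) polys_in_simps(5) vp_S) auto
  moreover have "\<Theta> ?p = \<Theta> (vp (Y a))"
  proof -
    have h: "homog wt (v a) ?p" by (intro homog_simps(2) h1 p2(2) h3)
    have "L ?p = \<eta> a" unfolding eq by (simp only: L_simps L_vp lgen_simps p1(3) p2(3) mult_1_left)
    then have "\<Theta> ?p = Polynomial.monom (\<eta> a) (v a)" using \<Theta>_homog[OF h] by simp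
    also have "\<dots> = \<Theta> (vp (Y a))" using \<Theta>_homog[OF vp_homog[of "Y a"]] by (simp only: L_vp lgen_simps wt_simps)
    finally show ?thesis .
  qed
  ultimately show False using redundant[OF a] by blast
qed

end

text \<open>\<open>sq\<close> states that products of two y lie in the ideal (x,z), read in degree
  \<open>2 * vv\<close>: the cofactors of x and z have pole orders bounded by the smaller degrees,
  and there is no cofactor of z if \<open>q\<close> is too large.\<close>

locale curve_alg_uniform = curve_alg +
  fixes vv :: nat
  assumes vv: "1 \<le> vv" and v_eq: "a \<in> {1..s} \<Longrightarrow> v a = vv"
    and sq: "f \<in> {1..s} \<Longrightarrow> c \<in> {1..s} \<Longrightarrow> \<exists>r1\<in>Vr W ((2 * vv - 1) * d). \<exists>r2.
      (q \<le> 2 * vv \<longrightarrow> r2 \<in> Vr W ((2 * vv - q) * d)) \<and> (\<not> q \<le> 2 * vv \<longrightarrow> r2 = 0) \<and> \<eta> f * \<eta> c = r1 + \<zeta> * r2"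
begin

definition low :: "(var, 'a) mpoly \<Rightarrow> bool" where "low p \<longleftrightarrow> (\<forall>m\<in>Poly_Mapping.keys p. ydeg m \<le> 1)"

lemma low_simps: "low 0" "low p \<Longrightarrow> low p' \<Longrightarrow> low (p + p')" 
proof -
  show "low p \<Longrightarrow> low p' \<Longrightarrow> low (p + p')"
    unfolding low_def by (meson Un_iff keys_add subsetD)
qed (simp add: low_def)

lemma low_mult: assumes "low p" "ydeg \<mu> = 0" shows "low (Poly_Mapping.single \<mu> c * p)"
  unfolding low_def
proof
  fix m assume "m \<in> Poly_Mapping.keys (Poly_Mapping.single \<mu> c * p)"
  then obtain a b where ab: "m = a + b" "a \<in> Poly_Mapping.keys (Poly_Mapping.single \<mu> c)" "b \<in> Poly_Mapping.keys p"
    using keys_mult[of "Poly_Mapping.single \<mu> c" p] by blast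
  then have "a = \<mu>" by (auto split: if_splits)
  then show "ydeg m \<le> 1" using ab assms by (simp add: ydeg_add low_def)
qed

lemma ydeg_XZ [simp]: "ydeg (Poly_Mapping.single X k) = 0" "ydeg (Poly_Mapping.single Z k) = 0"
  by (simp_all add: ydeg_def)

lemma split_var: "u \<in> Poly_Mapping.keys m \<Longrightarrow> m = Poly_Mapping.single u 1 + (m - Poly_Mapping.single u (1::nat))"
  by (rule poly_mapping_eqI) (auto simp: lookup_add lookup_minus lookup_single when_def in_keys_iff)


definition NFj :: "nat \<Rightarrow> 'a fls \<Rightarrow> bool" where "NFj j x \<longleftrightarrow> (\<exists>p\<in>S. homog wt j p \<and> low p \<and> L p = x)"

lemma NFj_add: "NFj j x \<Longrightarrow> NFj j y \<Longrightarrow> NFj j (x + y)"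
  unfolding NFj_def by (metis L_simps(3) homog_simps(2) low_simps(2) polys_in_simps(2))

lemma NFj_X: "NFj j x \<Longrightarrow> NFj (Suc j) x"
proof -
  assume "NFj j x"
  then obtain p where p: "p \<in> S" "homog wt j p" "low p" "L p = x" by (auto simp: NFj_def)
  have "vp X * p \<in> S" by (intro polys_in_simps(5) vp_S XZ_pvars p(1))
  moreover have "homog wt (Suc j) (vp X * p)" using homog_simps(5)[OF vp_homog[of X] p(2)] by simp
  moreover have "low (vp X * p)" by (intro low_mult p(3) ydeg_XZ)
  moreover have "L (vp X * p) = x" by (simp only: L_simps L_vp lgen_simps p(4) mult_1_left)
  ultimately show ?thesis unfolding NFj_def by blast
qed

lemma NFj_Z: "NFj j x \<Longrightarrow> NFj (q + j) (\<zeta> * x)"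
proof -
  assume "NFj j x"
  then obtain p where p: "p \<in> S" "homog wt j p" "low p" "L p = x" by (auto simp: NFj_def)
  have "vp Z * p \<in> S" by (intro polys_in_simps(5) vp_S XZ_pvars p(1))
  moreover have "homog wt (q + j) (vp Z * p)" using homog_simps(5)[OF vp_homog[of Z] p(2)] by simp
  moreover have "low (vp Z * p)" by (intro low_mult p(3) ydeg_XZ)
  moreover have "L (vp Z * p) = \<zeta> * x" by (simp only: L_simps L_vp lgen_simps p(4))
  ultimately show ?thesis unfolding NFj_def by blast
qed

lemma NFj_cmult: "NFj j x \<Longrightarrow> NFj j (fls_const c * x)"
proof -
  assume "NFj j x"
  then obtain p where p: "p \<in> S" "homog wt j p" "low p" "L p = x" by (auto simp: NFj_def)
  have "low (const_poly c * p)" unfolding const_poly_def by (rule low_mult[OF p(3)]) (simp add: ydeg_def)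
  then show ?thesis unfolding NFj_def using p homog_const_mult[OF p(2)]
    by (intro bexI[of _ "const_poly c * p"]) simp_all
qed

text \<open>Induction on the degree. A factor x or z is split off directly; in a monomial with two y
  their product is rewritten by \<open>sq\<close> into multiples of x and z. In either case the
  cofactors have smaller degree.\<close>

lemma normal_form: "x \<in> V (j * d) \<Longrightarrow> NFj j x"
proof (induction j arbitrary: x rule: less_induct)
  case (less j)
  obtain P where P: "P \<in> S" "homog wt j P" "L P = x" by (rule V_L[OF less.prems])
  have mono: "NFj j (mon lgen m)" if m: "Poly_Mapping.keys m \<subseteq> pvars s" "wdeg wt m = j" for m
  proof -
    have S1: "Poly_Mapping.single m' (1::'a) \<in> S" "homog wt (wdeg wt m') (Poly_Mapping.single m' (1::'a))"
      if "Poly_Mapping.keys m' \<subseteq> pvars s" for m' using that by simp_all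
    have MV: "mon lgen m' \<in> V (wdeg wt m' * d)" if "Poly_Mapping.keys m' \<subseteq> pvars s" for m'
      using L_V[OF S1[OF that]] by (simp add: L_single)
    have rec: "NFj j (lgen u * mon lgen m')" if u: "u \<in> {X, Z}" "m = Poly_Mapping.single u 1 + m'" for u m'
    proof -
      have km: "Poly_Mapping.keys m' \<subseteq> pvars s" using m(1) u(2) by (simp add: keys_plus_nat)
      have wu: "wt u \<ge> 1" using u(1) q by auto
      have j: "j = wt u + wdeg wt m'" using m(2) u(2) by (simp add: wdeg_add)
      have "NFj (wdeg wt m') (mon lgen m')" by (rule less.IH[OF _ MV[OF km]]) (use j wu in simp)
      then show ?thesis using u(1) j NFj_X NFj_Z by auto
    qed
    have monu: "mon lgen (Poly_Mapping.single u 1 + m') = lgen u * mon lgen m'" for u m'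
      by (simp only: mon_add mon_single power_one_right)
    consider (XZ) u where "u \<in> {X, Z}" "u \<in> Poly_Mapping.keys m" | (low) "ydeg m \<le> 1" | (high) "2 \<le> ydeg m" by fastforce
    then show ?thesis
    proof cases
      case XZ
      from rec[OF XZ(1) split_var[OF XZ(2)]] show ?thesis
        using monu[of u "m - Poly_Mapping.single u 1"] split_var[OF XZ(2)] by simp
    next
      case low
      then have "low (Poly_Mapping.single m 1)" by (auto simp: low_def split: if_splits)
      then show ?thesis unfolding NFj_def using S1[OF m(1)] m(2)
        by (intro bexI[of _ "Poly_Mapping.single m 1"]) (simp_all add: L_single)
    next
      case high
      obtain f c m' where *: "1 \<le> f" "f \<le> c" "c \<le> s" "Poly_Mapping.keys m' \<subseteq> Vc s c" "m = m' + (mY f + mY c)"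
        by (rule quadratic_split[OF m(1) high])
      have fc: "f \<in> {1..s}" "c \<in> {1..s}" using * by auto
      have km: "Poly_Mapping.keys m' \<subseteq> pvars s" using m(1) *(5) by (simp add: keys_plus_nat)
      have j: "j = wdeg wt m' + 2 * vv" using m(2) v_eq[OF fc(1)] v_eq[OF fc(2)] by (simp add: *(5) wdeg_add)
      obtain r1 r2 where r: "r1 \<in> V ((2 * vv - 1) * d)" "q \<le> 2 * vv \<longrightarrow> r2 \<in> V ((2 * vv - q) * d)" "\<not> q \<le> 2 * vv \<longrightarrow> r2 = 0"
        "\<eta> f * \<eta> c = r1 + \<zeta> * r2" using sq[OF fc] by blast
      have "mon lgen m = mon lgen m' * (\<eta> f * \<eta> c)"
        unfolding *(5) mon_add mY_def mon_single by simp
      also have "\<dots> = mon lgen m' * r1 + \<zeta> * (mon lgen m' * r2)" unfolding r(4) by (simp add: algebra_simps)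
      finally have e: "mon lgen m = mon lgen m' * r1 + \<zeta> * (mon lgen m' * r2)" .
      have "mon lgen m' * r1 \<in> V ((j - 1) * d)"
        using V_mult[OF MV[OF km] r(1)] j vv by (simp add: add_mult_distrib[symmetric])
      then have "NFj (j - 1) (mon lgen m' * r1)" by (intro less.IH) (use j vv in simp_all)
      then have n1: "NFj j (mon lgen m' * r1)" using NFj_X[of "j - 1"] j vv by simp
      have n2: "NFj j (\<zeta> * (mon lgen m' * r2))"
      proof (cases "q \<le> 2 * vv")
        case True
        have "mon lgen m' * r2 \<in> V ((wdeg wt m' + (2 * vv - q)) * d)"
          using V_mult[OF MV[OF km] r(2)[rule_format, OF True]] by (simp only: add_mult_distrib)
        then have "NFj (wdeg wt m' + (2 * vv - q)) (mon lgen m' * r2)" by (intro less.IH) (use j q True in simp_all)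
        from NFj_Z[OF this] show ?thesis using j True by simp
      next
        case False
        then have "r2 = 0" using r(3) by blast
        then show ?thesis unfolding NFj_def by (intro bexI[of _ 0]) (simp_all add: low_simps)
      qed
      show ?thesis unfolding e by (rule NFj_add[OF n1 n2])
    qed
  qed
  have "NFj j (L P)"
  proof (rule poly_mapping_closure[of "\<lambda>P. NFj j (L P)" P])
    show "NFj j (L 0)" unfolding NFj_def by (intro bexI[of _ 0]) (simp_all add: low_simps)
    fix m assume "m \<in> Poly_Mapping.keys P"
    then have "Poly_Mapping.keys m \<subseteq> pvars s" "wdeg wt m = j" using P by (auto simp: polys_in_def homog_def)
    from NFj_cmult[OF mono[OF this]] show "NFj j (L (Poly_Mapping.single m (Poly_Mapping.lookup P m)))" by (simp add: L_single)
  qed (simp add: NFj_add)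
  then show ?case by (simp add: P(3))
qed

lemma quadratic_normal_form:
  assumes "1 \<le> f" "f \<le> c" "c \<le> s"
  shows "\<exists>p\<in>S. (\<forall>m\<in>Poly_Mapping.keys p. ydeg m \<le> 1) \<and> homog wt (2 * vv) p \<and> \<Theta> (Poly_Mapping.single (mY f + mY c) 1 - p) = 0"
proof -
  have fc: "f \<in> {1..s}" "c \<in> {1..s}" using assms by auto
  let ?m = "Poly_Mapping.single (mY f + mY c) (1::'a)"
  have m: "?m \<in> S" using fc by (auto simp: keys_plus_nat pvars_def)
  have hm: "homog wt (2 * vv) ?m" using v_eq[OF fc(1)] v_eq[OF fc(2)] by (simp add: wdeg_add)
  obtain p where p: "p \<in> S" "homog wt (2 * vv) p" "low p" "L p = L ?m"
    using normal_form[OF L_V[OF m hm]] by (auto simp: NFj_def)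
  have "\<Theta> (?m - p) = 0" unfolding \<Theta>_homog[OF homog_simps(4)[OF hm p(2)]] by (simp add: p(4))
  then show ?thesis using p by (auto simp: low_def)
qed

text \<open>The part of a polynomial of degree at most 1 in the y that is not divisible by \<open>x\<close>; since \<open>x\<close> corresponds to the
  function 1, its image is determined modulo functions of smaller pole order.\<close>

definition lead :: "nat \<Rightarrow> 'a \<Rightarrow> (nat \<Rightarrow> 'a) \<Rightarrow> (var, 'a) mpoly" where
  "lead j c0 c = (if q dvd j then const_poly c0 * vp Z ^ (j div q) else 0) +
     (if vv \<le> j \<and> q dvd (j - vv) then vp Z ^ ((j - vv) div q) * (\<Sum>a\<in>{1..s}. const_poly (c a) * vp (Y a)) else 0)"

lemma lead_add: "lead j c0 c + lead j c0' c' = lead j (c0 + c0') (\<lambda>a. c a + c' a)"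
  unfolding lead_def by (auto simp: algebra_simps sum.distrib simp del: L_simps)

lemma lead_0 [simp]: "lead j 0 (\<lambda>_. 0) = 0" by (simp add: lead_def)

lemma L_lead: "L (lead j c0 c) = (if q dvd j then fls_const c0 * \<zeta> ^ (j div q) else 0) +
     (if vv \<le> j \<and> q dvd (j - vv) then \<zeta> ^ ((j - vv) div q) * (\<Sum>a\<in>{1..s}. fls_const (c a) * \<eta> a) else 0)"
  unfolding lead_def by (simp only: L_simps L_vp lgen_simps if_distrib[of L])

lemma vpZ_power: "vp Z ^ k = Poly_Mapping.single (Poly_Mapping.single Z k) 1"
  by (induction k) (simp_all add: mult_single single_add[symmetric] flip: single_one)

lemma lead_monomial:
  assumes m: "Poly_Mapping.keys m \<subseteq> pvars s" "wdeg wt m = j" "ydeg m \<le> 1" "X \<notin> Poly_Mapping.keys m"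
  shows "\<exists>c0 c. Poly_Mapping.single m b = lead j c0 c"
proof -
  have Zonly: "m' = Poly_Mapping.single Z (Poly_Mapping.lookup m' Z)" if "Poly_Mapping.keys m' \<subseteq> {Z}" for m' :: "var \<Rightarrow>\<^sub>0 nat"
    using that by (intro poly_mapping_eqI) (auto simp: lookup_single when_def in_keys_iff)
  show ?thesis
  proof (cases "\<exists>a. Y a \<in> Poly_Mapping.keys m")
    case False
    then have "Poly_Mapping.keys m \<subseteq> {Z}" using m(1,4) by (auto simp: pvars_def)
    then obtain k where k: "m = Poly_Mapping.single Z k" using Zonly by blast
    then have "j = k * q" using m(2) by simp
    then have jq: "j div q = k" "q dvd j" using q by simp_all
    have "Poly_Mapping.single m b = lead j b (\<lambda>_. 0)"
      unfolding lead_def jq(1) vpZ_power k by (simp add: jq(2) const_poly_def mult_single)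
    then show ?thesis by blast
  next
    case True
    then obtain a where a: "Y a \<in> Poly_Mapping.keys m" by blast
    define m' where "m' = m - mY a"
    have mm: "m = m' + mY a" unfolding m'_def by (rule split_mY[OF a])
    then have "ydeg m' = 0" using m(3) by (simp add: ydeg_add)
    then have nY: "Y b \<notin> Poly_Mapping.keys m'" for b
      using wdeg_ge[of "Y b" m' "\<lambda>u. case u of Y a \<Rightarrow> 1 | _ \<Rightarrow> 0"] by (auto simp: ydeg_def)
    have "Poly_Mapping.keys m' \<subseteq> {Z}" using m(1,4) nY mm by (auto simp: pvars_def keys_plus_nat)
    then obtain k where k: "m' = Poly_Mapping.single Z k" using Zonly by blast
    have as: "a \<in> {1..s}" using a m(1) by (auto simp: pvars_def)
    have j: "j = k * q + vv" using m(2) v_eq[OF as] by (simp add: mm k wdeg_add)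
    let ?c = "\<lambda>a'. if a' = a then b else 0"
    have "(\<Sum>a'\<in>{1..s}. const_poly (?c a') * vp (Y a')) = const_poly b * vp (Y a)"
      using as by (simp add: if_distrib[of const_poly] if_distrib[of "\<lambda>x. x * _"] sum.delta cong: if_cong)
    then have "lead j 0 ?c = vp Z ^ k * (const_poly b * vp (Y a))"
      using q by (simp add: lead_def j)
    also have "\<dots> = Poly_Mapping.single m b"
      unfolding vpZ_power mm k by (simp add: const_poly_def mult_single mY_def)
    finally show ?thesis by metis
  qed
qed

text \<open>The monomials divisible by x make up \<open>p'\<close>. In degree 0 there are none,
  which must be recorded because \<open>j - 1\<close> is truncated.\<close>

lemma split_X:
  assumes p: "p \<in> S" "homog wt j p" "low p"
  shows "\<exists>p' c0 c. p = vp X * p' + lead j c0 c \<and> p' \<in> S \<and> homog wt (j - 1) p' \<and> low p' \<and> (j = 0 \<longrightarrow> p' = 0)"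
proof (rule poly_mapping_closure[of "\<lambda>p. \<exists>p' c0 c. p = vp X * p' + lead j c0 c \<and> p' \<in> S \<and> homog wt (j - 1) p' \<and> low p' \<and> (j = 0 \<longrightarrow> p' = 0)" p])
  show "\<exists>p' c0 c. 0 = vp X * p' + lead j c0 c \<and> p' \<in> S \<and> homog wt (j - 1) p' \<and> low p' \<and> (j = 0 \<longrightarrow> p' = 0)"
    by (intro exI[of _ 0] exI[of _ "\<lambda>_. 0"]) (simp add: low_simps)
  fix a b :: "(var, 'a) mpoly"
  assume "\<exists>p' c0 c. a = vp X * p' + lead j c0 c \<and> p' \<in> S \<and> homog wt (j - 1) p' \<and> low p' \<and> (j = 0 \<longrightarrow> p' = 0)"
    "\<exists>p' c0 c. b = vp X * p' + lead j c0 c \<and> p' \<in> S \<and> homog wt (j - 1) p' \<and> low p' \<and> (j = 0 \<longrightarrow> p' = 0)"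
  then obtain p1 c1 e1 p2 c2 e2 where *: "a = vp X * p1 + lead j c1 e1" "p1 \<in> S" "homog wt (j - 1) p1" "low p1" "j = 0 \<longrightarrow> p1 = 0"
    "b = vp X * p2 + lead j c2 e2" "p2 \<in> S" "homog wt (j - 1) p2" "low p2" "j = 0 \<longrightarrow> p2 = 0" by blast
  have "a + b = vp X * (p1 + p2) + lead j (c1 + c2) (\<lambda>x. e1 x + e2 x)"
    unfolding lead_add[symmetric] *(1,6) by (simp add: algebra_simps)
  moreover have "p1 + p2 \<in> S" "homog wt (j - 1) (p1 + p2)" "low (p1 + p2)" "j = 0 \<longrightarrow> p1 + p2 = 0" using * low_simps(2) by auto
  ultimately show "\<exists>p' c0 c. a + b = vp X * p' + lead j c0 c \<and> p' \<in> S \<and> homog wt (j - 1) p' \<and> low p' \<and> (j = 0 \<longrightarrow> p' = 0)" by blast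
next
  fix m assume mk: "m \<in> Poly_Mapping.keys p"
  let ?b = "Poly_Mapping.lookup p m"
  have m: "Poly_Mapping.keys m \<subseteq> pvars s" "wdeg wt m = j" "ydeg m \<le> 1" using p mk by (auto simp: polys_in_def homog_def low_def)
  show "\<exists>p' c0 c. Poly_Mapping.single m ?b = vp X * p' + lead j c0 c \<and> p' \<in> S \<and> homog wt (j - 1) p' \<and> low p' \<and> (j = 0 \<longrightarrow> p' = 0)"
  proof (cases "X \<in> Poly_Mapping.keys m")
    case True
    define m' where "m' = m - Poly_Mapping.single X 1"
    have mm: "m = Poly_Mapping.single X 1 + m'" unfolding m'_def by (rule split_var[OF True])
    have j: "j = Suc (wdeg wt m')" using m(2) by (simp add: mm wdeg_add)
    have "Poly_Mapping.single m ?b = vp X * Poly_Mapping.single m' ?b + lead j 0 (\<lambda>_. 0)" by (simp add: mult_single mm)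
    moreover have "Poly_Mapping.single m' ?b \<in> S" using m(1) by (auto simp: mm keys_plus_nat)
    moreover have "homog wt (j - 1) (Poly_Mapping.single m' ?b)" using j by simp
    moreover have "low (Poly_Mapping.single m' ?b)" using m(3) by (auto simp: low_def mm ydeg_add split: if_splits)
    moreover have "j = 0 \<longrightarrow> Poly_Mapping.single m' ?b = 0" using j by simp
    ultimately show ?thesis by blast
  next
    case False
    obtain c0 c where "Poly_Mapping.single m ?b = lead j c0 c" using lead_monomial[OF m False] by blast
    then show ?thesis by (intro exI[of _ 0] exI[of _ c0] exI[of _ c]) (simp add: low_simps)
  qed
qed

text \<open>Dividing by a nonzero coefficient \<open>c a\<close> would present \<open>y_a\<close> as
  a combination of the others modulo (x,z).\<close>

lemma independent_mod_xz:
  assumes S: "(\<Sum>a\<in>{1..s}. fls_const (c a) * \<eta> a) = y1 + \<zeta> * y2"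
    and y: "y1 \<in> V ((vv - 1) * d)" "q \<le> vv \<Longrightarrow> y2 \<in> V ((vv - q) * d)" "\<not> q \<le> vv \<Longrightarrow> y2 = 0"
    and a: "a \<in> {1..s}"
  shows "c a = 0"
proof (rule ccontr)
  assume ca: "c a \<noteq> 0"
  let ?i = "fls_const (inverse (c a))"
  let ?B = "\<Sum>b\<in>{1..s} - {a}. fls_const (c b) * \<eta> b"
  have va: "v a = vv" by (rule v_eq[OF a])
  have "(\<Sum>b\<in>{1..s}. fls_const (c b) * \<eta> b) = fls_const (c a) * \<eta> a + (\<Sum>b\<in>{1..s} - {a}. fls_const (c b) * \<eta> b)"
    using a by (intro sum.remove) simp_all
  note remove = this
  have "fls_const (c a) * \<eta> a = y1 + \<zeta> * y2 - (\<Sum>b\<in>{1..s} - {a}. fls_const (c b) * \<eta> b)"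
    unfolding eq_diff_eq remove[symmetric] by (rule S)
  then have "?i * (fls_const (c a) * \<eta> a) = ?i * (y1 + \<zeta> * y2 - ?B)" by simp
  moreover have "?i * (fls_const (c a) * \<eta> a) = \<eta> a" using ca by (simp add: mult.assoc[symmetric])
  ultimately have "\<eta> a = ?i * (y1 + \<zeta> * y2 - ?B)" by simp
  also have "\<dots> = ?i * y1 + \<zeta> * (?i * y2) + - (?i * ?B)" by (simp add: algebra_simps)
  also have "- (?i * ?B) = (\<Sum>b\<in>{1..s} - {a}. fls_const (- inverse (c a) * c b) * \<eta> b)"
    unfolding sum_distrib_left sum_negf[symmetric]
    by (rule sum.cong[OF refl]) (simp add: mult.assoc[symmetric])
  finally have "\<eta> a = ?i * y1 + \<zeta> * (?i * y2) + (\<Sum>b\<in>{1..s} - {a}. fls_const (- inverse (c a) * c b) * \<eta> b)" .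
  moreover have "?i * y1 \<in> V ((v a - 1) * d)" using y(1) va by (simp add: V_cmult)
  moreover have "q \<le> v a \<Longrightarrow> ?i * y2 \<in> V ((v a - q) * d)" using y(2) va by (simp add: V_cmult)
  moreover have "\<not> q \<le> v a \<Longrightarrow> ?i * y2 = 0" using y(3) va by simp
  ultimately show False using redundant_combination[OF a, of "{1..s} - {a}" "?i * y1" "?i * y2" "\<lambda>b. - inverse (c a) * c b"] v_eq va by auto
qed

text \<open>The pole order of \<open>L (lead j c0 c)\<close> is smaller than the degree allows.
  After cancelling a power of \<zeta>, this puts the combination of the \<eta> into the ideal (x,z),
  so the \<open>c a\<close> vanish; what is left is a multiple of a power of \<zeta> with pole order
  exactly \<open>j * d\<close>.\<close>

lemma lead_zero:
  assumes h: "1 \<le> j \<Longrightarrow> L (lead j c0 c) \<in> V ((j - 1) * d)" and 0: "j = 0 \<Longrightarrow> L (lead j c0 c) = 0"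
  shows "lead j c0 c = 0"
proof -
  let ?S = "\<Sum>a\<in>{1..s}. fls_const (c a) * \<eta> a"
  let ?A = "if q dvd j then fls_const c0 * \<zeta> ^ (j div q) else 0"
  have SV: "?S \<in> V (vv * d)" using \<eta>V v_eq by (intro V_sum V_cmult) fastforce
  then have SW: "?S \<in> W" by (simp add: V_iff)
  have c: "\<forall>a\<in>{1..s}. c a = 0" if vj: "vv \<le> j \<and> q dvd (j - vv)"
  proof -
    define k where "k = (j - vv) div q"
    have jk: "j = k * q + vv" using vj by (simp add: k_def)
    have e: "L (lead j c0 c) = ?A + \<zeta> ^ k * ?S" unfolding L_lead k_def using vj by simp
    have hV: "?A + \<zeta> ^ k * ?S \<in> V ((k * q + (vv - 1)) * d)" using h jk vv unfolding e by simp
    have "\<exists>y1 y2. ?S = y1 + \<zeta> * y2 \<and> y1 \<in> V ((vv - 1) * d) \<and> (q \<le> vv \<longrightarrow> y2 \<in> V ((vv - q) * d)) \<and> (\<not> q \<le> vv \<longrightarrow> y2 = 0)"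
    proof (cases "q dvd j")
      case False
      then have "\<zeta> ^ k * ?S \<in> V ((k * q + (vv - 1)) * d)" using hV by simp
      from \<zeta>_pow_cancel[OF SW this] show ?thesis by (intro exI[of _ ?S] exI[of _ 0]) (simp add: V_0)
    next
      \<comment> \<open>Here a pure power of z occurs in degree \<open>j\<close> as well. It
        contributes a power of \<zeta> with positive exponent \<open>r\<close>, as \<open>vv\<close>
        is positive, and so belongs to the multiples of z.\<close>
      case True
      then have "q dvd vv" using jk by (simp add: dvd_add_right_iff)
      then obtain r where r: "vv = q * r" by blast
      then obtain r' where r': "r = Suc r'" using vv by (cases r) auto
      have jd: "j div q = k + r" using q by (simp add: jk r)
      have "?A + \<zeta> ^ k * ?S = \<zeta> ^ k * (fls_const c0 * \<zeta> ^ r + ?S)" using True by (simp add: jd power_add algebra_simps)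
      then have x: "\<zeta> ^ k * (fls_const c0 * \<zeta> ^ r + ?S) \<in> V ((k * q + (vv - 1)) * d)" using hV by simp
      have "\<zeta> ^ r \<in> W" using \<zeta>_pow[of r] by (simp add: V_iff)
      then have "fls_const c0 * \<zeta> ^ r + ?S \<in> W" by (intro Wadd Wmult Wc SW)
      from \<zeta>_pow_cancel[OF this x] have y1: "fls_const c0 * \<zeta> ^ r + ?S \<in> V ((vv - 1) * d)" .
      have "\<zeta> ^ r' \<in> V ((vv - q) * d)" using \<zeta>_pow[of r'] by (simp add: r r' mult.commute)
      then have y2: "- (fls_const c0 * \<zeta> ^ r') \<in> V ((vv - q) * d)" by (intro V_uminus V_cmult)
      have "?S = (fls_const c0 * \<zeta> ^ r + ?S) + \<zeta> * (- (fls_const c0 * \<zeta> ^ r'))" by (simp add: r' algebra_simps)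
      moreover have "q \<le> vv" by (simp add: r r')
      ultimately show ?thesis using y1 y2 by blast
    qed
    then obtain y1 y2 where y: "?S = y1 + \<zeta> * y2" "y1 \<in> V ((vv - 1) * d)" "q \<le> vv \<longrightarrow> y2 \<in> V ((vv - q) * d)" "\<not> q \<le> vv \<longrightarrow> y2 = 0" by blast
    show ?thesis using independent_mod_xz[OF y(1,2)] y(3,4) by blast
  qed
  have l: "lead j c0 c = (if q dvd j then const_poly c0 * vp Z ^ (j div q) else 0)"
  proof (cases "vv \<le> j \<and> q dvd (j - vv)")
    case True
    have "(\<Sum>a\<in>{1..s}. const_poly (c a) * vp (Y a)) = 0" using c[OF True] by (intro sum.neutral) simp
    then show ?thesis by (simp only: lead_def mult_zero_right if_cancel add_0_right)
  next
    case False
    then show ?thesis unfolding lead_def by (simp only: if_False add_0_right)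
  qed
  show ?thesis
  proof (cases "q dvd j \<and> c0 \<noteq> 0")
    case True
    have Ll: "L (lead j c0 c) = fls_const c0 * \<zeta> ^ (j div q)" unfolding l using True by (simp only: L_simps L_vp lgen_simps if_True)
    have jq: "int (j div q) * int (q * d) = int (j * d)" using True by (metis dvd_div_mult_self mult.assoc of_nat_mult)
    have nz: "L (lead j c0 c) \<noteq> 0" unfolding Ll using True \<zeta>0 by simp
    have sd: "fls_subdegree (L (lead j c0 c)) = - int (j * d)"
      unfolding Ll using True \<zeta>0 jq by (simp add: fls_subdegree_pow \<zeta>deg)
    have "1 \<le> j" using nz 0 by (cases j) auto
    then have "- int ((j - 1) * d) \<le> - int (j * d)" using h nz sd by (auto simp: V_iff)
    then have "j * d \<le> (j - 1) * d" by linarith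
    then show ?thesis using d \<open>1 \<le> j\<close> by simp
  qed (auto simp: l)
qed

text \<open>\<open>L p'\<close> has pole order at most \<open>(j - 1) * d\<close>, hence so has the
  image of the leading part, which vanishes by \<open>lead_zero\<close>. Then \<open>p'\<close> is a
  normal element of the kernel in smaller degree.\<close>

lemma normal_zero: "p \<in> S \<Longrightarrow> homog wt j p \<Longrightarrow> low p \<Longrightarrow> L p = 0 \<Longrightarrow> p = 0"
proof (induction j arbitrary: p rule: less_induct)
  case (less j)
  obtain p' c0 c where *: "p = vp X * p' + lead j c0 c" "p' \<in> S" "homog wt (j - 1) p'" "low p'" "j = 0 \<longrightarrow> p' = 0"
    using split_X[OF less.prems(1-3)] by blast
  have Lp: "L p' + L (lead j c0 c) = 0" using less.prems(4) unfolding *(1) by (simp only: L_simps L_vp lgen_simps mult_1_left)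
  then have Ll: "L (lead j c0 c) = - L p'" by (simp add: eq_neg_iff_add_eq_0 add.commute)
  have l0: "lead j c0 c = 0"
    by (rule lead_zero) (use Ll *(5) V_uminus[OF L_V[OF *(2,3)]] in simp_all)
  show ?case
  proof (cases "j = 0")
    case True then show ?thesis using * l0 by simp
  next
    case False
    have "L p' = 0" using Lp l0 by simp
    then have "p' = 0" using less.IH[of "j - 1" p'] * False by simp
    then show ?thesis using * l0 by simp
  qed
qed

lemma normal_kernel: assumes "p \<in> S" "\<Theta> p = 0" "\<forall>m\<in>Poly_Mapping.keys p. ydeg m \<le> 1" shows "p = 0"
proof -
  have "hcomp wt j p = 0" for j
  proof (rule normal_zero[OF hcomp_polys_in[OF assms(1)] hcomp_homog])
    show "low (hcomp wt j p)" using assms(3) by (auto simp: low_def in_keys_iff hcomp_lookup)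
    have "\<Theta> (hcomp wt j p) = 0" unfolding \<Theta>_hcomp assms(2) by simp
    then show "L (hcomp wt j p) = 0" using \<Theta>_homog[OF hcomp_homog[of wt j p]] by simp
  qed
  then show ?thesis using sum_hcomp[of wt p] by simp
qed

end

section \<open>Ordinary points with d = g + 1\<close>

locale curve_alg_ordinary = curve_alg +
  fixes g :: nat
  assumes dg: "d = g + 1" and q1: "q = 1"
    and ord: "{r. \<exists>x\<in>W. x \<noteq> 0 \<and> int r = - fls_subdegree x} = UNIV - {1..g}"
begin

text \<open>Leading terms are removed by multiples of \<zeta>, by induction on the pole order. The
  case \<open>m = 2\<close> is excluded because a pole order between \<open>d\<close> and
  \<open>2 * d\<close> may exceed \<open>d\<close> by a gap; exactly there the new generators
  occur.\<close>

lemma pole_split: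
  assumes m: "m = 1 \<or> 3 \<le> m"
  shows "r \<le> m * d \<Longrightarrow> x \<in> V r \<Longrightarrow> \<exists>x1\<in>V ((m - 1) * d). \<exists>x2\<in>V ((m - 1) * d). x = x1 + \<zeta> * x2"
proof (induction r arbitrary: x rule: less_induct)
  case (less r)
  show ?case
  proof (cases "x \<in> V ((m - 1) * d)")
    case True
    then show ?thesis by (intro bexI[of _ x] bexI[of _ 0]) (simp_all add: V_0)
  next
    case False
    then have x: "x \<in> W" "x \<noteq> 0" "fls_subdegree x < - int ((m - 1) * d)" "- int r \<le> fls_subdegree x"
      using less.prems(2) by (auto simp: V_iff)
    define r' where "r' = nat (- fls_subdegree x)"
    have "fls_subdegree x \<le> 0" using x(3) of_nat_0_le_iff[of "(m - 1) * d", where 'a = int] by linarith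
    then have r': "fls_subdegree x = - int r'" by (simp add: r'_def)
    have b: "(m - 1) * d < r'" "r' \<le> r" "r' \<le> m * d" using x(3,4) less.prems(1) unfolding r' by linarith+
    have "r' \<in> {r. \<exists>x\<in>W. x \<noteq> 0 \<and> int r = - fls_subdegree x}" using x r' by auto
    then have rH: "r' \<notin> {1..g}" unfolding ord by simp
    have md: "m * d = (m - 1) * d + d" using m by (cases m) auto
    \<comment> \<open>For \<open>m = 1\<close> the gaps force the pole order to be \<open>d\<close>
      itself; for \<open>m \<ge> 3\<close> it exceeds \<open>2 * d\<close>, so subtracting
      \<open>d\<close> leaves more than \<open>g\<close>.\<close>
    have dr: "d \<le> r' \<and> r' - d \<notin> {1..g}"
    proof (cases "m = 1")
      case True
      then have "r' = d" using b rH dg by auto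
      then show ?thesis by simp
    next
      case False
      then have "2 * d \<le> (m - 1) * d" using m by (intro mult_right_mono) auto
      then have "2 * d < r'" using b(1) by linarith
      then show ?thesis using dg by auto
    qed
    then have "r' - d \<in> {r. \<exists>x\<in>W. x \<noteq> 0 \<and> int r = - fls_subdegree x}" unfolding ord by simp
    then obtain h where h: "h \<in> W" "h \<noteq> 0" "int (r' - d) = - fls_subdegree h" by blast
    have hV: "h \<in> V ((m - 1) * d)" 
    proof -
      have "int (r' - d) \<le> int ((m - 1) * d)" using b(3) md by linarith
      then show ?thesis using h by (simp add: V_iff)
    qed
    have "fls_subdegree (\<zeta> * h) = - int r'" using h \<zeta>0 \<zeta>deg q1 dr by simp
    from leading_cancel[OF _ r' this] obtain c where
      c: "x - fls_const c * (\<zeta> * h) = 0 \<or> - int r' < fls_subdegree (x - fls_const c * (\<zeta> * h))" using h \<zeta>0 by auto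
    have r1: "1 \<le> r'" using b(1) by linarith
    have "x - fls_const c * (\<zeta> * h) \<in> W" using Wadd[OF x(1) W_uminus[OF Wmult[OF Wc Wmult[OF \<zeta>W h(1)]]]] by simp
    then have "x - fls_const c * (\<zeta> * h) \<in> V (r' - 1)" using c r1 by (auto simp: V_iff)
    note x' = this
    have "\<exists>x1\<in>V ((m - 1) * d). \<exists>x2\<in>V ((m - 1) * d). x - fls_const c * (\<zeta> * h) = x1 + \<zeta> * x2"
      by (rule less.IH[OF _ _ x']) (use b r1 in linarith)+
    then obtain x1 x2 where xx: "x1 \<in> V ((m - 1) * d)" "x2 \<in> V ((m - 1) * d)" "x - fls_const c * (\<zeta> * h) = x1 + \<zeta> * x2"
      by blast
    have "x = x1 + \<zeta> * (x2 + fls_const c * h)" using xx(3) by (simp add: algebra_simps)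
    moreover have "x2 + fls_const c * h \<in> V ((m - 1) * d)" by (intro V_add V_cmult xx(2) hV)
    ultimately show ?thesis using xx(1) by blast
  qed
qed

lemma v_2: assumes a: "a \<in> {1..s}" shows "v a = 2"
proof (rule ccontr)
  assume "v a \<noteq> 2"
  then have "v a = 1 \<or> 3 \<le> v a" using v_pos[OF a] by linarith
  from pole_split[OF this order_refl \<eta>V[OF a]] obtain x1 x2 where
    x: "x1 \<in> V ((v a - 1) * d)" "x2 \<in> V ((v a - 1) * d)" "\<eta> a = x1 + \<zeta> * x2" by blast
  show False
    by (rule redundant_combination[OF a, of "{}" x1 x2]) (use x q1 v_pos[OF a] in simp_all)
qed

text \<open>Products of two generators have degree 4, where \<open>pole_split\<close> expresses
  every element by x and z.\<close>

lemma uniform: "curve_alg_uniform W d q s \<zeta> v \<eta> 2"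
proof
  show "(1::nat) \<le> 2" by simp
  show "v a = 2" if "a \<in> {1..s}" for a using v_2[OF that] .
  fix f c assume fc: "f \<in> {1..s}" "c \<in> {1..s}"
  have "\<eta> f * \<eta> c \<in> V (4 * d)" using V_mult[OF \<eta>V[OF fc(1)] \<eta>V[OF fc(2)]] v_2[OF fc(1)] v_2[OF fc(2)] by simp
  from pole_split[of 4, OF _ order_refl this] obtain x1 x2 where
    "x1 \<in> V (3 * d)" "x2 \<in> V (3 * d)" "\<eta> f * \<eta> c = x1 + \<zeta> * x2" by auto
  then show "\<exists>r1\<in>V ((2 * 2 - 1) * d). \<exists>r2. (q \<le> 2 * 2 \<longrightarrow> r2 \<in> V ((2 * 2 - q) * d)) \<and> (\<not> q \<le> 2 * 2 \<longrightarrow> r2 = 0) \<and> \<eta> f * \<eta> c = r1 + \<zeta> * r2"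
    using q1 by (intro bexI[of _ x1] exI[of _ x2]) simp_all
qed

end

section \<open>The minimal resolution of the expanded section ring\<close>

context curve_alg
begin

sublocale gs: graded_setup s wt \<Theta> "\<lambda>j p. Polynomial.monom (poly.coeff p j) j"
  by unfold_locales simp_all

text \<open>If basis elements go to homogeneous elements of their own degree, the augmentation
  commutes with the projections to degrees, as \<open>gres\<close> demands.\<close>

lemma eps_mcomp:
  assumes a: "\<And>b. b \<in> B \<Longrightarrow> a b = Polynomial.monom (x b) (bd b)" and u: "u \<in> free_mod s B"
  shows "gs.eps a (mcomp wt bd j u) = Polynomial.monom (poly.coeff (gs.eps a u) j) j"
proof -
  have ku: "Poly_Mapping.keys u \<subseteq> B" using u by (simp add: free_mod_def)
  have "Poly_Mapping.keys (mcomp wt bd j u) \<subseteq> Poly_Mapping.keys u"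
    by (auto simp: in_keys_iff mcomp_lookup split: if_splits)
  then have "gs.eps a (mcomp wt bd j u) = (\<Sum>b\<in>Poly_Mapping.keys u. \<Theta> (Poly_Mapping.lookup (mcomp wt bd j u) b) * a b)"
    by (intro gs.eps_superset) simp_all
  also have "\<dots> = (\<Sum>b\<in>Poly_Mapping.keys u. Polynomial.monom (poly.coeff (\<Theta> (Poly_Mapping.lookup u b) * a b) j) j)"
  proof (rule sum.cong[OF refl])
    fix b assume "b \<in> Poly_Mapping.keys u"
    then have ab: "a b = Polynomial.monom (x b) (bd b)" using a ku by blast
    have "poly.coeff (\<Theta> (Poly_Mapping.lookup u b) * a b) j =
        (if bd b \<le> j then x b * poly.coeff (\<Theta> (Poly_Mapping.lookup u b)) (j - bd b) else 0)"
      unfolding ab mult.commute[of _ "Polynomial.monom _ _"] coeff_monom_mult by simp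
    then show "\<Theta> (Poly_Mapping.lookup (mcomp wt bd j u) b) * a b = Polynomial.monom (poly.coeff (\<Theta> (Poly_Mapping.lookup u b) * a b) j) j"
      unfolding mcomp_lookup by (cases "bd b \<le> j") (simp_all add: ab \<Theta>_hcomp mult_monom mult.commute)
  qed
  also have "\<dots> = Polynomial.monom (poly.coeff (gs.eps a u) j) j"
    unfolding gs.eps_def by (rule poly_eqI) (simp add: Polynomial.coeff_sum)
  finally show ?thesis .
qed

end

context curve_alg_uniform
begin

definition uniform_res :: "(nat \<Rightarrow> nat \<Rightarrow> (nat \<Rightarrow>\<^sub>0 (var, 'a) mpoly)) \<Rightarrow> (nat \<Rightarrow> 'a ratfun) \<Rightarrow> 'a resolution" where
  "uniform_res D A = \<lparr>basis = pommaret_basis s, bdeg = (\<lambda>i _. pommaret_degree vv i), diff = D, aug = A\<rparr>"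

lemma uniform_res_simps [simp]:
  "basis (uniform_res D A) = pommaret_basis s" "bdeg (uniform_res D A) i b = pommaret_degree vv i" "diff (uniform_res D A) = D" "aug (uniform_res D A) = A"
  by (simp_all add: uniform_res_def)

theorem uniform_resolution:
  obtains D where "\<And>A. gs.gres (uniform_res D A) (\<lambda>_. 1) (Rt W d)"
    "\<And>i b c. b \<in> pommaret_basis s (Suc i) \<Longrightarrow> const_term (Poly_Mapping.lookup (D i b) c) = 0"
proof -
  define I0 where "I0 = {p \<in> S. \<Theta> p = 0}"
  have wY: "wt (Y a) = vv" if "1 \<le> a" "a \<le> s" for a using v_eq[of a] that by simp
  have I0: "0 \<in> I0" "p \<in> I0 \<Longrightarrow> p' \<in> I0 \<Longrightarrow> p + p' \<in> I0" "p \<in> S \<Longrightarrow> p' \<in> I0 \<Longrightarrow> p * p' \<in> I0" for p p'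
    by (simp_all add: I0_def)
  have nf: "\<exists>p\<in>S. (\<forall>m\<in>Poly_Mapping.keys p. ydeg m \<le> 1) \<and> homog wt (2 * vv) p \<and> Poly_Mapping.single (mY f + mY c) 1 - p \<in> I0"
    if cf: "1 \<le> f" "f \<le> c" "c \<le> s" for f c
  proof -
    have fc: "f \<in> {1..s}" "c \<in> {1..s}" using cf by simp_all
    obtain p where p: "p \<in> S" "\<forall>m\<in>Poly_Mapping.keys p. ydeg m \<le> 1" "homog wt (2 * vv) p" "\<Theta> (Poly_Mapping.single (mY f + mY c) 1 - p) = 0"
      using quadratic_normal_form[OF cf] by blast
    have "Poly_Mapping.keys (mY f + mY c) \<subseteq> pvars s" using fc by (simp add: mY_def keys_plus_nat pvars_def)
    then have "Poly_Mapping.single (mY f + mY c) 1 - p \<in> S" using p(1) by simp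
    then have "Poly_Mapping.single (mY f + mY c) 1 - p \<in> I0" unfolding I0_def using p(4) by blast
    then show ?thesis using p by blast
  qed
  have uniq: "p = 0" if "p \<in> I0" "p \<in> S" "\<forall>m\<in>Poly_Mapping.keys p. ydeg m \<le> 1" for p
    using normal_kernel[of p] that by (simp add: I0_def)
  obtain D where D: "\<And>i e. e \<in> pommaret_basis s (Suc i) \<Longrightarrow> D i e \<in> free_mod s (pommaret_basis s i)"
    "\<And>i e. e \<in> pommaret_basis s (Suc i) \<Longrightarrow> mhom wt (\<lambda>_. pommaret_degree vv i) (pommaret_degree vv (Suc i)) (D i e)"
    "{u \<in> free_mod s {0}. Poly_Mapping.lookup u 0 \<in> I0} = lin_ext (D 0) ` free_mod s (pommaret_basis s 1)"
    "\<And>i. {u \<in> free_mod s (pommaret_basis s (Suc i)). lin_ext (D i) u = 0} = lin_ext (D (Suc i)) ` free_mod s (pommaret_basis s (Suc (Suc i)))"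
    using pommaret_resolution[of s wt vv I0, OF wY I0 nf uniq] by blast
  have E0: "pommaret_basis s 0 = {0}" by simp
  have eps: "gs.eps (\<lambda>_. 1) u = \<Theta> (Poly_Mapping.lookup u 0)" if "u \<in> free_mod s {0}" for u
    using gs.eps_superset[of "{0}" u "\<lambda>_. 1"] that by (simp add: free_mod_def)
  have mem: "Poly_Mapping.lookup u 0 \<in> S" if "u \<in> free_mod s {0}" for u using that by (simp add: free_mod_def)
  have "gs.eps (\<lambda>_. 1) ` free_mod s {0} = Rt W d"
  proof -
    have "gs.eps (\<lambda>_. 1) ` free_mod s {0} = \<Theta> ` S"
    proof (intro Set.set_eqI iffI)
      fix y assume "y \<in> gs.eps (\<lambda>_. 1) ` free_mod s {0}"
      then show "y \<in> \<Theta> ` S" using eps mem by auto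
    next
      fix y assume "y \<in> \<Theta> ` S"
      then obtain p where p: "p \<in> S" "y = \<Theta> p" by blast
      have "Poly_Mapping.single 0 p \<in> free_mod s {0}" using p by simp
      moreover have "gs.eps (\<lambda>_. 1) (Poly_Mapping.single 0 p) = y" using p by simp
      ultimately show "y \<in> gs.eps (\<lambda>_. 1) ` free_mod s {0}" by blast
    qed
    then show ?thesis unfolding gen .
  qed
  moreover have "{u \<in> free_mod s {0}. gs.eps (\<lambda>_. 1) u = 0} = lin_ext (D 0) ` free_mod s (pommaret_basis s 1)"
    unfolding D(3)[symmetric] using eps mem by (auto simp: I0_def)
  moreover have "gs.eps (\<lambda>_. 1) (mcomp wt (\<lambda>_. pommaret_degree vv 0) j u) = Polynomial.monom (poly.coeff (gs.eps (\<lambda>_. 1) u) j) j"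
    if "u \<in> free_mod s {0}" for u j
    by (rule eps_mcomp[of "{0}" _ "\<lambda>_. 1"]) (use that in \<open>simp_all add: pommaret_degree_def monom_0 one_pCons\<close>)
  ultimately have "gs.gres (uniform_res D A) (\<lambda>_. 1) (Rt W d)" for A
    unfolding gs.gres_def uniform_res_simps E0 uniform_res_def resolution.simps
    using D finite_pommaret_basis[of s] E0 by (simp del: pommaret_basis.simps(1) add: D(4))
  moreover have "const_term (Poly_Mapping.lookup (D i b) c) = 0" if b: "b \<in> pommaret_basis s (Suc i)" for i b c
  proof (rule ccontr)
    assume "const_term (Poly_Mapping.lookup (D i b) c) \<noteq> 0"
    then have 0: "0 \<in> Poly_Mapping.keys (Poly_Mapping.lookup (D i b) c)" by (simp add: const_term_def in_keys_iff)
    then have "c \<in> Poly_Mapping.keys (D i b)" by (auto simp: in_keys_iff)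
    \<comment> \<open>A constant term would have degree 0, but degrees of basis elements jump by
      \<open>2 * vv\<close> at the beginning and by \<open>vv\<close> afterwards.\<close>
    then have "homog wt (pommaret_degree vv (Suc i) - pommaret_degree vv i) (Poly_Mapping.lookup (D i b) c)" using D(2)[OF b] by (simp add: mhom_def)
    then have "pommaret_degree vv (Suc i) - pommaret_degree vv i = 0" using 0 by (auto simp: homog_def wdeg_def)
    then show False using vv by (cases i) (simp_all add: pommaret_degree_def)
  qed
  ultimately show thesis using that by blast
qed

lemma tensor_homology_uniform:
  assumes "gs.gres F a (Rt W d)"
  shows "tensor_homology_dim F i j = (if j = pommaret_degree vv i then int (card (pommaret_basis s i)) else 0)"
proof -
  obtain D where D: "\<And>A. gs.gres (uniform_res D A) (\<lambda>_. 1) (Rt W d)"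
    "\<And>i b c. b \<in> pommaret_basis s (Suc i) \<Longrightarrow> const_term (Poly_Mapping.lookup (D i b) c) = 0"
    using uniform_resolution by blast
  have "tensor_homology_dim F i j = int (card (gs.pc (uniform_res D undefined) i j))"
    by (rule gs.tensor_homology_eq[OF assms D(1)[of undefined]]) (simp add: D(2))
  then show ?thesis by (simp add: gs.pc_def)
qed

text \<open>The comparison theorem is applied to \<open>F\<close> against itself and against the
  Pommaret resolution. A basis element in another degree would contribute to homology that is known
  to vanish.\<close>

lemma minimal_pure:
  assumes F: "gs.gres F a (Rt W d)" and min: "\<And>i b c. b \<in> basis F (Suc i) \<Longrightarrow> const_term (Poly_Mapping.lookup (diff F i b) c) = 0"
    and b: "b \<in> basis F i"
  shows "bdeg F i b = pommaret_degree vv i"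
proof (rule ccontr)
  assume *: "bdeg F i b \<noteq> pommaret_degree vv i"
  have "int (card (gs.pc F i (bdeg F i b))) = 0"
    using gs.tensor_homology_eq[OF F F min, of i "bdeg F i b"] tensor_homology_uniform[OF F, of i "bdeg F i b"] * by simp
  moreover have "finite (gs.pc F i (bdeg F i b))" unfolding gs.pc_def by (rule gs.gresD(1)[OF F])
  ultimately show False using b by (auto simp: gs.pc_def)
qed

lemma tensor_homology_uniform_Suc:
  assumes "gs.gres F a (Rt W d)"
  shows "tensor_homology_dim F (Suc i) ((Suc i + 1) * vv) = int (Suc i * ((s + 1) choose (Suc i + 1)))"
  using tensor_homology_uniform[OF assms, of "Suc i" "(Suc i + 1) * vv"] card_pommaret_basis[of s i] by (simp add: pommaret_degree_def)

end

text \<open>An injective map from a ring structure with carrier into a ring of the type class.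
  Identities are verified in the image, and even the ring axioms of the source are derived in this
  way.\<close>

locale ring_embedding =
  fixes R :: "('a, 'm) ring_scheme" (structure) and h :: "'a \<Rightarrow> 'r::comm_ring_1"
  assumes closed: "x \<in> carrier R \<Longrightarrow> y \<in> carrier R \<Longrightarrow> x \<oplus> y \<in> carrier R" "x \<in> carrier R \<Longrightarrow> y \<in> carrier R \<Longrightarrow> x \<otimes> y \<in> carrier R"
      "\<zero> \<in> carrier R" "\<one> \<in> carrier R"
    and neg: "x \<in> carrier R \<Longrightarrow> \<exists>y\<in>carrier R. h y = - h x"
    and hom: "x \<in> carrier R \<Longrightarrow> y \<in> carrier R \<Longrightarrow> h (x \<oplus> y) = h x + h y" "x \<in> carrier R \<Longrightarrow> y \<in> carrier R \<Longrightarrow> h (x \<otimes> y) = h x * h y"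
      "h \<zero> = 0" "h \<one> = 1"
    and inj: "inj_on h (carrier R)"
begin

lemma eqI: "x \<in> carrier R \<Longrightarrow> y \<in> carrier R \<Longrightarrow> h x = h y \<Longrightarrow> x = y"
  using inj by (blast dest: inj_onD)

lemma is_cring: "cring R"
proof (rule cringI)
  show "abelian_group R"
  proof (rule abelian_groupI)
    fix x assume x: "x \<in> carrier R"
    obtain y where y: "y \<in> carrier R" "h y = - h x" using neg[OF x] by blast
    have "y \<oplus> x = \<zero>" by (rule eqI) (use x y in \<open>simp_all add: closed hom\<close>)
    then show "\<exists>y\<in>carrier R. y \<oplus> x = \<zero>" using y by blast
  qed (auto intro!: eqI simp: closed hom ac_simps)
  show "comm_monoid R" by (rule comm_monoidI) (auto intro!: eqI simp: closed hom ac_simps)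
qed (auto intro!: eqI simp: closed hom algebra_simps)

sublocale cring R by (rule is_cring)

lemma hom_uminus: "x \<in> carrier R \<Longrightarrow> h (\<ominus> x) = - h x"
  using hom(1)[of "\<ominus> x" x] hom(3) by (simp add: l_neg eq_neg_iff_add_eq_0)

lemma hom_pow: "x \<in> carrier R \<Longrightarrow> h (x [^] (k::nat)) = h x ^ k"
  by (induction k) (simp_all add: hom mult.commute)

lemma hom_finsum: "f \<in> A \<rightarrow> carrier R \<Longrightarrow> h (finsum R f A) = (\<Sum>x\<in>A. h (f x))"
  by (induction A rule: infinite_finite_induct) (simp_all add: hom)

lemma hom_finprod: "f \<in> A \<rightarrow> carrier R \<Longrightarrow> h (finprod R f A) = (\<Prod>x\<in>A. h (f x))"
  by (induction A rule: infinite_finite_induct) (simp_all add: hom)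

text \<open>The elements whose image is a combination of \<open>h a\<close> and \<open>h b\<close>
  already form an ideal containing \<open>a\<close> and \<open>b\<close>, so they exhaust the
  generated one.\<close>

lemma genideal_pair:
  assumes a: "a \<in> carrier R" and b: "b \<in> carrier R" and x: "x \<in> genideal R {a, b}"
  obtains r1 r2 where "r1 \<in> carrier R" "r2 \<in> carrier R" "h x = h a * h r1 + h b * h r2"
proof -
  define J where "J = {x \<in> carrier R. \<exists>r1\<in>carrier R. \<exists>r2\<in>carrier R. h x = h a * h r1 + h b * h r2}"
  have J: "x \<in> carrier R \<Longrightarrow> r1 \<in> carrier R \<Longrightarrow> r2 \<in> carrier R \<Longrightarrow> h x = h a * h r1 + h b * h r2 \<Longrightarrow> x \<in> J" for x r1 r2
    unfolding J_def by blast
  have JE: "\<exists>r1 r2. x \<in> carrier R \<and> r1 \<in> carrier R \<and> r2 \<in> carrier R \<and> h x = h a * h r1 + h b * h r2" if "x \<in> J" for x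
    using that unfolding J_def by blast
  have mult_closed: "y \<otimes> x \<in> J" if xJ: "x \<in> J" and y: "y \<in> carrier R" for x y
  proof -
    obtain r1 r2 where r: "x \<in> carrier R" "r1 \<in> carrier R" "r2 \<in> carrier R" "h x = h a * h r1 + h b * h r2"
      using JE[OF xJ] by blast
    show ?thesis by (rule J[of _ "y \<otimes> r1" "y \<otimes> r2"]) (use r y in \<open>simp_all add: hom algebra_simps\<close>)
  qed
  have "ideal J R"
  proof (rule idealI)
    show "ring R" by (rule ring_axioms)
    show "subgroup J (add_monoid R)"
    proof (rule add.subgroupI)
      show "J \<subseteq> carrier R" unfolding J_def by blast
      have "\<zero> \<in> J" by (rule J[of _ \<zero> \<zero>]) (simp_all add: hom)
      then show "J \<noteq> {}" by blast
      show "\<ominus> x \<in> J" if xJ: "x \<in> J" for x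
      proof -
        obtain r1 r2 where r: "x \<in> carrier R" "r1 \<in> carrier R" "r2 \<in> carrier R" "h x = h a * h r1 + h b * h r2"
          using JE[OF xJ] by blast
        show ?thesis by (rule J[of _ "\<ominus> r1" "\<ominus> r2"]) (use r in \<open>simp_all add: hom_uminus\<close>)
      qed
      show "x \<oplus> y \<in> J" if xJ: "x \<in> J" and yJ: "y \<in> J" for x y
      proof -
        obtain r1 r2 where r: "x \<in> carrier R" "r1 \<in> carrier R" "r2 \<in> carrier R" "h x = h a * h r1 + h b * h r2"
          using JE[OF xJ] by blast
        obtain r3 r4 where r': "y \<in> carrier R" "r3 \<in> carrier R" "r4 \<in> carrier R" "h y = h a * h r3 + h b * h r4"
          using JE[OF yJ] by blast
        show ?thesis by (rule J[of _ "r1 \<oplus> r3" "r2 \<oplus> r4"]) (use r r' in \<open>simp_all add: hom algebra_simps\<close>)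
      qed
    qed
    show "y \<otimes> x \<in> J" if "x \<in> J" "y \<in> carrier R" for x y using mult_closed that .
    show "x \<otimes> y \<in> J" if xJ: "x \<in> J" and y: "y \<in> carrier R" for x y
    proof -
      have "x \<in> carrier R" using xJ unfolding J_def by blast
      then show ?thesis using mult_closed[OF xJ y] y by (simp add: m_comm)
    qed
  qed
  moreover have "{a, b} \<subseteq> J" using J[of a \<one> \<zero>] J[of b \<zero> \<one>] a b by (simp add: hom)
  ultimately have "genideal R {a, b} \<subseteq> J" by (rule genideal_minimal)
  then show thesis using JE x that by blast
qed

end

section \<open>The section ring\<close>

context smooth_point
begin

sublocale emb: ring_embedding "function_field n C" \<Phi>
proof
  show "\<exists>y\<in>carrier K. \<Phi> y = - \<Phi> x" if "x \<in> carrier K" for x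
  proof (rule bexI[of _ "cf (- 1) [*] x"])
    show "\<Phi> (cf (- 1) [*] x) = - \<Phi> x" using that by (simp add: \<Phi>_mult)
  qed (use that in simp)
  show "inj_on \<Phi> (carrier K)" by (rule inj_onI) (rule \<Phi>_inj)
qed (simp_all add: \<Phi>_add \<Phi>_mult)

interpretation UPK: UP_cring K "UP K"
  by unfold_locales

abbreviation "UK \<equiv> UP K"
abbreviation "co \<equiv> up_ring.coeff UK"
abbreviation "Wf \<equiv> \<Phi> ` regular_away n C P"

definition \<Psi> :: "(nat \<Rightarrow> 'k ratfun) \<Rightarrow> 'k fls poly" where
  "\<Psi> p = Abs_poly (\<lambda>i. \<Phi> (co p i))"

lemma coeff_\<Psi>: assumes p: "p \<in> carrier UK" shows "poly.coeff (\<Psi> p) i = \<Phi> (co p i)"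
proof -
  have "\<forall>\<^sub>\<infinity>i. \<Phi> (co p i) = 0"
    unfolding MOST_nat by (intro exI[of _ "deg K p"] allI impI) (simp add: UPK.deg_aboveD p)
  then show ?thesis unfolding \<Psi>_def by (simp add: Abs_poly_inverse)
qed

lemma co_carrier: "p \<in> carrier UK \<Longrightarrow> co p i \<in> carrier K"
  by (rule UPK.coeff_closed)

sublocale embU: ring_embedding "UP (function_field n C)" \<Psi>
proof
  show "x \<oplus>\<^bsub>UK\<^esub> y \<in> carrier UK" "x \<otimes>\<^bsub>UK\<^esub> y \<in> carrier UK" if "x \<in> carrier UK" "y \<in> carrier UK" for x y
    using that by simp_all
  show 01: "\<zero>\<^bsub>UK\<^esub> \<in> carrier UK" "\<one>\<^bsub>UK\<^esub> \<in> carrier UK" by simp_all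
  show add: "\<Psi> (x \<oplus>\<^bsub>UK\<^esub> y) = \<Psi> x + \<Psi> y" if "x \<in> carrier UK" "y \<in> carrier UK" for x y
    by (rule poly_eqI) (use that in \<open>simp add: coeff_\<Psi> \<Phi>_add co_carrier\<close>)
  show "\<Psi> (x \<otimes>\<^bsub>UK\<^esub> y) = \<Psi> x * \<Psi> y" if xy: "x \<in> carrier UK" "y \<in> carrier UK" for x y
  proof (rule poly_eqI)
    fix m
    have "\<Phi> (\<Oplus>\<^bsub>K\<^esub>i\<in>{..m}. co x i [*] co y (m - i)) = (\<Sum>i\<in>{..m}. \<Phi> (co x i [*] co y (m - i)))"
      by (rule emb.hom_finsum) (use xy co_carrier in auto)
    then show "poly.coeff (\<Psi> (x \<otimes>\<^bsub>UK\<^esub> y)) m = poly.coeff (\<Psi> x * \<Psi> y) m"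
      using xy by (simp add: coeff_\<Psi> UPK.coeff_mult Polynomial.coeff_mult \<Phi>_mult co_carrier)
  qed
  show z: "\<Psi> \<zero>\<^bsub>UK\<^esub> = 0" by (rule poly_eqI) (use 01 in \<open>simp add: coeff_\<Psi>\<close>)
  show "\<Psi> \<one>\<^bsub>UK\<^esub> = 1" by (rule poly_eqI) (use 01 in \<open>simp add: coeff_\<Psi>\<close>)
  show "\<exists>y\<in>carrier UK. \<Psi> y = - \<Psi> x" if x: "x \<in> carrier UK" for x
  proof (rule bexI[of _ "\<ominus>\<^bsub>UK\<^esub> x"])
    show "\<ominus>\<^bsub>UK\<^esub> x \<in> carrier UK" using x by simp
    then have "\<Psi> (\<ominus>\<^bsub>UK\<^esub> x) + \<Psi> x = 0" using add[of "\<ominus>\<^bsub>UK\<^esub> x" x] z x by (simp add: UPK.P.l_neg)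
    then show "\<Psi> (\<ominus>\<^bsub>UK\<^esub> x) = - \<Psi> x" by (simp add: eq_neg_iff_add_eq_0)
  qed
  show "inj_on \<Psi> (carrier UK)"
  proof (rule inj_onI)
    fix x y assume xy: "x \<in> carrier UK" "y \<in> carrier UK" "\<Psi> x = \<Psi> y"
    have "co x i = co y i" for i
    proof (rule \<Phi>_inj)
      show "\<Phi> (co x i) = \<Phi> (co y i)" using coeff_\<Psi>[OF xy(1), of i] coeff_\<Psi>[OF xy(2), of i] xy(3) by simp
    qed (use xy co_carrier in simp_all)
    then show "x = y" using xy by (intro UPK.up_eqI) simp_all
  qed
qed

sublocale Wf: filtered_alg Wf
proof
  show "fls_const c \<in> Wf" for c using regular_away_closed(3)[of c] by (rule rev_image_eqI) simp
  have W: "regular_away n C P \<subseteq> carrier K" by (auto simp: regular_away_iff)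
  fix x y assume "x \<in> Wf" "y \<in> Wf"
  then obtain a b where ab: "a \<in> regular_away n C P" "b \<in> regular_away n C P" "x = \<Phi> a" "y = \<Phi> b" by blast
  show "x + y \<in> Wf" using regular_away_closed(1)[OF ab(1,2)] by (rule rev_image_eqI) (use ab W in \<open>simp add: \<Phi>_add subset_iff\<close>)
  show "x * y \<in> Wf" using regular_away_closed(2)[OF ab(1,2)] by (rule rev_image_eqI) (use ab W in \<open>simp add: \<Phi>_mult subset_iff\<close>)
qed

lemma regular_away_carrier: "f \<in> regular_away n C P \<Longrightarrow> f \<in> carrier K" by (simp add: regular_away_iff)

lemma Wf_iff: "f \<in> carrier K \<Longrightarrow> \<Phi> f \<in> Wf \<longleftrightarrow> f \<in> regular_away n C P"
  using regular_away_carrier \<Phi>_inj by blast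

text \<open>The condition on poles becomes an inequality between subdegrees. The zero function is
  treated apart, as \<open>ord_at\<close> carries no information there.\<close>

lemma sections_iff: "f \<in> carrier K \<Longrightarrow> f \<in> sections n C P r \<longleftrightarrow> \<Phi> f \<in> Vr Wf r"
proof (cases "f = \<zero>\<^bsub>K\<^esub>")
  case True
  then show ?thesis using regular_away_closed(3)[of 0] Wf.V_0[of r] by (simp add: sections_def)
qed (simp add: sections_def Wf.V_iff Wf_iff \<Phi>_eq_0 ord_at_eq)

lemma sections_carrier: "f \<in> sections n C P r \<Longrightarrow> f \<in> carrier K"
  by (simp add: sections_def regular_away_carrier)

lemma section_ring_carrier: "p \<in> carrier (section_ring n C P e) \<longleftrightarrow> p \<in> carrier UK \<and> \<Psi> p \<in> Rt Wf e"
  by (auto simp: section_ring_def Rt_def coeff_\<Psi> sections_iff co_carrier)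

lemma section_ring_ops [simp]:
  "mult (section_ring n C P e) = mult UK" "add (section_ring n C P e) = add UK"
  "one (section_ring n C P e) = one UK" "zero (section_ring n C P e) = zero UK"
  by (simp_all add: section_ring_def)

lemma section_ring_embedding: "ring_embedding (section_ring n C P e) \<Psi>"
proof
  fix x y assume x: "x \<in> carrier (section_ring n C P e)"
  then have x': "x \<in> carrier UK" "\<Psi> x \<in> Rt Wf e" by (simp_all add: section_ring_carrier)
  show "\<exists>y\<in>carrier (section_ring n C P e). \<Psi> y = - \<Psi> x"
    using embU.hom_uminus[OF x'(1)] x'
    by (intro bexI[of _ "\<ominus>\<^bsub>UK\<^esub> x"]) (simp_all add: section_ring_carrier Rt_def Wf.V_uminus)
  assume y: "y \<in> carrier (section_ring n C P e)"
  then have y': "y \<in> carrier UK" "\<Psi> y \<in> Rt Wf e" by (simp_all add: section_ring_carrier)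
  show "\<Psi> (x \<oplus>\<^bsub>section_ring n C P e\<^esub> y) = \<Psi> x + \<Psi> y" "\<Psi> (x \<otimes>\<^bsub>section_ring n C P e\<^esub> y) = \<Psi> x * \<Psi> y"
    using x' y' by (simp_all add: embU.hom)
  show "x \<oplus>\<^bsub>section_ring n C P e\<^esub> y \<in> carrier (section_ring n C P e)"
    using x' y' by (simp add: section_ring_carrier embU.hom Rt_def Wf.V_add)
  have "(\<Sum>i\<le>m. poly.coeff (\<Psi> x) i * poly.coeff (\<Psi> y) (m - i)) \<in> Vr Wf (m * e)" for m
  proof (rule Wf.V_sum)
    fix i assume i: "i \<in> {..m}"
    have "poly.coeff (\<Psi> x) i * poly.coeff (\<Psi> y) (m - i) \<in> Vr Wf (i * e + (m - i) * e)"
      by (rule Wf.V_mult) (use x' y' in \<open>simp_all add: Rt_def\<close>)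
    moreover have "i * e + (m - i) * e = m * e" using i by (simp flip: add_mult_distrib)
    ultimately show "poly.coeff (\<Psi> x) i * poly.coeff (\<Psi> y) (m - i) \<in> Vr Wf (m * e)" by (simp only:)
  qed
  then show "x \<otimes>\<^bsub>section_ring n C P e\<^esub> y \<in> carrier (section_ring n C P e)"
    using x' y' by (simp add: section_ring_carrier embU.hom Rt_def Polynomial.coeff_mult)
next
  show "\<zero>\<^bsub>section_ring n C P e\<^esub> \<in> carrier (section_ring n C P e)"
    by (simp add: section_ring_carrier embU.hom Rt_def Wf.V_0)
  have "fls_const 1 \<in> Vr Wf r" for r by (rule Wf.V_const)
  then have "1 \<in> Vr Wf r" for r by simp
  then show "\<one>\<^bsub>section_ring n C P e\<^esub> \<in> carrier (section_ring n C P e)"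
    by (simp add: section_ring_carrier embU.hom Rt_def Wf.V_0)
  show "inj_on \<Psi> (carrier (section_ring n C P e))"
    by (rule inj_on_subset[OF embU.inj]) (auto simp: section_ring_carrier)
qed (simp_all add: embU.hom)

lemma \<Psi>_homog_elt: "f \<in> carrier K \<Longrightarrow> \<Psi> (homog_elt n C m f) = Polynomial.monom (\<Phi> f) m"
  by (rule poly_eqI) (simp add: homog_elt_def coeff_\<Psi>)

lemma homog_elt_mem: "f \<in> sections n C P (m * e) \<Longrightarrow> homog_elt n C m f \<in> carrier (section_ring n C P e)"
  using sections_carrier[of f "m * e"] sections_iff[of f "m * e"]
  by (simp add: section_ring_carrier \<Psi>_homog_elt Rt_def Wf.V_0) (simp add: homog_elt_def)

text \<open>Coefficients are lifted one by one. Injectivity of \<Phi> turns the vanishing of high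
  coefficients into the bound required of elements of \<open>UP\<close>.\<close>

lemma \<Psi>_section_ring: "\<Psi> ` carrier (section_ring n C P e) = Rt Wf e"
proof (intro equalityI subsetI)
  fix y assume y: "y \<in> Rt Wf e"
  have "\<exists>f. f \<in> regular_away n C P \<and> \<Phi> f = poly.coeff y m" for m
  proof -
    have "poly.coeff y m \<in> Wf" using y by (simp add: Rt_def Vr_def)
    then show ?thesis by (metis imageE)
  qed
  then obtain f where f: "\<And>m. f m \<in> regular_away n C P" "\<And>m. \<Phi> (f m) = poly.coeff y m" by metis
  have "bound \<zero>\<^bsub>K\<^esub> (Polynomial.degree y) f"
  proof (rule bound.intro)
    fix m assume "Polynomial.degree y < m"
    then have "\<Phi> (f m) = 0" unfolding f(2) by (rule coeff_eq_0)
    then show "f m = \<zero>\<^bsub>K\<^esub>" using \<Phi>_eq_0[OF regular_away_carrier[OF f(1)]] by simp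
  qed
  then have fU: "f \<in> up K" using regular_away_carrier[OF f(1)] by (intro mem_upI) blast+
  then have fc: "f \<in> carrier UK" by (simp add: UP_def)
  have "\<Psi> f = y" by (rule poly_eqI) (use fc fU f(2) in \<open>simp add: coeff_\<Psi>, simp add: UP_def\<close>)
  then show "y \<in> \<Psi> ` carrier (section_ring n C P e)" using fc y by (auto simp: section_ring_carrier)
qed (auto simp: section_ring_carrier)

lemma const_section: "cf c \<in> sections n C P r"
  by (simp add: sections_iff Wf.V_const)

lemma one_section: "\<one>\<^bsub>K\<^esub> \<in> sections n C P r"
  using const_section[of 1 r] by (simp add: const_fun_simps)

lemma pgen_mem:
  assumes "\<zeta> \<in> sections n C P (q * e)" "\<forall>a\<in>{1..s}. \<eta> a \<in> sections n C P (v a * e)" "u \<in> pvars s"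
  shows "pgen n C q \<zeta> v \<eta> u \<in> carrier (section_ring n C P e)"
    "\<Psi> (pgen n C q \<zeta> v \<eta> u) = tgen q (\<Phi> \<zeta>) v (\<Phi> \<circ> \<eta>) u"
  using assms one_section[of "1 * e"] sections_carrier
  by (auto simp: pgen_def tgen_def pvars_def x_elt_def \<Psi>_homog_elt intro!: homog_elt_mem)

lemma pres_map_eq:
  assumes \<zeta>: "\<zeta> \<in> sections n C P (q * e)" and \<eta>: "\<forall>a\<in>{1..s}. \<eta> a \<in> sections n C P (v a * e)" and p: "p \<in> polys_in (pvars s)"
  shows "pres_map n C P e (pgen n C q \<zeta> v \<eta>) p \<in> carrier (section_ring n C P e)"
    "\<Psi> (pres_map n C P e (pgen n C q \<zeta> v \<eta>) p) = polyh.ev (tgen q (\<Phi> \<zeta>) v (\<Phi> \<circ> \<eta>)) p"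
proof -
  let ?S = "section_ring n C P e" let ?g = "pgen n C q \<zeta> v \<eta>"
  interpret SR: ring_embedding ?S \<Psi> by (rule section_ring_embedding)
  have km: "Poly_Mapping.keys m \<subseteq> pvars s" if "m \<in> Poly_Mapping.keys p" for m using p that by (auto simp: polys_in_def)
  note g = pgen_mem[OF \<zeta> \<eta>]
  have c: "homog_elt n C 0 (cf c) \<in> carrier ?S" "\<Psi> (homog_elt n C 0 (cf c)) = [:fls_const c:]" for c
    using homog_elt_mem[OF const_section[of c "0 * e"]] by (simp_all add: \<Psi>_homog_elt monom_0)
  have pw: "(\<lambda>u. ?g u [^]\<^bsub>?S\<^esub> Poly_Mapping.lookup m u) \<in> Poly_Mapping.keys m \<rightarrow> carrier ?S" if "m \<in> Poly_Mapping.keys p" for m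
    using g(1) km[OF that] by (intro Pi_I SR.nat_pow_closed) blast
  have fp: "(\<Otimes>\<^bsub>?S\<^esub>u\<in>Poly_Mapping.keys m. ?g u [^]\<^bsub>?S\<^esub> Poly_Mapping.lookup m u) \<in> carrier ?S"
    "\<Psi> (\<Otimes>\<^bsub>?S\<^esub>u\<in>Poly_Mapping.keys m. ?g u [^]\<^bsub>?S\<^esub> Poly_Mapping.lookup m u) = mon (tgen q (\<Phi> \<zeta>) v (\<Phi> \<circ> \<eta>)) m"
    if m: "m \<in> Poly_Mapping.keys p" for m
  proof -
    show "(\<Otimes>\<^bsub>?S\<^esub>u\<in>Poly_Mapping.keys m. ?g u [^]\<^bsub>?S\<^esub> Poly_Mapping.lookup m u) \<in> carrier ?S"
      by (rule SR.finprod_closed[OF pw[OF m]])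
    show "\<Psi> (\<Otimes>\<^bsub>?S\<^esub>u\<in>Poly_Mapping.keys m. ?g u [^]\<^bsub>?S\<^esub> Poly_Mapping.lookup m u) = mon (tgen q (\<Phi> \<zeta>) v (\<Phi> \<circ> \<eta>)) m"
      unfolding SR.hom_finprod[OF pw[OF m]] mon_def
      by (rule prod.cong[OF refl]) (use g km[OF m] in \<open>simp add: SR.hom_pow subset_iff\<close>)
  qed
  have fs: "(\<lambda>m. homog_elt n C 0 (cf (Poly_Mapping.lookup p m)) \<otimes>\<^bsub>?S\<^esub>
      (\<Otimes>\<^bsub>?S\<^esub>u\<in>Poly_Mapping.keys m. ?g u [^]\<^bsub>?S\<^esub> Poly_Mapping.lookup m u)) \<in> Poly_Mapping.keys p \<rightarrow> carrier ?S"
    using SR.m_closed c(1) fp(1) by blast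
  show "pres_map n C P e ?g p \<in> carrier ?S"
    unfolding pres_map_def by (rule SR.finsum_closed[OF fs])
  show "\<Psi> (pres_map n C P e ?g p) = polyh.ev (tgen q (\<Phi> \<zeta>) v (\<Phi> \<circ> \<eta>)) p"
    unfolding pres_map_def SR.hom_finsum[OF fs] polyh.ev_def
  proof (rule sum.cong[OF refl])
    fix m assume m: "m \<in> Poly_Mapping.keys p"
    show "\<Psi> (homog_elt n C 0 (cf (Poly_Mapping.lookup p m)) \<otimes>\<^bsub>?S\<^esub>
      (\<Otimes>\<^bsub>?S\<^esub>u\<in>Poly_Mapping.keys m. ?g u [^]\<^bsub>?S\<^esub> Poly_Mapping.lookup m u)) =
      [:fls_const (Poly_Mapping.lookup p m):] * mon (tgen q (\<Phi> \<zeta>) v (\<Phi> \<circ> \<eta>)) m"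
      unfolding SR.hom(2)[OF c(1) fp(1)[OF m]] c(2) fp(2)[OF m] ..
  qed
qed

lemma weierstrass_eq: "weierstrass n C P = {r. \<exists>x\<in>Wf. x \<noteq> 0 \<and> int r = - fls_subdegree x}"
proof -
  have "(\<exists>x\<in>Wf. x \<noteq> 0 \<and> int r = - fls_subdegree x) \<longleftrightarrow> (\<exists>f\<in>regular_away n C P. f \<noteq> \<zero>\<^bsub>K\<^esub> \<and> int r = - ord_at n C P f)" for r
    unfolding bex_simps(7)
    by (intro bex_cong refl) (simp add: \<Phi>_eq_0 ord_at_eq regular_away_carrier cong: conj_cong)
  then show ?thesis unfolding weierstrass_def by simp
qed

text \<open>Generation and minimality are equalities of images inside the section ring, on which
  \<Psi> is injective, so both can be read off after expansion. The clause on functions without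
  poles is \<open>global_const\<close>.\<close>

lemma presentation_curve_alg:
  assumes d: "1 \<le> d" and mp: "min_presentation n C P d q \<zeta> s v \<eta>"
  shows "curve_alg Wf d q s (\<Phi> \<zeta>) v (\<Phi> \<circ> \<eta>)"
proof -
  let ?m = "pres_map n C P d (pgen n C q \<zeta> v \<eta>)" let ?\<Theta> = "polyh.ev (tgen q (\<Phi> \<zeta>) v (\<Phi> \<circ> \<eta>))"
  have q: "1 \<le> q" and \<zeta>: "\<zeta> \<in> sections n C P (q * d)" "\<zeta> \<noteq> \<zero>\<^bsub>K\<^esub>" "ord_at n C P \<zeta> = - int (q * d)"
    and \<eta>: "\<forall>a\<in>{1..s}. \<eta> a \<in> sections n C P (v a * d)"
    and gen: "?m ` polys_in (pvars s) = carrier (section_ring n C P d)"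
    and mn: "U' \<subset> pvars s \<Longrightarrow> ?m ` polys_in U' \<noteq> carrier (section_ring n C P d)" for U'
    using mp by (simp_all add: min_presentation_def is_q_def)
  note pm = pres_map_eq[OF \<zeta>(1) \<eta>]
  have im: "?\<Theta> ` polys_in U' = \<Psi> ` ?m ` polys_in U'" if "U' \<subseteq> pvars s" for U'
    unfolding image_image
  proof (rule image_cong[OF refl])
    fix p :: "(var, 'k) mpoly" assume "p \<in> polys_in U'"
    then have "p \<in> polys_in (pvars s)" using that unfolding polys_in_def by blast
    then show "?\<Theta> p = \<Psi> (?m p)" by (rule pm(2)[symmetric])
  qed
  show ?thesis
  proof
    show "1 \<le> d" "1 \<le> q" by fact+
    show "\<exists>c. x = fls_const c" if x: "x \<in> Wf" "0 \<le> fls_subdegree x" for x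
    proof -
      obtain f where f: "f \<in> regular_away n C P" "x = \<Phi> f" using x(1) by blast
      then obtain c where "f = cf c" using global_const[of f] x(2) by blast
      then show ?thesis using f by auto
    qed
    show "\<Phi> \<zeta> \<in> Wf" using \<zeta>(1) by (auto simp: sections_def)
    show "\<Phi> \<zeta> \<noteq> 0" using \<zeta>(2) \<Phi>_eq_0[OF sections_carrier[OF \<zeta>(1)]] by blast
    show "fls_subdegree (\<Phi> \<zeta>) = - int (q * d)" using ord_at_eq[OF sections_carrier[OF \<zeta>(1)] \<zeta>(2)] \<zeta>(3) by simp
    show "(\<Phi> \<circ> \<eta>) a \<in> Vr Wf (v a * d)" if "a \<in> {1..s}" for a
    proof -
      have "\<eta> a \<in> sections n C P (v a * d)" using \<eta> that by blast
      then show ?thesis using sections_iff[OF sections_carrier] unfolding comp_def by blast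
    qed
    show "?\<Theta> ` polys_in (pvars s) = Rt Wf d" unfolding im[OF subset_refl] gen by (rule \<Psi>_section_ring)
    show "?\<Theta> ` polys_in U' \<noteq> Rt Wf d" if U': "U' \<subset> pvars s" for U'
    proof
      assume "?\<Theta> ` polys_in U' = Rt Wf d"
      then have eq: "\<Psi> ` ?m ` polys_in U' = \<Psi> ` carrier (section_ring n C P d)"
        unfolding im[OF psubset_imp_subset[OF U']] \<Psi>_section_ring .
      have "polys_in U' \<subseteq> (polys_in (pvars s) :: (var, 'k) mpoly set)" using U' by (auto simp: polys_in_def)
      then have "?m ` polys_in U' \<subseteq> carrier (section_ring n C P d)" using pm(1) by blast
      from inj_on_image_eq_iff[OF ring_embedding.inj[OF section_ring_embedding] this subset_refl]
      have "?m ` polys_in U' = carrier (section_ring n C P d)" using eq by (rule iffD1)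
      then show False by (rule notE[OF mn[OF U']])
    qed
  qed
qed

definition gr_aug :: "'k resolution \<Rightarrow> nat \<Rightarrow> 'k fls poly" where
  "gr_aug F b = Polynomial.monom (\<Phi> (aug F b)) (bdeg F 0 b)"

lemma aug_map_eq:
  assumes \<zeta>: "\<zeta> \<in> sections n C P (q * e)" and \<eta>: "\<forall>a\<in>{1..s}. \<eta> a \<in> sections n C P (v a * e)"
    and F: "\<forall>b\<in>basis F 0. aug F b \<in> sections n C P (bdeg F 0 b * e)" and u: "u \<in> free_mod s (basis F 0)"
  shows "aug_map n C P e (pgen n C q \<zeta> v \<eta>) F u \<in> carrier (section_ring n C P e)"
    "\<Psi> (aug_map n C P e (pgen n C q \<zeta> v \<eta>) F u) =
       (\<Sum>b\<in>Poly_Mapping.keys u. polyh.ev (tgen q (\<Phi> \<zeta>) v (\<Phi> \<circ> \<eta>)) (Poly_Mapping.lookup u b) * gr_aug F b)"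
proof -
  let ?S = "section_ring n C P e" let ?g = "pgen n C q \<zeta> v \<eta>"
  interpret SR: ring_embedding ?S \<Psi> by (rule section_ring_embedding)
  have ub: "Poly_Mapping.lookup u b \<in> polys_in (pvars s)" for b using u by (simp add: free_mod_def)
  have b: "aug F b \<in> sections n C P (bdeg F 0 b * e)" if "b \<in> Poly_Mapping.keys u" for b using that u F by (auto simp: free_mod_def)
  note pm = pres_map_eq[OF \<zeta> \<eta> ub]
  have fs: "(\<lambda>b. pres_map n C P e ?g (Poly_Mapping.lookup u b) \<otimes>\<^bsub>?S\<^esub> homog_elt n C (bdeg F 0 b) (aug F b)) \<in> Poly_Mapping.keys u \<rightarrow> carrier ?S"
    using SR.m_closed pm(1) homog_elt_mem[OF b] by blast
  show "aug_map n C P e ?g F u \<in> carrier ?S"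
    unfolding aug_map_def by (rule SR.finsum_closed[OF fs])
  show "\<Psi> (aug_map n C P e ?g F u) =
       (\<Sum>b\<in>Poly_Mapping.keys u. polyh.ev (tgen q (\<Phi> \<zeta>) v (\<Phi> \<circ> \<eta>)) (Poly_Mapping.lookup u b) * gr_aug F b)"
    unfolding aug_map_def SR.hom_finsum[OF fs]
  proof (rule sum.cong[OF refl])
    fix b assume bk: "b \<in> Poly_Mapping.keys u"
    show "\<Psi> (pres_map n C P e ?g (Poly_Mapping.lookup u b) \<otimes>\<^bsub>?S\<^esub> homog_elt n C (bdeg F 0 b) (aug F b)) =
        polyh.ev (tgen q (\<Phi> \<zeta>) v (\<Phi> \<circ> \<eta>)) (Poly_Mapping.lookup u b) * gr_aug F b"
      unfolding SR.hom(2)[OF pm(1) homog_elt_mem[OF b[OF bk]]] pm(2) \<Psi>_homog_elt[OF sections_carrier[OF b[OF bk]]] gr_aug_def ..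
  qed
qed

text \<open>Only the clauses about the augmentation need translation: injectivity of \<Psi> carries
  over image and kernel, and homogeneity of the chosen sections gives compatibility with the
  projections to degrees.\<close>

lemma free_resolution_iff:
  assumes d: "1 \<le> d" and mp: "min_presentation n C P d q \<zeta> s v \<eta>"
  shows "free_resolution n C P d q \<zeta> s v \<eta> F \<longleftrightarrow>
    (\<forall>b\<in>basis F 0. aug F b \<in> sections n C P (bdeg F 0 b * d)) \<and>
    graded_setup.gres s (pweight q v) (polyh.ev (tgen q (\<Phi> \<zeta>) v (\<Phi> \<circ> \<eta>)))
      (\<lambda>j p. Polynomial.monom (poly.coeff p j) j) F (gr_aug F) (Rt Wf d)"
proof -
  interpret A: curve_alg Wf d q s "\<Phi> \<zeta>" v "\<Phi> \<circ> \<eta>" by (rule presentation_curve_alg[OF d mp])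
  let ?S = "section_ring n C P d"
  let ?a = "aug_map n C P d (pgen n C q \<zeta> v \<eta>) F" let ?M = "free_mod s (basis F 0) :: (nat \<Rightarrow>\<^sub>0 (var, 'k) mpoly) set"
  interpret SR: ring_embedding ?S \<Psi> by (rule section_ring_embedding)
  have \<zeta>: "\<zeta> \<in> sections n C P (q * d)" and \<eta>: "\<forall>a\<in>{1..s}. \<eta> a \<in> sections n C P (v a * d)"
    using mp by (simp_all add: min_presentation_def)
  show ?thesis
  proof (cases "\<forall>b\<in>basis F 0. aug F b \<in> sections n C P (bdeg F 0 b * d)")
    case True
    have am: "?a u \<in> carrier ?S" "\<Psi> (?a u) = A.gs.eps (gr_aug F) u" if "u \<in> ?M" for u
      using aug_map_eq[OF \<zeta> \<eta> True that] unfolding A.gs.eps_def by simp_all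
    have sub: "?a ` ?M \<subseteq> carrier ?S" using am(1) by blast
    have "A.gs.eps (gr_aug F) ` ?M = \<Psi> ` ?a ` ?M" unfolding image_image using am(2) by (intro image_cong) auto
    then have 1: "?a ` ?M = carrier ?S \<longleftrightarrow> A.gs.eps (gr_aug F) ` ?M = Rt Wf d"
      using inj_on_image_eq_iff[OF SR.inj sub subset_refl] unfolding \<Psi>_section_ring by simp
    have "?a u = \<zero>\<^bsub>?S\<^esub> \<longleftrightarrow> A.gs.eps (gr_aug F) u = 0" if "u \<in> ?M" for u
      using SR.eqI[OF am(1)[OF that] SR.closed(3)] am(2)[OF that] SR.hom(3) by metis
    then have 2: "{u \<in> ?M. ?a u = \<zero>\<^bsub>?S\<^esub>} = {u \<in> ?M. A.gs.eps (gr_aug F) u = 0}" by blast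
    have 3: "\<forall>u\<in>?M. \<forall>j. A.gs.eps (gr_aug F) (mcomp (pweight q v) (bdeg F 0) j u) =
        Polynomial.monom (poly.coeff (A.gs.eps (gr_aug F) u) j) j"
      using A.eps_mcomp[of "basis F 0" "gr_aug F" "\<lambda>b. \<Phi> (aug F b)" "bdeg F 0"] by (simp add: gr_aug_def)
    show ?thesis
      unfolding free_resolution_def Let_def A.gs.gres_def 1 2 mhom_def
      by (simp only: eqTrueI[OF True] eqTrueI[OF 3] simp_thms)
  next
    case False
    then show ?thesis unfolding free_resolution_def Let_def by (simp only: simp_thms)
  qed
qed

lemma uniform_conclusion:
  assumes d: "1 \<le> d" and mp: "min_presentation n C P d q \<zeta> s v \<eta>"
    and un: "curve_alg_uniform Wf d q s (\<Phi> \<zeta>) v (\<Phi> \<circ> \<eta>) vv"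
  shows "min_resolution_pure n C P d q \<zeta> s v \<eta>"
    "1 \<le> i \<Longrightarrow> betti n C P d q \<zeta> s v \<eta> i ((i + 1) * vv) = int (i * ((s + 1) choose (i + 1)))"
proof -
  interpret A: curve_alg_uniform Wf d q s "\<Phi> \<zeta>" v "\<Phi> \<circ> \<eta>" vv by (rule un)
  note iff = free_resolution_iff[OF d mp]
  have "\<exists>D. A.gs.gres (A.uniform_res D (\<lambda>_. \<one>\<^bsub>K\<^esub>)) (\<lambda>_. 1) (Rt Wf d) \<and>
      (\<forall>i. \<forall>b\<in>pommaret_basis s (Suc i). \<forall>c. const_term (Poly_Mapping.lookup (D i b) c) = 0)"
  proof (rule A.uniform_resolution)
    fix D
    assume 1: "\<And>B. A.gs.gres (A.uniform_res D B) (\<lambda>_. 1) (Rt Wf d)"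
      and 2: "\<And>i b c. b \<in> pommaret_basis s (Suc i) \<Longrightarrow> const_term (Poly_Mapping.lookup (D i b) c) = 0"
    show ?thesis by (rule exI[of _ D], rule conjI, rule 1) (intro allI ballI, erule 2)
  qed
  then obtain D where D: "A.gs.gres (A.uniform_res D (\<lambda>_. \<one>\<^bsub>K\<^esub>)) (\<lambda>_. 1) (Rt Wf d)"
    "\<forall>i. \<forall>b\<in>pommaret_basis s (Suc i). \<forall>c. const_term (Poly_Mapping.lookup (D i b) c) = 0"
    by (elim exE conjE)
  let ?G = "A.uniform_res D (\<lambda>_. \<one>\<^bsub>K\<^esub>)"
  have "gr_aug ?G = (\<lambda>_. 1)" by (rule ext) (simp add: gr_aug_def pommaret_degree_def monom_0 one_pCons)
  then have G: "free_resolution n C P d q \<zeta> s v \<eta> ?G"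
    unfolding iff using D(1) one_section by simp
  then have "min_free_resolution n C P d q \<zeta> s v \<eta> ?G"
    unfolding min_free_resolution_def using D(2) by simp
  moreover have "is_pure F" if F: "min_free_resolution n C P d q \<zeta> s v \<eta> F" for F
  proof -
    have F': "A.gs.gres F (gr_aug F) (Rt Wf d)"
      "\<And>i b c. b \<in> basis F (Suc i) \<Longrightarrow> const_term (Poly_Mapping.lookup (diff F i b) c) = 0"
      using F unfolding min_free_resolution_def iff by blast+
    show ?thesis unfolding is_pure_def using A.minimal_pure[OF F'] by blast
  qed
  ultimately show "min_resolution_pure n C P d q \<zeta> s v \<eta>" unfolding min_resolution_pure_def by blast
  \<comment> \<open>\<open>betti\<close> refers to an unspecified resolution; the one just
    constructed guarantees that the choice is a resolution.\<close>
  have "free_resolution n C P d q \<zeta> s v \<eta> (SOME F. free_resolution n C P d q \<zeta> s v \<eta> F)"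
    using G by (rule someI)
  then have H: "A.gs.gres (SOME F. free_resolution n C P d q \<zeta> s v \<eta> F) (gr_aug (SOME F. free_resolution n C P d q \<zeta> s v \<eta> F)) (Rt Wf d)"
    unfolding iff by blast
  show "betti n C P d q \<zeta> s v \<eta> i ((i + 1) * vv) = int (i * ((s + 1) choose (i + 1)))" if "1 \<le> i"
    using A.tensor_homology_uniform_Suc[OF H, of "i - 1"] that unfolding betti_def by simp
qed

text \<open>The classes of two y lie in \<aa>, so their product is 0 in the quotient and the product
  of the y is in (x,z). For \<open>s = 0\<close> the hypothesis says nothing about \<open>w\<close>;
  1 serves as a positive weight then.\<close>

lemma square_zero_uniform:
  assumes d: "1 \<le> d" and mp: "min_presentation n C P d q \<zeta> s v \<eta>"
    and sq: "ideal_prod (A_ring n C P d q \<zeta>) (A_plus n C P d q \<zeta>) (A_plus n C P d q \<zeta>) = {\<zero>\<^bsub>A_ring n C P d q \<zeta>\<^esub>}"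
    and v: "\<forall>a\<in>{1..s}. v a = w"
  shows "curve_alg_uniform Wf d q s (\<Phi> \<zeta>) v (\<Phi> \<circ> \<eta>) (if s = 0 then 1 else w)"
proof -
  interpret A: curve_alg Wf d q s "\<Phi> \<zeta>" v "\<Phi> \<circ> \<eta>" by (rule presentation_curve_alg[OF d mp])
  let ?S = "section_ring n C P d" let ?I = "xz_ideal n C P d q \<zeta>" let ?y = "\<lambda>a. homog_elt n C (v a) (\<eta> a)"
  interpret SR: ring_embedding ?S \<Psi> by (rule section_ring_embedding)
  have \<zeta>: "\<zeta> \<in> sections n C P (q * d)" and \<eta>: "\<And>a. a \<in> {1..s} \<Longrightarrow> \<eta> a \<in> sections n C P (v a * d)"
    using mp by (simp_all add: min_presentation_def)
  have x: "x_elt n C \<in> carrier ?S" unfolding x_elt_def by (rule homog_elt_mem[OF one_section])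
  have z: "homog_elt n C q \<zeta> \<in> carrier ?S" by (rule homog_elt_mem[OF \<zeta>])
  interpret I: ideal ?I ?S unfolding xz_ideal_def by (rule SR.genideal_ideal) (use x z in blast)
  have "\<exists>r1\<in>Vr Wf ((2 * w - 1) * d). \<exists>r2. (q \<le> 2 * w \<longrightarrow> r2 \<in> Vr Wf ((2 * w - q) * d)) \<and> (\<not> q \<le> 2 * w \<longrightarrow> r2 = 0) \<and>
      \<Phi> (\<eta> f) * \<Phi> (\<eta> c) = r1 + \<Phi> \<zeta> * r2" if fc: "f \<in> {1..s}" "c \<in> {1..s}" for f c
  proof -
    have w: "v f = w" "v c = w" using v fc by blast+
    then have w1: "1 \<le> w" using A.v_pos[OF fc(1)] by simp
    have yS: "?y a \<in> carrier ?S" if "a \<in> {1..s}" for a by (rule homog_elt_mem[OF \<eta>[OF that]])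
    have plus: "?I +>\<^bsub>?S\<^esub> ?y a \<in> A_plus n C P d q \<zeta>" if a: "a \<in> {1..s}" for a
    proof -
      have "co (?y a) 0 = \<zero>\<^bsub>K\<^esub>"
        unfolding homog_elt_def using sections_carrier[OF \<eta>[OF a]] A.v_pos[OF a] by simp
      then show ?thesis unfolding A_plus_def using yS[OF a] by blast
    qed
    have "(?I +>\<^bsub>?S\<^esub> ?y f) \<otimes>\<^bsub>A_ring n C P d q \<zeta>\<^esub> (?I +>\<^bsub>?S\<^esub> ?y c) \<in>
        ideal_prod (A_ring n C P d q \<zeta>) (A_plus n C P d q \<zeta>) (A_plus n C P d q \<zeta>)"
      by (rule ideal_prod.prod[OF plus[OF fc(1)] plus[OF fc(2)]])
    then have "(?I +>\<^bsub>?S\<^esub> ?y f) \<otimes>\<^bsub>A_ring n C P d q \<zeta>\<^esub> (?I +>\<^bsub>?S\<^esub> ?y c) = \<zero>\<^bsub>A_ring n C P d q \<zeta>\<^esub>"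
      unfolding sq by simp
    then have "?I +>\<^bsub>?S\<^esub> (?y f \<otimes>\<^bsub>?S\<^esub> ?y c) = ?I"
      using I.rcoset_mult_add[OF yS[OF fc(1)] yS[OF fc(2)]] by (simp add: A_ring_def FactRing_def)
    then have "?y f \<otimes>\<^bsub>?S\<^esub> ?y c \<in> ?I" using I.a_rcos_self[of "?y f \<otimes>\<^bsub>?S\<^esub> ?y c"] yS fc SR.m_closed by metis
    then obtain r1 r2 where r: "r1 \<in> carrier ?S" "r2 \<in> carrier ?S"
      "\<Psi> (?y f \<otimes>\<^bsub>?S\<^esub> ?y c) = \<Psi> (x_elt n C) * \<Psi> r1 + \<Psi> (homog_elt n C q \<zeta>) * \<Psi> r2"
      unfolding xz_ideal_def by (rule SR.genideal_pair[OF x z])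
    have "\<Psi> (?y f \<otimes>\<^bsub>?S\<^esub> ?y c) = Polynomial.monom (\<Phi> (\<eta> f) * \<Phi> (\<eta> c)) (2 * w)"
      unfolding SR.hom(2)[OF yS[OF fc(1)] yS[OF fc(2)]]
      by (simp add: \<Psi>_homog_elt sections_carrier[OF \<eta>] fc[simplified] mult_monom w mult_2)
    moreover have "\<Psi> (x_elt n C) = Polynomial.monom 1 1" unfolding x_elt_def by (simp add: \<Psi>_homog_elt)
    moreover have "\<Psi> (homog_elt n C q \<zeta>) = Polynomial.monom (\<Phi> \<zeta>) q" by (rule \<Psi>_homog_elt[OF sections_carrier[OF \<zeta>]])
    ultimately have "Polynomial.monom (\<Phi> (\<eta> f) * \<Phi> (\<eta> c)) (2 * w) =
        Polynomial.monom 1 1 * \<Psi> r1 + Polynomial.monom (\<Phi> \<zeta>) q * \<Psi> r2" using r(3) by simp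
    then have "poly.coeff (Polynomial.monom (\<Phi> (\<eta> f) * \<Phi> (\<eta> c)) (2 * w)) (2 * w) =
        poly.coeff (Polynomial.monom 1 1 * \<Psi> r1 + Polynomial.monom (\<Phi> \<zeta>) q * \<Psi> r2) (2 * w)" by simp
    \<comment> \<open>Coefficients are compared in degree \<open>2 * w\<close>: x shifts by 1 and z
      by \<open>q\<close>, so the second cofactor is absent when \<open>q\<close> exceeds this
      degree.\<close>
    then have e: "\<Phi> (\<eta> f) * \<Phi> (\<eta> c) = poly.coeff (\<Psi> r1) (2 * w - 1) +
        \<Phi> \<zeta> * (if q \<le> 2 * w then poly.coeff (\<Psi> r2) (2 * w - q) else 0)"
      using w1 by (simp add: coeff_monom_mult not_less split: if_splits)
    have "\<Psi> r1 \<in> Rt Wf d" "\<Psi> r2 \<in> Rt Wf d" using r(1,2) by (simp_all add: section_ring_carrier)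
    then show ?thesis
      by (intro bexI[of _ "poly.coeff (\<Psi> r1) (2 * w - 1)"] exI[of _ "if q \<le> 2 * w then poly.coeff (\<Psi> r2) (2 * w - q) else 0"])
        (use e in \<open>simp_all add: Rt_def\<close>)
  qed
  then show ?thesis
  proof unfold_locales
    show "1 \<le> (if s = 0 then 1 else w)" using v A.v_pos[of 1] by auto
    show "v a = (if s = 0 then 1 else w)" if "a \<in> {1..s}" for a using v that by auto
  qed auto
qed

text \<open>\<open>g + 1\<close> lies beyond the last gap, so \<zeta> already occurs in degree
  1.\<close>

lemma ordinary_uniform:
  assumes o: "ordinary n C P g" and mp: "min_presentation n C P (g + 1) q \<zeta> s v \<eta>"
  shows "curve_alg_uniform Wf (g + 1) q s (\<Phi> \<zeta>) v (\<Phi> \<circ> \<eta>) 2"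
proof -
  interpret A: curve_alg Wf "g + 1" q s "\<Phi> \<zeta>" v "\<Phi> \<circ> \<eta>" by (rule presentation_curve_alg[OF _ mp]) simp
  have wr: "weierstrass n C P = UNIV - {1..g}" using o unfolding ordinary_def by blast
  have q: "q = 1"
  proof -
    have "1 * (g + 1) \<in> weierstrass n C P" unfolding wr by simp
    then show ?thesis using mp unfolding min_presentation_def is_q_def by (meson le_antisym order_refl)
  qed
  interpret B: curve_alg_ordinary Wf "g + 1" q s "\<Phi> \<zeta>" v "\<Phi> \<circ> \<eta>" g
    by unfold_locales (use q wr weierstrass_eq in simp_all)
  show ?thesis by (rule B.uniform)
qed

end

theorem corollary4p4:
  fixes n g d :: nat
    and C :: "(nat \<Rightarrow> 'k::alg_closed_field) set"
    and P :: "nat \<Rightarrow> 'k"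
  assumes "smooth_projective_curve n C"
    and "has_genus n C g"
    and "P \<in> C"
    and "d \<ge> 1"
  shows "(\<forall>q \<zeta> s v \<eta> w.
            min_presentation n C P d q \<zeta> s v \<eta> \<longrightarrow>
            ideal_prod (A_ring n C P d q \<zeta>) (A_plus n C P d q \<zeta>) (A_plus n C P d q \<zeta>)
              = {\<zero>\<^bsub>A_ring n C P d q \<zeta>\<^esub>} \<longrightarrow>
            (\<forall>a\<in>{1..s}. v a = w) \<longrightarrow>
            min_resolution_pure n C P d q \<zeta> s v \<eta> \<and>
            (\<forall>i\<in>{1..s}. betti n C P d q \<zeta> s v \<eta> i ((i + 1) * w)
                           = int (i * ((s + 1) choose (i + 1)))))
       \<and> (ordinary n C P g \<longrightarrow>
            (\<forall>q \<zeta> s v \<eta>.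
              min_presentation n C P (g + 1) q \<zeta> s v \<eta> \<longrightarrow>
              min_resolution_pure n C P (g + 1) q \<zeta> s v \<eta>))"
proof -
  have pv: "proj_variety n C" and sm: "smooth_curve_at n C P"
    using assms by (simp_all add: smooth_projective_curve_def)
  interpret smooth_point n C P g
    by unfold_locales (use pv sm assms in simp_all)
  show ?thesis
  proof (intro conjI allI impI ballI)
    fix q \<zeta> s v \<eta> w
    assume mp: "min_presentation n C P d q \<zeta> s v \<eta>"
      and sq: "ideal_prod (A_ring n C P d q \<zeta>) (A_plus n C P d q \<zeta>) (A_plus n C P d q \<zeta>) = {\<zero>\<^bsub>A_ring n C P d q \<zeta>\<^esub>}"
      and v: "\<forall>a\<in>{1..s}. v a = w"
    note un = square_zero_uniform[OF assms(4) mp sq v]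
    show "min_resolution_pure n C P d q \<zeta> s v \<eta>" by (rule uniform_conclusion(1)[OF assms(4) mp un])
    \<comment> \<open>An index in \<open>{1..s}\<close> makes \<open>s\<close> positive, so the
      conditional weight in \<open>un\<close> is \<open>w\<close>.\<close>
    fix i assume i: "i \<in> {1..s}"
    then show "betti n C P d q \<zeta> s v \<eta> i ((i + 1) * w) = int (i * ((s + 1) choose (i + 1)))"
      using uniform_conclusion(2)[OF assms(4) mp un, of i] by simp
  next
    fix q \<zeta> s v \<eta>
    assume o: "ordinary n C P g" and mp: "min_presentation n C P (g + 1) q \<zeta> s v \<eta>"
    show "min_resolution_pure n C P (g + 1) q \<zeta> s v \<eta>"
      by (rule uniform_conclusion(1)[OF _ mp ordinary_uniform[OF o mp]]) simp
  qed
qed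

end
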